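(* Let $k$ be a perfect field whose absolute Galois group $\mathrm{Gal}(\overline{k}/k)$ is procyclic, let $F\in\mathrm{Gal}(\overline{k}/k)$ be a topological generator, and let $r$ be the order (a Steinitz number) of the profinite group $\mathrm{Gal}(\overline{k}/k)$. Let $K$ be a geometrically irreducible function field over $k$, let $M/K$ be a finite normal extension with $G=\mathrm{Aut}_K(M)$, let $k'$ be the integral closure of $k$ in $M$, let $N=\mathrm{Aut}(M/Kk')$, and let $\overline{F}\subseteq G$ be the coset of $N$ corresponding to the image of $F$ under $\mathrm{Gal}(\overline{k}/k)\to\mathrm{Gal}(k'/k)\cong G/N$. Let $\gamma\in\overline{F}$ and assume that $m=\mathrm{ord}(\gamma)$ divides $r$. Let $k_m$ be the unique extension of degree $m$ of $k$ in some algebraic closure of $K$ containing $M$, and let $F'$ be the image of $F$ under the maps $\mathrm{Gal}(\overline{k}/k)\to\mathrm{Gal}(k_m/k)\cong\mathrm{Gal}(k_mK/K)$. Then: \begin{enumerate} \item $\mathrm{Gal}(k_mM/K)=\mathrm{Gal}(k_mK/K)\times_{\mathrm{Gal}(k'K/K)}\mathrm{Gal}(M/K)$, and this group contains $(F',\gamma)$; \item $M_\gamma=(k_mM)^{\langle (F',\gamma)\rangle}$ is geometrically irreducible over $k$ and satisfies $k_mM_\gamma=k_mM$. \end{enumerate} Furthermore, the map $$\phi\colon \mathcal{P}^1_{M_\gamma/k}\to\mathcal{P}^1_{K/k},\qquad Q\mapsto Q|_K$$ is well defined, has image $\{P\in\mathcal{P}^1_{K/k}:\gamma\in(P,M/K)\}$,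 and for every $P\in\mathcal{P}^1_{K/k}$ one has $\#\phi^{-1}(P)=\#N\cdot (P,M)(\gamma)$.
   Context: A geometrically irreducible function field over $k$ is a finitely generated field extension $K$ of $k$ of transcendence degree $1$ such that $k$ is integrally closed in $K$. For a function field $L$ over $k$, $\mathcal{P}_{L/k}$ denotes the set of valuation rings of $L$ containing $k$ and different from $L$ (primes); $\mathrm{k}_P$ is the residue field of $P$, $\deg_k(P)=[\mathrm{k}_P:k]$, and $\mathcal{P}^1_{L/k}$ is the set of $P\in\mathcal{P}_{L/k}$ with $\mathrm{k}_P=k$ (rational primes). For a subfield $L'$, $P|_{L'}$ denotes the restriction of $P$ to $L'$. For $P\in\mathcal{P}_{K/k}$ and $Q\in\mathcal{P}_{M/k}$ above $P$: the decomposition group is $D_{Q,K}=\{g\in G: gQ=Q\}$; there is a natural surjection $D_{Q,K}\to\mathrm{Gal}(\mathrm{k}_Q/\mathrm{k}_P)$ whose kernel is the inertia group $I_{Q,K}$. After choosing a $k$-embedding $\mathrm{k}_Q\subseteq\overline{k}$, the image of $F^{[\mathrm{k}_P:k]}$ under $\mathrm{Gal}(\overline{k}/\mathrm{k}_P)\to\mathrm{Gal}(\mathrm{k}_Q/\mathrm{k}_P)$ is a canonical generator, and $(Q,M/K)\subseteq D_{Q,K}$ denotes the set of elements of $D_{Q,K}$ mapping to this generator. The set $(P,M/K)$ denotes the union of the sets $(Q,M/K)$ over all $Q$ above $P$. The probability measure $(P,M)$ on $G$ is defined by $$(P,M)(\gamma)=\frac{\#\big((Q,M/K)\cap\Gamma\big)}{\#\Gamma\cdot\#(Q,M/K)},$$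 where $\Gamma$ is the conjugacy class of $\gamma$ in $G$ and $Q$ is any prime of $M$ above $P$. *)

theory Defs
  imports
    "HOL-Analysis.Function_Topology"
    "HOL-Library.Extended_Nat"
    "HOL-Computational_Algebra.Primes"
    "HOL-Algebra.Algebra"
begin

text \<open>
  All fields are subfields, given by their carrier sets, of one field \<open>\<Omega>\<close>, which in the theorem
  is an algebraic closure of the function field \<open>K\<close>.
\<close>


section \<open>Fields and field extensions\<close>

definition perfect_field :: "('a, 'b) ring_scheme \<Rightarrow> bool" where
  "perfect_field R \<longleftrightarrow> field R \<and>
     (\<forall>p::nat. Factorial_Ring.prime p \<longrightarrow> [p] \<cdot>\<^bsub>R\<^esub> \<one>\<^bsub>R\<^esub> = \<zero>\<^bsub>R\<^esub> \<longrightarrow>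
        (\<lambda>x. x [^]\<^bsub>R\<^esub> p) ` carrier R = carrier R)"

text \<open>Over a field, an element is integral iff it is algebraic.\<close>

definition integral_closure_in :: "('a, 'b) ring_scheme \<Rightarrow> 'a set \<Rightarrow> 'a set \<Rightarrow> 'a set" where
  "integral_closure_in \<Omega> k L = {x \<in> L. ring.algebraic \<Omega> k x}"

definition compositum :: "('a, 'b) ring_scheme \<Rightarrow> 'a set \<Rightarrow> 'a set \<Rightarrow> 'a set" where
  "compositum \<Omega> E L = generate_field \<Omega> (E \<union> L)"

text \<open>
  Transcendence degree 1 is expressed by a transcendence basis \<open>{t}\<close>.
\<close>

definition geom_irred_function_field :: "('a, 'b) ring_scheme \<Rightarrow> 'a set \<Rightarrow> 'a set \<Rightarrow> bool" where
  "geom_irred_function_field \<Omega> k K \<longleftrightarrow>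
     subfield k \<Omega> \<and> subfield K \<Omega> \<and> k \<subseteq> K \<and>
     (\<exists>S. finite S \<and> S \<subseteq> K \<and> K = generate_field \<Omega> (k \<union> S)) \<and>
     (\<exists>t\<in>K. ring.transcendental \<Omega> k t \<and>
        (\<forall>x\<in>K. ring.algebraic \<Omega> (generate_field \<Omega> (k \<union> {t})) x)) \<and>
     integral_closure_in \<Omega> k K = k"

text \<open>
  Splitting over \<open>M\<close> is the library's \<open>splitted\<close> for the ring with carrier \<open>M\<close>. The library's
  \<open>splitted_on M\<close> is unsuitable: it intersects with \<open>mset_set M\<close>, which is empty for infinite \<open>M\<close>.
\<close>

definition finite_normal_extension :: "('a, 'b) ring_scheme \<Rightarrow> 'a set \<Rightarrow> 'a set \<Rightarrow> bool" where
  "finite_normal_extension \<Omega> K M \<longleftrightarrow>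
     subfield K \<Omega> \<and> subfield M \<Omega> \<and> K \<subseteq> M \<and> ring.finite_dimension \<Omega> K M \<and>
     (\<forall>p \<in> carrier (K[X]\<^bsub>\<Omega>\<^esub>). pirreducible\<^bsub>\<Omega>\<^esub> K p \<longrightarrow>
        (\<exists>x\<in>M. ring.eval \<Omega> p x = \<zero>\<^bsub>\<Omega>\<^esub>) \<longrightarrow> ring.splitted (\<Omega>\<lparr>carrier := M\<rparr>) p)"

definition the_extension_of_degree :: "('a, 'b) ring_scheme \<Rightarrow> 'a set \<Rightarrow> nat \<Rightarrow> 'a set" where
  "the_extension_of_degree \<Omega> k m =
     (THE E. subfield E \<Omega> \<and> k \<subseteq> E \<and> ring.dimension \<Omega> m k E)"


section \<open>Automorphism groups\<close>

text \<open>
  \<open>aut_group \<Omega> E L\<close> is $\mathrm{Aut}_E(L)$. As in \<open>BijGroup\<close>, automorphisms are extensional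
  functions on \<open>L\<close>, so restriction to a subfield \<open>L'\<close> is the library function \<open>restrict _ L'\<close>.
\<close>

definition aut_group :: "('a, 'b) ring_scheme \<Rightarrow> 'a set \<Rightarrow> 'a set \<Rightarrow> ('a \<Rightarrow> 'a) monoid" where
  "aut_group \<Omega> E L = BijGroup L
     \<lparr>carrier := {\<sigma> \<in> Bij L. \<sigma> \<in> ring_hom (\<Omega>\<lparr>carrier := L\<rparr>) (\<Omega>\<lparr>carrier := L\<rparr>) \<and> (\<forall>x\<in>E. \<sigma> x = x)}\<rparr>"

definition fixed_field :: "'a set \<Rightarrow> ('a \<Rightarrow> 'a) set \<Rightarrow> 'a set" where
  "fixed_field L H = {x \<in> L. \<forall>\<sigma>\<in>H. \<sigma> x = x}"

text \<open>
  Krull topology: a basis consists of the cosets of $\mathrm{Aut}_E(L)$ for the subextensions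
  \<open>E\<close> of \<open>L\<close> that are finite over \<open>k\<close>.
\<close>

definition krull_topology :: "('a, 'b) ring_scheme \<Rightarrow> 'a set \<Rightarrow> 'a set \<Rightarrow> ('a \<Rightarrow> 'a) topology" where
  "krull_topology \<Omega> k L = topology_generated_by
     {{\<tau> \<in> carrier (aut_group \<Omega> k L). \<forall>x\<in>E. \<tau> x = \<sigma> x} | \<sigma> E.
        \<sigma> \<in> carrier (aut_group \<Omega> k L) \<and> subfield E \<Omega> \<and> k \<subseteq> E \<and> E \<subseteq> L \<and>
        ring.finite_dimension \<Omega> k E}"

definition topological_generator :: "('g, 'c) monoid_scheme \<Rightarrow> 'g topology \<Rightarrow> 'g \<Rightarrow> bool" where
  "topological_generator G T F \<longleftrightarrow> F \<in> carrier G \<and> T closure_of (generate G {F}) = carrier G"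

definition procyclic :: "('g, 'c) monoid_scheme \<Rightarrow> 'g topology \<Rightarrow> bool" where
  "procyclic G T \<longleftrightarrow> (\<exists>F. topological_generator G T F)"

text \<open>
  A Steinitz number $\prod_p p^{r(p)}$ is represented by its exponent function; only values at
  primes are relevant. The order of a profinite group is the least common multiple of the indices
  of its open subgroups (which are finite).
\<close>

type_synonym steinitz = "nat \<Rightarrow> enat"

definition profinite_order :: "('g, 'c) monoid_scheme \<Rightarrow> 'g topology \<Rightarrow> steinitz" where
  "profinite_order G T =
     (\<lambda>p. SUP U \<in> {U. subgroup U G \<and> openin T U}. enat (multiplicity p (card (rcosets\<^bsub>G\<^esub> U))))"

definition nat_dvd_steinitz :: "nat \<Rightarrow> steinitz \<Rightarrow> bool" where
  "nat_dvd_steinitz m r \<longleftrightarrow> m > 0 \<and> (\<forall>p. Factorial_Ring.prime p \<longrightarrow> enat (multiplicity p m) \<le> r p)"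

definition fibre_product ::
  "('g, 'c) monoid_scheme \<Rightarrow> ('h, 'd) monoid_scheme \<Rightarrow> ('g \<Rightarrow> 'q) \<Rightarrow> ('h \<Rightarrow> 'q) \<Rightarrow> ('g \<times> 'h) monoid" where
  "fibre_product A B f g = (A \<times>\<times> B)\<lparr>carrier := {(a, b) \<in> carrier A \<times> carrier B. f a = g b}\<rparr>"

definition conjugacy_class :: "('g, 'c) monoid_scheme \<Rightarrow> 'g \<Rightarrow> 'g set" where
  "conjugacy_class G x =
     orbit G (\<lambda>g. \<lambda>h \<in> carrier G. g \<otimes>\<^bsub>G\<^esub> h \<otimes>\<^bsub>G\<^esub> inv\<^bsub>G\<^esub> g) x"


section \<open>Primes\<close>

definition valuation_ring_of :: "('a, 'b) ring_scheme \<Rightarrow> 'a set \<Rightarrow> 'a set \<Rightarrow> bool" where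
  "valuation_ring_of \<Omega> L V \<longleftrightarrow>
     subring V \<Omega> \<and> V \<subseteq> L \<and> (\<forall>x \<in> L - {\<zero>\<^bsub>\<Omega>\<^esub>}. x \<in> V \<or> inv\<^bsub>\<Omega>\<^esub> x \<in> V)"

definition primes_of :: "('a, 'b) ring_scheme \<Rightarrow> 'a set \<Rightarrow> 'a set \<Rightarrow> 'a set set" where
  "primes_of \<Omega> k L = {V. valuation_ring_of \<Omega> L V \<and> k \<subseteq> V \<and> V \<noteq> L}"

definition maximal_ideal :: "('a, 'b) ring_scheme \<Rightarrow> 'a set \<Rightarrow> 'a set" where
  "maximal_ideal \<Omega> V = V - Units (\<Omega>\<lparr>carrier := V\<rparr>)"

definition residue_field :: "('a, 'b) ring_scheme \<Rightarrow> 'a set \<Rightarrow> 'a set ring" where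
  "residue_field \<Omega> V = (\<Omega>\<lparr>carrier := V\<rparr>) Quot (maximal_ideal \<Omega> V)"

definition residue_class :: "('a, 'b) ring_scheme \<Rightarrow> 'a set \<Rightarrow> 'a \<Rightarrow> 'a set" where
  "residue_class \<Omega> V x = maximal_ideal \<Omega> V +>\<^bsub>\<Omega>\<^esub> x"

text \<open>The field \<open>k\<close> is identified with its image \<open>residue_class \<Omega> V ` k\<close> in the residue field.\<close>

definition prime_degree :: "('a, 'b) ring_scheme \<Rightarrow> 'a set \<Rightarrow> 'a set \<Rightarrow> nat" where
  "prime_degree \<Omega> k V =
     ring.dim (residue_field \<Omega> V) (residue_class \<Omega> V ` k) (carrier (residue_field \<Omega> V))"

definition rational_primes_of :: "('a, 'b) ring_scheme \<Rightarrow> 'a set \<Rightarrow> 'a set \<Rightarrow> 'a set set" where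
  "rational_primes_of \<Omega> k L =
     {V \<in> primes_of \<Omega> k L. carrier (residue_field \<Omega> V) = residue_class \<Omega> V ` k}"

definition primes_above :: "('a, 'b) ring_scheme \<Rightarrow> 'a set \<Rightarrow> 'a set \<Rightarrow> 'a set \<Rightarrow> 'a set \<Rightarrow> 'a set set" where
  "primes_above \<Omega> k K M P = {Q \<in> primes_of \<Omega> k M. Q \<inter> K = P}"

definition decomposition_group :: "('a, 'b) ring_scheme \<Rightarrow> 'a set \<Rightarrow> 'a set \<Rightarrow> 'a set \<Rightarrow> ('a \<Rightarrow> 'a) set" where
  "decomposition_group \<Omega> K M Q = {g \<in> carrier (aut_group \<Omega> K M). g ` Q = Q}"

definition residue_embeddings :: "('a, 'b) ring_scheme \<Rightarrow> 'a set \<Rightarrow> 'a set \<Rightarrow> ('a set \<Rightarrow> 'a) set" where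
  "residue_embeddings \<Omega> k Q =
     {\<iota> \<in> ring_hom (residue_field \<Omega> Q) (\<Omega>\<lparr>carrier := integral_closure_in \<Omega> k (carrier \<Omega>)\<rparr>).
        \<forall>c\<in>k. \<iota> (residue_class \<Omega> Q c) = c}"

text \<open>
  \<open>frobenius_at \<Omega> k K M F Q\<close> is the set $(Q, M/K)$. Residue classes are cosets, so an element
  \<open>g\<close> of the decomposition group acts on the residue field of \<open>Q\<close> by \<open>r \<mapsto> g ` r\<close>; via a
  \<open>k\<close>-embedding \<open>\<iota>\<close> of this residue field into the algebraic closure of \<open>k\<close>, that action has to
  be the restriction of $F^{\deg P}$ with $P = Q \cap K$. The condition does not depend
  on \<open>\<iota>\<close>, because the Galois group of \<open>k\<close> is abelian.
\<close>

definition frobenius_at ::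
  "('a, 'b) ring_scheme \<Rightarrow> 'a set \<Rightarrow> 'a set \<Rightarrow> 'a set \<Rightarrow> ('a \<Rightarrow> 'a) \<Rightarrow> 'a set \<Rightarrow> ('a \<Rightarrow> 'a) set" where
  "frobenius_at \<Omega> k K M F Q =
     {g \<in> decomposition_group \<Omega> K M Q.
        \<exists>\<iota> \<in> residue_embeddings \<Omega> k Q. \<forall>r \<in> carrier (residue_field \<Omega> Q).
          \<iota> (g ` r) =
          (F [^]\<^bsub>aut_group \<Omega> k (integral_closure_in \<Omega> k (carrier \<Omega>))\<^esub> prime_degree \<Omega> k (Q \<inter> K)) (\<iota> r)}"

definition frobenius_over ::
  "('a, 'b) ring_scheme \<Rightarrow> 'a set \<Rightarrow> 'a set \<Rightarrow> 'a set \<Rightarrow> ('a \<Rightarrow> 'a) \<Rightarrow> 'a set \<Rightarrow> ('a \<Rightarrow> 'a) set" where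
  "frobenius_over \<Omega> k K M F P = (\<Union>Q \<in> primes_above \<Omega> k K M P. frobenius_at \<Omega> k K M F Q)"

text \<open>
  The value at \<open>\<gamma>\<close> of the measure $(P, M)$ for $P = Q \cap K$. It is the same for all primes \<open>Q\<close>
  of \<open>M\<close> above \<open>P\<close>, as these are conjugate under $\mathrm{Aut}_K(M)$.
\<close>

definition frobenius_measure ::
  "('a, 'b) ring_scheme \<Rightarrow> 'a set \<Rightarrow> 'a set \<Rightarrow> 'a set \<Rightarrow> ('a \<Rightarrow> 'a) \<Rightarrow> 'a set \<Rightarrow> ('a \<Rightarrow> 'a) \<Rightarrow> real" where
  "frobenius_measure \<Omega> k K M F Q \<gamma> =
     (let \<Gamma> = conjugacy_class (aut_group \<Omega> K M) \<gamma>; S = frobenius_at \<Omega> k K M F Q in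
      real (card (S \<inter> \<Gamma>)) / (real (card \<Gamma>) * real (card S)))"

end

theory Submission
  imports Defs
begin

text \<open>
  A place of a subfield \<open>E\<close> is a homomorphism \<open>\<rho>\<close> from a valuation ring of \<open>E\<close> to the algebraic closure
  of \<open>k\<close>. Rational primes are the places with values in \<open>k\<close>, and for a place \<open>\<rho>\<close> of \<open>M\<close> with valuation
  ring \<open>Q\<close> above a rational prime \<open>P\<close> the set $(Q, M/K)$ consists of the \<open>g\<close> with
  \<open>\<rho> \<circ> g = F \<circ> \<rho>\<close>.

  Let \<open>L = k\<^sub>mM\<close> and let \<open>s\<close> be the automorphism \<open>(F', \<gamma>)\<close> of \<open>L\<close>. The places \<open>\<rho>\<close> of \<open>L\<close> above \<open>P\<close> that are
  the identity on \<open>k\<^sub>m\<close> and satisfy \<open>\<rho> \<circ> s = F \<circ> \<rho>\<close> restrict bijectively both to the rational primes of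
  $M_\gamma$ above \<open>P\<close> and to the places of \<open>M\<close> above \<open>P\<close> that are the identity on \<open>k'\<close> and satisfy
  \<open>\<rho> \<circ> \<gamma> = F \<circ> \<rho>\<close>. To count the latter, fix one place \<open>\<rho>\<close> above \<open>P\<close> that is the identity on \<open>k'\<close>, with
  valuation ring \<open>Q\<close> and inertia group \<open>I\<close>, and consider the \<open>n \<in> N\<close> with \<open>n\<gamma>n\<^sup>-\<^sup>1\<close> in $(Q, M/K)$: the map
  \<open>n \<mapsto> \<rho> \<circ> n\<close> sends them onto the places to be counted with fibres of size \<open>#I\<close>, the number of elements of
  $(Q, M/K)$, and \<open>n \<mapsto> n\<gamma>n\<^sup>-\<^sup>1\<close> sends them onto $(Q, M/K) \cap \Gamma$ with fibres of size \<open>#N / #\<Gamma>\<close>.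

  All this rests on the conjugacy of places. Two homomorphisms on a ring that agree on the invariants
  of a finite group \<open>H\<close> differ at each element \<open>d\<close> by some \<open>g \<in> H\<close>, as one sees by evaluating the
  polynomial whose roots are the conjugates of \<open>d\<close>; applied to polynomials over the ring this yields a
  \<open>g\<close> that does not depend on \<open>d\<close>.
\<close>

section \<open>Polynomials\<close>

text \<open>Inseparability shapes the proof: \<open>M\<close> is merely normal over
  \<open>K\<close>, and \<open>K\<close> need not be perfect, so an element fixed by all
  automorphisms need not lie in the base field. What survives is that it is the only root of its
  minimal polynomial, which is therefore a power of a linear factor. For places this suffices, since
  a vanishing power of a difference of two values forces them to be equal; where membership is
  needed, a polynomial with simple roots or the perfectness of \<open>k\<close> removes the
  multiplicity. The Galois theory of \<open>k\<close> rests on one property of \<open>F\<close>: its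
  fixed elements in the algebraic closure lie in \<open>k\<close>. The property passes to powers of
  \<open>F\<close> over their fixed fields, so degrees can be computed by induction. Embeddings are
  extended as places, because elements algebraic over a field of finite elements stay finite. The
  order \<open>m\<close> of \<gamma> enters twice: \<gamma>^m = 1 puts the constants
  \<open>k'\<close> of \<open>M\<close> into \<open>k\<^sub>m\<close>, and as \<open>m\<close>
  divides \<open>r\<close>, \<open>k\<^sub>m\<close> has degree \<open>m\<close>. So the group
  generated by \<open>s\<close> acts faithfully on \<open>k\<^sub>m\<close>, which gives
  \<open>k\<^sub>mM\<^sub>\<gamma> = k\<^sub>mM\<close>.\<close>

lemma eval_map_hom:
  assumes "domain D" "cring C" "\<Psi> \<in> ring_hom D C" "y \<in> carrier C"
  shows "(\<lambda>p. ring.eval C (map \<Psi> p) y) \<in> ring_hom (poly_ring D) C"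
proof -
  interpret D: domain D by fact
  interpret C: cring C by fact
  interpret h: ring_hom_ring D C \<Psi>
    using assms(3) by unfold_locales
  have inc: "set p \<subseteq> carrier D" if "p \<in> carrier (poly_ring D)" for p
    using that D.polynomial_in_carrier[OF D.carrier_is_subring] univ_poly_carrier by blast
  have inc': "set (map \<Psi> p) \<subseteq> carrier C" if "set p \<subseteq> carrier D" for p
    using that by auto
  show ?thesis
  proof (rule ring_hom_memI)
    fix p assume p: "p \<in> carrier (poly_ring D)"
    show "C.eval (map \<Psi> p) y \<in> carrier C"
      using C.eval_in_carrier[OF inc'[OF inc[OF p]] assms(4)] .
  next
    fix p q assume p: "p \<in> carrier (poly_ring D)" and q: "q \<in> carrier (poly_ring D)"
    note pq = inc[OF p] inc[OF q]
    \<comment> \<open>\<open>\<Psi>\<close> may kill leading coefficients, so the image list need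
      not be a polynomial. Evaluation ignores leading zeros, and it is the normalised list that can
      be compared with the product.\<close>
    have "C.eval (map \<Psi> (D.poly_mult p q)) y = C.eval (C.normalize (map \<Psi> (D.poly_mult p q))) y"
      using C.eval_normalize[OF inc'[OF D.poly_mult_in_carrier[OF pq]] assms(4)] by simp
    also have "\<dots> = C.eval (map \<Psi> p) y \<otimes>\<^bsub>C\<^esub> C.eval (map \<Psi> q) y"
      unfolding h.poly_mult_hom'[OF pq]
      by (rule C.eval_poly_mult[OF inc'[OF pq(1)] inc'[OF pq(2)] assms(4)])
    finally show "C.eval (map \<Psi> (p \<otimes>\<^bsub>poly_ring D\<^esub> q)) y = C.eval (map \<Psi> p) y \<otimes>\<^bsub>C\<^esub> C.eval (map \<Psi> q) y"
      by (simp add: univ_poly_mult)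
    have "C.eval (map \<Psi> (D.poly_add p q)) y = C.eval (C.normalize (map \<Psi> (D.poly_add p q))) y"
      using C.eval_normalize[OF inc'[OF D.poly_add_in_carrier[OF pq]] assms(4)] by simp
    also have "\<dots> = C.eval (map \<Psi> p) y \<oplus>\<^bsub>C\<^esub> C.eval (map \<Psi> q) y"
      unfolding h.poly_add_hom'[OF pq]
      by (rule C.eval_poly_add[OF inc'[OF pq(1)] inc'[OF pq(2)] assms(4)])
    finally show "C.eval (map \<Psi> (p \<oplus>\<^bsub>poly_ring D\<^esub> q)) y = C.eval (map \<Psi> p) y \<oplus>\<^bsub>C\<^esub> C.eval (map \<Psi> q) y"
      by (simp add: univ_poly_add)
  next
    show "C.eval (map \<Psi> \<one>\<^bsub>poly_ring D\<^esub>) y = \<one>\<^bsub>C\<^esub>"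
      using assms(4) by (simp add: univ_poly_one)
  qed
qed

text \<open>Injectivity keeps the leading coefficient nonzero, so the image list is already
  normalised and is a polynomial again.\<close>

lemma map_poly_hom:
  assumes "domain D" "domain C" "g \<in> ring_hom D C" "inj_on g (carrier D)"
  shows "map g \<in> ring_hom (poly_ring D) (poly_ring C)"
proof -
  interpret D: domain D by fact
  interpret C: domain C by fact
  interpret h: ring_hom_ring D C g
    using assms(3) by unfold_locales
  have inc: "set p \<subseteq> carrier D" if "p \<in> carrier (poly_ring D)" for p
    using that D.polynomial_in_carrier[OF D.carrier_is_subring] univ_poly_carrier by blast
  have nz: "g a \<noteq> \<zero>\<^bsub>C\<^esub>" if "a \<in> carrier D" "a \<noteq> \<zero>\<^bsub>D\<^esub>" for a
    using that assms(4) h.hom_zero D.zero_closed by (metis inj_onD)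
  have mem: "map g p \<in> carrier (poly_ring C)" if "p \<in> carrier (poly_ring D)" for p
  proof (cases p)
    case Nil then show ?thesis by (simp add: univ_poly_carrier[symmetric] polynomial_def)
  next
    case (Cons a q)
    then have "a \<noteq> \<zero>\<^bsub>D\<^esub>" "a \<in> carrier D" "set q \<subseteq> carrier D"
      using that inc[OF that] by (auto simp: univ_poly_carrier[symmetric] polynomial_def)
    then show ?thesis
      using Cons nz by (auto simp: univ_poly_carrier[symmetric] polynomial_def)
  qed
  have norm: "C.normalize (map g p) = map g p" if "p \<in> carrier (poly_ring D)" for p
    using mem[OF that] C.normalize_polynomial univ_poly_carrier by blast
  show ?thesis
  proof (rule ring_hom_memI)
    fix p q assume p: "p \<in> carrier (poly_ring D)" and q: "q \<in> carrier (poly_ring D)"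
    interpret PD: domain "poly_ring D"
      using D.univ_poly_is_domain[OF D.carrier_is_subring] .
    show "map g p \<in> carrier (poly_ring C)" by (rule mem[OF p])
    show "map g (p \<otimes>\<^bsub>poly_ring D\<^esub> q) = map g p \<otimes>\<^bsub>poly_ring C\<^esub> map g q"
      using norm[OF PD.m_closed[OF p q]] h.poly_mult_hom'[OF inc[OF p] inc[OF q]]
      by (simp add: univ_poly_mult)
    show "map g (p \<oplus>\<^bsub>poly_ring D\<^esub> q) = map g p \<oplus>\<^bsub>poly_ring C\<^esub> map g q"
      using norm[OF PD.a_closed[OF p q]] h.poly_add_hom'[OF inc[OF p] inc[OF q]]
      by (simp add: univ_poly_add)
  next
    show "map g \<one>\<^bsub>poly_ring D\<^esub> = \<one>\<^bsub>poly_ring C\<^esub>" by (simp add: univ_poly_one)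
  qed
qed

section \<open>Monic polynomials with prescribed simple roots\<close>

definition lin_prod :: "('a, 'b) ring_scheme \<Rightarrow> 'a set \<Rightarrow> 'a list" where
  "lin_prod D S = finprod (poly_ring D) (\<lambda>s. [\<one>\<^bsub>D\<^esub>, \<ominus>\<^bsub>D\<^esub> s]) S"

context domain
begin

lemma poly_ring_domain: "domain (poly_ring R)"
  by (rule univ_poly_is_domain[OF carrier_is_subring])

lemma lin_closed: "s \<in> carrier R \<Longrightarrow> [\<one>, \<ominus> s] \<in> carrier (poly_ring R)"
  by (simp add: univ_poly_carrier[symmetric] polynomial_def)

lemma lin_prod_closed: "S \<subseteq> carrier R \<Longrightarrow> lin_prod R S \<in> carrier (poly_ring R)"
proof -
  interpret P: domain "poly_ring R" by (rule poly_ring_domain)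
  show "S \<subseteq> carrier R \<Longrightarrow> lin_prod R S \<in> carrier (poly_ring R)"
    unfolding lin_prod_def by (rule P.finprod_closed) (auto intro: lin_closed)
qed

lemma lin_prod_insert:
  assumes "finite S" "S \<subseteq> carrier R" "s \<in> carrier R" "s \<notin> S"
  shows "lin_prod R (insert s S) = [\<one>, \<ominus> s] \<otimes>\<^bsub>poly_ring R\<^esub> lin_prod R S"
proof -
  interpret P: domain "poly_ring R" by (rule poly_ring_domain)
  show ?thesis
    unfolding lin_prod_def using assms by (subst P.finprod_insert) (auto intro: lin_closed)
qed

lemma lin_prod_monic:
  assumes "finite S" "S \<subseteq> carrier R"
  shows "lin_prod R S \<noteq> [] \<and> lead_coeff (lin_prod R S) = \<one> \<and> degree (lin_prod R S) = card S"
  using assms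
proof (induction S)
  case empty
  interpret P: domain "poly_ring R" by (rule poly_ring_domain)
  show ?case by (simp add: lin_prod_def univ_poly_one)
next
  case (insert s S)
  interpret P: domain "poly_ring R" by (rule poly_ring_domain)
  have s: "s \<in> carrier R" "S \<subseteq> carrier R" using insert by auto
  note cl = lin_closed[OF s(1)] lin_prod_closed[OF s(2)]
  note pol = cl[unfolded univ_poly_carrier[symmetric]]
  note eq = lin_prod_insert[OF insert(1) s(2,1) insert(2), unfolded univ_poly_mult]
  have ne: "lin_prod R S \<noteq> []" using insert s by auto
  have "poly_mult [\<one>, \<ominus> s] (lin_prod R S) \<noteq> []"
    using poly_mult_integral[OF carrier_is_subring pol] ne by auto
  then show ?case
    using insert s ne poly_mult_lead_coeff[OF carrier_is_subring pol]
      poly_mult_degree_eq[OF carrier_is_subring pol]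
    by (simp add: eq)
qed

text \<open>The roots live in \<open>R\<close> while the point of evaluation lives in another ring:
  the conjugacy argument evaluates the images under two homomorphisms \<open>\<Psi>\<close> at one
  and the same point.\<close>

lemma eval_map_lin_prod:
  assumes C: "cring C" "\<Psi> \<in> ring_hom R C" "y \<in> carrier C" and S: "S \<subseteq> carrier R"
  shows "ring.eval C (map \<Psi> (lin_prod R S)) y = finprod C (\<lambda>s. y \<ominus>\<^bsub>C\<^esub> \<Psi> s) S"
proof -
  interpret P: domain "poly_ring R" by (rule poly_ring_domain)
  interpret C: cring C by fact
  interpret \<Psi>: ring_hom_cring R C \<Psi> using C(2) by unfold_locales
  interpret h: ring_hom_cring "poly_ring R" C "\<lambda>p. ring.eval C (map \<Psi> p) y"
    using eval_map_hom[OF domain_axioms C] by unfold_locales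
  have "ring.eval C (map \<Psi> (lin_prod R S)) y =
      finprod C ((\<lambda>p. ring.eval C (map \<Psi> p) y) \<circ> (\<lambda>s. [\<one>, \<ominus> s])) S"
    unfolding lin_prod_def using S by (intro h.hom_finprod) (auto intro: lin_closed)
  also have "\<dots> = finprod C (\<lambda>s. y \<ominus>\<^bsub>C\<^esub> \<Psi> s) S"
  proof (rule C.finprod_cong')
    fix s assume "s \<in> S"
    then have s: "s \<in> carrier R" using S by auto
    have "\<Psi> (\<ominus> s) = \<ominus>\<^bsub>C\<^esub> \<Psi> s" using s by simp
    then show "((\<lambda>p. ring.eval C (map \<Psi> p) y) \<circ> (\<lambda>s. [\<one>, \<ominus> s])) s = y \<ominus>\<^bsub>C\<^esub> \<Psi> s"
      using s C(3) by (simp add: a_minus_def)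
  qed (use S C(3) in auto)
  finally show ?thesis .
qed

lemma eval_lin_prod:
  assumes "S \<subseteq> carrier R" "y \<in> carrier R"
  shows "eval (lin_prod R S) y = finprod R (\<lambda>s. y \<ominus> s) S"
  using eval_map_lin_prod[OF is_cring _ assms(2,1), of id] by (simp add: ring_hom_def)

lemma finprod_zero_iff:
  assumes "finite S" "f \<in> S \<rightarrow> carrier R"
  shows "finprod R f S = \<zero> \<longleftrightarrow> (\<exists>s\<in>S. f s = \<zero>)"
  using assms
proof (induction S)
  case (insert s S)
  then have "finprod R f (insert s S) = f s \<otimes> finprod R f S"
    by (intro finprod_insert) auto
  then show ?case using insert by (simp add: integral_iff Pi_iff)
qed simp

lemma eval_lin_prod_zero_iff:
  assumes "finite S" "S \<subseteq> carrier R" "y \<in> carrier R"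
  shows "eval (lin_prod R S) y = \<zero> \<longleftrightarrow> y \<in> S"
proof -
  have "eval (lin_prod R S) y = \<zero> \<longleftrightarrow> (\<exists>s\<in>S. y \<ominus> s = \<zero>)"
    unfolding eval_lin_prod[OF assms(2,3)] using assms by (intro finprod_zero_iff) auto
  then show ?thesis using assms by (metis r_right_minus_eq subsetD)
qed

text \<open>\<open>g\<close> permutes the roots, so applying it to the coefficients merely reindexes
  the product.\<close>

lemma map_lin_prod:
  assumes g: "g \<in> ring_hom R R" "inj_on g (carrier R)" and S: "S \<subseteq> carrier R" "g ` S = S"
  shows "map g (lin_prod R S) = lin_prod R S"
proof -
  interpret P: domain "poly_ring R" by (rule poly_ring_domain)
  interpret g: ring_hom_cring R R g using g(1) by unfold_locales
  interpret h: ring_hom_cring "poly_ring R" "poly_ring R" "map g"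
    using map_poly_hom[OF domain_axioms domain_axioms g] by unfold_locales
  have "map g (lin_prod R S) = finprod (poly_ring R) (map g \<circ> (\<lambda>s. [\<one>, \<ominus> s])) S"
    unfolding lin_prod_def using S by (intro h.hom_finprod) (auto intro: lin_closed)
  also have "\<dots> = finprod (poly_ring R) (\<lambda>s. [\<one>, \<ominus> (g s)]) S"
    using S by (intro P.finprod_cong') (auto intro!: lin_closed)
  also have "\<dots> = finprod (poly_ring R) (\<lambda>s. [\<one>, \<ominus> s]) (g ` S)"
    using S g by (intro P.finprod_reindex[symmetric]) (auto intro!: lin_closed intro: inj_on_subset)
  finally show ?thesis using S by (simp add: lin_prod_def)
qed

lemma set_lin_prod_fixed:
  assumes "g \<in> ring_hom R R" "inj_on g (carrier R)" and "S \<subseteq> carrier R" "g ` S = S"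
    and "c \<in> set (lin_prod R S)"
  shows "g c = c"
proof -
  have "map g (lin_prod R S) = map id (lin_prod R S)" using map_lin_prod[OF assms(1-4)] by simp
  then show ?thesis using assms(5) by (metis id_apply map_eq_conv)
qed

end

section \<open>Elements that are the only root of their minimal polynomial\<close>

context field
begin

text \<open>Over an algebraically closed field the minimal polynomial splits, and with a single root
  all its factors equal \<open>X - x\<close>. This describes purely inseparable elements without
  reference to the characteristic.\<close>

lemma Irr_only_root:
  assumes "algebraically_closed R" "subfield E R" "x \<in> carrier R" "(algebraic over E) x"
    and only: "\<And>y. y \<in> carrier R \<Longrightarrow> eval (Irr E x) y = \<zero> \<Longrightarrow> y = x"
  shows "\<exists>n\<ge>1. Irr E x = [\<one>, \<ominus> x] [^]\<^bsub>poly_ring R\<^esub> (n::nat)"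
proof -
  interpret C: algebraically_closed R by fact
  interpret P: domain "poly_ring R" by (rule poly_ring_domain)
  define p where "p = Irr E x"
  note I = IrrE[OF assms(2-4), folded p_def]
  have pE: "p \<in> carrier (E[X])" by fact
  have p: "p \<in> carrier (poly_ring R)" using carrier_polynomial_shell[OF subfieldE(1)[OF assms(2)] I(1)] .
  have deg: "degree p \<ge> 1" using pirreducible_degree[OF assms(2) I(1,2)] .
  then have ne: "p \<noteq> []" by auto
  define n where "n = alg_mult p x"
  have "roots p = replicate_mset (count (roots p) x) x"
  proof (rule multiset_eqI)
    fix y
    have "y = x" if "y \<in># roots p"
      using that roots_mem_iff_is_root[OF p] only unfolding is_root_def p_def by auto
    then show "count (roots p) y = count (replicate_mset (count (roots p) x) x) y"
      by (metis count_replicate_mset not_in_iff)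
  qed
  then have "size (roots p) = count (roots p) x" by (metis size_replicate_mset)
  then have n: "degree p = n"
    using C.roots_over_carrier[OF p] alg_mult_eq_count_roots[OF p] by (simp add: splitted_def n_def)
  let ?q = "[\<one>, \<ominus> x] [^]\<^bsub>poly_ring R\<^esub> n"
  have q: "?q \<in> carrier (poly_ring R)" using lin_closed[OF assms(3)] by simp
  have "?q pdivides p" using alg_multE(1)[OF assms(3) p ne] by (simp add: n_def)
  then obtain r where r: "r \<in> carrier (poly_ring R)" "p = ?q \<otimes>\<^bsub>poly_ring R\<^esub> r"
    unfolding pdivides_def factor_def by auto
  have dq: "degree ?q = n" using polynomial_pow_degree[OF lin_closed[OF assms(3)], of n] by simp
  have rne: "r \<noteq> []" "?q \<noteq> []"
    using r ne P.r_null[OF q] P.l_null[OF r(1)] by (auto simp: univ_poly_zero)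
  have dr: "degree r = 0"
    using poly_mult_degree_eq[OF carrier_is_subring q[folded univ_poly_carrier] r(1)[folded univ_poly_carrier]]
      r(2) rne dq n by (simp add: univ_poly_mult)
  have lq: "lead_coeff ([\<one>, \<ominus> x] [^]\<^bsub>poly_ring R\<^esub> (j::nat)) = \<one> \<and> [\<one>, \<ominus> x] [^]\<^bsub>poly_ring R\<^esub> j \<noteq> []" for j
  proof (induction j)
    case 0 then show ?case by (simp add: univ_poly_one)
  next
    case (Suc j)
    have "[\<one>, \<ominus> x] [^]\<^bsub>poly_ring R\<^esub> j \<in> carrier (poly_ring R)" using lin_closed[OF assms(3)] by simp
    then show ?case
      using Suc poly_mult_lead_coeff[OF carrier_is_subring, of "[\<one>, \<ominus> x] [^]\<^bsub>poly_ring R\<^esub> j" "[\<one>, \<ominus> x]"]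
        poly_mult_integral[OF carrier_is_subring, of "[\<one>, \<ominus> x] [^]\<^bsub>poly_ring R\<^esub> j" "[\<one>, \<ominus> x]"]
        lin_closed[OF assms(3)]
      by (auto simp: univ_poly_mult univ_poly_carrier)
  qed
  have rin: "lead_coeff r \<in> carrier R"
    using r(1) rne by (cases r) (auto simp: univ_poly_carrier[symmetric] polynomial_def)
  have "lead_coeff p = lead_coeff ?q \<otimes> lead_coeff r"
    using poly_mult_lead_coeff[OF carrier_is_subring q[folded univ_poly_carrier] r(1)[folded univ_poly_carrier] rne(2,1)]
      r(2) by (simp add: univ_poly_mult)
  then have "lead_coeff r = \<one>" using lq[of n] I(3) rin by simp
  with dr rne have "r = [\<one>]" by (cases r) auto
  then have "p = ?q" using r(2) q P.r_one[OF q] by (simp add: univ_poly_one)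
  then show ?thesis using n deg unfolding p_def by auto
qed

text \<open>The minimal polynomial is a power of \<open>X - x\<close> and divides a polynomial over
  \<open>E\<close> in which \<open>x\<close> is a simple root, so the exponent is 1 and
  \<open>x\<close> is, up to sign, a coefficient. In the applications \<open>S\<close> is an orbit
  and \<open>only\<close> comes from extending embeddings; together they play the part of the
  fundamental theorem of Galois theory.\<close>

lemma mem_of_only_root:
  assumes "algebraically_closed R" "subfield E R"
    and S: "finite S" "S \<subseteq> carrier R" "x \<in> S" "lin_prod R S \<in> carrier (E[X])"
    and only: "\<And>y. y \<in> carrier R \<Longrightarrow> eval (Irr E x) y = \<zero> \<Longrightarrow> y = x"
  shows "x \<in> E"
proof -
  interpret P: domain "poly_ring R" by (rule poly_ring_domain)
  have x: "x \<in> carrier R" using S by auto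
  define p where "p = lin_prod R S"
  define q where "q = lin_prod R (S - {x})"
  have q: "q \<in> carrier (poly_ring R)" unfolding q_def using S by (intro lin_prod_closed) auto
  have pq: "p = [\<one>, \<ominus> x] \<otimes>\<^bsub>poly_ring R\<^esub> q"
    using lin_prod_insert[of "S - {x}" x] S unfolding p_def q_def by (auto simp: insert_absorb)
  have qx: "eval q x \<noteq> \<zero>"
    using eval_lin_prod_zero_iff[of "S - {x}" x] S unfolding q_def by auto
  have px: "eval p x = \<zero>" using eval_lin_prod_zero_iff[of S x] S unfolding p_def by auto
  have alg: "(algebraic over E) x"
    using algebraicI[OF S(4)] px lin_prod_monic[OF S(1,2)] unfolding p_def by (simp add: over_def)
  obtain n where n: "n \<ge> 1" "Irr E x = [\<one>, \<ominus> x] [^]\<^bsub>poly_ring R\<^esub> (n::nat)"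
    using Irr_only_root[OF assms(1,2) x alg only] by auto
  have "Irr E x pdivides p" using Irr_minimal[OF assms(2) x alg S(4)[folded p_def] px] .
  then obtain s where s: "s \<in> carrier (poly_ring R)" "p = Irr E x \<otimes>\<^bsub>poly_ring R\<^esub> s"
    unfolding pdivides_def factor_def by auto
  let ?l = "[\<one>, \<ominus> x]"
  note l = lin_closed[OF x]
  obtain j where j: "n = Suc j" using n by (cases n) auto
  let ?lj = "?l [^]\<^bsub>poly_ring R\<^esub> j"
  have lj: "?lj \<in> carrier (poly_ring R)" using l by simp
  have "p = ?l \<otimes>\<^bsub>poly_ring R\<^esub> (?lj \<otimes>\<^bsub>poly_ring R\<^esub> s)"
    using s n j l lj P.m_assoc[OF l lj s(1)] P.m_comm[OF lj l] by simp
  then have "q = ?lj \<otimes>\<^bsub>poly_ring R\<^esub> s"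
    using pq P.m_lcancel[of ?l q "?lj \<otimes>\<^bsub>poly_ring R\<^esub> s"] l lj q s(1)
    by (simp add: univ_poly_zero)
  then have ev: "eval q x = eval ?lj x \<otimes> eval s x"
    using ring_hom_mult[OF eval_is_hom[OF carrier_is_subring x] lj s(1)] by simp
  \<comment> \<open>A second factor \<open>X - x\<close> would make the cofactor \<open>q\<close>,
    whose roots are the other elements of \<open>S\<close>, vanish at \<open>x\<close>.\<close>
  have "j = 0"
  proof (rule ccontr)
    assume "j \<noteq> 0"
    then obtain i where i: "j = Suc i" by (cases j) auto
    have li: "?l [^]\<^bsub>poly_ring R\<^esub> i \<in> carrier (poly_ring R)" using l by simp
    have "eval ?lj x = eval (?l [^]\<^bsub>poly_ring R\<^esub> i) x \<otimes> eval ?l x"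
      using ring_hom_mult[OF eval_is_hom[OF carrier_is_subring x] li l] i by simp
    also have "eval ?l x = \<zero>" using x by (simp add: r_neg)
    finally have "eval ?lj x = \<zero>"
      using ring_hom_closed[OF eval_is_hom[OF carrier_is_subring x] li] by simp
    then show False
      using qx ev ring_hom_closed[OF eval_is_hom[OF carrier_is_subring x] s(1)] by simp
  qed
  then have "Irr E x = ?l" using n j l by simp
  then have "\<ominus> x \<in> E"
    using IrrE(1)[OF assms(2) x alg] by (simp add: univ_poly_carrier[symmetric] polynomial_def)
  then show "x \<in> E" using subringE(5)[OF subfieldE(1)[OF assms(2)]] x by (metis minus_minus)
qed

end

abbreviation (in ring) subhom :: "'a set \<Rightarrow> 'a set \<Rightarrow> ('a \<Rightarrow> 'a) set" where
  "subhom A A' \<equiv> ring_hom (R\<lparr>carrier := A\<rparr>) (R\<lparr>carrier := A'\<rparr>)"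

abbreviation (in ring) Aut :: "'a set \<Rightarrow> 'a set \<Rightarrow> ('a \<Rightarrow> 'a) set" where
  "Aut E L \<equiv> carrier (aut_group R E L)"

section \<open>Places\<close>

context field
begin

text \<open>Partial homomorphisms and places are represented by their graphs.\<close>

definition partial_hom :: "('a \<times> 'a) set \<Rightarrow> bool" where
  "partial_hom \<rho> \<longleftrightarrow> \<rho> \<subseteq> carrier R \<times> carrier R \<and> (\<one>, \<one>) \<in> \<rho> \<and>
     (\<forall>x y. (x, y) \<in> \<rho> \<longrightarrow> (\<ominus> x, \<ominus> y) \<in> \<rho>) \<and>
     (\<forall>x y x' y'. (x, y) \<in> \<rho> \<longrightarrow> (x', y') \<in> \<rho> \<longrightarrow> (x \<oplus> x', y \<oplus> y') \<in> \<rho> \<and> (x \<otimes> x', y \<otimes> y') \<in> \<rho>) \<and>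
     (\<forall>y. (\<zero>, y) \<in> \<rho> \<longrightarrow> y = \<zero>)"

text \<open>An element outside the domain has the value infinity. Asking that its inverse have the
  value zero, rather than merely lie in the domain, makes places maximal among partial homomorphisms
  on \<open>M\<close>.\<close>

definition place_on :: "'a set \<Rightarrow> ('a \<times> 'a) set \<Rightarrow> bool" where
  "place_on M \<rho> \<longleftrightarrow> partial_hom \<rho> \<and> Domain \<rho> \<subseteq> M \<and>
     (\<forall>x\<in>M - {\<zero>}. x \<in> Domain \<rho> \<or> (inv x, \<zero>) \<in> \<rho>)"

definition app :: "('a \<times> 'a) set \<Rightarrow> 'a \<Rightarrow> 'a" where
  "app \<rho> x = (THE y. (x, y) \<in> \<rho>)"

definition closed_field :: "'a set \<Rightarrow> bool" where
  "closed_field C \<longleftrightarrow> subfield C R \<and> (\<forall>p\<in>carrier (C[X]). degree p \<ge> 1 \<longrightarrow> (\<exists>c\<in>C. eval p c = \<zero>))"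

lemma partial_homD:
  assumes "partial_hom \<rho>"
  shows "(x, y) \<in> \<rho> \<Longrightarrow> x \<in> carrier R" "(x, y) \<in> \<rho> \<Longrightarrow> y \<in> carrier R" "(\<one>, \<one>) \<in> \<rho>"
    "(x, y) \<in> \<rho> \<Longrightarrow> (\<ominus> x, \<ominus> y) \<in> \<rho>"
    "(x, y) \<in> \<rho> \<Longrightarrow> (x', y') \<in> \<rho> \<Longrightarrow> (x \<oplus> x', y \<oplus> y') \<in> \<rho>"
    "(x, y) \<in> \<rho> \<Longrightarrow> (x', y') \<in> \<rho> \<Longrightarrow> (x \<otimes> x', y \<otimes> y') \<in> \<rho>"
    "(\<zero>, y) \<in> \<rho> \<Longrightarrow> y = \<zero>" "(\<zero>, \<zero>) \<in> \<rho>"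
    "(x, y) \<in> \<rho> \<Longrightarrow> (x', y') \<in> \<rho> \<Longrightarrow> (x \<ominus> x', y \<ominus> y') \<in> \<rho>"
    "(x, y) \<in> \<rho> \<Longrightarrow> (x, z) \<in> \<rho> \<Longrightarrow> y = z"
    "(x, y) \<in> \<rho> \<Longrightarrow> (x [^] (n::nat), y [^] n) \<in> \<rho>"
proof -
  note D = assms[unfolded partial_hom_def]
  show c1: "x \<in> carrier R" if "(x, y) \<in> \<rho>" for x y using D that by blast
  show c2: "y \<in> carrier R" if "(x, y) \<in> \<rho>" for x y using D that by blast
  show one: "(\<one>, \<one>) \<in> \<rho>" using D by blast
  show neg: "(\<ominus> x, \<ominus> y) \<in> \<rho>" if "(x, y) \<in> \<rho>" for x y using D that by blast
  show add: "(x \<oplus> x', y \<oplus> y') \<in> \<rho>" if "(x, y) \<in> \<rho>" "(x', y') \<in> \<rho>" for x y x' y' using D that by blast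
  show mult: "(x \<otimes> x', y \<otimes> y') \<in> \<rho>" if "(x, y) \<in> \<rho>" "(x', y') \<in> \<rho>" for x y x' y' using D that by blast
  show z: "y = \<zero>" if "(\<zero>, y) \<in> \<rho>" for y using D that by blast
  show "(\<zero>, \<zero>) \<in> \<rho>" using add[OF one neg[OF one]] by (simp add: r_neg)
  show min: "(x \<ominus> x', y \<ominus> y') \<in> \<rho>" if "(x, y) \<in> \<rho>" "(x', y') \<in> \<rho>" for x y x' y'
    using add[OF that(1) neg[OF that(2)]] by (simp add: a_minus_def)
  \<comment> \<open>The difference of the two pairs lies over zero, so the last conjunct of
    \<open>partial_hom\<close> is what makes a graph single-valued.\<close>
  show "y = z" if "(x, y) \<in> \<rho>" "(x, z) \<in> \<rho>"
    using z min[OF that] c1 c2 that by (metis r_right_minus_eq)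
  show "(x [^] n, y [^] n) \<in> \<rho>" if "(x, y) \<in> \<rho>"
    by (induction n) (use one mult that in auto)
qed

lemma app_eq: "partial_hom \<rho> \<Longrightarrow> (x, y) \<in> \<rho> \<Longrightarrow> app \<rho> x = y"
  unfolding app_def using partial_homD(10) by blast

lemma app_mem: "partial_hom \<rho> \<Longrightarrow> x \<in> Domain \<rho> \<Longrightarrow> (x, app \<rho> x) \<in> \<rho>"
  using app_eq by blast

lemma subring_Domain: "partial_hom \<rho> \<Longrightarrow> subring (Domain \<rho>) R"
proof (rule subringI)
  assume "partial_hom \<rho>"
  note D = partial_homD[OF this]
  show "Domain \<rho> \<subseteq> carrier R" using D(1) by auto
  show "\<one> \<in> Domain \<rho>" using D(3) by (rule DomainI)
  show "\<ominus> x \<in> Domain \<rho>" if x: "x \<in> Domain \<rho>" for x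
  proof -
    obtain a where a: "(x, a) \<in> \<rho>" using x by blast
    show ?thesis by (rule DomainI[OF D(4)[OF a]])
  qed
  show "x \<otimes> y \<in> Domain \<rho>" "x \<oplus> y \<in> Domain \<rho>" if xy: "x \<in> Domain \<rho>" "y \<in> Domain \<rho>" for x y
  proof -
    obtain a b where ab: "(x, a) \<in> \<rho>" "(y, b) \<in> \<rho>" using xy by blast
    show "x \<otimes> y \<in> Domain \<rho>" by (rule DomainI[OF D(6)[OF ab]])
    show "x \<oplus> y \<in> Domain \<rho>" by (rule DomainI[OF D(5)[OF ab]])
  qed
qed

lemma app_hom:
  assumes "partial_hom \<rho>" "A \<subseteq> Domain \<rho>"
  shows "app \<rho> \<in> ring_hom (R\<lparr>carrier := A\<rparr>) R"
proof (rule ring_hom_memI)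
  note D = partial_homD[OF assms(1)] and ap = app_eq[OF assms(1)]
  have am: "(x, app \<rho> x) \<in> \<rho>" if "x \<in> carrier (R\<lparr>carrier := A\<rparr>)" for x
    using app_mem[OF assms(1), of x] that assms(2) by auto
  show "app \<rho> x \<in> carrier R" if "x \<in> carrier (R\<lparr>carrier := A\<rparr>)" for x
    by (rule D(2)[OF am[OF that]])
  show "app \<rho> (x \<otimes>\<^bsub>R\<lparr>carrier := A\<rparr>\<^esub> y) = app \<rho> x \<otimes> app \<rho> y"
       "app \<rho> (x \<oplus>\<^bsub>R\<lparr>carrier := A\<rparr>\<^esub> y) = app \<rho> x \<oplus> app \<rho> y"
    if "x \<in> carrier (R\<lparr>carrier := A\<rparr>)" "y \<in> carrier (R\<lparr>carrier := A\<rparr>)" for x y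
    using ap[OF D(6)[OF am[OF that(1)] am[OF that(2)]]] ap[OF D(5)[OF am[OF that(1)] am[OF that(2)]]]
    by simp_all
  show "app \<rho> \<one>\<^bsub>R\<lparr>carrier := A\<rparr>\<^esub> = \<one>" using ap[OF D(3)] by simp
qed

lemma eval_mem_partial_hom:
  assumes "partial_hom \<rho>" "set ps \<subseteq> \<rho>" "(x, y) \<in> \<rho>"
  shows "(eval (map fst ps) x, eval (map snd ps) y) \<in> \<rho>"
  using assms(2)
proof (induction ps)
  case Nil show ?case using partial_homD(8)[OF assms(1)] by simp
next
  case (Cons a ps)
  note D = partial_homD[OF assms(1)]
  have "(fst a \<otimes> x [^] length ps, snd a \<otimes> y [^] length ps) \<in> \<rho>"
    using D(6)[OF _ D(11)[OF assms(3)]] Cons.prems by (metis list.set_intros(1) prod.collapse subsetD)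
  then show ?case using D(5) Cons by simp
qed

section \<open>Partial homomorphisms as subrings of the product ring\<close>

abbreviation RR where "RR \<equiv> RDirProd R R"

lemma RR_simps:
  "carrier RR = carrier R \<times> carrier R" "\<one>\<^bsub>RR\<^esub> = (\<one>, \<one>)" "\<zero>\<^bsub>RR\<^esub> = (\<zero>, \<zero>)"
  "(x, y) \<otimes>\<^bsub>RR\<^esub> (x', y') = (x \<otimes> x', y \<otimes> y')"
  "(x, y) \<oplus>\<^bsub>RR\<^esub> (x', y') = (x \<oplus> x', y \<oplus> y')"
  by (simp_all add: RDirProd_def DirProd_def monoid.defs)

lemma RR_cring: "cring RR"
proof -
  interpret RR: ring RR by (rule RDirProd_ring[OF ring_axioms ring_axioms])
  have "x \<otimes>\<^bsub>RR\<^esub> y = y \<otimes>\<^bsub>RR\<^esub> x" if "x \<in> carrier RR" "y \<in> carrier RR" for x y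
    using that by (cases x; cases y) (simp add: RR_simps(1,4) m_comm)
  then have "comm_monoid RR" by (rule RR.monoid_comm_monoidI)
  then show ?thesis using RR.ring_axioms by (simp add: cring_def)
qed

lemma RR_a_inv: "x \<in> carrier R \<Longrightarrow> y \<in> carrier R \<Longrightarrow> \<ominus>\<^bsub>RR\<^esub> (x, y) = (\<ominus> x, \<ominus> y)"
proof -
  assume xy: "x \<in> carrier R" "y \<in> carrier R"
  interpret RR: cring RR by (rule RR_cring)
  show ?thesis using xy by (intro RR.minus_equality) (auto simp: RR_simps l_neg)
qed

lemma RR_fst: "ring_hom_ring RR R fst" and RR_snd: "ring_hom_ring RR R snd"
proof -
  interpret RR: cring RR by (rule RR_cring)
  have "fst \<in> ring_hom RR R" "snd \<in> ring_hom RR R"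
    unfolding ring_hom_def RR_simps(1) by (auto simp: RR_simps(2,4,5))
  then show "ring_hom_ring RR R fst" "ring_hom_ring RR R snd"
    using ring_hom_ringI2[OF RR.ring_axioms ring_axioms] by blast+
qed

text \<open>With graphs viewed as subrings of the product, extending a homomorphism from
  \<open>A\<close> to \<open>A[x]\<close> by sending \<open>x\<close> to \<open>y\<close> means
  adjoining the pair \<open>(x, y)\<close> to a subring. The only obstruction is a nonzero second
  component over zero.\<close>

lemma partial_hom_iff: "partial_hom \<rho> \<longleftrightarrow> subring \<rho> RR \<and> (\<forall>y. (\<zero>, y) \<in> \<rho> \<longrightarrow> y = \<zero>)"
proof -
  interpret RR: cring RR by (rule RR_cring)
  show ?thesis
  proof
    assume h: "partial_hom \<rho>"
    have "subring \<rho> RR"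
    proof (rule RR.subringI)
      note D = partial_homD[OF h]
      show "\<rho> \<subseteq> carrier RR" using h by (simp add: partial_hom_def RR_simps(1))
      show "\<one>\<^bsub>RR\<^esub> \<in> \<rho>" using D(3) by (simp add: RR_simps)
      show "\<ominus>\<^bsub>RR\<^esub> z \<in> \<rho>" if "z \<in> \<rho>" for z
        using that D(1)[of "fst z" "snd z"] D(2)[of "fst z" "snd z"] D(4)[of "fst z" "snd z"]
          RR_a_inv[of "fst z" "snd z"] by simp
      show "z \<otimes>\<^bsub>RR\<^esub> w \<in> \<rho>" if "z \<in> \<rho>" "w \<in> \<rho>" for z w
        using that D(6)[of "fst z" "snd z" "fst w" "snd w"] RR_simps(4)[of "fst z" "snd z" "fst w" "snd w"]
        by simp
      show "z \<oplus>\<^bsub>RR\<^esub> w \<in> \<rho>" if "z \<in> \<rho>" "w \<in> \<rho>" for z w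
        using that D(5)[of "fst z" "snd z" "fst w" "snd w"] RR_simps(5)[of "fst z" "snd z" "fst w" "snd w"]
        by simp
    qed
    then show "subring \<rho> RR \<and> (\<forall>y. (\<zero>, y) \<in> \<rho> \<longrightarrow> y = \<zero>)" using partial_homD(7)[OF h] by simp
  next
    assume h: "subring \<rho> RR \<and> (\<forall>y. (\<zero>, y) \<in> \<rho> \<longrightarrow> y = \<zero>)"
    then have s: "subring \<rho> RR" by blast
    have sub: "\<rho> \<subseteq> carrier R \<times> carrier R" using subringE(1)[OF s] by (simp add: RR_simps)
    have "(\<ominus> x, \<ominus> y) \<in> \<rho>" if "(x, y) \<in> \<rho>" for x y
      using subringE(5)[OF s that] sub that RR_a_inv[of x y] by auto
    moreover have "(x \<otimes> x', y \<otimes> y') \<in> \<rho>" "(x \<oplus> x', y \<oplus> y') \<in> \<rho>"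
      if "(x, y) \<in> \<rho>" "(x', y') \<in> \<rho>" for x y x' y'
      using subringE(6,7)[OF s that] by (simp_all add: RR_simps)
    moreover have "(\<one>, \<one>) \<in> \<rho>" using subringE(3)[OF s] by (simp add: RR_simps)
    ultimately show "partial_hom \<rho>"
      unfolding partial_hom_def using sub conjunct2[OF h] by simp
  qed
qed

definition adjoin :: "('a \<times> 'a) set \<Rightarrow> 'a \<times> 'a \<Rightarrow> ('a \<times> 'a) set" where
  "adjoin \<rho> z = {ring.eval RR p z | p. set p \<subseteq> \<rho>}"

lemma subring_adjoin:
  assumes "subring \<rho> RR" "z \<in> carrier RR"
  shows "subring (adjoin \<rho> z) RR" "\<rho> \<subseteq> adjoin \<rho> z" "z \<in> adjoin \<rho> z"
proof -
  interpret RR: cring RR by (rule RR_cring)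
  note s = subringE[OF assms(1)]
  have inc: "set p \<subseteq> carrier RR" if "set p \<subseteq> \<rho>" for p using that s(1) by blast
  have const: "r \<in> adjoin \<rho> z" if "r \<in> \<rho>" for r
  proof -
    have "RR.eval [r] z = r" using that s(1) assms(2) by (simp add: subsetD)
    then show ?thesis unfolding adjoin_def using that by (intro CollectI exI[of _ "[r]"]) simp
  qed
  then show "\<rho> \<subseteq> adjoin \<rho> z" by auto
  show "z \<in> adjoin \<rho> z"
    unfolding adjoin_def
  proof (intro CollectI exI[of _ "[\<one>\<^bsub>RR\<^esub>, \<zero>\<^bsub>RR\<^esub>]"] conjI)
    show "set [\<one>\<^bsub>RR\<^esub>, \<zero>\<^bsub>RR\<^esub>] \<subseteq> \<rho>" using s(2,3) by simp
    show "z = RR.eval [\<one>\<^bsub>RR\<^esub>, \<zero>\<^bsub>RR\<^esub>] z" using assms(2) by simp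
  qed
  have mult: "a \<otimes>\<^bsub>RR\<^esub> b \<in> adjoin \<rho> z" if ab: "a \<in> adjoin \<rho> z" "b \<in> adjoin \<rho> z" for a b
  proof -
    obtain p q where pq: "set p \<subseteq> \<rho>" "set q \<subseteq> \<rho>" "a = RR.eval p z" "b = RR.eval q z"
      using ab unfolding adjoin_def by auto
    have "set (RR.poly_mult p q) \<subseteq> \<rho>"
      using RR.poly_mult_is_polynomial[OF assms(1) pq(1,2)] unfolding polynomial_def by fastforce
    moreover note RR.eval_poly_mult[OF inc[OF pq(1)] inc[OF pq(2)] assms(2)]
    ultimately show ?thesis unfolding adjoin_def pq(3,4) by (metis (mono_tags, lifting) mem_Collect_eq)
  qed
  have add: "a \<oplus>\<^bsub>RR\<^esub> b \<in> adjoin \<rho> z" if ab: "a \<in> adjoin \<rho> z" "b \<in> adjoin \<rho> z" for a b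
  proof -
    obtain p q where pq: "set p \<subseteq> \<rho>" "set q \<subseteq> \<rho>" "a = RR.eval p z" "b = RR.eval q z"
      using ab unfolding adjoin_def by auto
    have "set (RR.poly_add p q) \<subseteq> \<rho>"
      using RR.poly_add_is_polynomial[OF assms(1) pq(1,2)] unfolding polynomial_def by fastforce
    moreover note RR.eval_poly_add[OF inc[OF pq(1)] inc[OF pq(2)] assms(2)]
    ultimately show ?thesis unfolding adjoin_def pq(3,4) by (metis (mono_tags, lifting) mem_Collect_eq)
  qed
  have sub: "adjoin \<rho> z \<subseteq> carrier RR"
  proof
    fix a assume "a \<in> adjoin \<rho> z"
    then obtain p where p: "set p \<subseteq> \<rho>" "a = RR.eval p z" unfolding adjoin_def by blast
    show "a \<in> carrier RR" unfolding p(2) by (rule RR.eval_in_carrier[OF inc[OF p(1)] assms(2)])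
  qed
  show "subring (adjoin \<rho> z) RR"
  proof (rule RR.subringI[OF sub const[OF s(3)] _ mult add])
    fix a assume a: "a \<in> adjoin \<rho> z"
    have "\<ominus>\<^bsub>RR\<^esub> \<one>\<^bsub>RR\<^esub> \<otimes>\<^bsub>RR\<^esub> a \<in> adjoin \<rho> z" using mult[OF const[OF s(5)[OF s(3)]] a] .
    moreover have "\<ominus>\<^bsub>RR\<^esub> \<one>\<^bsub>RR\<^esub> \<otimes>\<^bsub>RR\<^esub> a = \<ominus>\<^bsub>RR\<^esub> a"
      using RR.l_minus[OF RR.one_closed, of a] RR.l_one[of a] sub a by auto
    ultimately show "\<ominus>\<^bsub>RR\<^esub> a \<in> adjoin \<rho> z" by simp
  qed
qed

lemma eval_RR:
  assumes "set p \<subseteq> carrier RR" "x \<in> carrier R" "y \<in> carrier R"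
  shows "ring.eval RR p (x, y) = (eval (map fst p) x, eval (map snd p) y)"
proof -
  interpret f: ring_hom_ring RR R fst by (rule RR_fst)
  interpret s: ring_hom_ring RR R snd by (rule RR_snd)
  have xy: "(x, y) \<in> carrier RR" using assms by (simp add: RR_simps)
  show ?thesis
    using f.eval_hom'[OF xy assms(1)] s.eval_hom'[OF xy assms(1)] by (intro prod_eqI) auto
qed

lemma eval_in_subring:
  assumes "subring C R" "set p \<subseteq> C" "c \<in> C" shows "eval p c \<in> C"
  using ring.eval_in_carrier[OF subring_is_ring[OF assms(1)], of p c] assms by simp

lemma eval_smult:
  assumes "set p \<subseteq> carrier R" "x \<in> carrier R" "a \<in> carrier R"
  shows "eval (map (\<lambda>b. a \<otimes> b) p) x = a \<otimes> eval p x"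
  using assms(1) by (induction p) (auto simp: assms r_distr m_assoc eval_in_carrier)

lemma eval_map2_add:
  assumes "length p = length q" "set p \<subseteq> carrier R" "set q \<subseteq> carrier R" "x \<in> carrier R"
  shows "eval (map2 (\<oplus>) p q) x = eval p x \<oplus> eval q x"
  using assms(1-3)
proof (induction p q rule: list_induct2)
  case (Cons a p b q)
  then have "eval p x \<in> carrier R" "eval q x \<in> carrier R" using assms(4) by (auto intro: eval_in_carrier)
  then show ?case using Cons assms(4) by (auto simp: l_distr a_ac)
qed simp

text \<open>Reversing the coefficients turns p(1/x) x^d into the value of the reversed polynomial at
  \<open>x\<close>, where \<open>d\<close> is the formal degree. The length is \<open>d + 1\<close>,
  hence the additional factor \<open>x\<close> on the right.\<close>

lemma eval_rev:
  assumes "set p \<subseteq> carrier R" "x \<in> carrier R" "y \<in> carrier R" "x \<otimes> y = \<one>"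
  shows "eval p y \<otimes> x [^] length p = eval (rev p) x \<otimes> x"
  using assms(1)
proof (induction p)
  case (Cons a p)
  have a: "a \<in> carrier R" and p: "set p \<subseteq> carrier R" using Cons by auto
  have e: "eval p y \<in> carrier R" "eval (rev p) x \<in> carrier R"
    using eval_in_carrier[OF p assms(3)] eval_in_carrier[of "rev p" x] p assms(2) by simp_all
  have yx: "y [^] length p \<otimes> x [^] length p = \<one>"
    using assms(2-4) by (metis nat_pow_distrib m_comm nat_pow_one)
  have "eval (a # p) y \<otimes> x [^] length (a # p)
      = a \<otimes> (y [^] length p \<otimes> x [^] length p) \<otimes> x \<oplus> (eval p y \<otimes> x [^] length p) \<otimes> x"
    using a e assms by (simp add: l_distr m_assoc)
  also have "\<dots> = a \<otimes> x \<oplus> (eval (rev p) x \<otimes> x) \<otimes> x" using Cons.IH[OF p] a by (simp add: yx)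
  also have "\<dots> = (eval (rev p) x \<otimes> x \<oplus> a) \<otimes> x" using a e assms by (simp add: l_distr a_comm)
  also have "eval (rev p) x \<otimes> x \<oplus> a = eval (rev (a # p)) x"
    using eval_append_aux[of "rev p" a x] p a assms by simp
  finally show ?case .
qed (use assms in simp)

text \<open>Each term of \<open>p\<close> at the pole \<open>x = 1/y\<close> is absorbed by a higher
  power of \<open>y\<close>, which leaves a positive power of an element of value zero.\<close>

lemma eval_pole:
  assumes "partial_hom \<rho>" "x \<in> carrier R" "(y, \<zero>) \<in> \<rho>" "x \<otimes> y = \<one>" "set p \<subseteq> Domain \<rho>" "length p \<le> n"
  shows "(eval p x \<otimes> y [^] n, \<zero>) \<in> \<rho>"
  using assms(5,6)
proof (induction p)
  case Nil
  have "y \<in> carrier R" using partial_homD(1)[OF assms(1,3)] .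
  then show ?case using partial_homD(8)[OF assms(1)] by simp
next
  case (Cons a p)
  note D = partial_homD[OF assms(1)]
  have y: "y \<in> carrier R" using D(1)[OF assms(3)] .
  obtain b where ab: "(a, b) \<in> \<rho>" using Cons by auto
  have a: "a \<in> carrier R" using D(1)[OF ab] .
  have p: "set p \<subseteq> carrier R" using Cons.prems D(1) by auto
  define j where "j = n - length p"
  have n: "n = length p + j" "j > 0" using Cons.prems unfolding j_def by auto
  have "x [^] length p \<otimes> y [^] length p = \<one>"
    using assms(2,4) y by (metis nat_pow_distrib nat_pow_one)
  then have "x [^] length p \<otimes> y [^] n = y [^] j"
    using assms(2) y unfolding n(1) by (simp add: nat_pow_mult[symmetric] m_assoc[symmetric])
  then have "eval (a # p) x \<otimes> y [^] n = a \<otimes> y [^] j \<oplus> eval p x \<otimes> y [^] n"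
    using a y assms(2) eval_in_carrier[OF p assms(2)] by (simp add: l_distr m_assoc)
  moreover have "(a \<otimes> y [^] j, \<zero>) \<in> \<rho>"
    using D(6)[OF ab D(11)[OF assms(3), of j]] n(2) D(2)[OF ab] by (simp add: nat_pow_zero)
  moreover have "(eval p x \<otimes> y [^] n, \<zero>) \<in> \<rho>" using Cons by auto
  ultimately show ?case using D(5)[of "a \<otimes> y [^] j" \<zero> "eval p x \<otimes> y [^] n" \<zero>] by simp
qed

text \<open>Valuation rings are integrally closed. At a pole, dividing an equation over
  \<open>E\<close> by the top power of \<open>x\<close> expresses the leading coefficient through
  elements of value zero, whereas a nonzero element of the field \<open>E\<close> is a unit of the
  domain.\<close>

lemma place_integral:
  assumes "place_on M \<rho>" "subfield E R" "E \<subseteq> Domain \<rho>" "x \<in> M" "x \<in> carrier R" "(algebraic over E) x"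
  shows "x \<in> Domain \<rho>"
proof (rule ccontr)
  assume nd: "x \<notin> Domain \<rho>"
  have h: "partial_hom \<rho>" using assms(1) by (simp add: place_on_def)
  note D = partial_homD[OF h]
  have x0: "x \<noteq> \<zero>" using nd D(8) by auto
  then have y: "(inv x, \<zero>) \<in> \<rho>" using assms(1,4) nd by (auto simp: place_on_def)
  have xy: "x \<otimes> inv x = \<one>" "inv x \<in> carrier R" using x0 assms(5) field_Units by auto
  obtain p where p: "p \<in> carrier (E[X])" "p \<noteq> []" "eval p x = \<zero>"
    using algebraicE[OF subfieldE(1)[OF assms(2)] assms(5)] assms(6) unfolding over_def by metis
  obtain a q where aq: "p = a # q" using p by (cases p) auto
  have a: "a \<in> E" "a \<noteq> \<zero>" "set q \<subseteq> E" using p aq by (auto simp: univ_poly_carrier[symmetric] polynomial_def)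
  have cl: "a \<in> carrier R" "set q \<subseteq> carrier R" using a subfieldE(3)[OF assms(2)] by auto
  define n where "n = length q"
  have e: "eval q x \<in> carrier R" using eval_in_carrier[OF cl(2) assms(5)] .
  have one: "x [^] n \<otimes> inv x [^] n = \<one>" using xy assms(5) by (metis nat_pow_distrib nat_pow_one)
  have "(eval q x \<otimes> inv x [^] n, \<zero>) \<in> \<rho>"
    using eval_pole[OF h assms(5) y xy(1), of q n] a assms(3) n_def by auto
  moreover have "a \<oplus> eval q x \<otimes> inv x [^] n = \<zero>"
  proof -
    have "\<zero> = eval p x \<otimes> inv x [^] n" using p xy by simp
    also have "\<dots> = a \<otimes> (x [^] n \<otimes> inv x [^] n) \<oplus> eval q x \<otimes> inv x [^] n"
      using cl e xy assms(5) unfolding aq n_def by (simp add: l_distr m_assoc)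
    finally show ?thesis using one cl by simp
  qed
  then have "a = \<ominus> (eval q x \<otimes> inv x [^] n)"
    using cl e xy by (metis minus_equality m_closed nat_pow_closed)
  ultimately have "(a, \<ominus> \<zero>) \<in> \<rho>" using D(4)[of "eval q x \<otimes> inv x [^] n" \<zero>] by simp
  then have a0: "(a, \<zero>) \<in> \<rho>" by simp
  have "inv a \<in> E" using subfield_m_inv(1)[OF assms(2)] a by auto
  then obtain b where b: "(inv a, b) \<in> \<rho>" using assms(3) by auto
  have "a \<otimes> inv a = \<one>" using subfield_m_inv(2)[OF assms(2)] a by auto
  then have "(\<one>, \<zero>) \<in> \<rho>" using D(6)[OF a0 b] D(2)[OF b] by simp
  then show False using D(10)[OF D(3)] by force
qed

text \<open>Places are maximal: for an \<open>x\<close> gained by \<open>\<rho>'\<close> the inverse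
  already has value zero under \<open>\<rho>\<close>, and multiplying the two pairs would give 1 the
  value zero.\<close>

lemma place_eq:
  assumes "place_on M \<rho>" "place_on M \<rho>'" "M \<subseteq> carrier R" "\<rho> \<subseteq> \<rho>'"
  shows "\<rho> = \<rho>'"
proof -
  have h: "partial_hom \<rho>" "partial_hom \<rho>'" using assms by (auto simp: place_on_def)
  note D = partial_homD[OF h(1)] and D' = partial_homD[OF h(2)]
  have "(x, y) \<in> \<rho>" if xy: "(x, y) \<in> \<rho>'" for x y
  proof (cases "x \<in> Domain \<rho>")
    case True
    then show ?thesis using D'(10)[OF xy] assms(4) by blast
  next
    case False
    have x: "x \<in> M" "x \<noteq> \<zero>" using xy assms(2) False D(8) by (auto simp: place_on_def)
    then have i: "(inv x, \<zero>) \<in> \<rho>'" using assms False by (auto simp: place_on_def)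
    have "x \<otimes> inv x = \<one>" using x assms(3) field_Units by auto
    then have "(\<one>, \<zero>) \<in> \<rho>'" using D'(6)[OF xy i] D'(2)[OF xy] by simp
    then show ?thesis using D'(10)[OF D'(3)] by force
  qed
  then show ?thesis using assms(4) by auto
qed

lemma place_inv:
  assumes "place_on M \<rho>" "M \<subseteq> carrier R" "(x, y) \<in> \<rho>" "y \<noteq> \<zero>" "subfield M R"
  shows "(inv x, inv y) \<in> \<rho>" "x \<noteq> \<zero>"
proof -
  have h: "partial_hom \<rho>" using assms by (auto simp: place_on_def)
  note D = partial_homD[OF h]
  show x: "x \<noteq> \<zero>" using D(7) assms by auto
  have xM: "x \<in> M" using assms(1,3) by (auto simp: place_on_def)
  have i: "inv x \<in> M - {\<zero>}" using subfield_m_inv(1)[OF assms(5)] x xM by auto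
  have xi: "x \<otimes> inv x = \<one>" "x \<in> carrier R" "inv (inv x) = x"
    using x xM assms(2) field_Units by auto
  have y: "y \<in> carrier R" "y \<otimes> inv y = \<one>" "inv y \<in> carrier R" using D(2)[OF assms(3)] assms(4) field_Units by auto
  have "inv x \<in> Domain \<rho>"
  proof (rule ccontr)
    assume "inv x \<notin> Domain \<rho>"
    then have "(x, \<zero>) \<in> \<rho>" using assms(1) i xi(3) by (auto simp: place_on_def)
    then show False using D(10)[OF assms(3)] assms(4) by auto
  qed
  then obtain z where z: "(inv x, z) \<in> \<rho>" by auto
  have "(\<one>, y \<otimes> z) \<in> \<rho>" using D(6)[OF assms(3) z] xi by simp
  then have "y \<otimes> z = \<one>" using D(10)[OF D(3), of "y \<otimes> z"] by simp
  then have "z = inv y" using y D(2)[OF z] by (metis comm_inv_char)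
  then show "(inv x, inv y) \<in> \<rho>" using z by simp
qed

lemma place_restrict:
  assumes "place_on M \<rho>" "E \<subseteq> M" "subfield E R"
  shows "place_on E (\<rho> \<inter> E \<times> UNIV)"
proof -
  have h: "partial_hom \<rho>" using assms by (auto simp: place_on_def)
  note D = partial_homD[OF h] and s = subringE[OF subfieldE(1)[OF assms(3)]]
  have "partial_hom (\<rho> \<inter> E \<times> UNIV)"
    unfolding partial_hom_def
  proof (intro conjI allI impI)
    show "\<rho> \<inter> E \<times> UNIV \<subseteq> carrier R \<times> carrier R" using D(1,2) by auto
    show "(\<one>, \<one>) \<in> \<rho> \<inter> E \<times> UNIV" using D(3) s(3) by simp
    show "(\<ominus> x, \<ominus> y) \<in> \<rho> \<inter> E \<times> UNIV" if "(x, y) \<in> \<rho> \<inter> E \<times> UNIV" for x y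
      using that D(4)[of x y] s(5)[of x] by simp
    show "(x \<oplus> x', y \<oplus> y') \<in> \<rho> \<inter> E \<times> UNIV" "(x \<otimes> x', y \<otimes> y') \<in> \<rho> \<inter> E \<times> UNIV"
      if "(x, y) \<in> \<rho> \<inter> E \<times> UNIV" "(x', y') \<in> \<rho> \<inter> E \<times> UNIV" for x y x' y'
      using that D(5,6)[of x y x' y'] s(6,7)[of x x'] by simp_all
    show "y = \<zero>" if "(\<zero>, y) \<in> \<rho> \<inter> E \<times> UNIV" for y using that D(7)[of y] by simp
  qed
  moreover have "x \<in> Domain (\<rho> \<inter> E \<times> UNIV) \<or> (inv x, \<zero>) \<in> \<rho> \<inter> E \<times> UNIV" if "x \<in> E - {\<zero>}" for x
  proof -
    have "x \<in> M - {\<zero>}" "inv x \<in> E" "x \<in> E"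
      using that assms(2) subfield_m_inv(1)[OF assms(3) that] by auto
    then show ?thesis using assms(1) unfolding place_on_def by blast
  qed
  ultimately show ?thesis unfolding place_on_def by auto
qed

end

section \<open>Maximal partial homomorphisms are places\<close>

context field
begin

text \<open>Coefficient lists start with the highest degree, so this is a relation of degree
  \<open>n\<close> for \<open>x\<close> with constant term 1 and all other coefficients of value
  zero. Such a relation rules out a finite value at \<open>x\<close>, as it would give 1 =
  0.\<close>

definition pole_free :: "('a \<times> 'a) set \<Rightarrow> 'a \<Rightarrow> nat \<Rightarrow> bool" where
  "pole_free \<rho> x n \<longleftrightarrow> (\<exists>q. (\<forall>a\<in>set q. (a, \<zero>) \<in> \<rho>) \<and> length q = n \<and> eval (q @ [\<one>]) x = \<zero>)"

context
  fixes \<rho> C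
  assumes h: "partial_hom \<rho>" and C: "closed_field C" and ran: "Range \<rho> \<subseteq> C"
    and maximal: "\<And>z. z \<in> carrier R \<times> C \<Longrightarrow> partial_hom (adjoin \<rho> z) \<Longrightarrow> z \<in> \<rho>"
begin

private lemmas D = partial_homD[OF h]

private lemma Csub: "subfield C R" "subring C R" "C \<subseteq> carrier R"
  using C subfieldE[of C R] by (auto simp: closed_field_def)

private lemma rho_sub: "subring \<rho> RR" and rho_carr: "\<rho> \<subseteq> carrier RR"
  using h unfolding partial_hom_iff by (auto dest: subringE(1))

text \<open>The domain of a maximal partial homomorphism is a local ring. Adjoining the pair of
  inverses keeps the graph single-valued, because a polynomial in that pair, multiplied by a power
  of \<open>(s, t)\<close>, falls back into \<open>\<rho>\<close>.\<close>

private lemma inv_mem: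
  assumes st: "(s, t) \<in> \<rho>" "t \<noteq> \<zero>"
  shows "s \<noteq> \<zero>" "(inv s, inv t) \<in> \<rho>"
proof -
  interpret RR: cring RR by (rule RR_cring)
  show s0: "s \<noteq> \<zero>" using D(7) st by auto
  have cl: "s \<in> carrier R" "t \<in> carrier R" using D(1,2)[OF st(1)] by auto
  have i: "s \<otimes> inv s = \<one>" "inv s \<in> carrier R" "t \<otimes> inv t = \<one>" "inv t \<in> carrier R"
    using cl s0 st(2) field_Units by auto
  have tC: "t \<in> C - {\<zero>}" using ran st by auto
  have itC: "inv t \<in> C" using subfield_m_inv(1)[OF Csub(1) tC] by auto
  let ?z = "(s, t)" and ?z' = "(inv s, inv t)"
  have zc: "?z \<in> carrier RR" "?z' \<in> carrier RR" using cl i by (auto simp: RR_simps)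
  have zz: "?z \<otimes>\<^bsub>RR\<^esub> ?z' = \<one>\<^bsub>RR\<^esub>" using i by (simp add: RR_simps)
  have key: "RR.eval p ?z' \<otimes>\<^bsub>RR\<^esub> ?z [^]\<^bsub>RR\<^esub> length p \<in> \<rho>" if "set p \<subseteq> \<rho>" for p
    using that
  proof (induction p)
    case Nil
    show ?case using zc subringE(2)[OF rho_sub] by simp
  next
    case (Cons a p)
    have a: "a \<in> carrier RR" "a \<in> \<rho>" and p: "set p \<subseteq> carrier RR" "set p \<subseteq> \<rho>" using Cons.prems rho_carr by auto
    have e: "RR.eval p ?z' \<in> carrier RR" by (rule RR.eval_in_carrier[OF p(1) zc(2)])
    have one: "?z' [^]\<^bsub>RR\<^esub> length p \<otimes>\<^bsub>RR\<^esub> ?z [^]\<^bsub>RR\<^esub> length p = \<one>\<^bsub>RR\<^esub>"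
      using RR.nat_pow_distrib[OF zc(2,1), of "length p"] zz RR.m_comm[OF zc] by simp
    have zp: "?z [^]\<^bsub>RR\<^esub> length p \<in> carrier RR" "?z' [^]\<^bsub>RR\<^esub> length p \<in> carrier RR" using zc by simp_all
    have "RR.eval (a # p) ?z' \<otimes>\<^bsub>RR\<^esub> ?z [^]\<^bsub>RR\<^esub> length (a # p)
      = (a \<otimes>\<^bsub>RR\<^esub> (?z' [^]\<^bsub>RR\<^esub> length p \<otimes>\<^bsub>RR\<^esub> ?z [^]\<^bsub>RR\<^esub> length p) \<oplus>\<^bsub>RR\<^esub> (RR.eval p ?z' \<otimes>\<^bsub>RR\<^esub> ?z [^]\<^bsub>RR\<^esub> length p)) \<otimes>\<^bsub>RR\<^esub> ?z"
      using a(1) e zc zp by (simp add: RR.l_distr RR.m_assoc)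
    also have "\<dots> = (a \<oplus>\<^bsub>RR\<^esub> (RR.eval p ?z' \<otimes>\<^bsub>RR\<^esub> ?z [^]\<^bsub>RR\<^esub> length p)) \<otimes>\<^bsub>RR\<^esub> ?z"
      unfolding one using a(1) by simp
    finally show ?case
      using subringE(6)[OF rho_sub subringE(7)[OF rho_sub a(2) Cons.IH[OF p(2)]] st(1)] by simp
  qed
  have pw: "?z [^]\<^bsub>RR\<^esub> (n::nat) = (s [^] n, t [^] n)" for n
    by (induction n) (simp_all add: RR_simps)
  have "partial_hom (adjoin \<rho> ?z')"
    unfolding partial_hom_iff
  proof (intro conjI allI impI)
    show "subring (adjoin \<rho> ?z') RR" by (rule subring_adjoin(1)[OF rho_sub zc(2)])
    fix y assume "(\<zero>, y) \<in> adjoin \<rho> ?z'"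
    then obtain p where p: "set p \<subseteq> \<rho>" "(\<zero>, y) = RR.eval p ?z'" unfolding adjoin_def by blast
    have "(\<zero>, y) \<in> carrier RR" unfolding p(2) using p(1) rho_carr by (intro RR.eval_in_carrier zc) auto
    then have y: "y \<in> carrier R" by (simp add: RR_simps)
    have "(\<zero>, y) \<otimes>\<^bsub>RR\<^esub> (s [^] length p, t [^] length p) \<in> \<rho>" using key[OF p(1)] unfolding p(2)[symmetric] pw .
    then have "(\<zero>, y \<otimes> t [^] length p) \<in> \<rho>" using cl by (simp add: RR_simps)
    then have z: "y \<otimes> t [^] length p = \<zero>" by (rule D(7))
    have "t [^] length p \<otimes> inv t [^] length p = \<one>" using i cl nat_pow_distrib[of t "inv t"] by simp
    then have "t [^] length p \<noteq> \<zero>" using i by auto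
    then show "y = \<zero>" using z y cl integral_iff by auto
  qed
  then show "?z' \<in> \<rho>" using maximal[of ?z'] i itC by auto
qed

private lemma smult_ker: "(a, \<zero>) \<in> \<rho> \<Longrightarrow> (b, c) \<in> \<rho> \<Longrightarrow> (b \<otimes> a, \<zero>) \<in> \<rho>"
  using D(6)[of b c a \<zero>] D(2)[of b c] by simp

private lemma pole_freeI:
  assumes "\<forall>a\<in>set q. (a, \<zero>) \<in> \<rho>" "(u, \<one>) \<in> \<rho>" "eval (q @ [u]) x = \<zero>" "x \<in> carrier R"
  shows "pole_free \<rho> x (length q)"
proof -
  have u: "u \<in> carrier R" "u \<noteq> \<zero>" "(inv u, inv \<one>) \<in> \<rho>"
    using D(1)[OF assms(2)] inv_mem[OF assms(2)] by auto
  have i: "inv u \<otimes> u = \<one>" "inv u \<in> carrier R" using u field_Units by auto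
  let ?q = "map (\<lambda>b. inv u \<otimes> b) q"
  have qc: "set q \<subseteq> carrier R" using assms(1) D(1) by auto
  have "eval (map (\<lambda>b. inv u \<otimes> b) (q @ [u])) x = \<zero>"
    using eval_smult[of "q @ [u]" x "inv u"] qc u(1) i(2) assms(3,4) by simp
  then have "eval (?q @ [\<one>]) x = \<zero>" using i by simp
  moreover have "(inv u \<otimes> a, \<zero>) \<in> \<rho>" if "a \<in> set q" for a
    using smult_ker[OF _ u(3)] assms(1) that by blast
  ultimately show ?thesis unfolding pole_free_def by (intro exI[of _ ?q]) simp
qed

private lemma pole_free_ge1: "pole_free \<rho> x n \<Longrightarrow> x \<in> carrier R \<Longrightarrow> n \<ge> 1"
  unfolding pole_free_def by (cases n) auto

text \<open>The classical descent of the extension theorem for places: a relation of degree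
  \<open>n'\<close> for \<open>1/x\<close> rewrites \<open>x^n'\<close> through lower powers with
  coefficients of value zero, and substituting this into the leading term of the relation for
  \<open>x\<close> lowers its degree.\<close>

private lemma pole_free_descend:
  assumes x: "x \<in> carrier R" "y \<in> carrier R" "x \<otimes> y = \<one>"
    and nx: "pole_free \<rho> x n" and ny: "pole_free \<rho> y n'" and le: "n' \<le> n"
  shows "pole_free \<rho> x (n - 1)"
proof -
  obtain q where q: "\<forall>a\<in>set q. (a, \<zero>) \<in> \<rho>" "length q = n" "eval (q @ [\<one>]) x = \<zero>"
    using nx unfolding pole_free_def by blast
  obtain v where v: "\<forall>a\<in>set v. (a, \<zero>) \<in> \<rho>" "length v = n'" "eval (v @ [\<one>]) y = \<zero>"
    using ny unfolding pole_free_def by blast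
  have n1: "n \<ge> 1" "n' \<ge> 1" using pole_free_ge1[OF nx x(1)] pole_free_ge1[OF ny x(2)] .
  obtain a q' where aq: "q = a # q'" using q n1 by (cases q) auto
  have qc: "set q \<subseteq> carrier R" "set v \<subseteq> carrier R" "a \<in> carrier R" "set q' \<subseteq> carrier R"
    using q(1) v(1) D(1) aq by auto
  let ?w = "rev v"
  have wc: "set ?w \<subseteq> carrier R" using qc by simp
  have ew: "eval ?w x \<in> carrier R" by (rule eval_in_carrier[OF wc x(1)])
  have "eval (\<one> # ?w) x \<otimes> x = \<zero>"
    using eval_rev[of "v @ [\<one>]" x y] qc x v(3) by simp
  moreover have "eval (\<one> # ?w) x \<in> carrier R" using wc x by (intro eval_in_carrier) auto
  ultimately have "eval (\<one> # ?w) x = \<zero>" using x integral_iff[of "eval (\<one> # ?w) x" x] by auto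
  then have "x [^] n' \<oplus> eval ?w x = \<zero>" using v(2) x by simp
  then have xn': "x [^] n' = \<ominus> eval ?w x" using x ew minus_equality[of "x [^] n'" "eval ?w x"] by simp
  \<comment> \<open>These are the coefficients of \<open>a x^n\<close> after the substitution. The
    zeros account for the factor x^(n - n'), which gives \<open>w'\<close> the length of the
    remaining relation \<open>q' @ [\<one>]\<close>.\<close>
  define w' where "w' = map (\<lambda>b. \<ominus> a \<otimes> b) ?w @ replicate (n - n') \<zero>"
  have w'c: "set w' \<subseteq> carrier R" unfolding w'_def using qc by auto
  have w'k: "(b, \<zero>) \<in> \<rho>" if b: "b \<in> set w'" for b
  proof (cases "b = \<zero>")
    case True then show ?thesis using D(8) by simp
  next
    case False
    then obtain c where c: "c \<in> set v" "b = \<ominus> a \<otimes> c" using b by (auto simp: w'_def)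
    have "(\<ominus> a, \<ominus> \<zero>) \<in> \<rho>" using q(1) aq by (intro D(4)) auto
    then show ?thesis unfolding c(2) using smult_ker v(1) c(1) by blast
  qed
  have lw: "length w' = n" unfolding w'_def using v(2) le by simp
  have "eval w' x = eval (map (\<lambda>b. \<ominus> a \<otimes> b) ?w) x \<otimes> x [^] (n - n')"
  proof -
    have "eval (replicate (n - n') \<zero>) x = \<zero>" using eval_replicate[of "[]" x "n - n'"] x by simp
    moreover have "set (map (\<lambda>b. \<ominus> a \<otimes> b) ?w) \<subseteq> carrier R" using wc qc(3) by auto
    moreover from this have "eval (map (\<lambda>b. \<ominus> a \<otimes> b) ?w) x \<in> carrier R" using x by (intro eval_in_carrier)
    moreover have "set (replicate (n - n') \<zero>) \<subseteq> carrier R" by auto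
    ultimately show ?thesis
      unfolding w'_def using eval_append[of "map (\<lambda>b. \<ominus> a \<otimes> b) ?w" "replicate (n - n') \<zero>" x] x by simp
  qed
  also have "\<dots> = (\<ominus> a \<otimes> eval ?w x) \<otimes> x [^] (n - n')"
    using eval_smult[OF wc x(1), of "\<ominus> a"] qc(3) by simp
  also have "\<dots> = a \<otimes> (x [^] n' \<otimes> x [^] (n - n'))"
    unfolding xn' using qc(3) ew x by (simp add: l_minus r_minus m_assoc)
  also have "\<dots> = a \<otimes> x [^] n" using x le by (simp add: nat_pow_mult)
  finally have ew': "eval w' x = a \<otimes> x [^] n" .
  define r where "r = map2 (\<oplus>) w' (q' @ [\<one>])"
  have lq': "length (q' @ [\<one>]) = n" using q(2) aq by simp
  have er: "eval r x = eval w' x \<oplus> eval (q' @ [\<one>]) x"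
    unfolding r_def using lw lq' w'c qc(4) x by (intro eval_map2_add) auto
  have "eval (q @ [\<one>]) x = a \<otimes> x [^] n \<oplus> eval (q' @ [\<one>]) x" using lq' unfolding aq by simp
  then have r0: "eval r x = \<zero>" using er ew' q(3) by simp
  have lr: "length r = n" unfolding r_def using lw lq' by simp
  have rnth: "r ! i = w' ! i \<oplus> (q' @ [\<one>]) ! i" if "i < n" for i
    unfolding r_def using that lw lq' by simp
  have rk: "(r ! i, \<zero>) \<in> \<rho>" if "i < n - 1" for i
  proof -
    have "(w' ! i, \<zero>) \<in> \<rho>" using w'k[of "w' ! i"] that lw by simp
    moreover have "(q' ! i, \<zero>) \<in> \<rho>" using q(1) aq that lq' by auto
    ultimately have "(w' ! i \<oplus> q' ! i, \<zero> \<oplus> \<zero>) \<in> \<rho>" by (rule D(5))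
    moreover have "i < length q'" using that lq' by simp
    then have "(q' @ [\<one>]) ! i = q' ! i" by (simp add: nth_append)
    ultimately show ?thesis using rnth[of i] that by simp
  qed
  \<comment> \<open>The constant term is no longer 1 but still has value 1, and
    \<open>pole_freeI\<close> divides by it.\<close>
  have rl: "(r ! (n - 1), \<one>) \<in> \<rho>"
  proof -
    have "(w' ! (n - 1), \<zero>) \<in> \<rho>" using w'k[of "w' ! (n - 1)"] n1 lw by simp
    then have "(w' ! (n - 1) \<oplus> \<one>, \<zero> \<oplus> \<one>) \<in> \<rho>" using D(3) by (rule D(5))
    moreover have "n - 1 = length q'" using lq' by simp
    then have "(q' @ [\<one>]) ! (n - 1) = \<one>" by simp
    ultimately show ?thesis using rnth[of "n - 1"] n1 by simp
  qed
  have rsplit: "r = butlast r @ [r ! (n - 1)]"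
    using lr n1 by (metis append_butlast_last_id last_conv_nth length_0_conv not_one_le_zero)
  have "pole_free \<rho> x (length (butlast r))"
  proof (rule pole_freeI[OF _ rl])
    show "\<forall>b\<in>set (butlast r). (b, \<zero>) \<in> \<rho>"
      using rk lr by (auto simp: in_set_conv_nth nth_butlast)
    show "eval (butlast r @ [r ! (n - 1)]) x = \<zero>" using r0 rsplit by simp
  qed (rule x(1))
  then show ?thesis using lr by simp
qed

private lemma Range_subfield: "subfield (Range \<rho>) R"
proof (rule subfieldI')
  show "subring (Range \<rho>) R"
  proof (rule subringI)
    show "Range \<rho> \<subseteq> carrier R" using D(2) by auto
    show "\<one> \<in> Range \<rho>" using D(3) by (rule RangeI)
    show "\<ominus> x \<in> Range \<rho>" if x: "x \<in> Range \<rho>" for x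
    proof -
      obtain a where a: "(a, x) \<in> \<rho>" using x by blast
      show ?thesis by (rule RangeI[OF D(4)[OF a]])
    qed
    show "x \<otimes> y \<in> Range \<rho>" "x \<oplus> y \<in> Range \<rho>" if xy: "x \<in> Range \<rho>" "y \<in> Range \<rho>" for x y
    proof -
      obtain a b where ab: "(a, x) \<in> \<rho>" "(b, y) \<in> \<rho>" using xy by blast
      show "x \<otimes> y \<in> Range \<rho>" by (rule RangeI[OF D(6)[OF ab]])
      show "x \<oplus> y \<in> Range \<rho>" by (rule RangeI[OF D(5)[OF ab]])
    qed
  qed
  fix t assume t: "t \<in> Range \<rho> - {\<zero>}"
  then obtain s where "(s, t) \<in> \<rho>" "t \<noteq> \<zero>" by blast
  then show "inv t \<in> Range \<rho>" using inv_mem(2) by blast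
qed

text \<open>By maximality no \<open>c\<close> in \<open>C\<close> can serve as value of
  \<open>x\<close>, so the reductions of the polynomials vanishing at \<open>x\<close> have no
  common root in \<open>C\<close>. They form an ideal over the residue field, and as
  \<open>C\<close> is algebraically closed it must be the unit ideal; a member reducing to 1 is the
  desired relation.\<close>

private lemma pole_free_of_not_mem:
  assumes x: "x \<in> carrier R" "x \<notin> Domain \<rho>"
  shows "\<exists>n. pole_free \<rho> x n"
proof -
  interpret RR: cring RR by (rule RR_cring)
  interpret s: ring_hom_ring RR R snd by (rule RR_snd)
  interpret f: ring_hom_ring RR R fst by (rule RR_fst)
  define k0 where "k0 = Range \<rho>"
  have k0: "subfield k0 R" unfolding k0_def by (rule Range_subfield)
  note k0r = subfieldE(1)[OF k0]
  interpret P: domain "k0[X]" by (rule univ_poly_is_domain[OF k0r])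
  \<comment> \<open>Lists of pairs in \<open>\<rho>\<close> are polynomials over the domain carried
    along with their reductions.\<close>
  define V where "V = {p. set p \<subseteq> \<rho> \<and> eval (map fst p) x = \<zero>}"
  define J where "J = (\<lambda>p. normalize (map snd p)) ` V"
  have carr: "set p \<subseteq> carrier RR" if "set p \<subseteq> \<rho>" for p using that rho_carr by blast
  have fc: "set (map fst p) \<subseteq> carrier R" "set (map snd p) \<subseteq> carrier R" if "set p \<subseteq> \<rho>" for p
    using that D(1,2) by auto
  have Jc: "J \<subseteq> carrier (k0[X])"
  proof
    fix g assume "g \<in> J"
    then obtain p where p: "set p \<subseteq> \<rho>" "g = normalize (map snd p)" unfolding J_def V_def by blast
    have "set (map snd p) \<subseteq> k0" using p(1) unfolding k0_def by force
    then have "polynomial k0 g" unfolding p(2) by (rule normalize_gives_polynomial)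
    then show "g \<in> carrier (k0[X])" by (simp add: univ_poly_carrier)
  qed
  have Jadd: "f1 \<oplus>\<^bsub>k0[X]\<^esub> f2 \<in> J" if J: "f1 \<in> J" "f2 \<in> J" for f1 f2
  proof -
    obtain p q where p: "set p \<subseteq> \<rho>" "eval (map fst p) x = \<zero>" "f1 = normalize (map snd p)"
      and q: "set q \<subseteq> \<rho>" "eval (map fst q) x = \<zero>" "f2 = normalize (map snd q)"
      using J unfolding J_def V_def by blast
    define r where "r = RR.poly_add p q"
    have r: "set r \<subseteq> \<rho>"
      using RR.poly_add_is_polynomial[OF rho_sub p(1) q(1)] unfolding polynomial_def r_def by auto
    have "eval (map fst r) x = eval (normalize (map fst r)) x" using eval_normalize[OF fc(1)[OF r] x(1)] by simp
    also have "\<dots> = \<zero>"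
      unfolding r_def f.poly_add_hom'[OF carr[OF p(1)] carr[OF q(1)]]
      using eval_poly_add[OF fc(1)[OF p(1)] fc(1)[OF q(1)] x(1)] p(2) q(2) by simp
    finally have "r \<in> V" using r unfolding V_def by simp
    moreover have "f1 \<oplus>\<^bsub>k0[X]\<^esub> f2 = normalize (map snd r)"
      unfolding r_def s.poly_add_hom'[OF carr[OF p(1)] carr[OF q(1)]] univ_poly_add p(3) q(3)
      using poly_add_normalize(3)[OF fc(2)[OF p(1)] fc(2)[OF q(1)]] by simp
    ultimately show ?thesis unfolding J_def by blast
  qed
  have Jmult: "g \<otimes>\<^bsub>k0[X]\<^esub> f1 \<in> J" if J: "f1 \<in> J" and g: "g \<in> carrier (k0[X])" for f1 g
  proof -
    obtain p where p: "set p \<subseteq> \<rho>" "eval (map fst p) x = \<zero>" "f1 = normalize (map snd p)"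
      using J unfolding J_def V_def by blast
    have gk: "set g \<subseteq> k0" using g by (auto simp: univ_poly_carrier[symmetric] polynomial_def)
    have gc: "set g \<subseteq> carrier R" using gk subfieldE(3)[OF k0] by auto
    have "\<exists>q. set q \<subseteq> \<rho> \<and> map snd q = g"
      using gk
    proof (induction g)
      case (Cons a g)
      then obtain q b where "set q \<subseteq> \<rho>" "map snd q = g" "(b, a) \<in> \<rho>" unfolding k0_def by auto
      then show ?case by (intro exI[of _ "(b, a) # q"]) auto
    qed simp
    then obtain q where q: "set q \<subseteq> \<rho>" "map snd q = g" by blast
    define r where "r = RR.poly_mult q p"
    have r: "set r \<subseteq> \<rho>"
      using RR.poly_mult_is_polynomial[OF rho_sub q(1) p(1)] unfolding polynomial_def r_def by auto
    have "eval (map fst r) x = eval (normalize (map fst r)) x" using eval_normalize[OF fc(1)[OF r] x(1)] by simp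
    also have "\<dots> = \<zero>"
      unfolding r_def f.poly_mult_hom'[OF carr[OF q(1)] carr[OF p(1)]]
      using eval_poly_mult[OF fc(1)[OF q(1)] fc(1)[OF p(1)] x(1)] p(2)
        eval_in_carrier[OF fc(1)[OF q(1)] x(1)] by simp
    finally have "r \<in> V" using r unfolding V_def by simp
    moreover have "g \<otimes>\<^bsub>k0[X]\<^esub> f1 = normalize (map snd r)"
      unfolding r_def s.poly_mult_hom'[OF carr[OF q(1)] carr[OF p(1)]] univ_poly_mult p(3) q(2)
      using poly_mult_normalize[OF fc(2)[OF p(1)] gc] poly_mult_comm[OF gc fc(2)[OF p(1)]]
        poly_mult_comm[OF gc normalize_in_carrier[OF fc(2)[OF p(1)]]] by simp
    ultimately show ?thesis unfolding J_def by blast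
  qed
  have idl: "ideal J (k0[X])"
  proof (rule idealI)
    show "ring (k0[X])" by (rule P.ring_axioms)
    show "subgroup J (add_monoid (k0[X]))"
    proof (rule P.add.subgroupI)
      show "J \<subseteq> carrier (k0[X])" by (rule Jc)
      have "[] \<in> V" unfolding V_def by simp
      then show "J \<noteq> {}" unfolding J_def by blast
      show "\<ominus>\<^bsub>k0[X]\<^esub> a \<in> J" if a: "a \<in> J" for a
      proof -
        have "\<ominus>\<^bsub>k0[X]\<^esub> \<one>\<^bsub>k0[X]\<^esub> \<otimes>\<^bsub>k0[X]\<^esub> a \<in> J" using Jmult[OF a] by simp
        then show ?thesis using P.l_minus[OF P.one_closed, of a] a Jc by auto
      qed
    qed (rule Jadd)
    show "y \<otimes>\<^bsub>k0[X]\<^esub> a \<in> J" if "a \<in> J" "y \<in> carrier (k0[X])" for a y using Jmult that by blast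
    show "a \<otimes>\<^bsub>k0[X]\<^esub> y \<in> J" if "a \<in> J" "y \<in> carrier (k0[X])" for a y
      using Jmult[OF that] P.m_comm[of y a] that Jc by auto
  qed
  have noroot: "\<exists>g\<in>J. eval g c \<noteq> \<zero>" if c: "c \<in> C" for c
  proof -
    have cc: "c \<in> carrier R" using c Csub(3) by auto
    have zc: "(x, c) \<in> carrier RR" using x cc by (simp add: RR_simps)
    have "\<not> partial_hom (adjoin \<rho> (x, c))" using maximal[of "(x, c)"] x c by blast
    then obtain y where y: "(\<zero>, y) \<in> adjoin \<rho> (x, c)" "y \<noteq> \<zero>"
      unfolding partial_hom_iff using subring_adjoin(1)[OF rho_sub zc] by blast
    then obtain p where p: "set p \<subseteq> \<rho>" "(\<zero>, y) = RR.eval p (x, c)" unfolding adjoin_def by blast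
    have "(\<zero>, y) = (eval (map fst p) x, eval (map snd p) c)"
      using p(2) eval_RR[OF carr[OF p(1)] x(1) cc] by simp
    then have "p \<in> V" "eval (map snd p) c \<noteq> \<zero>" using p(1) y(2) unfolding V_def by auto
    moreover have "eval (normalize (map snd p)) c = eval (map snd p) c"
      using eval_normalize[OF fc(2)[OF p(1)] cc] .
    ultimately show ?thesis unfolding J_def by force
  qed
  have C0: "\<zero> \<in> C" using subringE(2)[OF Csub(2)] .
  have "J \<noteq> {[]}" using noroot[OF C0] by auto
  then obtain g where g: "g \<in> carrier (k0[X])" "lead_coeff g = \<one>" "J = PIdl\<^bsub>k0[X]\<^esub> g"
    using exists_unique_gen[OF k0 idl] by blast
  have "degree g = 0"
  proof (rule ccontr)
    assume d: "degree g \<noteq> 0"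
    have "k0 \<subseteq> C" using ran unfolding k0_def .
    then have "g \<in> carrier (C[X])" using g(1) by (auto simp: univ_poly_carrier[symmetric] polynomial_def)
    then obtain c where c: "c \<in> C" "eval g c = \<zero>" using C d unfolding closed_field_def by force
    have cc: "c \<in> carrier R" using c Csub(3) by auto
    obtain f where f: "f \<in> J" "eval f c \<noteq> \<zero>" using noroot[OF c(1)] by blast
    then obtain b where b: "b \<in> carrier (k0[X])" "f = b \<otimes>\<^bsub>k0[X]\<^esub> g" unfolding g(3) cgenideal_def by blast
    have "eval f c = eval b c \<otimes> eval g c"
      using ring_hom_mult[OF eval_is_hom[OF k0r cc] b(1) g(1)] b(2) by simp
    then show False using f(2) c(2) ring_hom_closed[OF eval_is_hom[OF k0r cc] b(1)] by simp
  qed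
  moreover have "g \<noteq> []"
  proof
    assume "g = []"
    then have "J \<subseteq> {[]}" unfolding g(3) cgenideal_def using P.r_null by (auto simp: univ_poly_zero)
    moreover have "J \<noteq> {}" using noroot[OF C0] by auto
    ultimately show False using \<open>J \<noteq> {[]}\<close> by blast
  qed
  ultimately have "g = [\<one>]" using g(2) by (cases g) auto
  moreover have "g \<in> J" unfolding g(3) by (rule P.cgenideal_self[OF g(1)])
  ultimately obtain p where p: "set p \<subseteq> \<rho>" "eval (map fst p) x = \<zero>" "normalize (map snd p) = [\<one>]"
    unfolding J_def V_def by auto
  \<comment> \<open>Normalising strips leading zeros only, so the reduced coefficients are zeros
    followed by a single 1 in the position of the constant term.\<close>
  define j where "j = length (map snd p) - length (normalize (map snd p))"
  have sp: "map snd p = replicate j \<zero> @ [\<one>]"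
    using normalize_trick[of "map snd p"] unfolding j_def p(3) .
  obtain q u where qu: "p = q @ [u]" "map snd q = replicate j \<zero>" "snd u = \<one>"
    using sp by (auto simp: map_eq_append_conv)
  have "\<forall>a\<in>set (map fst q). (a, \<zero>) \<in> \<rho>"
  proof
    fix a assume "a \<in> set (map fst q)"
    then obtain b where b: "(a, b) \<in> set q" by auto
    then have "b \<in> set (map snd q)" by force
    then have "b = \<zero>" unfolding qu(2) by simp
    then show "(a, \<zero>) \<in> \<rho>" using b p(1) qu(1) by auto
  qed
  moreover have "(fst u, \<one>) \<in> \<rho>" using p(1) qu(1,3) by (cases u) auto
  moreover have "eval (map fst q @ [fst u]) x = \<zero>" using p(2) unfolding qu(1) by simp
  ultimately show ?thesis using pole_freeI[of "map fst q" "fst u" x] x(1) by blast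
qed

text \<open>If \<open>x\<close> and its inverse were both outside the domain, both would satisfy
  relations; among those of minimal degree the descent shortens the longer one.\<close>

lemma maximal_is_place: "place_on (carrier R) \<rho>"
  unfolding place_on_def
proof (intro conjI ballI h)
  show "Domain \<rho> \<subseteq> carrier R" using D(1) by auto
  fix x assume x: "x \<in> carrier R - {\<zero>}"
  have xi: "x \<otimes> inv x = \<one>" "inv x \<otimes> x = \<one>" "inv x \<in> carrier R" "inv (inv x) = x" "x \<in> carrier R"
    using x field_Units by auto
  have "x \<in> Domain \<rho> \<or> inv x \<in> Domain \<rho>"
  proof (rule ccontr)
    assume "\<not> (x \<in> Domain \<rho> \<or> inv x \<in> Domain \<rho>)"
    then have ex: "\<exists>n. pole_free \<rho> x n" "\<exists>n. pole_free \<rho> (inv x) n"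
      using pole_free_of_not_mem xi by auto
    define n where "n = (LEAST n. pole_free \<rho> x n)"
    define n' where "n' = (LEAST n. pole_free \<rho> (inv x) n)"
    have n: "pole_free \<rho> x n" "pole_free \<rho> (inv x) n'"
      unfolding n_def n'_def using ex by (auto intro: LeastI_ex)
    have ge: "n \<ge> 1" "n' \<ge> 1" using pole_free_ge1 n xi by auto
    consider "n' \<le> n" | "n \<le> n'" by linarith
    then show False
    proof cases
      case 1
      then have "pole_free \<rho> x (n - 1)" by (rule pole_free_descend[OF xi(5,3,1) n])
      then have "n \<le> n - 1" unfolding n_def by (rule Least_le)
      then show False using ge by simp
    next
      case 2
      then have "pole_free \<rho> (inv x) (n' - 1)" by (rule pole_free_descend[OF xi(3,5,2) n(2,1)])
      then have "n' \<le> n' - 1" unfolding n'_def by (rule Least_le)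
      then show False using ge by simp
    qed
  qed
  then consider "x \<in> Domain \<rho>" | t where "(inv x, t) \<in> \<rho>" by blast
  then show "x \<in> Domain \<rho> \<or> (inv x, \<zero>) \<in> \<rho>"
  proof cases
    case (2 t)
    then show ?thesis using inv_mem(2)[OF 2] xi(4) by (cases "t = \<zero>") auto
  qed simp
qed

end

text \<open>Zorn's lemma among extensions with values in \<open>C\<close>. Adjoining a pair with
  second component in \<open>C\<close> does not leave this family, so its maximal members satisfy
  the maximality assumed above.\<close>

theorem place_extension:
  assumes h0: "partial_hom \<rho>\<^sub>0" and C: "closed_field C" and ran: "Range \<rho>\<^sub>0 \<subseteq> C"
  obtains \<rho> where "place_on (carrier R) \<rho>" "\<rho>\<^sub>0 \<subseteq> \<rho>" "Range \<rho> \<subseteq> C"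
proof -
  define A where "A = {\<rho>. partial_hom \<rho> \<and> \<rho>\<^sub>0 \<subseteq> \<rho> \<and> Range \<rho> \<subseteq> C}"
  have "\<Union>Ch \<in> A" if ch: "Ch \<noteq> {}" "subset.chain A Ch" for Ch
  proof -
    have mem: "\<And>\<rho>. \<rho> \<in> Ch \<Longrightarrow> partial_hom \<rho> \<and> \<rho>\<^sub>0 \<subseteq> \<rho> \<and> Range \<rho> \<subseteq> C"
      using ch(2) unfolding subset_chain_def A_def by blast
    have tot: "\<exists>\<rho>\<in>Ch. z \<in> \<rho> \<and> w \<in> \<rho>" if zw: "z \<in> \<Union>Ch" "w \<in> \<Union>Ch" for z w
    proof -
      obtain \<rho> \<sigma> where "z \<in> \<rho>" "\<rho> \<in> Ch" "w \<in> \<sigma>" "\<sigma> \<in> Ch" using zw by blast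
      then show ?thesis using ch(2) unfolding subset_chain_def by blast
    qed
    have "partial_hom (\<Union>Ch)"
      unfolding partial_hom_def
    proof (intro conjI allI impI)
      show "\<Union>Ch \<subseteq> carrier R \<times> carrier R" using mem unfolding partial_hom_def by blast
      obtain \<rho> where \<rho>: "\<rho> \<in> Ch" using ch(1) by blast
      show "(\<one>, \<one>) \<in> \<Union>Ch" using partial_homD(3)[of \<rho>] mem[OF \<rho>] \<rho> by blast
      show "(\<ominus> x, \<ominus> y) \<in> \<Union>Ch" if xy: "(x, y) \<in> \<Union>Ch" for x y
      proof -
        obtain \<sigma> where "\<sigma> \<in> Ch" "(x, y) \<in> \<sigma>" using xy by blast
        then show ?thesis using partial_homD(4)[of \<sigma> x y] mem[of \<sigma>] by blast
      qed
      show "(x \<oplus> x', y \<oplus> y') \<in> \<Union>Ch" "(x \<otimes> x', y \<otimes> y') \<in> \<Union>Ch"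
        if xy: "(x, y) \<in> \<Union>Ch" "(x', y') \<in> \<Union>Ch" for x y x' y'
      proof -
        obtain \<sigma> where \<sigma>: "\<sigma> \<in> Ch" "(x, y) \<in> \<sigma>" "(x', y') \<in> \<sigma>" using tot[OF xy] by blast
        show "(x \<oplus> x', y \<oplus> y') \<in> \<Union>Ch" "(x \<otimes> x', y \<otimes> y') \<in> \<Union>Ch"
          using partial_homD(5,6)[OF _ \<sigma>(2,3)] mem[OF \<sigma>(1)] \<sigma>(1) by blast+
      qed
      show "y = \<zero>" if y: "(\<zero>, y) \<in> \<Union>Ch" for y
      proof -
        obtain \<sigma> where "\<sigma> \<in> Ch" "(\<zero>, y) \<in> \<sigma>" using y by blast
        then show ?thesis using partial_homD(7)[of \<sigma> y] mem[of \<sigma>] by blast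
      qed
    qed
    moreover have "\<rho>\<^sub>0 \<subseteq> \<Union>Ch" "Range (\<Union>Ch) \<subseteq> C" using mem ch(1) by blast+
    ultimately show ?thesis unfolding A_def by blast
  qed
  moreover have "A \<noteq> {}" using h0 ran unfolding A_def by blast
  ultimately obtain \<rho> where \<rho>: "\<rho> \<in> A" "\<forall>\<sigma>\<in>A. \<rho> \<subseteq> \<sigma> \<longrightarrow> \<sigma> = \<rho>"
    using subset_Zorn_nonempty[of A] by blast
  have r: "partial_hom \<rho>" "\<rho>\<^sub>0 \<subseteq> \<rho>" "Range \<rho> \<subseteq> C" using \<rho>(1) unfolding A_def by auto
  have sub: "subring \<rho> RR" using r(1) unfolding partial_hom_iff by blast
  have Cr: "subring C R" "C \<subseteq> carrier R" using C subfieldE(1,3) unfolding closed_field_def by auto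
  have "z \<in> \<rho>" if z: "z \<in> carrier R \<times> C" and ad: "partial_hom (adjoin \<rho> z)" for z
  proof -
    have zc: "z \<in> carrier RR" using z Cr by (auto simp: RR_simps)
    have "Range (adjoin \<rho> z) \<subseteq> C"
    proof
      fix y assume "y \<in> Range (adjoin \<rho> z)"
      then obtain x p where p: "set p \<subseteq> \<rho>" "(x, y) = ring.eval RR p z" unfolding adjoin_def by blast
      have "set p \<subseteq> carrier RR" using p(1) subringE(1)[OF sub] by blast
      then have "ring.eval RR p z = (eval (map fst p) (fst z), eval (map snd p) (snd z))"
        using eval_RR[of p "fst z" "snd z"] zc by (cases z) (simp add: RR_simps)
      then have "y = eval (map snd p) (snd z)" using p(2) by simp
      moreover have "set (map snd p) \<subseteq> C" using p(1) r(3) by force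
      ultimately show "y \<in> C" using eval_in_subring[OF Cr(1), of "map snd p" "snd z"] z by auto
    qed
    then have "adjoin \<rho> z \<in> A" using ad r(2) subring_adjoin(2)[OF sub zc] unfolding A_def by blast
    then have "adjoin \<rho> z = \<rho>" using \<rho>(2) subring_adjoin(2)[OF sub zc] by blast
    then show "z \<in> \<rho>" using subring_adjoin(3)[OF sub zc] by simp
  qed
  then have "place_on (carrier R) \<rho>" using maximal_is_place[OF r(1) C r(3)] by blast
  then show thesis using that r by blast
qed

end

section \<open>Extension of homomorphisms\<close>

context field
begin

lemma closed_field_carrier:
  assumes "algebraically_closed R"
  shows "closed_field (carrier R)"
  unfolding closed_field_def
proof (intro conjI ballI impI)
  interpret C: algebraically_closed R by fact
  show "subfield (carrier R) R" by (rule carrier_is_subfield)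
  fix p assume p: "p \<in> carrier (poly_ring R)" and d: "degree p \<ge> 1"
  have "size (roots p) = degree p" using C.roots_over_carrier[OF p] by (simp add: splitted_def)
  then have "roots p \<noteq> {#}" using d by auto
  then obtain a where "a \<in># roots p" by blast
  then show "\<exists>c\<in>carrier R. eval p c = \<zero>"
    using roots_mem_iff_is_root[OF p] unfolding is_root_def by blast
qed

text \<open>Only the coefficients of one equation matter, and they generate a finite extension of
  \<open>E\<close>.\<close>

lemma algebraic_trans:
  assumes E: "subfield E R" and L: "subfield L R" and alg: "\<And>y. y \<in> L \<Longrightarrow> (algebraic over E) y"
    and x: "x \<in> carrier R" "(algebraic over L) x"
  shows "(algebraic over E) x"
proof -
  obtain p where p: "p \<in> carrier (L[X])" "p \<noteq> []" "eval p x = \<zero>"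
    using algebraicE[OF subfieldE(1)[OF L] x(1)] x(2) unfolding over_def by metis
  have sp: "set p \<subseteq> L" using p(1) by (auto simp: univ_poly_carrier[symmetric] polynomial_def)
  have spc: "set p \<subseteq> carrier R" using sp subfieldE(3)[OF L] by blast
  define E' where "E' = finite_extension E p"
  have E': "subfield E' R" unfolding E'_def by (rule finite_extension_is_subfield[OF E spc]) (use sp alg in blast)
  have fin: "finite_dimension E E'"
    unfolding E'_def by (rule finite_extension_finite_dimension(1)[OF E spc]) (use sp alg in blast)
  have "p \<in> carrier (E'[X])"
    using p(1) finite_extension_mem[OF subfieldE(1)[OF E] spc] unfolding E'_def
    by (auto simp: univ_poly_carrier[symmetric] polynomial_def)
  then have xa: "(algebraic over E') x" unfolding over_def using algebraicI[OF _ p(2,3)] by (simp add: over_def)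
  have "finite_dimension E' (simple_extension E' x)"
    using finite_dimension_simple_extension[OF E' x(1)] xa by blast
  then have "finite_dimension E (simple_extension E' x)" by (rule telescopic_base_dim(1)[OF E E' fin])
  then show ?thesis unfolding over_def
    using finite_dimension_imp_algebraic[OF E simple_extension_is_subring[OF subfieldE(1)[OF E'] x(1)]]
      simple_extension_mem[OF subfieldE(1)[OF E'] x(1)] unfolding over_def by blast
qed

lemma closed_field_algebraics:
  assumes "algebraically_closed R" "subfield k R"
  shows "closed_field {x \<in> carrier R. (algebraic over k) x}"
proof -
  define L where "L = {x \<in> carrier R. (algebraic over k) x}"
  have L: "subfield L R" unfolding L_def by (rule subfield_of_algebraics[OF assms(2)])
  have La: "(algebraic over k) y" if "y \<in> L" for y using that unfolding L_def by simp
  have "\<exists>c\<in>L. eval p c = \<zero>" if p: "p \<in> carrier (L[X])" and d: "degree p \<ge> 1" for p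
  proof -
    have "p \<in> carrier (poly_ring R)" by (rule carrier_polynomial_shell[OF subfieldE(1)[OF L] p])
    then have "\<exists>c\<in>carrier R. eval p c = \<zero>"
      using closed_field_carrier[OF assms(1)] d unfolding closed_field_def by simp
    then obtain c where c: "c \<in> carrier R" "eval p c = \<zero>" by (rule bexE)
    have "p \<noteq> []" using d by auto
    then have "(algebraic over L) c" using algebraicI[OF p _ c(2)] by (simp add: over_def)
    from algebraic_trans[OF assms(2) L La c(1) this] have "c \<in> L" unfolding L_def using c(1) by simp
    then show ?thesis using c(2) by (rule bexI[rotated])
  qed
  then show ?thesis unfolding closed_field_def L_def[symmetric] using L by simp
qed

text \<open>Elements algebraic over a field inside the domain cannot become poles, so a place
  extending \<open>\<rho>\<close> is an honest homomorphism on \<open>A\<close>. All extensions of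
  embeddings below come from here.\<close>

lemma hom_extension:
  assumes C: "closed_field C" and h: "partial_hom \<rho>" "Range \<rho> \<subseteq> C"
    and E: "subfield E R" "E \<subseteq> Domain \<rho>" and A: "A \<subseteq> carrier R" "\<And>x. x \<in> A \<Longrightarrow> (algebraic over E) x"
  obtains \<delta> where "\<delta> \<in> subhom A C"
    "\<And>x y. (x, y) \<in> \<rho> \<Longrightarrow> \<delta> x = y"
proof -
  obtain \<sigma> where \<sigma>: "place_on (carrier R) \<sigma>" "\<rho> \<subseteq> \<sigma>" "Range \<sigma> \<subseteq> C"
    using place_extension[OF h(1) C h(2)] .
  have ph: "partial_hom \<sigma>" using \<sigma>(1) by (simp add: place_on_def)
  have dom: "A \<subseteq> Domain \<sigma>"
  proof
    fix x assume x: "x \<in> A"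
    have "E \<subseteq> Domain \<sigma>" using E(2) \<sigma>(2) by blast
    then show "x \<in> Domain \<sigma>" using place_integral[OF \<sigma>(1) E(1)] x A by blast
  qed
  have hom: "app \<sigma> \<in> ring_hom (R\<lparr>carrier := A\<rparr>) R" by (rule app_hom[OF ph dom])
  have "app \<sigma> x \<in> C" if "x \<in> A" for x
    using app_mem[OF ph, of x] dom that \<sigma>(3) by blast
  then have "app \<sigma> \<in> subhom A C"
    using hom unfolding ring_hom_def by simp
  then show thesis
  proof (rule that)
    show "app \<sigma> x = y" if "(x, y) \<in> \<rho>" for x y
      by (rule app_eq[OF ph subsetD[OF \<sigma>(2) that]])
  qed
qed

lemma root_partial_hom:
  assumes E: "subfield E R" and x: "x \<in> carrier R" "(algebraic over E) x"
    and y: "y \<in> carrier R" "eval (Irr E x) y = \<zero>"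
  defines "\<rho> \<equiv> {(eval p x, eval p y) | p. p \<in> carrier (E[X])}"
  shows "partial_hom \<rho>" "(x, y) \<in> \<rho>" "\<And>e. e \<in> E \<Longrightarrow> (e, e) \<in> \<rho>"
proof -
  note Er = subfieldE(1)[OF E]
  interpret P: domain "E[X]" by (rule univ_poly_is_domain[OF Er])
  interpret ex: ring_hom_ring "E[X]" R "\<lambda>p. eval p x" by (rule eval_ring_hom[OF Er x(1)])
  interpret ey: ring_hom_ring "E[X]" R "\<lambda>p. eval p y" by (rule eval_ring_hom[OF Er y(1)])
  have mk: "(eval p x, eval p y) \<in> \<rho>" if "p \<in> carrier (E[X])" for p
    unfolding \<rho>_def using that by blast
  show e: "(e, e) \<in> \<rho>" if e: "e \<in> E" for e
  proof (cases "e = \<zero>")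
    case True
    then show ?thesis using mk[OF univ_poly_zero_closed] by simp
  next
    case False
    then have "[e] \<in> carrier (E[X])" using e by (simp add: univ_poly_carrier[symmetric] polynomial_def)
    moreover have "eval [e] x = e" "eval [e] y = e" using e subfieldE(3)[OF E] x y by auto
    ultimately show ?thesis using mk[of "[e]"] by simp
  qed
  show "(x, y) \<in> \<rho>" using mk[OF var_closed(1)[OF Er]] eval_var[OF x(1)] eval_var[OF y(1)] by simp
  show "partial_hom \<rho>"
    unfolding partial_hom_def
  proof (intro conjI allI impI)
    show "\<rho> \<subseteq> carrier R \<times> carrier R" unfolding \<rho>_def using ex.hom_closed ey.hom_closed by blast
    show "(\<one>, \<one>) \<in> \<rho>" using e subringE(3)[OF Er] by blast
    show "(\<ominus> a, \<ominus> b) \<in> \<rho>" if ab: "(a, b) \<in> \<rho>" for a b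
    proof -
      obtain p where p: "p \<in> carrier (E[X])" "a = eval p x" "b = eval p y" using ab unfolding \<rho>_def by blast
      have "eval (\<ominus>\<^bsub>E[X]\<^esub> p) x = \<ominus> a" "eval (\<ominus>\<^bsub>E[X]\<^esub> p) y = \<ominus> b" using p by simp_all
      then show ?thesis using mk[OF P.a_inv_closed[OF p(1)]] by simp
    qed
    show "(a \<oplus> a', b \<oplus> b') \<in> \<rho>" "(a \<otimes> a', b \<otimes> b') \<in> \<rho>"
      if ab: "(a, b) \<in> \<rho>" "(a', b') \<in> \<rho>" for a b a' b'
    proof -
      obtain p where p: "p \<in> carrier (E[X])" "a = eval p x" "b = eval p y" using ab unfolding \<rho>_def by blast
      obtain q where q: "q \<in> carrier (E[X])" "a' = eval q x" "b' = eval q y" using ab unfolding \<rho>_def by blast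
      have "eval (p \<oplus>\<^bsub>E[X]\<^esub> q) x = a \<oplus> a'" "eval (p \<oplus>\<^bsub>E[X]\<^esub> q) y = b \<oplus> b'"
        "eval (p \<otimes>\<^bsub>E[X]\<^esub> q) x = a \<otimes> a'" "eval (p \<otimes>\<^bsub>E[X]\<^esub> q) y = b \<otimes> b'"
        using p q by simp_all
      then show "(a \<oplus> a', b \<oplus> b') \<in> \<rho>" "(a \<otimes> a', b \<otimes> b') \<in> \<rho>"
        using mk[OF P.a_closed[OF p(1) q(1)]] mk[OF P.m_closed[OF p(1) q(1)]] by simp_all
    qed
    show "b = \<zero>" if ab: "(\<zero>, b) \<in> \<rho>" for b
    proof -
      obtain p where p: "p \<in> carrier (E[X])" "\<zero> = eval p x" "b = eval p y" using ab unfolding \<rho>_def by blast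
      have "Irr E x pdivides p" using Irr_minimal[OF E x p(1)] p(2) by simp
      then have "eval p y = \<zero>"
        using pdivides_imp_root_sharing[OF carrier_polynomial_shell[OF Er IrrE(1)[OF E x]] _ y(1)] y(2) by blast
      then show ?thesis using p(3) by simp
    qed
  qed
qed

lemma hom_of_root:
  assumes C: "closed_field C" and E: "subfield E R" "E \<subseteq> C" and A: "A \<subseteq> carrier R" "\<And>x. x \<in> A \<Longrightarrow> (algebraic over E) x"
    and x: "x \<in> A" and y: "y \<in> C" "eval (Irr E x) y = \<zero>"
  obtains \<delta> where "\<delta> \<in> subhom A C"
    "\<And>e. e \<in> E \<Longrightarrow> \<delta> e = e" "\<delta> x = y"
proof -
  have xc: "x \<in> carrier R" "(algebraic over E) x" using x A by auto
  have Cs: "subfield C R" using C by (simp add: closed_field_def)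
  have yc: "y \<in> carrier R" using y subfieldE(3)[OF Cs] by blast
  define \<rho> where "\<rho> = {(eval p x, eval p y) | p. p \<in> carrier (E[X])}"
  note r = root_partial_hom[OF E(1) xc yc y(2), folded \<rho>_def]
  have ran: "Range \<rho> \<subseteq> C"
  proof
    fix b assume "b \<in> Range \<rho>"
    then obtain p where p: "p \<in> carrier (E[X])" "b = eval p y" unfolding \<rho>_def by blast
    then have "set p \<subseteq> C" using E(2) by (auto simp: univ_poly_carrier[symmetric] polynomial_def)
    then show "b \<in> C" unfolding p(2) by (rule eval_in_subring[OF subfieldE(1)[OF Cs] _ y(1)])
  qed
  have dom: "E \<subseteq> Domain \<rho>" using r(3) by blast
  show thesis
  proof (rule hom_extension[OF C r(1) ran E(1) dom A])
    fix \<delta> assume \<delta>: "\<delta> \<in> subhom A C"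
      "\<And>x y. (x, y) \<in> \<rho> \<Longrightarrow> \<delta> x = y"
    show thesis by (rule that[OF \<delta>(1)]) (intro \<delta>(2) r(2,3); assumption)+
  qed assumption
qed

section \<open>Conjugacy of places\<close>

text \<open>Functions are compared only on the carrier, hence closure of \<open>H\<close> under
  composition is stated pointwise. Stability of the finite orbit together with injectivity makes
  every member of \<open>H\<close> permute it.\<close>

lemma orbit_root:
  assumes D: "domain D" and C: "domain C" and H: "finite H"
    "\<And>g. g \<in> H \<Longrightarrow> g \<in> ring_hom D D \<and> inj_on g (carrier D)"
    "\<And>g h. g \<in> H \<Longrightarrow> h \<in> H \<Longrightarrow> \<exists>g'\<in>H. \<forall>x\<in>carrier D. g' x = h (g x)"
    "\<exists>e\<in>H. \<forall>x\<in>carrier D. e x = x"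
    and \<Psi>: "\<Psi>1 \<in> ring_hom D C" "\<Psi>2 \<in> ring_hom D C"
    "\<And>x. x \<in> carrier D \<Longrightarrow> (\<And>h. h \<in> H \<Longrightarrow> h x = x) \<Longrightarrow> \<Psi>1 x = \<Psi>2 x"
    and d: "d \<in> carrier D"
  shows "\<exists>g\<in>H. \<Psi>2 d = \<Psi>1 (g d)"
proof -
  interpret D: domain D by fact
  interpret C: domain C by fact
  define S where "S = (\<lambda>g. g d) ` H"
  have S: "finite S" "S \<subseteq> carrier D"
    unfolding S_def using H(1) H(2) ring_hom_closed[OF _ d, where S = D] by auto
  have inv: "h ` S = S" if h: "h \<in> H" for h
  proof (rule endo_inj_surj[OF S(1)])
    show "inj_on h S" using H(2)[OF h] S(2) inj_on_subset by blast
    show "h ` S \<subseteq> S"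
    proof
      fix y assume "y \<in> h ` S"
      then obtain g where g: "g \<in> H" "y = h (g d)" unfolding S_def by blast
      obtain g' where g': "g' \<in> H" "\<forall>x\<in>carrier D. g' x = h (g x)" using H(3)[OF g(1) h] by blast
      have "y = g' d" using g'(2) g(2) d by simp
      then show "y \<in> S" unfolding S_def using g'(1) by simp
    qed
  qed
  obtain e where e: "e \<in> H" "\<forall>x\<in>carrier D. e x = x" using H(4) by blast
  then have "d = e d" using d by simp
  then have dS: "d \<in> S" unfolding S_def using e(1) by (rule image_eqI)
  have fix_coeff: "h c = c" if "h \<in> H" "c \<in> set (lin_prod D S)" for h c
  proof -
    have g: "h \<in> ring_hom D D" "inj_on h (carrier D)" using H(2)[OF that(1)] by simp_all
    show ?thesis by (rule D.set_lin_prod_fixed[OF g S(2) inv[OF that(1)] that(2)])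
  qed
  have cc: "c \<in> carrier D" if "c \<in> set (lin_prod D S)" for c
    using D.lin_prod_closed[OF S(2)] that
    by (auto simp: univ_poly_carrier[symmetric] polynomial_def)
  \<comment> \<open>The coefficients are invariants, so both homomorphisms map the polynomial to the
    same one; \<open>\<Psi>2 d\<close> is visibly a root of the second image and so a root of the
    first.\<close>
  have same: "map \<Psi>1 (lin_prod D S) = map \<Psi>2 (lin_prod D S)"
    by (rule map_cong[OF refl], rule \<Psi>(3)[OF cc fix_coeff])
  have y: "\<Psi>2 d \<in> carrier C" using ring_hom_closed[OF \<Psi>(2) d] .
  have f: "(\<lambda>s. \<Psi>2 d \<ominus>\<^bsub>C\<^esub> \<Psi>1 s) \<in> S \<rightarrow> carrier C" "(\<lambda>s. \<Psi>2 d \<ominus>\<^bsub>C\<^esub> \<Psi>2 s) \<in> S \<rightarrow> carrier C"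
    using y ring_hom_closed[OF \<Psi>(1)] ring_hom_closed[OF \<Psi>(2)] S(2) by auto
  have "finprod C (\<lambda>s. \<Psi>2 d \<ominus>\<^bsub>C\<^esub> \<Psi>1 s) S = finprod C (\<lambda>s. \<Psi>2 d \<ominus>\<^bsub>C\<^esub> \<Psi>2 s) S"
    using D.eval_map_lin_prod[OF C.is_cring \<Psi>(1) y S(2)] D.eval_map_lin_prod[OF C.is_cring \<Psi>(2) y S(2)] same by simp
  moreover have "finprod C (\<lambda>s. \<Psi>2 d \<ominus>\<^bsub>C\<^esub> \<Psi>2 s) S = \<zero>\<^bsub>C\<^esub>"
    unfolding C.finprod_zero_iff[OF S(1) f(2)] using dS y C.r_right_minus_eq by blast
  ultimately obtain s where "s \<in> S" "\<Psi>2 d \<ominus>\<^bsub>C\<^esub> \<Psi>1 s = \<zero>\<^bsub>C\<^esub>" 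
    using C.finprod_zero_iff[OF S(1) f(1)] by auto
  then have s: "s \<in> S" "\<Psi>2 d = \<Psi>1 s"
    using C.r_right_minus_eq[OF y ring_hom_closed[OF \<Psi>(1), of s]] S(2) by auto
  then obtain g where "g \<in> H" "s = g d" unfolding S_def by (auto elim: imageE)
  then show ?thesis using s(2) by (intro bexI[of _ g]) simp_all
qed

lemma poly_eq_of_infinite:
  assumes "u \<in> carrier (poly_ring R)" "v \<in> carrier (poly_ring R)"
    and "infinite {t \<in> carrier R. eval u t = eval v t}"
  shows "u = v"
proof -
  interpret P: domain "poly_ring R" by (rule poly_ring_domain)
  define w where "w = u \<ominus>\<^bsub>poly_ring R\<^esub> v"
  have w: "w \<in> carrier (poly_ring R)" unfolding w_def using assms by simp
  have "eval w t = \<zero>" if t: "t \<in> carrier R" "eval u t = eval v t" for t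
  proof -
    interpret e: ring_hom_ring "poly_ring R" R "\<lambda>p. eval p t" by (rule eval_ring_hom[OF carrier_is_subring t(1)])
    have "eval w t = eval u t \<ominus> eval v t" unfolding w_def a_minus_def P.minus_eq using assms by simp
    then show ?thesis using t e.hom_closed[OF assms(2)] by (simp add: r_neg a_minus_def)
  qed
  then have "{t \<in> carrier R. eval u t = eval v t} \<subseteq> {t. is_root w t}" if "w \<noteq> []"
    using that unfolding is_root_def by auto
  then have "w = []" using finite_number_of_roots[OF w] assms(3) finite_subset by blast
  then have "u \<ominus>\<^bsub>poly_ring R\<^esub> v = \<zero>\<^bsub>poly_ring R\<^esub>" unfolding w_def by (simp add: univ_poly_zero)
  then show ?thesis using P.r_right_minus_eq[OF assms(1,2)] by simp
qed

text \<open>If every \<open>g\<close> failed, one witness of failure for each \<open>g\<close> could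
  be collected as the coefficients of a polynomial. Every evaluation point \<open>t\<close> selects
  some \<open>g\<close>; as there are infinitely many points and finitely many \<open>g\<close>, one
  \<open>g\<close> is right at infinitely many points, hence coefficientwise, and in particular at
  its own witness.\<close>

lemma hom_conj:
  assumes A: "subring A R" and H: "finite H"
    "\<And>g. g \<in> H \<Longrightarrow> g \<in> subhom A A \<and> inj_on g A"
    "\<And>g h. g \<in> H \<Longrightarrow> h \<in> H \<Longrightarrow> \<exists>g'\<in>H. \<forall>x\<in>A. g' x = h (g x)"
    "\<exists>e\<in>H. \<forall>x\<in>A. e x = x"
    and \<psi>: "\<psi>1 \<in> ring_hom (R\<lparr>carrier := A\<rparr>) R" "\<psi>2 \<in> ring_hom (R\<lparr>carrier := A\<rparr>) R"
    "\<And>x. x \<in> A \<Longrightarrow> (\<And>h. h \<in> H \<Longrightarrow> h x = x) \<Longrightarrow> \<psi>1 x = \<psi>2 x"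
    and inf: "infinite (carrier R)"
  shows "\<exists>g\<in>H. \<forall>x\<in>A. \<psi>2 x = \<psi>1 (g x)"
proof (rule ccontr)
  assume no: "\<not> ?thesis"
  have ne: "\<exists>x. x \<in> A \<and> \<psi>2 x \<noteq> \<psi>1 (g x)" if g: "g \<in> H" for g
  proof (rule ccontr)
    assume "\<nexists>x. x \<in> A \<and> \<psi>2 x \<noteq> \<psi>1 (g x)"
    then have "\<forall>x\<in>A. \<psi>2 x = \<psi>1 (g x)" by blast
    from bexI[where P = "\<lambda>g. \<forall>x\<in>A. \<psi>2 x = \<psi>1 (g x)", OF this g] no show False by (rule notE[rotated])
  qed
  define w where "w g = (SOME x. x \<in> A \<and> \<psi>2 x \<noteq> \<psi>1 (g x))" for g
  have w: "w g \<in> A \<and> \<psi>2 (w g) \<noteq> \<psi>1 (g (w g))" if "g \<in> H" for g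
    unfolding w_def by (rule someI_ex[OF ne[OF that]])
  obtain ws where ws: "set ws = w ` H" using finite_list[of "w ` H"] H(1) by auto
  define RA where "RA = R\<lparr>carrier := A\<rparr>"
  interpret RA: domain RA unfolding RA_def by (rule subring_is_domain[OF A])
  have RAs: "carrier RA = A" "\<one>\<^bsub>RA\<^esub> = \<one>" "\<zero>\<^bsub>RA\<^esub> = \<zero>" by (simp_all add: RA_def)
  \<comment> \<open>The leading 1 turns the list of witnesses into a polynomial whatever the
    witnesses are.\<close>
  define p where "p = \<one> # ws"
  have p: "p \<in> carrier (poly_ring RA)" "set p \<subseteq> A"
    using ws w subringE(3)[OF A] unfolding p_def by (auto simp: univ_poly_carrier[symmetric] polynomial_def RAs)
  have D: "domain (poly_ring RA)" by (rule RA.poly_ring_domain)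
  have pinc: "set q \<subseteq> A" if "q \<in> carrier (poly_ring RA)" for q
    using that by (auto simp: univ_poly_carrier[symmetric] polynomial_def RAs)
  have one: "g \<one> = \<one>" if "g \<in> H" for g
    using H(2)[OF that] unfolding ring_hom_def by simp
  have gA: "g x \<in> A" if "g \<in> H" "x \<in> A" for g x
    using H(2)[OF that(1)] that(2) unfolding ring_hom_def by auto
  have ex: "\<exists>g\<in>H. eval (map \<psi>2 p) t = eval (map \<psi>1 (map g p)) t" if t: "t \<in> carrier R" for t
  proof -
    have "\<exists>g\<in>map ` H. (\<lambda>q. eval (map \<psi>2 q) t) p = (\<lambda>q. eval (map \<psi>1 q) t) (g p)"
    proof (rule orbit_root[OF D domain_axioms _ _ _ _ _ _ _ p(1)])
      show "finite (map ` H)" using H(1) by simp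
      show "(\<lambda>q. eval (map \<psi>1 q) t) \<in> ring_hom (poly_ring RA) R"
        by (rule eval_map_hom[OF RA.domain_axioms is_cring \<psi>(1)[folded RA_def] t])
      show "(\<lambda>q. eval (map \<psi>2 q) t) \<in> ring_hom (poly_ring RA) R"
        by (rule eval_map_hom[OF RA.domain_axioms is_cring \<psi>(2)[folded RA_def] t])
      show "f \<in> ring_hom (poly_ring RA) (poly_ring RA) \<and> inj_on f (carrier (poly_ring RA))" if f: "f \<in> map ` H" for f
      proof -
        obtain g where g: "g \<in> H" "f = map g" using f by blast
        have gh: "g \<in> ring_hom RA RA" "inj_on g (carrier RA)" using H(2)[OF g(1)] unfolding RA_def by auto
        have "inj_on (map g) (carrier (poly_ring RA))"
        proof (rule inj_onI)
          fix q r assume q: "q \<in> carrier (poly_ring RA)" and r: "r \<in> carrier (poly_ring RA)" and e: "map g q = map g r"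
          have "inj_on g (set q \<union> set r)"
            by (rule inj_on_subset[OF gh(2)]) (simp add: RAs(1) pinc[OF q] pinc[OF r])
          then show "q = r" using e inj_on_map_eq_map[of g q r] by simp
        qed
        then show ?thesis using map_poly_hom[OF RA.domain_axioms RA.domain_axioms gh] g(2) by blast
      qed
      show "\<exists>g'\<in>map ` H. \<forall>x\<in>carrier (poly_ring RA). g' x = h (g x)" if gh: "g \<in> map ` H" "h \<in> map ` H" for g h
      proof -
        obtain g0 h0 where g0: "g0 \<in> H" "g = map g0" "h0 \<in> H" "h = map h0" using gh by blast
        obtain g' where g': "g' \<in> H" "\<forall>x\<in>A. g' x = h0 (g0 x)" using H(3)[OF g0(1,3)] by blast
        have "map g' x = h (g x)" if "x \<in> carrier (poly_ring RA)" for x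
          using pinc[OF that] g'(2) unfolding g0(2,4) by auto
        then show ?thesis using g'(1) by blast
      qed
      obtain e where e: "e \<in> H" "\<forall>x\<in>A. e x = x" using H(4) by blast
      have "map e x = x" if "x \<in> carrier (poly_ring RA)" for x
        using pinc[OF that] e(2) by (simp add: map_idI subset_iff)
      then show "\<exists>e\<in>map ` H. \<forall>x\<in>carrier (poly_ring RA). e x = x" using e(1) by blast
      show "eval (map \<psi>1 x) t = eval (map \<psi>2 x) t"
        if x: "x \<in> carrier (poly_ring RA)" and fx: "\<And>h. h \<in> map ` H \<Longrightarrow> h x = x" for x
      proof -
        have "h c = c" if "h \<in> H" "c \<in> set x" for h c
        proof -
          have "map h x = map id x" using fx[of "map h"] that(1) by simp
          then show ?thesis using that(2) by (metis id_apply map_eq_conv)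
        qed
        then have "map \<psi>1 x = map \<psi>2 x"
          using pinc[OF x] by (intro map_cong[OF refl] \<psi>(3)) auto
        then show ?thesis by (rule arg_cong[where f = "\<lambda>l. eval l t"])
      qed
    qed
    then show ?thesis by blast
  qed
  have "\<exists>g\<in>H. infinite {t \<in> carrier R. eval (map \<psi>2 p) t = eval (map \<psi>1 (map g p)) t}"
    by (rule pigeonhole_infinite_rel[OF inf H(1)]) (intro ballI ex)
  then obtain g where g: "g \<in> H" "infinite {t \<in> carrier R. eval (map \<psi>2 p) t = eval (map \<psi>1 (map g p)) t}"
    by (rule bexE)
  have "\<psi>1 \<one> = \<one>" "\<psi>2 \<one> = \<one>" using \<psi>(1,2) unfolding ring_hom_def by auto
  moreover have "set (map \<psi>2 p) \<subseteq> carrier R" "set (map \<psi>1 (map g p)) \<subseteq> carrier R"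
    using p(2) ring_hom_closed[OF \<psi>(1)] ring_hom_closed[OF \<psi>(2)] gA[OF g(1)] by auto
  ultimately have "map \<psi>2 p \<in> carrier (poly_ring R)" "map \<psi>1 (map g p) \<in> carrier (poly_ring R)"
    using one[OF g(1)] unfolding p_def by (auto simp: univ_poly_carrier[symmetric] polynomial_def)
  then have "map \<psi>2 p = map \<psi>1 (map g p)" using g(2) by (rule poly_eq_of_infinite)
  moreover have "w g \<in> set p" using ws g(1) unfolding p_def by simp
  ultimately have "\<psi>2 (w g) = \<psi>1 (g (w g))" by auto
  then show False using w[OF g(1)] by blast
qed

text \<open>This is the composite \<rho> \<circ> g. Pulling back reverses the order of composition,
  so automorphisms act on places from the right.\<close>

definition pull :: "'a set \<Rightarrow> ('a \<Rightarrow> 'a) \<Rightarrow> ('a \<times> 'a) set \<Rightarrow> ('a \<times> 'a) set" where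
  "pull L g \<rho> = {(x, y). x \<in> L \<and> (g x, y) \<in> \<rho>}"

lemma subfield_hom:
  assumes L: "subfield L R" and g: "g \<in> subhom L L'" and L': "subfield L' R"
  shows "\<And>x. x \<in> L \<Longrightarrow> g x \<in> L'" "g \<one> = \<one>" "g \<zero> = \<zero>"
    "\<And>x y. x \<in> L \<Longrightarrow> y \<in> L \<Longrightarrow> g (x \<oplus> y) = g x \<oplus> g y"
    "\<And>x y. x \<in> L \<Longrightarrow> y \<in> L \<Longrightarrow> g (x \<otimes> y) = g x \<otimes> g y"
    "\<And>x. x \<in> L \<Longrightarrow> g (\<ominus> x) = \<ominus> g x"
    "\<And>x. x \<in> L \<Longrightarrow> x \<noteq> \<zero> \<Longrightarrow> g x \<noteq> \<zero> \<and> g (inv x) = inv (g x)"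
    "inj_on g L"
proof -
  note s = subringE[OF subfieldE(1)[OF L]] and s' = subringE[OF subfieldE(1)[OF L']]
  show cl: "g x \<in> L'" if "x \<in> L" for x using ring_hom_closed[OF g] that by simp
  then have cc: "g x \<in> carrier R" if "x \<in> L" for x using s'(1) that by blast
  show one: "g \<one> = \<one>" using ring_hom_one[OF g] by simp
  show add: "g (x \<oplus> y) = g x \<oplus> g y" if "x \<in> L" "y \<in> L" for x y using ring_hom_add[OF g] that by simp
  show mult: "g (x \<otimes> y) = g x \<otimes> g y" if "x \<in> L" "y \<in> L" for x y using ring_hom_mult[OF g] that by simp
  show z: "g \<zero> = \<zero>"
  proof -
    have "g \<zero> = g \<zero> \<oplus> g \<zero>" using add[OF s(2,2)] by simp
    then show ?thesis using cc[OF s(2)] by (metis add.r_cancel_one')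
  qed
  show neg: "g (\<ominus> x) = \<ominus> g x" if x: "x \<in> L" for x
  proof -
    have "g (\<ominus> x) \<oplus> g x = \<zero>" using add[OF s(5)[OF x] x] z x s(1) by (simp add: l_neg subset_iff)
    then show ?thesis using cc[OF x] cc[OF s(5)[OF x]] by (metis minus_equality)
  qed
  show invx: "g x \<noteq> \<zero> \<and> g (inv x) = inv (g x)" if x: "x \<in> L" "x \<noteq> \<zero>" for x
  proof -
    have i: "inv x \<in> L" "x \<otimes> inv x = \<one>" using subfield_m_inv[OF L, of x] x by auto
    have e: "g x \<otimes> g (inv x) = \<one>" using mult[OF x(1) i(1)] i(2) one by simp
    then have "g x \<noteq> \<zero>" using cc[OF i(1)] by auto
    moreover have "g (inv x) = inv (g x)" using e cc[OF x(1)] cc[OF i(1)] by (metis comm_inv_char)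
    ultimately show ?thesis by blast
  qed
  show "inj_on g L"
  proof (rule inj_onI)
    fix x y assume xy: "x \<in> L" "y \<in> L" "g x = g y"
    have m: "x \<oplus> \<ominus> y \<in> L" using s(7)[OF xy(1) s(5)[OF xy(2)]] .
    have "g (x \<oplus> \<ominus> y) = \<zero>" using add[OF xy(1) s(5)[OF xy(2)]] neg[OF xy(2)] xy cc by (simp add: r_neg)
    then have "x \<oplus> \<ominus> y = \<zero>" using invx[OF m] by blast
    then show "x = y" using xy s(1) by (metis a_minus_def r_right_minus_eq subsetD)
  qed
qed

lemma place_pull:
  assumes L: "subfield L R" and g: "g \<in> subhom L L" and \<rho>: "place_on L \<rho>"
  shows "place_on L (pull L g \<rho>)"
proof -
  have h: "partial_hom \<rho>" using \<rho> by (simp add: place_on_def)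
  note D = partial_homD[OF h] and G = subfield_hom[OF L g L] and s = subringE[OF subfieldE(1)[OF L]]
  have "partial_hom (pull L g \<rho>)"
    unfolding partial_hom_def
  proof (intro conjI allI impI)
    show "pull L g \<rho> \<subseteq> carrier R \<times> carrier R" unfolding pull_def using s(1) D(2) by blast
    show "(\<one>, \<one>) \<in> pull L g \<rho>" unfolding pull_def using D(3) G(2) s(3) by simp
    show "(\<ominus> x, \<ominus> y) \<in> pull L g \<rho>" if "(x, y) \<in> pull L g \<rho>" for x y
      using that D(4)[of "g x" y] G(6)[of x] s(5)[of x] unfolding pull_def by simp
    show "(x \<oplus> x', y \<oplus> y') \<in> pull L g \<rho>" "(x \<otimes> x', y \<otimes> y') \<in> pull L g \<rho>"
      if "(x, y) \<in> pull L g \<rho>" "(x', y') \<in> pull L g \<rho>" for x y x' y'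
      using that D(5,6)[of "g x" y "g x'" y'] G(4,5)[of x x'] s(6,7)[of x x'] unfolding pull_def by simp_all
    show "y = \<zero>" if "(\<zero>, y) \<in> pull L g \<rho>" for y using that D(7)[of y] G(3) unfolding pull_def by simp
  qed
  moreover have "x \<in> Domain (pull L g \<rho>) \<or> (inv x, \<zero>) \<in> pull L g \<rho>" if x: "x \<in> L - {\<zero>}" for x
  proof -
    have gx: "g x \<in> L - {\<zero>}" "g (inv x) = inv (g x)" using G(1,7)[of x] x by auto
    have i: "inv x \<in> L" using subfield_m_inv(1)[OF L x] by blast
    have "g x \<in> Domain \<rho> \<or> (inv (g x), \<zero>) \<in> \<rho>" using \<rho> gx(1) unfolding place_on_def by blast
    then show ?thesis unfolding pull_def using x i gx(2) by auto
  qed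
  ultimately show ?thesis unfolding place_on_def by (auto simp: pull_def)
qed

lemma annihilator_of_finite:
  assumes k: "subfield k R" and "finite Z" "Z \<subseteq> carrier R" "\<And>z. z \<in> Z \<Longrightarrow> (algebraic over k) z"
  shows "\<exists>p\<in>carrier (k[X]). p \<noteq> [] \<and> (\<forall>z\<in>Z. eval p z = \<zero>)"
  using assms(2-4)
proof (induction Z)
  case empty
  have "[\<one>] \<in> carrier (k[X])" using subringE(3)[OF subfieldE(1)[OF k]]
    by (simp add: univ_poly_carrier[symmetric] polynomial_def)
  then show ?case by blast
next
  case (insert z Z)
  note kr = subfieldE(1)[OF k]
  interpret P: domain "k[X]" by (rule univ_poly_is_domain[OF kr])
  obtain p where p: "p \<in> carrier (k[X])" "p \<noteq> []" "\<forall>z\<in>Z. eval p z = \<zero>" using insert by auto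
  have z: "z \<in> carrier R" "(algebraic over k) z" using insert by auto
  obtain q where q: "q \<in> carrier (k[X])" "q \<noteq> []" "eval q z = \<zero>"
    using algebraicE[OF kr z(1)] z(2) unfolding over_def by metis
  have "p \<otimes>\<^bsub>k[X]\<^esub> q \<noteq> []" using P.integral[of p q] p(1,2) q(1,2) by (auto simp: univ_poly_zero)
  moreover have "eval (p \<otimes>\<^bsub>k[X]\<^esub> q) w = \<zero>" if w: "w \<in> insert z Z" for w
  proof -
    have wc: "w \<in> carrier R" using w insert.prems(1) by blast
    have "eval (p \<otimes>\<^bsub>k[X]\<^esub> q) w = eval p w \<otimes> eval q w"
      using ring_hom_mult[OF eval_is_hom[OF kr wc] p(1) q(1)] by simp
    moreover have "eval p w \<in> carrier R" "eval q w \<in> carrier R"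
      using ring_hom_closed[OF eval_is_hom[OF kr wc] p(1)] ring_hom_closed[OF eval_is_hom[OF kr wc] q(1)] .
    ultimately show ?thesis using w p(3) q(3) by auto
  qed
  ultimately show ?case using P.m_closed[OF p(1) q(1)] by blast
qed

text \<open>
  The witness is \<open>1 / f(x)\<close>, where \<open>f = 1 + X p(X)\<close> and \<open>p\<close> annihilates all finite values of \<open>x\<close>
  under the given places: \<open>f(x)\<close> then takes the value \<open>1\<close> wherever \<open>x\<close> is finite, and has a pole
  wherever \<open>x\<close> has one.
\<close>

lemma place_denominator:
  assumes L: "subfield L R" and k: "subfield k R" and "finite P" and x: "x \<in> L"
    and pl: "\<And>\<rho>. \<rho> \<in> P \<Longrightarrow> place_on L \<rho>" and idk: "\<And>\<rho> c. \<rho> \<in> P \<Longrightarrow> c \<in> k \<Longrightarrow> (c, c) \<in> \<rho>"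
    and alg: "\<And>\<rho> y z. \<rho> \<in> P \<Longrightarrow> (y, z) \<in> \<rho> \<Longrightarrow> (algebraic over k) z"
  shows "\<exists>y. \<forall>\<rho>\<in>P. y \<in> Domain \<rho> \<and> x \<otimes> y \<in> Domain \<rho> \<and> (x \<in> Domain \<rho> \<longrightarrow> (y, \<one>) \<in> \<rho>)"
proof -
  have hom: "partial_hom \<rho>" if "\<rho> \<in> P" for \<rho> using pl[OF that] by (simp add: place_on_def)
  note Lc = subfieldE(3)[OF L]
  have xc: "x \<in> carrier R" using x Lc by blast
  define Z where "Z = {c. \<exists>\<rho>\<in>P. (x, c) \<in> \<rho>}"
  have "Z \<subseteq> (\<lambda>\<rho>. app \<rho> x) ` P" unfolding Z_def using app_eq[OF hom] by force
  then have Zf: "finite Z" using \<open>finite P\<close> finite_surj by blast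
  have Zc: "Z \<subseteq> carrier R" unfolding Z_def using partial_homD(2)[OF hom] by blast
  obtain p where p: "p \<in> carrier (k[X])" "p \<noteq> []" "\<And>z. z \<in> Z \<Longrightarrow> eval p z = \<zero>"
    using annihilator_of_finite[OF k Zf Zc] alg unfolding Z_def by blast
  define f where "f = p @ [\<one>]"
  have pk: "set p \<subseteq> k" "hd p \<noteq> \<zero>" using p by (auto simp: univ_poly_carrier[symmetric] polynomial_def)
  have k1: "\<one> \<in> k" "k \<subseteq> carrier R" using subringE(3)[OF subfieldE(1)[OF k]] subfieldE(3)[OF k] .
  have fk: "set f \<subseteq> k" unfolding f_def using pk k1 by simp
  have pc: "set p \<subseteq> carrier R" using pk k1 by blast
  define fx where "fx = eval f x"
  have fxc: "fx \<in> carrier R" unfolding fx_def using fk k1 xc by (intro eval_in_carrier) auto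
  have "inv fx \<in> Domain \<rho> \<and> x \<otimes> inv fx \<in> Domain \<rho> \<and> (x \<in> Domain \<rho> \<longrightarrow> (inv fx, \<one>) \<in> \<rho>)" if r: "\<rho> \<in> P" for \<rho>
  proof (cases "x \<in> Domain \<rho>")
    case True
    then obtain c where c: "(x, c) \<in> \<rho>" by blast
    note D = partial_homD[OF hom[OF r]]
    have cc: "c \<in> carrier R" "c \<in> Z" using D(2)[OF c] c r unfolding Z_def by auto
    have "set (map (\<lambda>a. (a, a)) f) \<subseteq> \<rho>" using fk idk[OF r] by auto
    from eval_mem_partial_hom[OF hom[OF r] this c]
    have "(fx, eval f c) \<in> \<rho>" unfolding fx_def by (simp add: comp_def)
    moreover have "eval f c = \<one>" unfolding f_def using eval_append_aux[OF pc one_closed cc(1)] p(3)[OF cc(2)] cc(1) by simp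
    ultimately have "(fx, \<one>) \<in> \<rho>" by simp
    from place_inv(1)[OF pl[OF r] Lc this _ L] have y: "(inv fx, \<one>) \<in> \<rho>" by simp
    then show ?thesis using D(6)[OF c y] by blast
  next
    case False
    note D = partial_homD[OF hom[OF r]]
    have x0: "x \<noteq> \<zero>" using False D(8) by auto
    then have w: "(inv x, \<zero>) \<in> \<rho>" using pl[OF r] x False unfolding place_on_def by blast
    have xi: "x \<otimes> inv x = \<one>" "inv x \<in> carrier R" using x0 xc field_Units by auto
    \<comment> \<open>At a pole, \<open>f(x)\<close> times the \<open>n\<close>-th power of
      \<open>1/x\<close> has as value the leading coefficient \<open>a\<close> of \<open>p\<close>.
      So \<open>1/f(x)\<close> is that power of \<open>1/x\<close> times a unit, and
      \<open>n \<ge> 1\<close> leaves room for the factor \<open>x\<close>.\<close>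
    obtain a q where aq: "f = a # q" "a = hd p" "q \<noteq> []" using p(2) unfolding f_def by (cases p) auto
    define n where "n = length q"
    have n: "n \<ge> 1" using aq(3) unfolding n_def by (cases q) auto
    have qk: "set q \<subseteq> k" "a \<in> k" using fk aq(1) by auto
    then have qc: "set q \<subseteq> carrier R" "a \<in> carrier R" using k1 by auto
    have e: "eval q x \<in> carrier R" by (rule eval_in_carrier[OF qc(1) xc])
    have wn: "inv x [^] n \<in> carrier R" "x [^] n \<otimes> inv x [^] n = \<one>"
      using xi nat_pow_distrib[OF xc xi(2), of n] by simp_all
    have "set q \<subseteq> Domain \<rho>" using qk idk[OF r] by blast
    then have "(eval q x \<otimes> inv x [^] n, \<zero>) \<in> \<rho>"
      using eval_pole[OF hom[OF r] xc w xi(1)] n_def by simp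
    then have "(a \<oplus> eval q x \<otimes> inv x [^] n, a \<oplus> \<zero>) \<in> \<rho>" by (rule D(5)[OF idk[OF r qk(2)]])
    moreover have "a \<oplus> eval q x \<otimes> inv x [^] n = fx \<otimes> inv x [^] n"
      unfolding fx_def aq(1) using qc e wn xc by (simp add: n_def[symmetric] l_distr m_assoc)
    ultimately have v: "(fx \<otimes> inv x [^] n, a) \<in> \<rho>" using qc by simp
    define v' where "v' = fx \<otimes> inv x [^] n"
    have a0: "a \<noteq> \<zero>" using aq(2) pk(2) by simp
    have iv: "(inv v', inv a) \<in> \<rho>" "v' \<noteq> \<zero>" using place_inv[OF pl[OF r] Lc v a0 L] unfolding v'_def by auto
    have v'c: "v' \<in> carrier R" "inv v' \<in> carrier R" "v' \<otimes> inv v' = \<one>"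
      using fxc wn(1) iv(2) field_Units unfolding v'_def by auto
    have "fx \<otimes> (inv x [^] n \<otimes> inv v') = \<one>" using v'c fxc wn(1) unfolding v'_def by (simp add: m_assoc)
    then have y: "inv fx = inv x [^] n \<otimes> inv v'"
      using fxc wn(1) v'c by (metis comm_inv_char m_closed)
    have "inv x [^] n \<otimes> inv v' \<in> Domain \<rho>" using D(6)[OF D(11)[OF w] iv(1)] by blast
    moreover have "x \<otimes> (inv x [^] n \<otimes> inv v') = inv x [^] (n - 1) \<otimes> inv v'"
    proof -
      obtain j where j: "n = Suc j" using n by (cases n) auto
      have "x \<otimes> (inv x [^] n) = inv x [^] j \<otimes> (x \<otimes> inv x)"
        unfolding j using m_lcomm[of x "inv x [^] j" "inv x"] xi xc by simp
      then show ?thesis using j xi xc v'c wn by (simp add: m_assoc[symmetric])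
    qed
    moreover have "inv x [^] (n - 1) \<otimes> inv v' \<in> Domain \<rho>" using D(6)[OF D(11)[OF w] iv(1)] by blast
    ultimately show ?thesis using False y by simp
  qed
  then show ?thesis by blast
qed

text \<open>The two places have different domains, so they are compared on the ring \<open>A\<close>
  of elements that are finite at all conjugates of both; it is stable under \<open>H\<close>, and
  \<open>hom_conj\<close> applies. Passing to fractions extends the result to the domain of
  \<open>\<rho>2\<close>, and inclusion of places is equality.\<close>

theorem place_conj:
  assumes L: "subfield L R" and k: "subfield k R" "k \<subseteq> L" and H: "finite H"
    "\<And>g. g \<in> H \<Longrightarrow> g \<in> subhom L L \<and> (\<forall>c\<in>k. g c = c)"
    "\<And>g h. g \<in> H \<Longrightarrow> h \<in> H \<Longrightarrow> \<exists>g'\<in>H. \<forall>x\<in>L. g' x = h (g x)"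
    "\<exists>e\<in>H. \<forall>x\<in>L. e x = x"
    and inf: "infinite (carrier R)"
    and pl: "place_on L \<rho>1" "place_on L \<rho>2"
    and idk: "\<And>c. c \<in> k \<Longrightarrow> (c, c) \<in> \<rho>1 \<and> (c, c) \<in> \<rho>2"
    and alg: "\<And>y. y \<in> Range \<rho>1 \<union> Range \<rho>2 \<Longrightarrow> (algebraic over k) y"
    and agree: "\<And>x y1 y2. (x, y1) \<in> \<rho>1 \<Longrightarrow> (x, y2) \<in> \<rho>2 \<Longrightarrow> (\<And>h. h \<in> H \<Longrightarrow> h x = x) \<Longrightarrow> y1 = y2"
  shows "\<exists>g\<in>H. \<rho>2 = pull L g \<rho>1"
proof -
  have h: "partial_hom \<rho>1" "partial_hom \<rho>2" using pl by (auto simp: place_on_def)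
  note Lc = subfieldE(3)[OF L]
  have hL: "g \<in> subhom L L" if "g \<in> H" for g using H(2)[OF that] by blast
  note gL = subfield_hom[OF L hL L]
  define P where "P = (\<lambda>g. pull L g \<rho>1) ` H \<union> (\<lambda>g. pull L g \<rho>2) ` H"
  have Pf: "finite P" unfolding P_def using H(1) by simp
  have Ppl: "place_on L \<rho>" if "\<rho> \<in> P" for \<rho>
    using that place_pull[OF L hL] pl unfolding P_def by blast
  have Pk: "(c, c) \<in> \<rho>" if "\<rho> \<in> P" "c \<in> k" for \<rho> c
  proof -
    have "(c, c) \<in> pull L g \<rho>1" "(c, c) \<in> pull L g \<rho>2" if "g \<in> H" for g
    proof -
      have "g c = c" using H(2)[OF \<open>g \<in> H\<close>] \<open>c \<in> k\<close> by blast
      then show "(c, c) \<in> pull L g \<rho>1" "(c, c) \<in> pull L g \<rho>2"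
        using idk[OF \<open>c \<in> k\<close>] \<open>c \<in> k\<close> k(2) unfolding pull_def by auto
    qed
    then show ?thesis using that(1) unfolding P_def by blast
  qed
  have Palg: "(algebraic over k) z" if "\<rho> \<in> P" "(y, z) \<in> \<rho>" for \<rho> y z
    using that alg[of z] unfolding P_def pull_def by auto
  obtain e where e: "e \<in> H" "\<forall>x\<in>L. e x = x" using H(4) by blast
  have ePull: "pull L e \<rho> = \<rho>" if "place_on L \<rho>" for \<rho>
    using that e(2) unfolding pull_def place_on_def by auto
  have \<rho>P: "\<rho>1 \<in> P" "\<rho>2 \<in> P" using ePull[OF pl(1)] ePull[OF pl(2)] e(1) unfolding P_def by force+
  define A where "A = {x \<in> L. \<forall>\<rho>\<in>P. x \<in> Domain \<rho>}"
  have AL: "A \<subseteq> L" unfolding A_def by blast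
  have A: "subring A R"
  proof -
    have eq: "A = \<Inter>(insert L (Domain ` P))" unfolding A_def by auto
    show ?thesis
      unfolding eq
    proof (rule subring_Inter)
      show "subring I R" if "I \<in> insert L (Domain ` P)" for I
        using that subfieldE(1)[OF L] subring_Domain Ppl unfolding place_on_def by auto
    qed simp
  qed
  have gA: "g x \<in> A" if g: "g \<in> H" and x: "x \<in> A" for g x
  proof -
    have "g x \<in> Domain \<rho>" if \<rho>: "\<rho> \<in> P" for \<rho>
    proof -
      obtain g' \<sigma> where g': "g' \<in> H" "\<rho> = pull L g' \<sigma>" "\<sigma> \<in> {\<rho>1, \<rho>2}" using \<rho> unfolding P_def by blast
      obtain g'' where g'': "g'' \<in> H" "\<forall>x\<in>L. g'' x = g' (g x)" using H(3)[OF g g'(1)] by blast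
      have "pull L g'' \<sigma> \<in> P" using g''(1) g'(3) unfolding P_def by blast
      then have "x \<in> Domain (pull L g'' \<sigma>)" using x unfolding A_def by blast
      then show ?thesis using g''(2) gL(1)[OF g] AL x unfolding g'(2) pull_def by auto
    qed
    then show ?thesis unfolding A_def using gL(1)[OF g] AL x by blast
  qed
  have "\<exists>g\<in>H. \<forall>x\<in>A. app \<rho>2 x = app \<rho>1 (g x)"
  proof (rule hom_conj[OF A H(1) _ _ _ _ _ _ inf])
    show "g \<in> subhom A A \<and> inj_on g A" if g: "g \<in> H" for g
    proof
      show "g \<in> subhom A A"
        using gA[OF g] gL(2)[OF g] by (intro ring_hom_memI) (auto simp: gL(4,5)[OF g] subsetD[OF AL])
      show "inj_on g A" using gL(8)[OF g] AL inj_on_subset by blast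
    qed
    show "\<exists>g'\<in>H. \<forall>x\<in>A. g' x = h (g x)" if "g \<in> H" "h \<in> H" for g h using H(3)[OF that] AL by blast
    show "\<exists>e\<in>H. \<forall>x\<in>A. e x = x" using e AL by blast
    have sub: "A \<subseteq> Domain \<rho>1" "A \<subseteq> Domain \<rho>2" using \<rho>P unfolding A_def by auto
    show "app \<rho>1 \<in> ring_hom (R\<lparr>carrier := A\<rparr>) R" "app \<rho>2 \<in> ring_hom (R\<lparr>carrier := A\<rparr>) R"
      using app_hom[OF h(1) sub(1)] app_hom[OF h(2) sub(2)] .
    show "app \<rho>1 x = app \<rho>2 x" if x: "x \<in> A" and fx: "\<And>h. h \<in> H \<Longrightarrow> h x = x" for x
    proof -
      have "(x, app \<rho>1 x) \<in> \<rho>1" "(x, app \<rho>2 x) \<in> \<rho>2"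
        using app_mem[OF h(1)] app_mem[OF h(2)] x sub by blast+
      then show ?thesis using agree[of x "app \<rho>1 x" "app \<rho>2 x"] fx by simp
    qed
  qed
  then obtain g where g: "g \<in> H" "\<And>x. x \<in> A \<Longrightarrow> app \<rho>2 x = app \<rho>1 (g x)" by blast
  have tr: "(g x, c) \<in> \<rho>1" if x: "x \<in> A" "(x, c) \<in> \<rho>2" for x c
  proof -
    have "g x \<in> Domain \<rho>1" using gA[OF g(1) x(1)] \<rho>P unfolding A_def by blast
    then have "(g x, app \<rho>1 (g x)) \<in> \<rho>1" by (rule app_mem[OF h(1)])
    then show ?thesis using g(2)[OF x(1)] app_eq[OF h(2) x(2)] by simp
  qed
  have "\<rho>2 \<subseteq> pull L g \<rho>1"
  proof
    fix z assume "z \<in> \<rho>2"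
    then obtain x c where z: "z = (x, c)" and xc: "(x, c) \<in> \<rho>2" by (cases z) auto
    have x: "x \<in> L" using xc pl(2) unfolding place_on_def by auto
    \<comment> \<open>\<open>y\<close> clears the poles of \<open>x\<close> at all conjugate places
      while keeping the value 1 at \<open>\<rho>2\<close>, which writes \<open>x\<close> as the
      quotient of \<open>x \<otimes> y\<close> by \<open>y\<close>, both in
      \<open>A\<close>.\<close>
    obtain y where y: "\<And>\<rho>. \<rho> \<in> P \<Longrightarrow> y \<in> Domain \<rho> \<and> x \<otimes> y \<in> Domain \<rho> \<and> (x \<in> Domain \<rho> \<longrightarrow> (y, \<one>) \<in> \<rho>)"
    proof -
      have "\<exists>y. \<forall>\<rho>\<in>P. y \<in> Domain \<rho> \<and> x \<otimes> y \<in> Domain \<rho> \<and> (x \<in> Domain \<rho> \<longrightarrow> (y, \<one>) \<in> \<rho>)"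
        by (rule place_denominator[OF L k(1) Pf x]) (erule Ppl, erule (1) Pk, erule (1) Palg)
      then show thesis using that by blast
    qed
    have y1: "(y, \<one>) \<in> \<rho>2" using y[OF \<rho>P(2)] xc by blast
    have yL: "y \<in> L" using y1 pl(2) unfolding place_on_def by auto
    have yA: "y \<in> A" unfolding A_def using y yL by blast
    have xyA: "x \<otimes> y \<in> A" unfolding A_def using y x yL subringE(6)[OF subfieldE(1)[OF L]] by blast
    have c: "c \<in> carrier R" using partial_homD(2)[OF h(2) xc] .
    have gy: "(g y, \<one>) \<in> \<rho>1" by (rule tr[OF yA y1])
    have "(g (x \<otimes> y), c \<otimes> \<one>) \<in> \<rho>1" by (rule tr[OF xyA partial_homD(6)[OF h(2) xc y1]])
    then have gxy: "(g x \<otimes> g y, c) \<in> \<rho>1" using gL(5)[OF g(1) x yL] c by simp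
    have "(inv (g y), inv \<one>) \<in> \<rho>1" "g y \<noteq> \<zero>" using place_inv[OF pl(1) Lc gy _ L] by auto
    then have iy: "(inv (g y), \<one>) \<in> \<rho>1" "g y \<otimes> inv (g y) = \<one>" "inv (g y) \<in> carrier R"
      using gL(1)[OF g(1) yL] Lc field_Units by auto
    have gc: "g x \<in> carrier R" "g y \<in> carrier R" using gL(1)[OF g(1)] x yL Lc by auto
    have "((g x \<otimes> g y) \<otimes> inv (g y), c \<otimes> \<one>) \<in> \<rho>1" by (rule partial_homD(6)[OF h(1) gxy iy(1)])
    then have "(g x, c) \<in> \<rho>1" using iy gc c by (simp add: m_assoc)
    then show "z \<in> pull L g \<rho>1" unfolding z pull_def using x by simp
  qed
  then have "\<rho>2 = pull L g \<rho>1" by (rule place_eq[OF pl(2) place_pull[OF L hL[OF g(1)] pl(1)] Lc])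
  then show ?thesis using g(1) by blast
qed

lemma nat_pow_eq_zero: "a \<in> carrier R \<Longrightarrow> a [^] (j::nat) = \<zero> \<Longrightarrow> a = \<zero>"
  by (induction j) (auto simp: integral_iff)

text \<open>For \<open>x\<close> purely inseparable over \<open>E\<close> agreement on
  \<open>E\<close> is still enough: both places send the coefficients of (X - x)^n to the same
  values, and evaluating the two images at \<open>y1\<close> gives
  \<open>(y1 - y2)^n = (y1 - y1)^n\<close>.\<close>

lemma place_agree_of_pow:
  assumes pl: "partial_hom \<rho>1" "partial_hom \<rho>2"
    and E: "\<rho>1 \<inter> E \<times> UNIV = \<rho>2 \<inter> E \<times> UNIV"
    and q: "[\<one>, \<ominus> x] [^]\<^bsub>poly_ring R\<^esub> (n::nat) \<in> carrier (E[X])"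
    and n: "n \<noteq> 0" and xy: "(x, y1) \<in> \<rho>1" "(x, y2) \<in> \<rho>2"
  shows "y1 = y2"
proof -
  define A where "A = Domain \<rho>1 \<inter> Domain \<rho>2"
  have A: "subring A R" unfolding A_def by (rule subring_inter[OF subring_Domain[OF pl(1)] subring_Domain[OF pl(2)]])
  define RA where "RA = R\<lparr>carrier := A\<rparr>"
  interpret RA: domain RA unfolding RA_def by (rule subring_is_domain[OF A])
  interpret P: domain "poly_ring RA" by (rule RA.poly_ring_domain)
  have PA: "poly_ring RA = A[X]" unfolding RA_def using univ_poly_consistent[OF A] by simp
  have ops: "monoid.mult (poly_ring RA) = monoid.mult (poly_ring R)" "one (poly_ring RA) = one (poly_ring R)"
    unfolding PA by (simp_all add: univ_poly_def)
  let ?l = "[\<one>, \<ominus> x]"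
  have xA: "x \<in> A" using xy unfolding A_def by blast
  have l: "?l \<in> carrier (poly_ring RA)"
    using xA subringE(3,5)[OF A] unfolding PA by (simp add: univ_poly_carrier[symmetric] polynomial_def)
  have pw: "?l [^]\<^bsub>poly_ring RA\<^esub> j = ?l [^]\<^bsub>poly_ring R\<^esub> (j::nat)" for j
    by (induction j) (simp_all add: ops)
  define Q where "Q = ?l [^]\<^bsub>poly_ring R\<^esub> n"
  have QA: "Q \<in> carrier (poly_ring RA)" unfolding Q_def pw[symmetric] using l by simp
  then have QA': "set Q \<subseteq> A" unfolding PA by (auto simp: univ_poly_carrier[symmetric] polynomial_def)
  have QE: "set Q \<subseteq> E" using q unfolding Q_def by (auto simp: univ_poly_carrier[symmetric] polynomial_def)
  have same: "map (app \<rho>1) Q = map (app \<rho>2) Q"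
  proof (rule map_cong[OF refl])
    fix c assume c: "c \<in> set Q"
    then have "(c, app \<rho>1 c) \<in> \<rho>1" using app_mem[OF pl(1), of c] QA' unfolding A_def by blast
    then have "(c, app \<rho>1 c) \<in> \<rho>2" using E c QE by blast
    then show "app \<rho>1 c = app \<rho>2 c" using app_eq[OF pl(2)] by simp
  qed
  have y: "y1 \<in> carrier R" "y2 \<in> carrier R" using partial_homD(2) pl xy by blast+
  have key: "eval (map (app \<rho>) Q) y1 = (y1 \<oplus> \<ominus> z) [^] n" if \<rho>: "partial_hom \<rho>" "A \<subseteq> Domain \<rho>" "(x, z) \<in> \<rho>" for \<rho> z
  proof -
    have hom: "app \<rho> \<in> ring_hom RA R" unfolding RA_def by (rule app_hom[OF \<rho>(1,2)])
    interpret h: ring_hom_ring "poly_ring RA" R "\<lambda>p. eval (map (app \<rho>) p) y1"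
      by (rule ring_hom_ringI2[OF P.ring_axioms ring_axioms eval_map_hom[OF RA.domain_axioms is_cring hom y(1)]])
    have "eval (map (app \<rho>) Q) y1 = (eval (map (app \<rho>) ?l) y1) [^] n"
      unfolding Q_def pw[symmetric] by (rule h.hom_nat_pow[OF l])
    also have "map (app \<rho>) ?l = [\<one>, \<ominus> z]"
      using app_eq[OF \<rho>(1) partial_homD(3)[OF \<rho>(1)]] app_eq[OF \<rho>(1) partial_homD(4)[OF \<rho>(1,3)]] by simp
    also have "eval [\<one>, \<ominus> z] y1 = y1 \<oplus> \<ominus> z" using y partial_homD(2)[OF \<rho>(1,3)] by simp
    finally show ?thesis .
  qed
  have "(y1 \<oplus> \<ominus> y2) [^] n = (y1 \<oplus> \<ominus> y1) [^] n"
    using key[OF pl(1) _ xy(1)] key[OF pl(2) _ xy(2)] same unfolding A_def by simp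
  then have "(y1 \<oplus> \<ominus> y2) [^] n = \<zero>" using y n by (simp add: r_neg nat_pow_zero)
  then have "y1 \<oplus> \<ominus> y2 = \<zero>" using y nat_pow_eq_zero[of "y1 \<oplus> \<ominus> y2" n] by simp
  then show ?thesis using y by (metis a_minus_def r_right_minus_eq)
qed

end

section \<open>Procyclic Galois theory\<close>

lemma card_set_mset_le: "card (set_mset M) \<le> size M"
  by (induction M) (auto simp: card_insert_if)

lemma (in domain) lin_prod_empty: "lin_prod R {} = [\<one>]"
proof -
  interpret P: domain "poly_ring R" by (rule poly_ring_domain)
  show ?thesis by (simp add: lin_prod_def univ_poly_one)
qed

context field
begin

lemma hom_eval:
  assumes L: "subfield L R" and \<phi>: "\<phi> \<in> subhom L L'" and L': "subfield L' R"
    and p: "set p \<subseteq> L" and x: "x \<in> L"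
  shows "\<phi> (eval p x) = eval (map \<phi> p) (\<phi> x)"
  using p
proof (induction p)
  case Nil
  show ?case using subfield_hom(3)[OF L \<phi> L'] by simp
next
  case (Cons a p)
  note h = subfield_hom[OF L \<phi> L'] and Lr = subfieldE(1)[OF L]
  have pw: "x [^] n \<in> L \<and> \<phi> (x [^] n) = \<phi> x [^] n" for n :: nat
  proof (induction n)
    case 0 show ?case using h(2) subringE(3)[OF Lr] by simp
  next
    case (Suc n)
    then show ?case using h(5)[of "x [^] n" x] subringE(6)[OF Lr, of "x [^] n" x] x by simp
  qed
  have a: "a \<in> L" "set p \<subseteq> L" using Cons.prems by auto
  have e: "eval p x \<in> L" by (rule eval_in_subring[OF Lr a(2) x])
  have m: "a \<otimes> x [^] length p \<in> L" using subringE(6)[OF Lr a(1)] pw by blast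
  have "\<phi> (eval (a # p) x) = \<phi> (a \<otimes> x [^] length p) \<oplus> \<phi> (eval p x)" using h(4)[OF m e] by simp
  also have "\<phi> (a \<otimes> x [^] length p) = \<phi> a \<otimes> \<phi> x [^] length p" using h(5)[OF a(1)] pw by simp
  finally show ?case using Cons.IH[OF a(2)] by simp
qed

lemma hom_root:
  assumes L: "subfield L R" and \<phi>: "\<phi> \<in> subhom L L'" and L': "subfield L' R"
    and E: "E \<subseteq> L" "\<And>c. c \<in> E \<Longrightarrow> \<phi> c = c" and p: "p \<in> carrier (E[X])" and x: "x \<in> L" "eval p x = \<zero>"
  shows "eval p (\<phi> x) = \<zero>"
proof -
  have pE: "set p \<subseteq> E" using p by (auto simp: univ_poly_carrier[symmetric] polynomial_def)
  then have "map \<phi> p = p" using E(2) by (intro map_idI) auto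
  moreover have "set p \<subseteq> L" using pE E(1) by (rule subset_trans)
  ultimately show ?thesis using hom_eval[OF L \<phi> L' _ x(1), of p] subfield_hom(3)[OF L \<phi> L'] x(2) by simp
qed

lemma a_inv_sub: "subring L R \<Longrightarrow> x \<in> L \<Longrightarrow> \<ominus>\<^bsub>R\<lparr>carrier := L\<rparr>\<^esub> x = \<ominus> x"
proof -
  assume L: "subring L R" and x: "x \<in> L"
  interpret RL: ring "R\<lparr>carrier := L\<rparr>" by (rule subring_is_ring[OF L])
  have "\<ominus> x \<in> L" "x \<in> carrier R" using subringE(1,5)[OF L] x by auto
  then show ?thesis using x by (intro RL.minus_equality) (auto simp: l_neg)
qed

text \<open>Invariance of the coefficients is proved in the subring, on which the endomorphism is
  defined, while minimal polynomials live over \<open>R\<close>; the coefficient lists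
  coincide.\<close>

lemma lin_prod_sub:
  assumes L: "subring L R" and S: "finite S" "S \<subseteq> L"
  shows "lin_prod (R\<lparr>carrier := L\<rparr>) S = lin_prod R S"
  using S
proof (induction S)
  case empty
  interpret RL: domain "R\<lparr>carrier := L\<rparr>" by (rule subring_is_domain[OF L])
  show ?case using RL.lin_prod_empty lin_prod_empty by simp
next
  case (insert s S)
  interpret RL: domain "R\<lparr>carrier := L\<rparr>" by (rule subring_is_domain[OF L])
  have s: "s \<in> L" "S \<subseteq> L" "s \<in> carrier R" "S \<subseteq> carrier R" using insert.prems subringE(1)[OF L] by auto
  have "lin_prod (R\<lparr>carrier := L\<rparr>) (insert s S) =
     [\<one>, \<ominus> s] \<otimes>\<^bsub>poly_ring (R\<lparr>carrier := L\<rparr>)\<^esub> lin_prod (R\<lparr>carrier := L\<rparr>) S"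
    using RL.lin_prod_insert[OF insert(1) _ _ insert(2)] s a_inv_sub[OF L s(1)] by simp
  also have "\<dots> = [\<one>, \<ominus> s] \<otimes>\<^bsub>poly_ring R\<^esub> lin_prod R S"
    using insert.IH[OF s(2)] L by (simp add: univ_poly_mult)
  also have "\<dots> = lin_prod R (insert s S)" by (rule lin_prod_insert[OF insert(1) s(4,3) insert(2), symmetric])
  finally show ?case .
qed

lemma lin_prod_mem:
  assumes L: "subfield L R" and \<phi>: "\<phi> \<in> subhom L L"
    and S: "finite S" "S \<subseteq> L" "\<phi> ` S \<subseteq> S" and E: "\<And>c. c \<in> L \<Longrightarrow> \<phi> c = c \<Longrightarrow> c \<in> E"
  shows "lin_prod R S \<in> carrier (E[X])"
proof -
  note Lr = subfieldE(1)[OF L]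
  interpret RL: domain "R\<lparr>carrier := L\<rparr>" by (rule subring_is_domain[OF Lr])
  have inj: "inj_on \<phi> (carrier (R\<lparr>carrier := L\<rparr>))" using subfield_hom(8)[OF L \<phi> L] by simp
  have S': "S \<subseteq> carrier (R\<lparr>carrier := L\<rparr>)" using S by simp
  have eq: "\<phi> ` S = S" by (rule endo_inj_surj[OF S(1,3) inj_on_subset[OF inj S']])
  have "set (lin_prod R S) \<subseteq> E"
  proof
    fix c assume c: "c \<in> set (lin_prod R S)"
    then have c': "c \<in> set (lin_prod (R\<lparr>carrier := L\<rparr>) S)" using lin_prod_sub[OF Lr S(1,2)] by simp
    have "c \<in> L" using c' RL.lin_prod_closed[OF S']
      by (auto simp: univ_poly_carrier[symmetric] polynomial_def)
    then show "c \<in> E" by (rule E) (rule RL.set_lin_prod_fixed[OF \<phi> inj S' eq c'])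
  qed
  moreover have "S \<subseteq> carrier R" using S subfieldE(3)[OF L] by auto
  ultimately show ?thesis using lin_prod_monic[OF S(1)]
    by (simp add: univ_poly_carrier[symmetric] polynomial_def)
qed

lemma ring_hom_sub:
  assumes "\<delta> \<in> ring_hom R R" "A \<subseteq> carrier R"
  shows "\<delta> \<in> ring_hom (R\<lparr>carrier := A\<rparr>) R"
  using ring_hom_closed[OF assms(1)] ring_hom_one[OF assms(1)] ring_hom_add[OF assms(1)] ring_hom_mult[OF assms(1)]
  by (intro ring_hom_memI) (simp_all add: subsetD[OF assms(2)])

text \<open>A basis of \<open>L\<close> over \<open>k\<close> still spans \<open>L\<close> over
  \<open>E\<close>.\<close>

lemma finite_dimension_mono:
  assumes k: "subfield k R" and E: "subfield E R" and sub: "k \<subseteq> E" "E \<subseteq> L"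
    and L: "subfield L R" and fin: "finite_dimension k L"
  shows "finite_dimension E L"
proof -
  obtain Us where Us: "set Us \<subseteq> carrier R" "independent k Us" "length Us = dim k L" "Span k Us = L"
    using exists_base[OF k finite_dimensionE[OF k fin]] by (auto simp: over_def)
  have UL: "set Us \<subseteq> L" using Span_base_incl[OF k Us(1)] Us(4) by simp
  have LL: "subalgebra E L R"
  proof (intro subalgebra.intro subalgebra_axioms.intro)
    show "subgroup L (add_monoid R)" using subfieldE(1)[OF L] by (simp add: subring_def)
    show "a \<otimes> v \<in> L" if "a \<in> E" "v \<in> L" for a v
      using subringE(6)[OF subfieldE(1)[OF L]] that sub(2) by blast
  qed
  have "Span E Us \<subseteq> L" by (rule subalgebra_Span_incl[OF E LL UL])
  moreover have "L \<subseteq> Span E Us"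
  proof -
    have "subalgebra k (Span E Us) R"
    proof (intro subalgebra.intro subalgebra_axioms.intro)
      show "subgroup (Span E Us) (add_monoid R)" by (rule Span_is_add_subgroup[OF E Us(1)])
      show "a \<otimes> v \<in> Span E Us" if "a \<in> k" "v \<in> Span E Us" for a v
        using Span_smult_closed[OF E Us(1)] that sub(1) by blast
    qed
    then show ?thesis using subalgebra_Span_incl[OF k _ Span_base_incl[OF E Us(1)]] Us(4) by simp
  qed
  ultimately show ?thesis using Span_finite_dimension[OF E Us(1)] by simp
qed

lemma dim_pos:
  assumes E: "subfield E R" and L: "subfield L R" and "finite_dimension E L"
  shows "dim E L \<noteq> 0"
proof
  assume "dim E L = 0"
  then have "dimension 0 E L" using finite_dimensionE[OF E assms(3)] by (simp add: over_def)
  then have "L = {\<zero>}" by (cases rule: dimension.cases) auto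
  then show False using subringE(3)[OF subfieldE(1)[OF L]] subfieldE(6)[OF L] by simp
qed

lemma degree_Irr_ge2:
  assumes E: "subfield E R" and x: "x \<in> carrier R" "(algebraic over E) x" "x \<notin> E"
  shows "degree (Irr E x) \<ge> 2"
proof (rule ccontr)
  note I = IrrE[OF E x(1,2)]
  assume "\<not> ?thesis"
  then have "degree (Irr E x) = 1" using pirreducible_degree[OF E I(1,2)] by linarith
  then obtain a b where ab: "a \<in> E" "b \<in> E" "Irr E x = [a, b]" by (rule degree_oneE[OF I(1)])
  then have "a = \<one>" using I(3) by simp
  moreover have "b \<in> carrier R" using ab subfieldE(3)[OF E] by auto
  ultimately have "x \<oplus> b = \<zero>" using I(4) ab x(1) by simp
  then have "x = \<ominus> b" using x(1) \<open>b \<in> carrier R\<close> minus_equality by metis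
  then show False using x(3) ab subringE(5)[OF subfieldE(1)[OF E]] by simp
qed

lemma dim_ge2:
  assumes E: "subfield E R" and L: "subfield L R" "E \<subseteq> L" and fin: "finite_dimension E L" and x: "x \<in> L" "x \<notin> E"
  shows "dim E L \<ge> 2"
proof -
  have xc: "x \<in> carrier R" using x subfieldE(3)[OF L(1)] by auto
  have xa: "(algebraic over E) x" using finite_dimension_imp_algebraic[OF E subfieldE(1)[OF L(1)] fin x(1)] .
  define E' where "E' = simple_extension E x"
  have E': "subfield E' R" unfolding E'_def using simple_extension_is_subfield[OF E xc] xa by simp
  have sub: "E \<subseteq> E'" "E' \<subseteq> L"
    unfolding E'_def using simple_extension_incl[OF subfieldE(3)[OF E] xc]
      simple_extension_subring_incl[OF subfieldE(1)[OF L(1)] L(2) x(1)] .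
  have f1: "finite_dimension E E'" unfolding E'_def using finite_dimension_simple_extension[OF E xc] xa by simp
  have f2: "finite_dimension E' L" by (rule finite_dimension_mono[OF E E' sub L(1) fin])
  have "dim E L = dim E E' * dim E' L" using telescopic_base_dim(2)[OF E E' f1 f2] by (simp add: over_def)
  moreover have "dim E E' \<ge> 2" using simple_extension_dim[OF E xc xa] degree_Irr_ge2[OF E xc xa x(2)]
    unfolding E'_def by (simp add: over_def)
  moreover have "dim E' L \<noteq> 0" by (rule dim_pos[OF E' L(1) f2])
  ultimately show ?thesis by (metis mult.right_neutral mult_le_mono One_nat_def Suc_leI not_gr_zero)
qed

end

text \<open>All that is kept of a topological generator over a perfect field is that its fixed
  elements lie in \<open>k\<close>. Since \<open>F\<close> is only asked to be an endomorphism of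
  \<open>kb\<close>, the axioms pass to \<open>F^n\<close> over its fixed field with
  \<open>kb\<close> unchanged, which drives the inductions on degrees.\<close>

locale frob = field R for R (structure) +
  fixes k kb :: "'a set" and F :: "'a \<Rightarrow> 'a"
  assumes ac: "algebraically_closed R" and inf: "infinite (carrier R)" and k: "subfield k R"
    and kb: "kb = {x \<in> carrier R. (algebraic over k) x}"
    and F: "F \<in> subhom kb kb"
    and fixF: "\<And>x. x \<in> kb \<Longrightarrow> F x = x \<Longrightarrow> x \<in> k" and Fk: "\<And>x. x \<in> k \<Longrightarrow> F x = x"
begin

text \<open>For positive \<open>n\<close> the degree over \<open>k\<close> divides \<open>n\<close>,
  and equals \<open>n\<close> only if \<open>k\<close> has an extension of that degree.
  \<open>K 0\<close> is all of \<open>kb\<close>.\<close>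

definition K :: "nat \<Rightarrow> 'a set" where "K n = {x \<in> kb. (F ^^ n) x = x}"

definition per :: "'a \<Rightarrow> nat" where "per x = (LEAST n. n > 0 \<and> (F ^^ n) x = x)"

lemma kb_subfield: "subfield kb R" unfolding kb by (rule subfield_of_algebraics[OF k])

lemma kb_closed: "closed_field kb" unfolding kb by (rule closed_field_algebraics[OF ac k])

lemma kb_carr: "kb \<subseteq> carrier R" and kb_alg: "x \<in> kb \<Longrightarrow> (algebraic over k) x" unfolding kb by auto

lemma k_sub_kb: "k \<subseteq> kb"
  using algebraic_self[OF subfieldE(1)[OF k]] subfieldE(3)[OF k] unfolding kb by auto

lemma Fn: "(F ^^ n) \<in> subhom kb kb"
proof (induction n)
  case 0 show ?case by (simp add: ring_hom_def)
next
  case (Suc n) show ?case using ring_hom_trans[OF Suc F] by (simp add: comp_def)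
qed

lemmas Fn_simps = subfield_hom[OF kb_subfield Fn kb_subfield]

lemma Fn_k: "x \<in> k \<Longrightarrow> (F ^^ n) x = x"
  by (induction n) (simp_all add: Fk)

lemma K_sub: "K n \<subseteq> kb" "k \<subseteq> K n"
  unfolding K_def using k_sub_kb Fn_k by auto

lemma K_subfield: "subfield (K n) R"
proof (rule subfieldI')
  note s = subringE[OF subfieldE(1)[OF kb_subfield]]
  show "subring (K n) R"
  proof (rule subringI)
    show "K n \<subseteq> carrier R" using K_sub(1) kb_carr by blast
    show "\<one> \<in> K n" unfolding K_def using Fn_simps(2) s(3) by simp
    show "\<ominus> x \<in> K n" if "x \<in> K n" for x using that Fn_simps(6)[of x] s(5)[of x] unfolding K_def by simp
    show "x \<otimes> y \<in> K n" "x \<oplus> y \<in> K n" if "x \<in> K n" "y \<in> K n" for x y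
      using that Fn_simps(4,5)[of x y] s(6,7)[of x y] unfolding K_def by simp_all
  qed
  show "inv x \<in> K n" if "x \<in> K n - {\<zero>}" for x
    using that Fn_simps(7)[of x] subfield_m_inv(1)[OF kb_subfield, of x] unfolding K_def by simp
qed

lemma K_dvd: "a dvd b \<Longrightarrow> K a \<subseteq> K b"
proof
  fix x assume "a dvd b" "x \<in> K a"
  then have "x \<in> kb" "(F ^^ (b mod a)) x = (F ^^ b) x" "b mod a = 0"
    unfolding K_def using funpow_mod_eq[where f = F and n = a and x = x and m = b] by auto
  then show "x \<in> K b" unfolding K_def by simp
qed

lemma funpow_diff:
  assumes x: "x \<in> kb" and "i \<le> j" and e: "(F ^^ i) x = (F ^^ j) x"
  shows "(F ^^ (j - i)) x = x"
proof -
  have "(F ^^ j) x = (F ^^ (i + (j - i))) x" using assms(2) by simp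
  also have "\<dots> = (F ^^ i) ((F ^^ (j - i)) x)" by (simp only: funpow_add comp_apply)
  finally have "(F ^^ i) ((F ^^ (j - i)) x) = (F ^^ i) x" using e by simp
  from inj_onD[OF Fn_simps(8) this Fn_simps(1)[OF x] x] show ?thesis .
qed

text \<open>The iterates are roots of one polynomial over \<open>k\<close>, so two of them coincide,
  and injectivity of \<open>F\<close> makes the orbit purely periodic.\<close>

lemma ex_period:
  assumes x: "x \<in> kb"
  shows "\<exists>n>0. (F ^^ n) x = x"
proof -
  have xc: "x \<in> carrier R" using x kb_carr by blast
  obtain p where p: "p \<in> carrier (k[X])" "p \<noteq> []" "eval p x = \<zero>"
    using algebraicE[OF subfieldE(1)[OF k] xc] kb_alg[OF x] unfolding over_def by metis
  have "range (\<lambda>i. (F ^^ i) x) \<subseteq> {z. is_root p z}"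
  proof (intro image_subsetI CollectI)
    fix i
    have "eval p ((F ^^ i) x) = \<zero>"
      by (rule hom_root[OF kb_subfield Fn kb_subfield k_sub_kb Fn_k p(1) x p(3)])
    then show "is_root p ((F ^^ i) x)" unfolding is_root_def using p(2) Fn_simps(1)[OF x] kb_carr by blast
  qed
  then have "finite (range (\<lambda>i. (F ^^ i) x))"
    using finite_number_of_roots[OF carrier_polynomial_shell[OF subfieldE(1)[OF k] p(1)]] finite_subset by blast
  then have "\<not> inj (\<lambda>i. (F ^^ i) x)" using finite_imageD infinite_UNIV_nat by blast
  then obtain i j where ij: "i < j" "(F ^^ i) x = (F ^^ j) x"
    unfolding inj_def by (metis linorder_neqE_nat)
  have "(F ^^ (j - i)) x = x" by (rule funpow_diff[OF x _ ij(2)]) (use ij(1) in simp)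
  then show ?thesis using ij(1) by (intro exI[of _ "j - i"]) simp
qed

lemma per:
  assumes x: "x \<in> kb"
  shows "per x > 0" "(F ^^ per x) x = x" "(F ^^ j) x = x \<longleftrightarrow> per x dvd j"
proof -
  have p: "per x > 0 \<and> (F ^^ per x) x = x"
    unfolding per_def using LeastI_ex[OF ex_period[OF x]] .
  then show p1: "per x > 0" and p2: "(F ^^ per x) x = x" by simp_all
  have m: "(F ^^ (j mod per x)) x = (F ^^ j) x" by (rule funpow_mod_eq[OF p2])
  show "(F ^^ j) x = x \<longleftrightarrow> per x dvd j"
  proof
    assume "(F ^^ j) x = x"
    then have fx: "(F ^^ (j mod per x)) x = x" using m by simp
    have le: "per x \<le> i" if "i > 0" "(F ^^ i) x = x" for i
      unfolding per_def by (rule Least_le) (use that in simp)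
    have "j mod per x < per x" using p1 by simp
    then have "\<not> j mod per x > 0" using le[OF _ fx] by linarith
    then show "per x dvd j" by (simp add: mod_eq_0_iff_dvd)
  next
    assume "per x dvd j"
    then show "(F ^^ j) x = x" using m by (simp add: mod_eq_0_iff_dvd[symmetric])
  qed
qed

lemma mem_K_per: "x \<in> kb \<Longrightarrow> x \<in> K (per x)"
  unfolding K_def using per(2) by simp

text \<open>An instance of \<open>hom_conj\<close> with powers of \<open>F\<close> as the finite
  set, comparing the inclusion with \<open>\<delta>\<close>: invariant elements are fixed by
  \<open>F\<close>, hence lie in \<open>k\<close>, where both maps are the identity.\<close>

lemma embedding_eq_power:
  assumes D: "D > 0" and \<delta>: "\<delta> \<in> ring_hom (R\<lparr>carrier := K D\<rparr>) R" "\<And>c. c \<in> k \<Longrightarrow> \<delta> c = c"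
  shows "\<exists>i. \<forall>x\<in>K D. \<delta> x = (F ^^ i) x"
proof -
  \<comment> \<open>Exponents run up to \<open>D\<close> and not only to \<open>D - 1\<close>, so
    that \<open>F\<close> itself is a member even for \<open>D = 1\<close>.\<close>
  define H where "H = (\<lambda>i. F ^^ i) ` {..<Suc D}"
  have FK: "(F ^^ i) x \<in> K D" if "x \<in> K D" for i x
  proof -
    have "(F ^^ D) ((F ^^ i) x) = (F ^^ i) ((F ^^ D) x)" by (metis funpow_add comp_apply add.commute)
    then show ?thesis using that Fn_simps(1)[of x i] unfolding K_def by simp
  qed
  have modK: "(F ^^ (i mod D)) x = (F ^^ i) x" if "x \<in> K D" for i x
    using that funpow_mod_eq[where f = F and n = D and x = x and m = i] unfolding K_def by simp
  have Kkb: "x \<in> kb" if "x \<in> K D" for x using that K_sub by blast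
  have "\<exists>g\<in>H. \<forall>x\<in>K D. \<delta> x = id (g x)"
  proof (rule hom_conj[OF subfieldE(1)[OF K_subfield] _ _ _ _ _ _ _ inf])
    show "finite H" unfolding H_def by simp
    show "g \<in> subhom (K D) (K D) \<and> inj_on g (K D)" if g: "g \<in> H" for g
    proof -
      obtain i where i: "g = F ^^ i" using g unfolding H_def by (auto elim: imageE)
      have "F ^^ i \<in> subhom (K D) (K D)"
        using FK Fn_simps(2) by (intro ring_hom_memI) (simp_all add: Fn_simps(4,5) Kkb)
      moreover have "inj_on (F ^^ i) (K D)" by (rule inj_on_subset[OF Fn_simps(8) K_sub(1)])
      ultimately show ?thesis unfolding i ..
    qed
    show "\<exists>g'\<in>H. \<forall>x\<in>K D. g' x = h (g x)" if gh: "g \<in> H" "h \<in> H" for g h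
    proof -
      obtain i where i: "g = F ^^ i" using gh(1) unfolding H_def by (auto elim: imageE)
      obtain j where j: "h = F ^^ j" using gh(2) unfolding H_def by (auto elim: imageE)
      have "(j + i) mod D < Suc D" using D by (simp add: less_SucI)
      then have "F ^^ ((j + i) mod D) \<in> H" unfolding H_def by (intro imageI) simp
      moreover have "\<forall>x\<in>K D. (F ^^ ((j + i) mod D)) x = h (g x)"
        unfolding i j using modK[of _ "j + i"] by (simp add: funpow_add)
      ultimately show ?thesis by (intro bexI[of _ "F ^^ ((j + i) mod D)"])
    qed
    have "F ^^ 0 \<in> H" unfolding H_def by (intro imageI) simp
    moreover have "\<forall>x\<in>K D. (F ^^ 0) x = x" by simp
    ultimately show "\<exists>e\<in>H. \<forall>x\<in>K D. e x = x" by (intro bexI[of _ "F ^^ 0"])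
    show "id \<in> ring_hom (R\<lparr>carrier := K D\<rparr>) R"
      using subfieldE(3)[OF K_subfield] by (intro ring_hom_memI) auto
    show "\<delta> \<in> ring_hom (R\<lparr>carrier := K D\<rparr>) R" by fact
    show "id x = \<delta> x" if x: "x \<in> K D" and fx: "\<And>h. h \<in> H \<Longrightarrow> h x = x" for x
    proof -
      have "F ^^ 1 \<in> H" unfolding H_def using D by (intro imageI) simp
      then have "F x = x" using fx[of "F ^^ 1"] by simp
      then have "x \<in> k" using fixF Kkb[OF x] by simp
      then show ?thesis using \<delta>(2) by simp
    qed
  qed
  then obtain g where g: "g \<in> H" "\<forall>x\<in>K D. \<delta> x = id (g x)" by (rule bexE)
  then obtain i where "g = F ^^ i" unfolding H_def by (auto elim: imageE)
  then show ?thesis using g(2) by auto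
qed

lemma orbit_poly:
  assumes x: "x \<in> kb"
  obtains S where "finite S" "S \<subseteq> kb" "x \<in> S" "lin_prod R S \<in> carrier (k[X])" "card S = per x"
    "\<forall>z\<in>S. \<exists>i. z = (F ^^ i) x"
proof -
  define S where "S = (\<lambda>i. (F ^^ i) x) ` {..<per x}"
  have f: "finite S" unfolding S_def by simp
  have sub: "S \<subseteq> kb" unfolding S_def using Fn_simps(1)[OF x] by blast
  have "(F ^^ 0) x \<in> S" unfolding S_def using per(1)[OF x] by (intro imageI) simp
  then have xS: "x \<in> S" by simp
  have card: "card S = per x"
  proof -
    have "inj_on (\<lambda>i. (F ^^ i) x) {..<per x}"
    proof (rule linorder_inj_onI)
      fix i j assume ij: "i < j" "i \<in> {..<per x}" "j \<in> {..<per x}"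
      show "(F ^^ i) x \<noteq> (F ^^ j) x"
      proof
        assume e: "(F ^^ i) x = (F ^^ j) x"
        have "(F ^^ (j - i)) x = x" by (rule funpow_diff[OF x _ e]) (use ij(1) in simp)
        then have "per x dvd j - i" using per(3)[OF x] by simp
        then show False using ij dvd_imp_le[of "per x" "j - i"] by simp
      qed
    qed auto
    then show ?thesis unfolding S_def by (simp add: card_image)
  qed
  have orb: "\<forall>z\<in>S. \<exists>i. z = (F ^^ i) x" unfolding S_def by blast
  have "F ` S \<subseteq> S"
  proof
    fix z assume "z \<in> F ` S"
    then obtain i where "z = F ((F ^^ i) x)" unfolding S_def by blast
    then have "z = (F ^^ (Suc i mod per x)) x" using funpow_mod_eq[OF per(2)[OF x], of "Suc i"] by simp
    then show "z \<in> S" unfolding S_def using per(1)[OF x] by simp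
  qed
  then have "lin_prod R S \<in> carrier (k[X])" by (intro lin_prod_mem[OF kb_subfield F f sub] fixF)
  then show thesis by (rule that[OF f sub xS _ card orb])
qed

text \<open>The minimal polynomial divides the orbit polynomial, which bounds its degree from above,
  and it vanishes on the whole orbit, which bounds its degree from below.\<close>

lemma degree_Irr: "x \<in> kb \<Longrightarrow> degree (Irr k x) = per x"
proof -
  assume x: "x \<in> kb"
  have xc: "x \<in> carrier R" "(algebraic over k) x" using x kb_carr kb_alg by auto
  obtain S where S: "finite S" "S \<subseteq> kb" "x \<in> S" "lin_prod R S \<in> carrier (k[X])" "card S = per x"
    "\<forall>z\<in>S. \<exists>i. z = (F ^^ i) x" by (rule orbit_poly[OF x])
  have Sc: "S \<subseteq> carrier R" using S(2) kb_carr by blast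
  note I = IrrE[OF k xc]
  have Ip: "Irr k x \<in> carrier (poly_ring R)" by (rule carrier_polynomial_shell[OF subfieldE(1)[OF k] I(1)])
  have "eval (lin_prod R S) x = \<zero>" using eval_lin_prod_zero_iff[OF S(1) Sc xc(1)] S(3) by simp
  then have "Irr k x pdivides lin_prod R S" by (rule Irr_minimal[OF k xc S(4)])
  then have le: "degree (Irr k x) \<le> per x"
    using pdivides_imp_degree_le[OF carrier_is_subring Ip lin_prod_closed[OF Sc]] lin_prod_monic[OF S(1) Sc] S(5) by simp
  have ne: "Irr k x \<noteq> []" using pirreducibleE(1)[OF subfieldE(1)[OF k] I(1,2)] .
  have "S \<subseteq> set_mset (roots (Irr k x))"
  proof
    fix z assume z: "z \<in> S"
    then obtain i where i: "z = (F ^^ i) x" using S(6) by blast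
    have "eval (Irr k x) z = \<zero>"
      unfolding i by (rule hom_root[OF kb_subfield Fn kb_subfield k_sub_kb Fn_k I(1) x I(4)])
    then have "is_root (Irr k x) z" unfolding is_root_def using ne z Sc by blast
    then show "z \<in># roots (Irr k x)" using roots_mem_iff_is_root[OF Ip] by simp
  qed
  then have "card S \<le> card (set_mset (roots (Irr k x)))" by (intro card_mono) auto
  also have "\<dots> \<le> size (roots (Irr k x))" by (rule card_set_mset_le)
  also have "\<dots> \<le> degree (Irr k x)" by (rule size_roots_le_degree[OF Ip])
  finally show ?thesis using le S(5) by simp
qed

lemma K_hom_of_kb:
  "\<delta> \<in> subhom kb kb \<Longrightarrow> \<delta> \<in> ring_hom (R\<lparr>carrier := K D\<rparr>) R"
proof -
  assume \<delta>: "\<delta> \<in> subhom kb kb"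
  note h = subfield_hom[OF kb_subfield \<delta> kb_subfield]
  show ?thesis using h(1,2) K_sub(1)[of D] kb_carr
    by (intro ring_hom_memI) (auto simp: h(4,5) subsetD[OF K_sub(1)])
qed

text \<open>An embedding over \<open>k(x)\<close> acts on \<open>K (per x)\<close> as a power of
  \<open>F\<close>, and fixing \<open>x\<close> forces the exponent to be a multiple of
  \<open>per x\<close>. It is therefore trivial there, so each element is the only root of its
  minimal polynomial over \<open>k(x)\<close>; the orbit polynomial supplies the simple
  roots.\<close>

lemma K_per: "x \<in> kb \<Longrightarrow> K (per x) = simple_extension k x"
proof
  assume x: "x \<in> kb"
  have xc: "x \<in> carrier R" "(algebraic over k) x" using x kb_carr kb_alg by auto
  define E where "E = simple_extension k x"
  have E: "subfield E R" unfolding E_def using simple_extension_is_subfield[OF k xc(1)] xc(2) by simp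
  have kE: "k \<subseteq> E" "x \<in> E" unfolding E_def
    using simple_extension_incl[OF subfieldE(3)[OF k] xc(1)] simple_extension_mem[OF subfieldE(1)[OF k] xc(1)] .
  show sub: "simple_extension k x \<subseteq> K (per x)"
    by (rule simple_extension_subring_incl[OF subfieldE(1)[OF K_subfield] K_sub(2) mem_K_per[OF x]])
  have Ekb: "E \<subseteq> kb" using sub K_sub(1) unfolding E_def by blast
  show "K (per x) \<subseteq> simple_extension k x"
  proof
    fix y assume y: "y \<in> K (per x)"
    then have ykb: "y \<in> kb" using K_sub by blast
    obtain S where S: "finite S" "S \<subseteq> kb" "y \<in> S" "lin_prod R S \<in> carrier (k[X])" "card S = per y"
      "\<forall>z\<in>S. \<exists>i. z = (F ^^ i) y" by (rule orbit_poly[OF ykb])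
    have Sc: "S \<subseteq> carrier R" using S(2) kb_carr by blast
    have pE: "lin_prod R S \<in> carrier (E[X])" using S(4) kE(1) by (auto simp: univ_poly_carrier[symmetric] polynomial_def)
    have alg: "(algebraic over E) z" if "z \<in> kb" for z
      using algebraic_mono[OF kE(1)] kb_alg[OF that] by (simp add: over_def)
    have "y \<in> E"
    proof (rule mem_of_only_root[OF ac E S(1) Sc S(3) pE])
      fix z assume z: "z \<in> carrier R" "eval (Irr E y) z = \<zero>"
      have I: "Irr E y \<in> carrier (E[X])" "Irr E y \<noteq> []"
        using IrrE[OF E subsetD[OF kb_carr ykb] alg[OF ykb]] pirreducibleE(1)[OF subfieldE(1)[OF E]] by auto
      have "(algebraic over E) z" using algebraicI[OF I z(2)] by (simp add: over_def)
      then have "(algebraic over k) z" by (intro algebraic_trans[OF k E _ z(1)]) (use Ekb kb_alg in blast)+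
      then have zkb: "z \<in> kb" using z(1) unfolding kb by simp
      show "z = y"
      proof (rule hom_of_root[OF kb_closed E Ekb kb_carr alg ykb zkb z(2)])
        fix \<delta> assume \<delta>: "\<delta> \<in> subhom kb kb" "\<And>e. e \<in> E \<Longrightarrow> \<delta> e = e" "\<delta> y = z"
        have c: "\<delta> c = c" if "c \<in> k" for c using \<delta>(2) that kE(1) by blast
        have "\<exists>i. \<forall>w\<in>K (per x). \<delta> w = (F ^^ i) w"
          by (rule embedding_eq_power[OF per(1)[OF x] K_hom_of_kb[OF \<delta>(1)] c])
        then obtain i where i: "\<And>w. w \<in> K (per x) \<Longrightarrow> \<delta> w = (F ^^ i) w" by blast
        have "(F ^^ i) x = x" using i[OF mem_K_per[OF x]] \<delta>(2)[OF kE(2)] by simp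
        then have "per x dvd i" using per(3)[OF x] by simp
        then have "y \<in> K i" using K_dvd y by blast
        then have "\<delta> y = y" using i[OF y] unfolding K_def by simp
        then show "z = y" using \<delta>(3) by simp
      qed
    qed
    then show "y \<in> simple_extension k x" unfolding E_def .
  qed
qed

lemma base_change:
  assumes "n > 0" shows "frob R (K n) kb (F ^^ n)"
proof (intro frob.intro frob_axioms.intro field_axioms ac inf)
  have alg: "(algebraic over k) x" if "x \<in> carrier R" "(algebraic over K n) x" for x
    using that K_sub(1) kb_alg by (intro algebraic_trans[OF k K_subfield _ that]) blast
  show "kb = {x \<in> carrier R. (algebraic over K n) x}"
  proof
    show "kb \<subseteq> {x \<in> carrier R. (algebraic over K n) x}"
      using algebraic_mono[OF K_sub(2)] kb_alg kb_carr by (auto simp: over_def)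
    show "{x \<in> carrier R. (algebraic over K n) x} \<subseteq> kb" using alg unfolding kb by blast
  qed
  show "F ^^ n \<in> subhom kb kb" by (rule Fn)
  show "subfield (K n) R" by (rule K_subfield)
  show "x \<in> K n" if "x \<in> kb" "(F ^^ n) x = x" for x using that unfolding K_def by simp
  show "(F ^^ n) x = x" if "x \<in> K n" for x using that unfolding K_def by simp
qed

end

text \<open>Induction on the degree, to show that the restriction of \<open>F\<close> to
  \<open>E\<close> has order exactly \<open>d\<close>: one element \<open>x\<close> outside
  \<open>k\<close> splits off the factor \<open>per x\<close>, and over \<open>K (per x)\<close> the
  corresponding power of \<open>F\<close> takes the role of \<open>F\<close>. As \<open>k\<close>
  and \<open>F\<close> change, the locale enters as an assumption.\<close>

lemma frob_dim:
  assumes "frob R k kb F" "subfield E R" "k \<subseteq> E" "E \<subseteq> kb" "ring.finite_dimension R k E" "d = ring.dim R k E"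
  shows "(\<forall>x\<in>E. (F ^^ d) x = x) \<and> (\<forall>j. (\<forall>x\<in>E. (F ^^ j) x = x) \<longrightarrow> d dvd j)"
  using assms
proof (induction d arbitrary: k F rule: less_induct)
  case (less d)
  interpret frob R k kb F by (rule less.prems(1))
  note E = less.prems(2) and kE = less.prems(3) and Ekb = less.prems(4) and fin = less.prems(5) and d = less.prems(6)
  show ?case
  proof (cases "E = k")
    case True
    have "dim k k = 1" using dimI[OF k dimension_one[OF k]] by (simp add: over_def)
    then have "d = 1" using d True by simp
    then show ?thesis using True Fk by simp
  next
    case False
    then obtain x where x: "x \<in> E" "x \<notin> k" using kE by blast
    have xkb: "x \<in> kb" using x(1) Ekb by blast
    have xc: "x \<in> carrier R" "(algebraic over k) x" using xkb kb_carr kb_alg by auto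
    define n where "n = per x"
    have n: "n > 0" "n \<ge> 2"
      using per(1)[OF xkb] degree_Irr[OF xkb] degree_Irr_ge2[OF k xc x(2)] unfolding n_def by auto
    have Kn: "K n = simple_extension k x" unfolding n_def by (rule K_per[OF xkb])
    have sub: "K n \<subseteq> E" unfolding Kn by (rule simple_extension_subring_incl[OF subfieldE(1)[OF E] kE x(1)])
    have f1: "finite_dimension k (K n)" unfolding Kn using finite_dimension_simple_extension[OF k xc(1)] xc(2) by simp
    have d1: "dim k (K n) = n" using simple_extension_dim[OF k xc] degree_Irr[OF xkb, folded n_def]
      unfolding Kn by (simp add: over_def)
    have f2: "finite_dimension (K n) E" by (rule finite_dimension_mono[OF k K_subfield K_sub(2) sub E fin])
    define d' where "d' = dim (K n) E"
    have dd: "d = n * d'" using telescopic_base_dim(2)[OF k K_subfield f1 f2] d d1 unfolding d'_def by (simp add: over_def)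
    have "d' \<noteq> 0" unfolding d'_def by (rule dim_pos[OF K_subfield E f2])
    then have lt: "d' < d" using dd n by simp
    note IH = less.IH[OF lt base_change[OF n(1)] E sub Ekb f2 d'_def]
    have pw: "((F ^^ n) ^^ j) y = (F ^^ (n * j)) y" for j y by (simp add: funpow_mult)
    have "d dvd j" if j: "\<forall>x\<in>E. (F ^^ j) x = x" for j
    proof -
      have "n dvd j" using per(3)[OF xkb] j x(1) unfolding n_def by blast
      then obtain i where i: "j = n * i" by (rule dvdE)
      then have "d' dvd i" using IH j by (simp add: pw)
      then show ?thesis using i dd by simp
    qed
    then show ?thesis using IH dd by (simp add: pw)
  qed
qed

context frob
begin

text \<open>By \<open>frob_dim\<close> every finite subextension of \<open>K n\<close> has a degree
  dividing \<open>n\<close>, so one of maximal degree exists, and adjoining an element outside it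
  would exceed the maximum.\<close>

lemma dim_K_dvd:
  assumes n: "n > 0"
  shows "finite_dimension k (K n)" "dim k (K n) dvd n"
proof -
  define \<E> where "\<E> = {E. subfield E R \<and> k \<subseteq> E \<and> E \<subseteq> K n \<and> finite_dimension k E}"
  have dv: "dim k E dvd n" if E: "E \<in> \<E>" for E
  proof -
    have E': "subfield E R" "k \<subseteq> E" "E \<subseteq> kb" "finite_dimension k E"
      using E K_sub(1)[of n] unfolding \<E>_def by auto
    have "\<forall>x\<in>E. (F ^^ n) x = x" using E unfolding \<E>_def K_def by auto
    then show ?thesis using frob_dim[OF frob_axioms E' refl] by blast
  qed
  have "finite_dimension k k" using dimension_one[OF k] finite_dimensionI by blast
  then have "k \<in> \<E>" unfolding \<E>_def using k K_sub(2) by simp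
  moreover have "\<forall>E. E \<in> \<E> \<longrightarrow> dim k E < Suc n" using dvd_imp_le[OF dv n] by (simp add: less_Suc_eq_le)
  ultimately obtain E where E: "E \<in> \<E>" "\<And>E'. E' \<in> \<E> \<Longrightarrow> dim k E' \<le> dim k E"
    using ex_has_greatest_nat[of "\<lambda>E. E \<in> \<E>" k "\<lambda>E. dim k E" "Suc n"] by (metis less_imp_le)
  have E': "subfield E R" "k \<subseteq> E" "E \<subseteq> K n" "finite_dimension k E" using E(1) unfolding \<E>_def by auto
  have "K n \<subseteq> E"
  proof
    fix y assume y: "y \<in> K n"
    show "y \<in> E"
    proof (rule ccontr)
      assume ny: "y \<notin> E"
      have ykb: "y \<in> kb" "y \<in> carrier R" using y K_sub(1) kb_carr by blast+
      have alg: "(algebraic over E) y" using algebraic_mono[OF E'(2)] kb_alg[OF ykb(1)] by (simp add: over_def)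
      define L where "L = simple_extension E y"
      have L: "subfield L R" unfolding L_def using simple_extension_is_subfield[OF E'(1) ykb(2)] alg by simp
      have EL: "E \<subseteq> L" "y \<in> L" unfolding L_def
        using simple_extension_incl[OF subfieldE(3)[OF E'(1)] ykb(2)] simple_extension_mem[OF subfieldE(1)[OF E'(1)] ykb(2)] .
      have LK: "L \<subseteq> K n" unfolding L_def by (rule simple_extension_subring_incl[OF subfieldE(1)[OF K_subfield] E'(3) y])
      have f: "finite_dimension E L" unfolding L_def using finite_dimension_simple_extension[OF E'(1) ykb(2)] alg by simp
      have fk: "finite_dimension k L" by (rule telescopic_base_dim(1)[OF k E'(1,4) f])
      then have "L \<in> \<E>" unfolding \<E>_def using L E'(2) EL(1) LK by auto
      then have "dim k L \<le> dim k E" by (rule E(2))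
      moreover have "dim k L = dim k E * dim E L" using telescopic_base_dim(2)[OF k E'(1,4) f] by (simp add: over_def)
      moreover have "dim E L \<ge> 2" by (rule dim_ge2[OF E'(1) L EL(1) f EL(2) ny])
      moreover have "dim k E \<noteq> 0" by (rule dim_pos[OF k E'(1,4)])
      ultimately show False by simp
    qed
  qed
  then have "E = K n" using E'(3) by blast
  then show "finite_dimension k (K n)" "dim k (K n) dvd n" using E'(4) dv[OF E(1)] by simp_all
qed

text \<open>With \<open>d\<close> the degree of \<open>E\<close>, the power \<open>F^d\<close> is
  trivial on \<open>E\<close>; so \<open>E\<close> lies in \<open>K d\<close>, whose degree is at
  most \<open>d\<close>.\<close>

lemma K_unique:
  assumes E: "subfield E R" "k \<subseteq> E" "finite_dimension k E"
  shows "E = K (dim k E)"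
proof -
  define d where "d = dim k E"
  have d0: "d > 0" unfolding d_def using dim_pos[OF k E(1,3)] by simp
  have Ekb: "E \<subseteq> kb"
    using finite_dimension_imp_algebraic[OF k subfieldE(1)[OF E(1)] E(3)] subfieldE(3)[OF E(1)] unfolding kb by blast
  have "\<forall>x\<in>E. (F ^^ d) x = x" using frob_dim[OF frob_axioms E(1,2) Ekb E(3) d_def] by blast
  then have sub: "E \<subseteq> K d" unfolding K_def using Ekb by blast
  note f = dim_K_dvd[OF d0]
  have f2: "finite_dimension E (K d)" by (rule finite_dimension_mono[OF k E(1,2) sub K_subfield f(1)])
  have "dim k (K d) = d * dim E (K d)" using telescopic_base_dim(2)[OF k E(1,3) f2] unfolding d_def by (simp add: over_def)
  moreover have "dim k (K d) \<le> d" using dvd_imp_le[OF f(2) d0] .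
  ultimately have "d * dim E (K d) < d * 2" using d0 by linarith
  then have "dim E (K d) < 2" by simp
  then have "K d \<subseteq> E" using dim_ge2[OF E(1) K_subfield sub f2] by (meson linorder_not_less subsetI)
  then show ?thesis using sub unfolding d_def by blast
qed

text \<open>With \<open>n = t s\<close>, the two steps of the tower have degrees at most
  \<open>t\<close> and \<open>s\<close>. Their product is \<open>n\<close>, so both bounds are
  attained.\<close>

lemma dim_K_of_dvd:
  assumes n: "n > 0" "dim k (K n) = n" and t: "t dvd n"
  shows "dim k (K t) = t"
proof -
  have t0: "t > 0" using n(1) t by (metis dvd_0_left_iff not_gr_zero)
  obtain s where s: "n = t * s" using t by (rule dvdE)
  have s0: "s > 0" using n(1) s by simp
  interpret B: frob R "K t" kb "F ^^ t" by (rule base_change[OF t0])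
  have eq: "B.K s = K n" unfolding B.K_def K_def s by (simp add: funpow_mult)
  note f1 = dim_K_dvd[OF t0] and f2 = B.dim_K_dvd[OF s0, unfolded eq]
  have "dim k (K n) = dim k (K t) * dim (K t) (K n)"
    using telescopic_base_dim(2)[OF k K_subfield f1(1) f2(1)] by (simp add: over_def)
  then have e: "t * s = dim k (K t) * dim (K t) (K n)" using n(2) s by simp
  have le: "dim k (K t) \<le> t" "dim (K t) (K n) \<le> s" using dvd_imp_le[OF f1(2) t0] dvd_imp_le[OF f2(2) s0] .
  show ?thesis
  proof (rule ccontr)
    assume "dim k (K t) \<noteq> t"
    then have "dim k (K t) < t" using le(1) by simp
    then have "dim k (K t) * dim (K t) (K n) < t * s" using le(2) s0 t0
      by (metis mult_le_mono2 mult_less_cancel2 order_le_less_trans)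
    then show False using e by simp
  qed
qed

lemma K_order:
  assumes n: "n > 0" "dim k (K n) = n" and j: "\<And>x. x \<in> K n \<Longrightarrow> (F ^^ j) x = x"
  shows "n dvd j"
  using frob_dim[OF frob_axioms K_subfield K_sub(2,1) dim_K_dvd(1)[OF n(1)] n(2)[symmetric]] j by blast

lemma extension_of_degree:
  assumes n: "n > 0" "dim k (K n) = n"
  shows "the_extension_of_degree R k n = K n"
  unfolding the_extension_of_degree_def
proof (rule the_equality)
  show "subfield (K n) R \<and> k \<subseteq> K n \<and> dimension n k (K n)"
    using K_subfield K_sub(2) finite_dimensionE[OF k dim_K_dvd(1)[OF n(1)]] n(2) by (simp add: over_def)
  fix E assume E: "subfield E R \<and> k \<subseteq> E \<and> dimension n k E"
  then have "finite_dimension k E" "dim k E = n"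
    using finite_dimensionI dimI[OF k] by (auto simp: over_def)
  then show "E = K n" using K_unique E by blast
qed

text \<open>This is linear disjointness of \<open>M\<close> and \<open>kb\<close> over their
  intersection. The exponents \<open>j\<close> for which \<open>F^j\<close> on \<open>K d\<close>
  extends by the identity on \<open>M\<close> are the multiples of some \<open>t\<close>, and
  \<open>K t\<close> lies in \<open>M\<close>. Hence \<open>F^s\<close> is trivial on
  \<open>K t\<close>, and as \<open>K t\<close> has degree \<open>t\<close>, \<open>t\<close>
  divides \<open>s\<close>.\<close>

lemma extend_power:
  assumes M: "subfield M R" "k \<subseteq> M" "\<And>x. x \<in> carrier R \<Longrightarrow> (algebraic over M) x"
    and s: "\<And>x. x \<in> M \<Longrightarrow> x \<in> kb \<Longrightarrow> (F ^^ s) x = x" and n: "n > 0"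
  obtains \<delta> where "\<delta> \<in> ring_hom R R" "\<And>x. x \<in> M \<Longrightarrow> \<delta> x = x" "\<And>x. x \<in> K n \<Longrightarrow> \<delta> x = (F ^^ s) x"
proof -
  \<comment> \<open>The degree of \<open>K n\<close> may be smaller than \<open>n\<close>; the same
    field written as \<open>K d\<close> has full degree, which is what the order of \<open>F\<close>
    on it requires.\<close>
  define d where "d = dim k (K n)"
  have fin: "finite_dimension k (K n)" by (rule dim_K_dvd(1)[OF n])
  have d0: "d > 0" unfolding d_def using dim_pos[OF k K_subfield fin] by simp
  have Kd: "K n = K d" using K_unique[OF K_subfield K_sub(2) fin] unfolding d_def .
  have dd: "dim k (K d) = d" by (simp only: Kd[symmetric]) (simp only: d_def)
  define J where "J = {j. \<exists>\<delta>\<in>ring_hom R R. (\<forall>x\<in>M. \<delta> x = x) \<and> (\<forall>x\<in>K d. \<delta> x = (F ^^ j) x)}"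
  have FK: "(F ^^ i) x \<in> K d" if "x \<in> K d" for i x
  proof -
    have "(F ^^ d) ((F ^^ i) x) = (F ^^ i) ((F ^^ d) x)" by (metis funpow_add comp_apply add.commute)
    then show ?thesis using that Fn_simps(1)[of x i] unfolding K_def by simp
  qed
  have Jadd: "i + j \<in> J" if ij: "i \<in> J" "j \<in> J" for i j
  proof -
    obtain \<delta> where \<delta>: "\<delta> \<in> ring_hom R R" "\<forall>x\<in>M. \<delta> x = x" "\<forall>x\<in>K d. \<delta> x = (F ^^ i) x" using ij(1) unfolding J_def by blast
    obtain \<epsilon> where \<epsilon>: "\<epsilon> \<in> ring_hom R R" "\<forall>x\<in>M. \<epsilon> x = x" "\<forall>x\<in>K d. \<epsilon> x = (F ^^ j) x" using ij(2) unfolding J_def by blast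
    have "\<delta> \<circ> \<epsilon> \<in> ring_hom R R" by (rule ring_hom_trans[OF \<epsilon>(1) \<delta>(1)])
    moreover have "\<forall>x\<in>M. (\<delta> \<circ> \<epsilon>) x = x" using \<delta>(2) \<epsilon>(2) by simp
    moreover have "\<forall>x\<in>K d. (\<delta> \<circ> \<epsilon>) x = (F ^^ (i + j)) x" using \<delta>(3) \<epsilon>(3) FK by (simp add: funpow_add)
    ultimately show ?thesis unfolding J_def by (intro CollectI bexI[of _ "\<delta> \<circ> \<epsilon>"]) simp_all
  qed
  have Jmod: "j \<in> J" if i: "i \<in> J" "i mod d = j mod d" for i j
  proof -
    have "(F ^^ i) x = (F ^^ j) x" if "x \<in> K d" for x
    proof -
      have x: "(F ^^ d) x = x" using that unfolding K_def by simp
      show ?thesis using funpow_mod_eq[OF x, of i] funpow_mod_eq[OF x, of j] i(2) by simp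
    qed
    then show ?thesis using i(1) unfolding J_def by simp
  qed
  have J0: "0 \<in> J" unfolding J_def by (intro CollectI bexI[of _ id]) (simp_all add: ring_hom_def)
  have Jd: "d \<in> J" using Jmod[OF J0] by simp
  have Jmult: "q * i \<in> J" if "i \<in> J" for q i by (induction q) (simp_all add: J0 Jadd that)
  define t where "t = (LEAST j. j > 0 \<and> j \<in> J)"
  have t: "t > 0 \<and> t \<in> J" unfolding t_def by (rule LeastI[of _ d]) (simp add: d0 Jd)
  have tdvd: "t dvd j" if j: "j \<in> J" for j
  proof -
    \<comment> \<open>Subtraction modulo \<open>d\<close>: adding \<open>d - 1\<close> copies of a
      multiple of \<open>t\<close> removes that multiple, so remainders modulo \<open>t\<close> stay
      in \<open>J\<close>.\<close>
    have "j + (d - 1) * (j div t * t) \<in> J" using Jadd[OF j Jmult[OF Jmult]] t by blast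
    moreover have "(j + (d - 1) * (j div t * t)) mod d = (j mod t) mod d"
    proof -
      have "j + (d - 1) * (j div t * t) = j mod t + d * (j div t * t)"
      proof -
        have "j + (d - 1) * (j div t * t) = j mod t + (j div t * t + (d - 1) * (j div t * t))"
          using div_mult_mod_eq[of j t] by linarith
        also have "j div t * t + (d - 1) * (j div t * t) = (1 + (d - 1)) * (j div t * t)" by (simp only: add_mult_distrib mult_1)
        finally show ?thesis using d0 by simp
      qed
      then show ?thesis by simp
    qed
    ultimately have jt: "j mod t \<in> J" by (rule Jmod)
    have le: "t \<le> i" if "i > 0" "i \<in> J" for i
      unfolding t_def by (rule Least_le) (use that in simp)
    have "j mod t < t" using t by simp
    then have "\<not> j mod t > 0" using le[OF _ jt] by linarith
    then show ?thesis by (simp add: mod_eq_0_iff_dvd)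
  qed
  \<comment> \<open>A conjugate of \<open>x\<close> over \<open>M\<close> is reached by an embedding
    that is some \<open>F^i\<close> on \<open>K d\<close> with \<open>i\<close> in \<open>J\<close>.
    Then \<open>t\<close> divides \<open>i\<close>, so the conjugate is \<open>x\<close>
    itself.\<close>
  have KtM: "x \<in> M" if x: "x \<in> K t" for x
  proof -
    have xkb: "x \<in> kb" and xd: "x \<in> K d" using x K_sub(1) K_dvd[OF tdvd[OF Jd]] by auto
    obtain S where S: "finite S" "S \<subseteq> kb" "x \<in> S" "lin_prod R S \<in> carrier (k[X])" "card S = per x"
      "\<forall>z\<in>S. \<exists>i. z = (F ^^ i) x" by (rule orbit_poly[OF xkb])
    have Sc: "S \<subseteq> carrier R" using S(2) kb_carr by blast
    have pM: "lin_prod R S \<in> carrier (M[X])" using S(4) M(2) by (auto simp: univ_poly_carrier[symmetric] polynomial_def)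
    show ?thesis
    proof (rule mem_of_only_root[OF ac M(1) S(1) Sc S(3) pM])
      fix z assume z: "z \<in> carrier R" "eval (Irr M x) z = \<zero>"
      show "z = x"
      proof (rule hom_of_root[OF closed_field_carrier[OF ac] M(1) subfieldE(3)[OF M(1)] subset_refl M(3) subsetD[OF kb_carr xkb] z])
        fix \<delta> assume \<delta>: "\<delta> \<in> subhom (carrier R) (carrier R)" "\<And>e. e \<in> M \<Longrightarrow> \<delta> e = e" "\<delta> x = z"
        have \<delta>R: "\<delta> \<in> ring_hom R R" using \<delta>(1) by simp
        have \<delta>K: "\<delta> \<in> ring_hom (R\<lparr>carrier := K d\<rparr>) R"
          by (rule ring_hom_sub[OF \<delta>R subfieldE(3)[OF K_subfield]])
        have c: "\<delta> c = c" if "c \<in> k" for c using \<delta>(2) M(2) that by blast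
        obtain i where i: "\<And>x. x \<in> K d \<Longrightarrow> \<delta> x = (F ^^ i) x" using embedding_eq_power[OF d0 \<delta>K c] by blast
        have "i \<in> J" unfolding J_def using \<delta>R \<delta>(2) i by (intro CollectI bexI[of _ \<delta>]) simp_all
        then have "x \<in> K i" using tdvd K_dvd x by blast
        then show "z = x" using \<delta>(3) i[OF xd] unfolding K_def by simp
      qed
    qed
  qed
  have "dim k (K t) = t" by (rule dim_K_of_dvd[OF d0 dd tdvd[OF Jd]])
  then have "t dvd s" using t KtM s K_sub(1) by (intro K_order) auto
  then obtain q where "s = t * q" by (rule dvdE)
  then have "s \<in> J" using Jmult[of t q] t by (simp add: mult.commute)
  then obtain \<delta> where \<delta>: "\<delta> \<in> ring_hom R R" "\<forall>x\<in>M. \<delta> x = x" "\<forall>x\<in>K d. \<delta> x = (F ^^ s) x" unfolding J_def by blast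
  show thesis by (rule that[OF \<delta>(1)]) (use \<delta>(2,3) in \<open>simp_all add: Kd\<close>)
qed

end

section \<open>Automorphism groups\<close>

context field
begin

lemma aut_iff:
  "g \<in> Aut E L \<longleftrightarrow>
     g \<in> Bij L \<and> g \<in> subhom L L \<and> (\<forall>x\<in>E. g x = x)"
  by (simp add: aut_group_def)

lemma aut_subgroup:
  assumes L: "subfield L R" and E: "E \<subseteq> L"
  shows "subgroup (Aut E L) (BijGroup L)"
proof
  interpret B: group "BijGroup L" by (rule group_BijGroup)
  show "Aut E L \<subseteq> carrier (BijGroup L)"
    by (auto simp: aut_iff BijGroup_def)
  show "\<one>\<^bsub>BijGroup L\<^esub> \<in> Aut E L"
    using B.one_closed subringE(3,6,7)[OF subfieldE(1)[OF L]] E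
    by (auto simp: aut_iff BijGroup_def ring_hom_def)
  show "g \<otimes>\<^bsub>BijGroup L\<^esub> h \<in> Aut E L"
    if gh: "g \<in> Aut E L" "h \<in> Aut E L" for g h
  proof -
    have b: "g \<in> Bij L" "h \<in> Bij L" using gh by (simp_all add: aut_iff)
    have hom: "g \<in> subhom L L" "h \<in> subhom L L"
      using gh by (simp_all add: aut_iff)
    note G = subfield_hom[OF L hom(1) L] and H = subfield_hom[OF L hom(2) L]
    note s = subringE[OF subfieldE(1)[OF L]]
    have "compose L g h \<in> subhom L L"
      using G(1,2,4,5) H(1,2,4,5) s(3,6,7) by (intro ring_hom_memI) (simp_all add: compose_def)
    moreover have "compose L g h x = x" if "x \<in> E" for x
      using gh that E by (auto simp: aut_iff compose_def)
    ultimately show ?thesis using b compose_Bij[OF b] by (simp add: aut_iff BijGroup_def)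
  qed
  show "inv\<^bsub>BijGroup L\<^esub> g \<in> Aut E L" if g: "g \<in> Aut E L" for g
  proof -
    have b: "g \<in> Bij L" using g by (simp add: aut_iff)
    have hom: "g \<in> subhom L L" using g by (simp add: aut_iff)
    note G = subfield_hom[OF L hom L]
    note s = subringE[OF subfieldE(1)[OF L]]
    define f where "f = restrict (inv_into L g) L"
    have surj: "g ` L = L" using b by (simp add: Bij_def bij_betw_def)
    have f: "f x \<in> L" "g (f x) = x" if "x \<in> L" for x
      using that surj inv_into_into[of x g L] f_inv_into_f[of x g L] by (simp_all add: f_def)
    have fg: "f (g x) = x" if "x \<in> L" for x
      using that G(1)[OF that] inv_into_f_f[OF G(8) that] by (simp add: f_def)
    have "f \<in> subhom L L"
    proof (rule ring_hom_memI)
      show "f x \<in> carrier (R\<lparr>carrier := L\<rparr>)" if "x \<in> carrier (R\<lparr>carrier := L\<rparr>)" for x using f(1) that by simp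
      show "f (x \<otimes>\<^bsub>R\<lparr>carrier := L\<rparr>\<^esub> y) = f x \<otimes>\<^bsub>R\<lparr>carrier := L\<rparr>\<^esub> f y"
        if "x \<in> carrier (R\<lparr>carrier := L\<rparr>)" "y \<in> carrier (R\<lparr>carrier := L\<rparr>)" for x y
        using fg[OF s(6)[OF f(1) f(1)], of x y] G(5)[OF f(1) f(1), of x y] f(2) that by simp
      show "f (x \<oplus>\<^bsub>R\<lparr>carrier := L\<rparr>\<^esub> y) = f x \<oplus>\<^bsub>R\<lparr>carrier := L\<rparr>\<^esub> f y"
        if "x \<in> carrier (R\<lparr>carrier := L\<rparr>)" "y \<in> carrier (R\<lparr>carrier := L\<rparr>)" for x y
        using fg[OF s(7)[OF f(1) f(1)], of x y] G(4)[OF f(1) f(1), of x y] f(2) that by simp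
      show "f \<one>\<^bsub>R\<lparr>carrier := L\<rparr>\<^esub> = \<one>\<^bsub>R\<lparr>carrier := L\<rparr>\<^esub>" using fg[OF s(3)] G(2) by simp
    qed
    moreover have "f x = x" if "x \<in> E" for x using fg[of x] g that E by (auto simp: aut_iff)
    moreover have "f \<in> Bij L" unfolding f_def by (rule restrict_inv_into_Bij[OF b])
    ultimately show ?thesis using inv_BijGroup[OF b] by (simp add: aut_iff f_def)
  qed
qed

lemma aut_group:
  assumes "subfield L R" "E \<subseteq> L" shows "group (aut_group R E L)"
proof -
  have "aut_group R E L = BijGroup L\<lparr>carrier := Aut E L\<rparr>" by (simp add: aut_group_def)
  then show ?thesis
    using group.subgroup_imp_group[OF group_BijGroup aut_subgroup[OF assms]] by simp
qed

lemma aut_mult: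
  assumes "g \<in> Aut E L" "h \<in> Aut E L"
  shows "g \<otimes>\<^bsub>aut_group R E L\<^esub> h = compose L g h"
  using assms by (simp add: aut_iff) (simp add: aut_group_def BijGroup_def)

lemma aut_one: "\<one>\<^bsub>aut_group R E L\<^esub> = (\<lambda>x\<in>L. x)"
  by (simp add: aut_group_def BijGroup_def)

lemma aut_hom: "g \<in> Aut E L \<Longrightarrow> g \<in> subhom L L"
  and aut_fix: "g \<in> Aut E L \<Longrightarrow> x \<in> E \<Longrightarrow> g x = x"
  and aut_ext: "g \<in> Aut E L \<Longrightarrow> g \<in> extensional L"
  and aut_surj: "g \<in> Aut E L \<Longrightarrow> g ` L = L"
  and aut_closed: "g \<in> Aut E L \<Longrightarrow> x \<in> L \<Longrightarrow> g x \<in> L"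
  by (auto simp: aut_iff Bij_def bij_betw_def)

lemma aut_eqI:
  assumes "g \<in> Aut E L" "h \<in> Aut E' L" "\<And>x. x \<in> L \<Longrightarrow> g x = h x"
  shows "g = h"
  using extensionalityI[OF aut_ext[OF assms(1)] aut_ext[OF assms(2)]] assms(3) by blast

lemma aut_apply:
  assumes "g \<in> Aut E L" "h \<in> Aut E L" "x \<in> L"
  shows "(g \<otimes>\<^bsub>aut_group R E L\<^esub> h) x = g (h x)"
  using aut_mult[OF assms(1,2)] assms(3) by (simp add: compose_def)

lemma aut_inv:
  assumes "subfield L R" "E \<subseteq> L" "g \<in> Aut E L" "x \<in> L"
  shows "(inv\<^bsub>aut_group R E L\<^esub> g) (g x) = x" "g ((inv\<^bsub>aut_group R E L\<^esub> g) x) = x"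
proof -
  interpret A: group "aut_group R E L" by (rule aut_group[OF assms(1,2)])
  have i: "inv\<^bsub>aut_group R E L\<^esub> g \<in> Aut E L" using assms(3) by simp
  show "(inv\<^bsub>aut_group R E L\<^esub> g) (g x) = x"
    using aut_apply[OF i assms(3,4)] A.l_inv[OF assms(3)] assms(4) by (simp add: aut_one)
  show "g ((inv\<^bsub>aut_group R E L\<^esub> g) x) = x"
    using aut_apply[OF assms(3) i assms(4)] A.r_inv[OF assms(3)] assms(4) by (simp add: aut_one)
qed

lemma aut_pow:
  assumes "subfield L R" "E \<subseteq> L" "g \<in> Aut E L" "x \<in> L"
  shows "(g [^]\<^bsub>aut_group R E L\<^esub> (n::nat)) x = (g ^^ n) x"
proof (induction n)
  case 0 show ?case using assms(4) by (simp add: aut_one)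
next
  case (Suc n)
  interpret A: group "aut_group R E L" by (rule aut_group[OF assms(1,2)])
  have "g [^]\<^bsub>aut_group R E L\<^esub> Suc n = g \<otimes>\<^bsub>aut_group R E L\<^esub> g [^]\<^bsub>aut_group R E L\<^esub> n"
    by (rule A.nat_pow_Suc2[OF assms(3)])
  then show ?case using aut_apply[OF assms(3) A.nat_pow_closed[OF assms(3)] assms(4)] Suc by simp
qed

text \<open>An injective endomorphism over \<open>E\<close> permutes the finite set of roots in
  \<open>L\<close> of each nonzero polynomial over \<open>E\<close>.\<close>

lemma endo_surj:
  assumes L: "subfield L R" and \<phi>: "\<phi> \<in> subhom L L"
    and E: "subfield E R" "E \<subseteq> L" "\<And>x. x \<in> E \<Longrightarrow> \<phi> x = x" and alg: "\<And>x. x \<in> L \<Longrightarrow> (algebraic over E) x"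
  shows "\<phi> ` L = L"
proof
  note h = subfield_hom[OF L \<phi> L]
  show "\<phi> ` L \<subseteq> L" using h(1) by blast
  show "L \<subseteq> \<phi> ` L"
  proof
    fix y assume y: "y \<in> L"
    then have yc: "y \<in> carrier R" using subfieldE(3)[OF L] by blast
    obtain p where p: "p \<in> carrier (E[X])" "p \<noteq> []" "eval p y = \<zero>"
      using algebraicE[OF subfieldE(1)[OF E(1)] yc] alg[OF y] unfolding over_def by metis
    define Z where "Z = {z \<in> L. eval p z = \<zero>}"
    have "Z \<subseteq> {z. is_root p z}" unfolding Z_def is_root_def using p(2) subfieldE(3)[OF L] by blast
    then have fin: "finite Z"
      using finite_number_of_roots[OF carrier_polynomial_shell[OF subfieldE(1)[OF E(1)] p(1)]] finite_subset by blast
    have "\<phi> ` Z \<subseteq> Z"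
    proof
      fix w assume "w \<in> \<phi> ` Z"
      then obtain z where z: "z \<in> L" "eval p z = \<zero>" "w = \<phi> z" unfolding Z_def by blast
      show "w \<in> Z" unfolding Z_def z(3) using h(1)[OF z(1)] hom_root[OF L \<phi> L E(2,3) p(1) z(1,2)] by simp
    qed
    moreover have "inj_on \<phi> Z" by (rule inj_on_subset[OF h(8)]) (simp add: Z_def)
    ultimately have "\<phi> ` Z = Z" by (rule endo_inj_surj[OF fin])
    moreover have "y \<in> Z" unfolding Z_def using y p(3) by simp
    ultimately show "y \<in> \<phi> ` L" unfolding Z_def by blast
  qed
qed

lemma restrict_aut:
  assumes L: "subfield L R" and \<phi>: "\<phi> \<in> subhom L L"
    and E: "subfield E R" "E \<subseteq> L" "\<And>x. x \<in> E \<Longrightarrow> \<phi> x = x" and alg: "\<And>x. x \<in> L \<Longrightarrow> (algebraic over E) x"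
    and E': "E' \<subseteq> L" "\<And>x. x \<in> E' \<Longrightarrow> \<phi> x = x"
  shows "restrict \<phi> L \<in> Aut E' L"
proof -
  note h = subfield_hom[OF L \<phi> L] and s = subringE[OF subfieldE(1)[OF L]]
  have "bij_betw \<phi> L L" unfolding bij_betw_def using h(8) endo_surj[OF L \<phi> E alg] by simp
  then have "restrict \<phi> L \<in> Bij L" unfolding Bij_def by (simp add: bij_betw_restrict_eq)
  moreover have "restrict \<phi> L \<in> subhom L L"
    using h(1,2,4,5) s(3,6,7) by (intro ring_hom_memI) simp_all
  ultimately show ?thesis unfolding aut_iff using E' by (simp add: subsetD[OF E'(1)])
qed

section \<open>Purely inseparable elements over perfect fields\<close>

lemma coeff_lin_mult:
  assumes "a \<in> carrier R" "set q \<subseteq> carrier R"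
  shows "coeff (poly_mult [\<one>, a] q) i = (if i = 0 then \<zero> else coeff q (i - 1)) \<oplus> a \<otimes> coeff q i"
proof -
  have c: "set (map (\<lambda>b. \<one> \<otimes> b) q @ [\<zero>]) \<subseteq> carrier R" "set (poly_mult [a] q) \<subseteq> carrier R"
    using assms poly_mult_in_carrier[of "[a]" q] by auto
  have m: "map (\<lambda>b. \<one> \<otimes> b) q = q" using assms(2) by (intro map_idI) auto
  have "coeff (poly_mult [\<one>, a] q) i = coeff (q @ [\<zero>]) i \<oplus> coeff (poly_mult [a] q) i"
    using poly_add_coeff[OF c] m by simp
  also have "coeff (q @ [\<zero>]) i = (if i = 0 then \<zero> else coeff q (i - 1))"
    using append_coeff[of q "[\<zero>]"] by simp
  also have "coeff (poly_mult [a] q) i = a \<otimes> coeff q i"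
    using poly_mult_const'(1)[OF assms(2,1)] normalize_coeff scalar_coeff[OF assms(1)] by metis
  finally show ?thesis .
qed

lemma coeff_lin_pow:
  assumes a: "a \<in> carrier R"
  shows "coeff ([\<one>, a] [^]\<^bsub>poly_ring R\<^esub> n) i = add_pow R (n choose i) (a [^] (n - i))"
proof (induction n arbitrary: i)
  case 0
  show ?case by (cases i) (simp_all add: univ_poly_one)
next
  case (Suc n)
  interpret P: domain "poly_ring R" by (rule poly_ring_domain)
  have l: "[\<one>, a] \<in> carrier (poly_ring R)" using a by (simp add: univ_poly_carrier[symmetric] polynomial_def)
  let ?q = "[\<one>, a] [^]\<^bsub>poly_ring R\<^esub> n"
  have "?q \<in> carrier (poly_ring R)" using l by simp
  then have q: "set ?q \<subseteq> carrier R" by (auto simp: univ_poly_carrier[symmetric] polynomial_def)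
  have "[\<one>, a] [^]\<^bsub>poly_ring R\<^esub> Suc n = poly_mult [\<one>, a] ?q"
    using P.nat_pow_Suc2[OF l, of n] by (simp add: univ_poly_mult)
  then have e: "coeff ([\<one>, a] [^]\<^bsub>poly_ring R\<^esub> Suc n) i = (if i = 0 then \<zero> else coeff ?q (i - 1)) \<oplus> a \<otimes> coeff ?q i"
    using coeff_lin_mult[OF a q] by simp
  show ?case
  proof (cases i)
    case 0
    then show ?thesis using e Suc.IH[of 0] a by (simp add: m_comm)
  next
    case (Suc j)
    have e': "coeff ([\<one>, a] [^]\<^bsub>poly_ring R\<^esub> Suc n) i = add_pow R (n choose j) (a [^] (n - j)) \<oplus> a \<otimes> (add_pow R (n choose Suc j) (a [^] (n - Suc j)))"
      using e Suc.IH[of j] Suc.IH[of "Suc j"] Suc by simp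
    also have "a \<otimes> (add_pow R (n choose Suc j) (a [^] (n - Suc j))) = add_pow R (n choose Suc j) (a [^] (n - j))"
    proof (cases "j < n")
      case True
      then have "n - j = Suc (n - Suc j)" by simp
      then have "a \<otimes> a [^] (n - Suc j) = a [^] (n - j)" using a by (simp add: m_comm)
      then show ?thesis using add_pow_rdistr[OF a nat_pow_closed[OF a], of "n choose Suc j"] by simp
    next
      case False
      then show ?thesis using a by (simp add: binomial_eq_0)
    qed
    also have "add_pow R (n choose j) (a [^] (n - j)) \<oplus> add_pow R (n choose Suc j) (a [^] (n - j)) = add_pow R (Suc n choose i) (a [^] (Suc n - i))"
      using add.nat_pow_mult[OF nat_pow_closed[OF a]] Suc by simp
    finally show ?thesis .
  qed
qed

lemma add_pow_one_mult: "add_pow R (a * b) \<one> = add_pow R (a) \<one> \<otimes> add_pow R (b::nat) \<one>"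
proof -
  have "add_pow R (a) \<one> \<otimes> add_pow R (b) \<one> = add_pow R (a) (\<one> \<otimes> add_pow R (b) \<one>)" by (rule add_pow_ldistr) simp_all
  also have "\<dots> = add_pow R (a) (add_pow R (b) \<one>)" by simp
  also have "\<dots> = add_pow R (b * a) \<one>" by (rule add.nat_pow_pow) simp
  finally show ?thesis by (simp add: mult.commute)
qed

text \<open>Injectivity of the \<open>p\<close>-th power map in characteristic \<open>p\<close>,
  from the identity (X + a)^p = X^p + a^p for \<open>a = - y\<close>, evaluated at \<open>z\<close>
  and at \<open>y\<close>.\<close>

lemma prime_pow_inj:
  assumes p: "Factorial_Ring.prime (p::nat)" "add_pow R (p) \<one> = \<zero>" and yz: "y \<in> carrier R" "z \<in> carrier R" "y [^] p = z [^] p"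
  shows "y = z"
proof -
  interpret P: domain "poly_ring R" by (rule poly_ring_domain)
  have p1: "p \<ge> 1" using prime_gt_0_nat[OF p(1)] by simp
  define a where "a = \<ominus> y"
  have a: "a \<in> carrier R" using yz by (simp add: a_def)
  have l: "[\<one>, a] \<in> carrier (poly_ring R)" using a by (simp add: univ_poly_carrier[symmetric] polynomial_def)
  define t where "t = monom \<one> (p - 1) @ [a [^] p]"
  have tc: "t \<in> carrier (poly_ring R)" unfolding t_def monom_def using a by (auto simp: univ_poly_carrier[symmetric] polynomial_def)
  have "coeff ([\<one>, a] [^]\<^bsub>poly_ring R\<^esub> p) i = coeff t i" for i
  proof -
    have lhs: "coeff ([\<one>, a] [^]\<^bsub>poly_ring R\<^esub> p) i = add_pow R (p choose i) (a [^] (p - i))" by (rule coeff_lin_pow[OF a])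
    have rhs: "coeff t i = (if i = 0 then a [^] p else if i = p then \<one> else \<zero>)"
      unfolding t_def append_coeff monom_coeff using p1 by auto
    consider "i = 0" | "i = p" | "0 < i" "i < p" | "i > p" by linarith
    then show ?thesis
    proof cases
      case 3
      then have "p dvd (p choose i)" using p(1) p1 by (intro dvd_choose_prime) auto
      then obtain c where c: "p choose i = p * c" by (rule dvdE)
      have "add_pow R (p choose i) (a [^] (p - i)) = add_pow R (p choose i) \<one> \<otimes> a [^] (p - i)"
        using add_pow_ldistr[OF one_closed nat_pow_closed[OF a], of "p choose i" "p - i"] a by simp
      also have "add_pow R (p choose i) \<one> = \<zero>" unfolding c add_pow_one_mult p(2) by simp
      finally show ?thesis using lhs rhs 3 a by simp
    qed (use lhs rhs a p1 in \<open>auto simp: binomial_eq_0\<close>)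
  qed
  then have "[\<one>, a] [^]\<^bsub>poly_ring R\<^esub> p = t"
    using coeff_iff_polynomial_cond[of "carrier R" "[\<one>, a] [^]\<^bsub>poly_ring R\<^esub> p" t] tc P.nat_pow_closed[OF l, of p]
    by (auto simp: univ_poly_carrier)
  moreover have ev: "eval ([\<one>, a] [^]\<^bsub>poly_ring R\<^esub> p) w = (w \<oplus> a) [^] p" if w: "w \<in> carrier R" for w
  proof -
    interpret h: ring_hom_ring "poly_ring R" R "\<lambda>q. eval q w" by (rule eval_ring_hom[OF carrier_is_subring w])
    have "eval ([\<one>, a] [^]\<^bsub>poly_ring R\<^esub> p) w = (eval [\<one>, a] w) [^] p" by (rule h.hom_nat_pow[OF l])
    then show ?thesis using w a by simp
  qed
  moreover have et: "eval t w = w [^] p \<oplus> a [^] p" if w: "w \<in> carrier R" for w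
  proof -
    have "eval t w = eval (monom \<one> (p - 1)) w \<otimes> w \<oplus> a [^] p"
      unfolding t_def using a w by (intro eval_append_aux) (auto simp: monom_def)
    also have "eval (monom \<one> (p - 1)) w = w [^] (p - 1)" using eval_monom[OF one_closed w] w by simp
    also have "w [^] (p - 1) \<otimes> w = w [^] p" using p1 nat_pow_Suc[of w "p - 1"] by simp
    finally show ?thesis .
  qed
  ultimately have key: "(w \<oplus> a) [^] p = w [^] p \<oplus> a [^] p" if "w \<in> carrier R" for w using that by simp
  have "(z \<oplus> a) [^] p = (y \<oplus> a) [^] p" using key[OF yz(1)] key[OF yz(2)] yz(3) by simp
  also have "\<dots> = \<zero>" using yz(1) p1 by (simp add: a_def r_neg nat_pow_zero)
  finally have "z \<oplus> a = \<zero>" using nat_pow_eq_zero[of "z \<oplus> a" p] yz a by simp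
  then show ?thesis using yz unfolding a_def by (metis minus_equality minus_minus a_inv_closed)
qed

lemma char_prime_of_zero:
  "n > 0 \<Longrightarrow> add_pow R (n::nat) \<one> = \<zero> \<Longrightarrow> \<exists>p::nat. Factorial_Ring.prime p \<and> add_pow R p \<one> = \<zero>"
proof (induction n rule: less_induct)
  case (less n)
  have "n \<noteq> 1" using less.prems by auto
  then obtain p where p: "Factorial_Ring.prime p" "p dvd n" using prime_factor_nat by blast
  then obtain c where c: "n = p * c" by (auto elim: dvdE)
  have "add_pow R (p) \<one> = \<zero> \<or> add_pow R (c) \<one> = \<zero>" using less.prems(2) integral[of "add_pow R (p) \<one>" "add_pow R (c) \<one>"] unfolding c add_pow_one_mult by simp
  moreover have "c < n" "c > 0" using c less.prems(1) prime_gt_1_nat[OF p(1)] by auto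
  ultimately show ?case using p(1) less.IH[of c] by blast
qed

text \<open>In (X + a)^n with \<open>a = - x\<close>, the coefficient of X^(n - q) is
  \<open>n choose q\<close> times \<open>a^q\<close>. If \<open>q\<close> is the exact power of the
  characteristic \<open>p\<close> in \<open>n\<close>, the binomial coefficient is prime to
  \<open>p\<close>; so \<open>a^q\<close> lies in \<open>k\<close>, and perfectness extracts the
  \<open>p\<close>-th roots. In characteristic zero \<open>q = 1\<close> works.\<close>

lemma mem_of_lin_pow:
  assumes k: "subfield k R" and perf: "perfect_field (R\<lparr>carrier := k\<rparr>)" and x: "x \<in> carrier R"
    and n: "n > 0" "[\<one>, \<ominus> x] [^]\<^bsub>poly_ring R\<^esub> (n::nat) \<in> carrier (k[X])"
  shows "x \<in> k"
proof -
  note s = subringE[OF subfieldE(1)[OF k]]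
  define a where "a = \<ominus> x"
  have a: "a \<in> carrier R" using x by (simp add: a_def)
  interpret k: field "R\<lparr>carrier := k\<rparr>" using subfield_iff(2)[OF k] .
  have kpow: "add_pow (R\<lparr>carrier := k\<rparr>) j \<one>\<^bsub>R\<lparr>carrier := k\<rparr>\<^esub> = add_pow R (j) \<one>" for j :: nat
    by (induction j) (simp_all add: add_pow_def)
  have kj: "add_pow R (j) \<one> \<in> k" for j :: nat using k.add.nat_pow_closed[OF k.one_closed, of j] kpow by simp
  have kexp: "y [^]\<^bsub>R\<lparr>carrier := k\<rparr>\<^esub> (j::nat) = y [^] j" for y j by (induction j) simp_all
  have co: "add_pow R (n choose i) (a [^] (n - i)) \<in> k" for i
  proof -
    have "set ([\<one>, a] [^]\<^bsub>poly_ring R\<^esub> n) \<subseteq> k" using n(2) unfolding a_def by (auto simp: univ_poly_carrier[symmetric] polynomial_def)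
    moreover have "coeff p i \<in> k" if "set p \<subseteq> k" for p using that by (induction p) (auto simp: s(2))
    ultimately show ?thesis using coeff_lin_pow[OF a, of n i] by metis
  qed
  have mem: "a [^] q \<in> k" if q: "q \<le> n" "add_pow R (n choose q) \<one> \<noteq> \<zero>" for q
  proof -
    have "add_pow R (n choose (n - q)) (a [^] q) \<in> k" using co[of "n - q"] q(1) by simp
    also have "n choose (n - q) = n choose q" using q(1) binomial_symmetric by metis
    also have "add_pow R (n choose q) (a [^] q) = add_pow R (n choose q) \<one> \<otimes> a [^] q"
      using add_pow_ldistr[OF one_closed nat_pow_closed[OF a], of "n choose q" q] a by simp
    finally have c: "add_pow R (n choose q) \<one> \<otimes> a [^] q \<in> k" .
    show ?thesis by (rule subfield_m_inv_simprule[OF k _ _ c]) (use kj q(2) a in auto)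
  qed
  have "a \<in> k"
  proof (cases "\<exists>p::nat. Factorial_Ring.prime p \<and> add_pow R p \<one> = \<zero>")
    case False
    then have "add_pow R (n) \<one> \<noteq> \<zero>" using char_prime_of_zero n(1) by blast
    then show ?thesis using mem[of 1] n(1) a by simp
  next
    case True
    then obtain p :: nat where p: "Factorial_Ring.prime p" "add_pow R p \<one> = \<zero>" by blast
    define e where "e = multiplicity p n"
    obtain m where m: "n = p ^ e * m" "\<not> p dvd m"
      using multiplicity_decompose'[of n p] n(1) p(1) unfolding e_def
      by (metis not_gr_zero not_prime_unit)
    have m0: "m > 0" using m(2) by (cases m) auto
    \<comment> \<open>The binomial fact behind Sylow's theorem: choosing \<open>p^e\<close> out of
      \<open>p^e m\<close> elements gives a number with the same power of \<open>p\<close> as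
      \<open>m\<close>.\<close>
    have "multiplicity p (n choose (p ^ e)) = 0"
      using const_p_fac[OF m0 p(1), of e] m(2) unfolding m(1) by (simp add: not_dvd_imp_multiplicity_0)
    moreover have le: "p ^ e \<le> n" using m(1) m0 by simp
    then have c0: "n choose (p ^ e) \<noteq> 0" by simp
    ultimately have nd: "\<not> p dvd (n choose (p ^ e))"
      using p(1) by (metis multiplicity_eq_zero_iff not_prime_unit)
    have "add_pow R (n choose (p ^ e)) \<one> \<noteq> \<zero>"
    proof
      assume z: "add_pow R (n choose (p ^ e)) \<one> = \<zero>"
      have "coprime (n choose (p ^ e)) p" using prime_imp_coprime[OF p(1) nd] by (simp add: coprime_commute)
      then have "gcd (n choose (p ^ e)) p = 1" by simp
      then obtain u v where uv: "(n choose (p ^ e)) * u = p * v + 1"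
        using bezout_nat[OF c0, of p] by auto
      have "add_pow R ((n choose (p ^ e)) * u) \<one> = \<zero>" unfolding add_pow_one_mult z by simp
      moreover have "add_pow R (p * v + 1) \<one> = add_pow R (p * v) \<one> \<oplus> add_pow R (1::nat) \<one>" by (rule add.nat_pow_mult[symmetric]) simp
      moreover have "add_pow R (p * v) \<one> = \<zero>" unfolding add_pow_one_mult p(2) by simp
      ultimately show False using uv by simp
    qed
    then have q: "a [^] (p ^ e) \<in> k" by (rule mem[OF le])
    have "a [^] (p ^ i) \<in> k \<Longrightarrow> a \<in> k" for i
    proof (induction i)
      case 0 then show ?case using a by simp
    next
      case (Suc i)
      have "a [^] (p ^ Suc i) = (a [^] (p ^ i)) [^] p" using nat_pow_pow[OF a] by (simp add: mult.commute)
      moreover have "(\<lambda>y. y [^] p) ` k = k"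
        using perf p kpow[of p] unfolding perfect_field_def by (simp add: kexp)
      ultimately have "(a [^] (p ^ i)) [^] p \<in> (\<lambda>y. y [^] p) ` k" using Suc.prems by simp
      then obtain y where y: "y \<in> k" "y [^] p = (a [^] (p ^ i)) [^] p" by (auto elim: imageE)
      have "y = a [^] (p ^ i)" by (rule prime_pow_inj[OF p _ _ y(2)]) (use y(1) s(1) a in auto)
      then show ?case using Suc.IH y(1) by simp
    qed
    then show ?thesis using q by blast
  qed
  then show ?thesis using s(5)[of a] x unfolding a_def by simp
qed

end

section \<open>The Krull topology\<close>

context field
begin

lemma infinite_of_transcendental:
  assumes k: "subfield k R" and t: "t \<in> carrier R" "transcendental k t"
  shows "infinite (carrier R)"
proof -
  have m: "monom \<one> n \<in> carrier (k[X])" for n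
    using subringE(2,3)[OF subfieldE(1)[OF k]] by (auto simp: univ_poly_carrier[symmetric] polynomial_def monom_def)
  have "inj (\<lambda>n. eval (monom \<one> n) t)"
  proof (rule injI)
    fix i j assume "eval (monom \<one> i) t = eval (monom \<one> j) t"
    then have "monom \<one> i = monom \<one> j" using t(2) m unfolding transcendental_def by (auto dest: inj_onD)
    then have "length (monom \<one> i) = length (monom \<one> j)" by simp
    then show "i = j" by (simp add: monom_def)
  qed
  then have "infinite (range (\<lambda>n. eval (monom \<one> n) t))" using finite_imageD infinite_UNIV_nat by blast
  moreover have "range (\<lambda>n. eval (monom \<one> n) t) \<subseteq> carrier R"
    using eval_in_carrier[OF monom_in_carrier[OF one_closed] t(1)] by blast
  ultimately show ?thesis using finite_subset by blast
qed

lemma fix_subgroup: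
  assumes L: "subfield L R" "E \<subseteq> L" and Y: "Y \<subseteq> L"
  shows "subgroup {g \<in> Aut E L. \<forall>x\<in>Y. g x = x} (aut_group R E L)"
proof -
  interpret A: group "aut_group R E L" by (rule aut_group[OF L])
  show ?thesis
  proof
    show "{g \<in> Aut E L. \<forall>x\<in>Y. g x = x} \<subseteq> Aut E L" by simp
    show "\<one>\<^bsub>aut_group R E L\<^esub> \<in> {g \<in> Aut E L. \<forall>x\<in>Y. g x = x}"
      using A.one_closed Y by (simp add: aut_one subset_iff)
    show "g \<otimes>\<^bsub>aut_group R E L\<^esub> h \<in> {g \<in> Aut E L. \<forall>x\<in>Y. g x = x}"
      if "g \<in> {g \<in> Aut E L. \<forall>x\<in>Y. g x = x}" "h \<in> {g \<in> Aut E L. \<forall>x\<in>Y. g x = x}" for g h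
      using that Y aut_apply[of g E L h] by (simp add: subset_iff)
    show "inv\<^bsub>aut_group R E L\<^esub> g \<in> {g \<in> Aut E L. \<forall>x\<in>Y. g x = x}"
      if g: "g \<in> {g \<in> Aut E L. \<forall>x\<in>Y. g x = x}" for g
    proof -
      have "(inv\<^bsub>aut_group R E L\<^esub> g) x = x" if "x \<in> Y" for x
        using aut_inv(1)[OF L, of g x] g that Y by auto
      then show ?thesis using g by simp
    qed
  qed
qed

text \<open>Agreeing with a given automorphism on \<open>k(x)\<close> is an open condition, so by
  density an \<open>x\<close> fixed by \<open>F\<close> is fixed by all automorphisms. Every
  embedding of \<open>kb\<close> over \<open>k\<close> into itself is an automorphism, so
  \<open>x\<close> is the only root of its minimal polynomial, and perfectness puts it into
  \<open>k\<close>.\<close>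

lemma frob_of_topological_generator:
  assumes ac: "algebraically_closed R" and inf: "infinite (carrier R)" and k: "subfield k R"
    and perf: "perfect_field (R\<lparr>carrier := k\<rparr>)"
    and kb: "kb = {x \<in> carrier R. (algebraic over k) x}"
    and F: "topological_generator (aut_group R k kb) (krull_topology R k kb) F"
  shows "frob R k kb F"
proof -
  define G where "G = aut_group R k kb"
  have kbs: "subfield kb R" unfolding kb by (rule subfield_of_algebraics[OF k])
  have kbc: "closed_field kb" unfolding kb by (rule closed_field_algebraics[OF ac k])
  have kba: "(algebraic over k) x" if "x \<in> kb" for x using that unfolding kb by simp
  have kbR: "kb \<subseteq> carrier R" unfolding kb by simp
  have kkb: "k \<subseteq> kb" using algebraic_self[OF subfieldE(1)[OF k]] subfieldE(3)[OF k] unfolding kb by auto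
  have FG: "F \<in> carrier G" and cl: "krull_topology R k kb closure_of (generate G {F}) = carrier G"
    using F unfolding topological_generator_def G_def by simp_all
  interpret G: group G unfolding G_def by (rule aut_group[OF kbs kkb])
  have fixed: "\<tau> x = x" if x: "x \<in> kb" "F x = x" and \<tau>: "\<tau> \<in> carrier G" for x \<tau>
  proof -
    have xc: "x \<in> carrier R" using x kbR by blast
    define E where "E = simple_extension k x"
    have E: "subfield E R" unfolding E_def using simple_extension_is_subfield[OF k xc] kba[OF x(1)] by simp
    have Efin: "finite_dimension k E" unfolding E_def using finite_dimension_simple_extension[OF k xc] kba[OF x(1)] by simp
    have kE: "k \<subseteq> E" "x \<in> E" unfolding E_def
      using simple_extension_incl[OF subfieldE(3)[OF k] xc] simple_extension_mem[OF subfieldE(1)[OF k] xc] .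
    have Ekb: "E \<subseteq> kb" unfolding E_def by (rule simple_extension_subring_incl[OF subfieldE(1)[OF kbs] kkb x(1)])
    define U where "U = {\<tau>' \<in> carrier G. \<forall>y\<in>E. \<tau>' y = \<tau> y}"
    have "openin (krull_topology R k kb) U"
      unfolding krull_topology_def
    proof (rule topology_generated_by_Basis, intro CollectI exI conjI)
      show "U = {\<tau>' \<in> Aut k kb. \<forall>y\<in>E. \<tau>' y = \<tau> y}" unfolding U_def G_def ..
      show "\<tau> \<in> Aut k kb" using \<tau> unfolding G_def .
    qed (fact E kE(1) Ekb Efin)+
    moreover have "\<tau> \<in> U" unfolding U_def using \<tau> by simp
    moreover have "\<tau> \<in> krull_topology R k kb closure_of (generate G {F})" using \<tau> cl by simp
    ultimately obtain g where g: "g \<in> generate G {F}" "g \<in> U" unfolding in_closure_of by blast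
    have "generate G {F} \<subseteq> {g \<in> carrier G. \<forall>y\<in>{x}. g y = y}"
      by (rule G.generate_subgroup_incl)
        (use FG x fix_subgroup[OF kbs kkb, of "{x}"] in \<open>simp_all add: G_def\<close>)
    then have "g x = x" using g(1) by auto
    then show ?thesis using g(2) kE(2) unfolding U_def by auto
  qed
  show ?thesis
  proof (intro frob.intro frob_axioms.intro field_axioms ac inf k kb)
    show "F \<in> subhom kb kb" using aut_hom FG unfolding G_def .
    show "F x = x" if "x \<in> k" for x using aut_fix[OF FG[unfolded G_def] that] .
    show "x \<in> k" if x: "x \<in> kb" "F x = x" for x
    proof -
      have xc: "x \<in> carrier R" using x kbR by blast
      have only: "y = x" if y: "y \<in> carrier R" "eval (Irr k x) y = \<zero>" for y
      proof -
        note I = IrrE[OF k xc kba[OF x(1)]]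
        have "(algebraic over k) y"
          using algebraicI[OF I(1) pirreducibleE(1)[OF subfieldE(1)[OF k] I(1,2)] y(2)] by (simp add: over_def)
        then have ykb: "y \<in> kb" unfolding kb using y(1) by simp
        show "y = x"
        proof (rule hom_of_root[OF kbc k kkb kbR kba x(1) ykb y(2)])
          fix \<delta> assume \<delta>: "\<delta> \<in> subhom kb kb" "\<And>e. e \<in> k \<Longrightarrow> \<delta> e = e" "\<delta> x = y"
          have "restrict \<delta> kb \<in> carrier G"
            unfolding G_def by (rule restrict_aut[OF kbs \<delta>(1) k kkb \<delta>(2) kba kkb \<delta>(2)])
          then have "restrict \<delta> kb x = x" by (rule fixed[OF x])
          then show "y = x" using \<delta>(3) x(1) by simp
        qed
      qed
      obtain n where n: "n \<ge> 1" "Irr k x = [\<one>, \<ominus> x] [^]\<^bsub>poly_ring R\<^esub> (n::nat)"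
        using Irr_only_root[OF ac k xc kba[OF x(1)] only] by blast
      show "x \<in> k"
        using mem_of_lin_pow[OF k perf xc, of n] n IrrE(1)[OF k xc kba[OF x(1)]] by simp
    qed
  qed
qed

end

context frob
begin

text \<open>Every finite subextension is some \<open>K D\<close>, and \<open>K (D1 * D2)\<close>
  contains \<open>K D1\<close> and \<open>K D2\<close>, so neighbourhoods of this form survive
  finite intersections.\<close>

lemma krull_nbhd:
  assumes "openin (krull_topology R k kb) U" "\<alpha> \<in> U"
  shows "\<exists>D>0. {\<tau> \<in> Aut k kb. \<forall>x\<in>K D. \<tau> x = \<alpha> x} \<subseteq> U"
proof -
  have "generate_topology_on {{\<tau> \<in> Aut k kb. \<forall>x\<in>E. \<tau> x = \<alpha> x} | \<alpha> E.
        \<alpha> \<in> Aut k kb \<and> subfield E R \<and> k \<subseteq> E \<and> E \<subseteq> kb \<and> finite_dimension k E} U"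
    using assms(1) unfolding krull_topology_def openin_topology_generated_by_iff .
  then show ?thesis
    using assms(2)
  proof (induction arbitrary: \<alpha>)
    case Empty
    then show ?case by simp
  next
    case (Int a b)
    obtain D1 where D1: "D1 > 0" "{\<tau> \<in> Aut k kb. \<forall>x\<in>K D1. \<tau> x = \<alpha> x} \<subseteq> a" using Int by blast
    obtain D2 where D2: "D2 > 0" "{\<tau> \<in> Aut k kb. \<forall>x\<in>K D2. \<tau> x = \<alpha> x} \<subseteq> b" using Int by blast
    have "K D1 \<subseteq> K (D1 * D2)" "K D2 \<subseteq> K (D1 * D2)" by (rule K_dvd, simp)+
    then have "{\<tau> \<in> Aut k kb. \<forall>x\<in>K (D1 * D2). \<tau> x = \<alpha> x} \<subseteq> a \<inter> b" using D1(2) D2(2) by blast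
    then show ?case using D1(1) D2(1) by (intro exI[of _ "D1 * D2"]) simp
  next
    case (UN \<U>)
    then obtain V where V: "V \<in> \<U>" "\<alpha> \<in> V" by (auto elim: UnionE)
    have "\<exists>D>0. {\<tau> \<in> Aut k kb. \<forall>x\<in>K D. \<tau> x = \<alpha> x} \<subseteq> V" by (rule UN.IH[OF V])
    then obtain D where D: "D > 0" "{\<tau> \<in> Aut k kb. \<forall>x\<in>K D. \<tau> x = \<alpha> x} \<subseteq> V" by (elim exE conjE)
    show ?case by (rule exI[of _ D], rule conjI[OF D(1)], rule subset_trans[OF D(2) Union_upper[OF V(1)]])
  next
    case (Basis s)
    then obtain \<alpha>' E where s: "s = {\<tau> \<in> Aut k kb. \<forall>x\<in>E. \<tau> x = \<alpha>' x}"
      and E: "subfield E R" "k \<subseteq> E" "finite_dimension k E" by blast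
    have "dim k E > 0" using dim_pos[OF k E(1,3)] by simp
    moreover have "{\<tau> \<in> Aut k kb. \<forall>x\<in>K (dim k E). \<tau> x = \<alpha> x} \<subseteq> s"
      using Basis(2) K_unique[OF E] unfolding s by auto
    ultimately show ?case by blast
  qed
qed

text \<open>An open subgroup contains all automorphisms trivial on some \<open>K d\<close>, and
  modulo these every automorphism is a power of \<open>F\<close>. The index is therefore the least
  \<open>j0 > 0\<close> with \<open>F^j0\<close> in \<open>U\<close>, and it divides
  \<open>d\<close> because \<open>F^d\<close> is trivial on \<open>K d\<close>.\<close>

lemma open_index:
  assumes FG: "F \<in> Aut k kb"
    and U: "subgroup U (aut_group R k kb)" "openin (krull_topology R k kb) U"
  obtains d where "d > 0" "dim k (K d) = d" "card (rcosets\<^bsub>aut_group R k kb\<^esub> U) dvd d"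
proof -
  define G where "G = aut_group R k kb"
  interpret G: group G unfolding G_def by (rule aut_group[OF kb_subfield k_sub_kb])
  have UG: "subgroup U G" using U(1) unfolding G_def .
  obtain D where D: "D > 0" "{\<tau> \<in> carrier G. \<forall>x\<in>K D. \<tau> x = \<one>\<^bsub>G\<^esub> x} \<subseteq> U"
    using krull_nbhd[OF U(2) subgroup.one_closed[OF U(1)]] unfolding G_def by blast
  define d where "d = dim k (K D)"
  have fin: "finite_dimension k (K D)" by (rule dim_K_dvd(1)[OF D(1)])
  have d0: "d > 0" unfolding d_def using dim_pos[OF k K_subfield fin] by simp
  have KD: "K D = K d" using K_unique[OF K_subfield K_sub(2) fin] unfolding d_def .
  have dd: "dim k (K d) = d" by (simp only: KD[symmetric]) (simp only: d_def)
  have fixU: "\<tau> \<in> U" if "\<tau> \<in> carrier G" "\<And>x. x \<in> K d \<Longrightarrow> \<tau> x = x" for \<tau>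
    using D(2) that K_sub(1)[of d] unfolding KD by (auto simp: G_def aut_one subset_iff)
  have FG': "F \<in> carrier G" using FG unfolding G_def .
  define f where "f j = F [^]\<^bsub>G\<^esub> (j::nat)" for j
  have f: "f j \<in> carrier G" for j unfolding f_def using FG' by simp
  have fx: "f j x = (F ^^ j) x" if "x \<in> kb" for j x
    unfolding f_def G_def by (rule aut_pow[OF kb_subfield k_sub_kb FG that])
  have fadd: "f (i + j) = f i \<otimes>\<^bsub>G\<^esub> f j" for i j unfolding f_def using G.nat_pow_mult[OF FG'] by simp
  have fd: "f d \<in> U"
  proof (rule fixU[OF f])
    fix x assume "x \<in> K d"
    then show "f d x = x" using fx K_sub(1) unfolding K_def by simp
  qed
  define j0 where "j0 = (LEAST j. j > 0 \<and> f j \<in> U)"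
  have j0: "j0 > 0 \<and> f j0 \<in> U" unfolding j0_def by (rule LeastI[of _ d]) (simp add: d0 fd)
  have j0le: "j0 \<le> j" if "j > 0" "f j \<in> U" for j unfolding j0_def by (rule Least_le) (use that in simp)
  have fdiff: "f (j - i) \<in> U" if "f i \<in> U" "f j \<in> U" "i \<le> j" for i j
  proof -
    have "f j = f i \<otimes>\<^bsub>G\<^esub> f (j - i)" using fadd[of i "j - i"] that(3) by simp
    then have "inv\<^bsub>G\<^esub> f i \<otimes>\<^bsub>G\<^esub> f j = f (j - i)" using f G.inv_solve_left[of "f (j - i)" "f i" "f j"] by simp
    then show ?thesis using subgroup.m_closed[OF UG subgroup.m_inv_closed[OF UG that(1)] that(2)] by simp
  qed
  have fmult: "f (q * j0) \<in> U" for q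
  proof (induction q)
    case 0
    then show ?case using subgroup.one_closed[OF UG] by (simp add: f_def)
  next
    case (Suc q)
    then show ?case using fadd[of j0 "q * j0"] subgroup.m_closed[OF UG] j0 by simp
  qed
  have fdvd: "f j \<in> U \<longleftrightarrow> j0 dvd j" for j
  proof
    assume "f j \<in> U"
    then have "f (j - (j div j0) * j0) \<in> U" by (rule fdiff[OF fmult]) simp
    then have "f (j mod j0) \<in> U" by (simp add: minus_div_mult_eq_mod)
    moreover have "j mod j0 < j0" using j0 by simp
    ultimately have "\<not> j mod j0 > 0" using j0le[of "j mod j0"] by linarith
    then show "j0 dvd j" by (simp add: mod_eq_0_iff_dvd)
  next
    assume "j0 dvd j"
    then obtain q where "j = q * j0" by (metis dvdE mult.commute)
    then show "f j \<in> U" using fmult by simp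
  qed
  \<comment> \<open>It is the inverse of a representative that is matched with a power of
    \<open>F\<close>; this writes the representative itself as an element of \<open>U\<close> times
    the inverse power.\<close>
  define c where "c i = U #>\<^bsub>G\<^esub> inv\<^bsub>G\<^esub> f i" for i
  have csub: "U \<subseteq> carrier G" by (rule subgroup.subset[OF UG])
  have inv_eq: "inv\<^bsub>G\<^esub> f i = f (j - i) \<otimes>\<^bsub>G\<^esub> inv\<^bsub>G\<^esub> f j" if "i \<le> j" for i j
  proof -
    have "f (j - i) \<otimes>\<^bsub>G\<^esub> f i = f j" using fadd[of "j - i" i] that by simp
    then have "f (j - i) = f j \<otimes>\<^bsub>G\<^esub> inv\<^bsub>G\<^esub> f i" using f G.inv_solve_right[of "f (j - i)" "f j" "f i"] by simp
    moreover have "f i \<otimes>\<^bsub>G\<^esub> f (j - i) = f (j - i) \<otimes>\<^bsub>G\<^esub> f i" using fadd[of i "j - i"] fadd[of "j - i" i] by (simp add: add.commute)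
    then have "f i \<otimes>\<^bsub>G\<^esub> f (j - i) = f j" using \<open>f (j - i) \<otimes>\<^bsub>G\<^esub> f i = f j\<close> by simp
    then have "f (j - i) = inv\<^bsub>G\<^esub> f i \<otimes>\<^bsub>G\<^esub> f j" using f G.inv_solve_left[of "f (j - i)" "f i" "f j"] by simp
    then show ?thesis using f by (simp add: G.m_assoc)
  qed
  have ceq: "c i = c j \<longleftrightarrow> f (j - i) \<in> U" if ij: "i \<le> j" for i j
  proof
    assume "c i = c j"
    moreover have "inv\<^bsub>G\<^esub> f i \<in> c i" unfolding c_def by (rule G.rcos_self[OF _ UG]) (simp add: f)
    ultimately obtain u where u: "u \<in> U" "inv\<^bsub>G\<^esub> f i = u \<otimes>\<^bsub>G\<^esub> inv\<^bsub>G\<^esub> f j" unfolding c_def r_coset_def by auto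
    then have "u \<otimes>\<^bsub>G\<^esub> inv\<^bsub>G\<^esub> f j = f (j - i) \<otimes>\<^bsub>G\<^esub> inv\<^bsub>G\<^esub> f j" using inv_eq[OF ij] by simp
    then have "u = f (j - i)" using G.right_cancel[of "inv\<^bsub>G\<^esub> f j" u "f (j - i)"] f u(1) csub by auto
    then show "f (j - i) \<in> U" using u(1) by simp
  next
    assume "f (j - i) \<in> U"
    then have "inv\<^bsub>G\<^esub> f i \<in> c j" unfolding c_def r_coset_def using inv_eq[OF ij] by auto
    then show "c i = c j" unfolding c_def using G.repr_independence[OF _ _ UG, of "inv\<^bsub>G\<^esub> f i" "inv\<^bsub>G\<^esub> f j"] f by simp
  qed
  have "rcosets\<^bsub>G\<^esub> U = c ` {..<j0}"
  proof
    show "c ` {..<j0} \<subseteq> rcosets\<^bsub>G\<^esub> U" unfolding c_def using f G.rcosetsI[OF csub] by auto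
    show "rcosets\<^bsub>G\<^esub> U \<subseteq> c ` {..<j0}"
    proof
      fix C assume "C \<in> rcosets\<^bsub>G\<^esub> U"
      then obtain \<tau> where \<tau>: "\<tau> \<in> carrier G" "C = U #>\<^bsub>G\<^esub> \<tau>" unfolding RCOSETS_def by auto
      define s where "s = inv\<^bsub>G\<^esub> \<tau>"
      have s: "s \<in> carrier G" unfolding s_def using \<tau>(1) by simp
      have sA: "s \<in> Aut k kb" using s unfolding G_def .
      have fA: "f i \<in> Aut k kb" for i using f unfolding G_def .
      have "\<exists>i. \<forall>x\<in>K d. s x = (F ^^ i) x"
        by (rule embedding_eq_power[OF d0 K_hom_of_kb[OF aut_hom[OF sA]] aut_fix[OF sA]])
      then obtain i where i: "\<And>x. x \<in> K d \<Longrightarrow> s x = (F ^^ i) x" by blast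
      have "inv\<^bsub>G\<^esub> f i \<otimes>\<^bsub>G\<^esub> s \<in> U"
      proof (rule fixU)
        show "inv\<^bsub>G\<^esub> f i \<otimes>\<^bsub>G\<^esub> s \<in> carrier G" using f s by simp
        fix x assume x: "x \<in> K d"
        then have xk: "x \<in> kb" using K_sub(1) by blast
        have iA: "inv\<^bsub>aut_group R k kb\<^esub> f i \<in> Aut k kb" using G.inv_closed[OF f] unfolding G_def .
        have "(inv\<^bsub>G\<^esub> f i \<otimes>\<^bsub>G\<^esub> s) x = (inv\<^bsub>G\<^esub> f i) (s x)" unfolding G_def by (rule aut_apply[OF iA sA xk])
        also have "\<dots> = (inv\<^bsub>G\<^esub> f i) (f i x)" using i[OF x] fx[OF xk] by simp
        also have "\<dots> = x" unfolding G_def by (rule aut_inv(1)[OF kb_subfield k_sub_kb fA xk])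
        finally show "(inv\<^bsub>G\<^esub> f i \<otimes>\<^bsub>G\<^esub> s) x = x" .
      qed
      from subgroup.m_inv_closed[OF UG this] have u: "inv\<^bsub>G\<^esub> s \<otimes>\<^bsub>G\<^esub> f i \<in> U" using f s by (simp add: G.inv_mult_group)
      have "inv\<^bsub>G\<^esub> s = \<tau>" unfolding s_def using \<tau>(1) by simp
      then have "\<tau> = (inv\<^bsub>G\<^esub> s \<otimes>\<^bsub>G\<^esub> f i) \<otimes>\<^bsub>G\<^esub> inv\<^bsub>G\<^esub> f i" using f \<tau>(1) by (simp add: G.m_assoc)
      then have "\<tau> \<in> c i" unfolding c_def r_coset_def using u by auto
      then have "C = c i" unfolding \<tau>(2) c_def using G.repr_independence[OF _ _ UG, of \<tau> "inv\<^bsub>G\<^esub> f i"] f by simp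
      also have "c i = c (i mod j0)"
      proof -
        have "i - i mod j0 = i div j0 * j0" by (simp add: minus_mod_eq_div_mult)
        then show ?thesis using ceq[of "i mod j0" i] fmult by simp
      qed
      finally show "C \<in> c ` {..<j0}" using j0 by simp
    qed
  qed
  moreover have "inj_on c {..<j0}"
  proof (rule linorder_inj_onI')
    fix i j assume ij: "i \<in> {..<j0}" "j \<in> {..<j0}" "i < j"
    have "\<not> j0 dvd j - i" using ij dvd_imp_le[of j0 "j - i"] by auto
    then show "c i \<noteq> c j" using ceq[of i j] ij fdvd by simp
  qed
  ultimately have "card (rcosets\<^bsub>G\<^esub> U) = j0" by (simp add: card_image)
  then have "card (rcosets\<^bsub>aut_group R k kb\<^esub> U) dvd d" using fdvd fd unfolding G_def by simp
  then show thesis by (rule that[OF d0 dd])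
qed

text \<open>For each prime the exponent required by \<open>m\<close> occurs in the index of an open
  subgroup, hence in the degree of some \<open>K d\<close> of full degree. For the product
  \<open>D\<close> of these finitely many \<open>d\<close>, the degree of \<open>K D\<close> is a
  multiple of \<open>m\<close>, and full degree passes to divisors.\<close>

lemma dim_K_of_dvd_profinite_order:
  assumes FG: "F \<in> Aut k kb"
    and m: "nat_dvd_steinitz m (profinite_order (aut_group R k kb) (krull_topology R k kb))"
  shows "m > 0" "dim k (K m) = m"
proof -
  show m0: "m > 0" using m unfolding nat_dvd_steinitz_def by simp
  have ex: "\<exists>d>0. dim k (K d) = d \<and> multiplicity p m \<le> multiplicity p d" if p: "Factorial_Ring.prime p" for p
  proof (cases "multiplicity p m = 0")
    case True
    have "(1::nat) > 0" by simp
    moreover have "dim k (K 1) dvd 1" by (rule dim_K_dvd(2)) simp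
    ultimately show ?thesis using True by (intro exI[of _ 1]) simp
  next
    case False
    then obtain a where a: "multiplicity p m = Suc a" using not0_implies_Suc by blast
    define \<U> where "\<U> = {U. subgroup U (aut_group R k kb) \<and> openin (krull_topology R k kb) U}"
    have "enat (Suc a) \<le> (SUP U\<in>\<U>. enat (multiplicity p (card (rcosets\<^bsub>aut_group R k kb\<^esub> U))))"
      using m p a unfolding nat_dvd_steinitz_def profinite_order_def \<U>_def by auto
    \<comment> \<open>A supremum may be infinite; a number strictly below it is exceeded by an
      actual member of the family, and exceeding \<open>a\<close> means reaching
      \<open>Suc a\<close>.\<close>
    moreover have "enat a < enat (Suc a)" by simp
    ultimately have "enat a < (SUP U\<in>\<U>. enat (multiplicity p (card (rcosets\<^bsub>aut_group R k kb\<^esub> U))))" by (rule less_le_trans[rotated])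
    then obtain U where U: "U \<in> \<U>" "enat a < enat (multiplicity p (card (rcosets\<^bsub>aut_group R k kb\<^esub> U)))"
      unfolding less_SUP_iff by blast
    have U': "subgroup U (aut_group R k kb)" "openin (krull_topology R k kb) U" using U(1) unfolding \<U>_def by simp_all
    obtain d where d: "d > 0" "dim k (K d) = d" "card (rcosets\<^bsub>aut_group R k kb\<^esub> U) dvd d"
      by (rule open_index[OF FG U'])
    have "multiplicity p (card (rcosets\<^bsub>aut_group R k kb\<^esub> U)) \<le> multiplicity p d"
      using d(1,3) by (intro dvd_imp_multiplicity_le) auto
    then show ?thesis using d(1,2) U(2) a by (intro exI[of _ d]) simp
  qed
  define g where "g p = (SOME d. d > 0 \<and> dim k (K d) = d \<and> multiplicity p m \<le> multiplicity p d)" for p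
  have g: "g p > 0 \<and> dim k (K (g p)) = g p \<and> multiplicity p m \<le> multiplicity p (g p)" if "Factorial_Ring.prime p" for p
    unfolding g_def by (rule someI_ex[OF ex[OF that]])
  define D where "D = (\<Prod>p\<in>prime_factors m. g p)"
  have D0: "D > 0" unfolding D_def using g by (intro prod_pos) (auto simp: prime_factors_dvd)
  define d where "d = dim k (K D)"
  have fin: "finite_dimension k (K D)" by (rule dim_K_dvd(1)[OF D0])
  have d0: "d > 0" unfolding d_def using dim_pos[OF k K_subfield fin] by simp
  have KD: "K D = K d" using K_unique[OF K_subfield K_sub(2) fin] unfolding d_def .
  have dd: "dim k (K d) = d" by (simp only: KD[symmetric]) (simp only: d_def)
  have "m dvd d"
  proof (rule multiplicity_le_imp_dvd)
    show "m \<noteq> 0" using m0 by simp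
    fix p :: nat assume p: "Factorial_Ring.prime p"
    show "multiplicity p m \<le> multiplicity p d"
    proof (cases "p \<in> prime_factors m")
      case False
      then have "multiplicity p m = 0" using p m0 by (auto simp: prime_factors_multiplicity)
      then show ?thesis by simp
    next
      case True
      note gp = g[OF p]
      have "g p dvd D" unfolding D_def using True by (intro dvd_prodI) auto
      then have sub: "K (g p) \<subseteq> K D" by (rule K_dvd)
      have f1: "finite_dimension k (K (g p))" using gp dim_K_dvd(1) by blast
      have f2: "finite_dimension (K (g p)) (K D)" by (rule finite_dimension_mono[OF k K_subfield K_sub(2) sub K_subfield fin])
      have "dim k (K D) = dim k (K (g p)) * dim (K (g p)) (K D)"
        using telescopic_base_dim(2)[OF k K_subfield f1 f2] by (simp add: over_def)
      then have "g p dvd d" using gp unfolding d_def by simp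
      then have "multiplicity p (g p) \<le> multiplicity p d" using d0 by (intro dvd_imp_multiplicity_le) auto
      then show ?thesis using gp by linarith
    qed
  qed
  then show "dim k (K m) = m" by (rule dim_K_of_dvd[OF d0 dd])
qed

end

section \<open>Composita and normal extensions\<close>

context field
begin

lemma preimage_subfield:
  assumes L: "subfield L R" and \<delta>: "\<delta> \<in> subhom L L'" and L': "subfield L' R"
    and T: "subfield T R"
  shows "subfield {x \<in> L. \<delta> x \<in> T} R"
proof (rule subfieldI')
  note h = subfield_hom[OF L \<delta> L'] and s = subringE[OF subfieldE(1)[OF L]] and t = subringE[OF subfieldE(1)[OF T]]
  show "subring {x \<in> L. \<delta> x \<in> T} R"
  proof (rule subringI)
    show "{x \<in> L. \<delta> x \<in> T} \<subseteq> carrier R" using s(1) by blast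
    show "\<one> \<in> {x \<in> L. \<delta> x \<in> T}" using h(2) s(3) t(3) by simp
    show "\<ominus> x \<in> {x \<in> L. \<delta> x \<in> T}" if "x \<in> {x \<in> L. \<delta> x \<in> T}" for x
      using that h(6)[of x] s(5)[of x] t(5)[of "\<delta> x"] by simp
    show "x \<otimes> y \<in> {x \<in> L. \<delta> x \<in> T}" "x \<oplus> y \<in> {x \<in> L. \<delta> x \<in> T}"
      if "x \<in> {x \<in> L. \<delta> x \<in> T}" "y \<in> {x \<in> L. \<delta> x \<in> T}" for x y
      using that h(4,5)[of x y] s(6,7)[of x y] t(6,7)[of "\<delta> x" "\<delta> y"] by simp_all
  qed
  show "inv x \<in> {x \<in> L. \<delta> x \<in> T}" if "x \<in> {x \<in> L. \<delta> x \<in> T} - {\<zero>}" for x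
    using that h(7)[of x] subfield_m_inv(1)[OF L, of x] subfield_m_inv(1)[OF T, of "\<delta> x"] by simp
qed

lemma equalizer_subfield:
  assumes L: "subfield L R" and L': "subfield L' R"
    and \<phi>: "\<phi> \<in> subhom L L'" and \<psi>: "\<psi> \<in> subhom L L'"
  shows "subfield {x \<in> L. \<phi> x = \<psi> x} R"
proof (rule subfieldI')
  note h = subfield_hom[OF L \<phi> L'] and h' = subfield_hom[OF L \<psi> L'] and s = subringE[OF subfieldE(1)[OF L]]
  show "subring {x \<in> L. \<phi> x = \<psi> x} R"
  proof (rule subringI)
    show "{x \<in> L. \<phi> x = \<psi> x} \<subseteq> carrier R" using s(1) by blast
    show "\<one> \<in> {x \<in> L. \<phi> x = \<psi> x}" using h(2) h'(2) s(3) by simp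
    show "\<ominus> x \<in> {x \<in> L. \<phi> x = \<psi> x}" if "x \<in> {x \<in> L. \<phi> x = \<psi> x}" for x
      using that h(6)[of x] h'(6)[of x] s(5)[of x] by simp
    show "x \<otimes> y \<in> {x \<in> L. \<phi> x = \<psi> x}" "x \<oplus> y \<in> {x \<in> L. \<phi> x = \<psi> x}"
      if "x \<in> {x \<in> L. \<phi> x = \<psi> x}" "y \<in> {x \<in> L. \<phi> x = \<psi> x}" for x y
      using that h(4,5)[of x y] h'(4,5)[of x y] s(6,7)[of x y] by simp_all
  qed
  show "inv x \<in> {x \<in> L. \<phi> x = \<psi> x}" if "x \<in> {x \<in> L. \<phi> x = \<psi> x} - {\<zero>}" for x
    using that h(7)[of x] h'(7)[of x] subfield_m_inv(1)[OF L, of x] by simp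
qed

lemma generate_hom_subset:
  assumes L: "subfield L R" and \<delta>: "\<delta> \<in> subhom L L'" and L': "subfield L' R"
    and T: "subfield T R" and S: "S \<subseteq> L" "\<And>x. x \<in> S \<Longrightarrow> \<delta> x \<in> T" and x: "x \<in> generate_field R S"
  shows "\<delta> x \<in> T"
proof -
  have "S \<subseteq> carrier R" using S(1) subfieldE(3)[OF L] by blast
  then have "generate_field R S \<subseteq> {x \<in> L. \<delta> x \<in> T}"
    by (rule generate_field_min_subfield1[OF _ preimage_subfield[OF L \<delta> L' T]]) (use S in blast)
  then show ?thesis using x by blast
qed

lemma generate_hom_eq:
  assumes L: "subfield L R" and L': "subfield L' R"
    and \<phi>: "\<phi> \<in> subhom L L'" and \<psi>: "\<psi> \<in> subhom L L'"
    and S: "S \<subseteq> L" "\<And>x. x \<in> S \<Longrightarrow> \<phi> x = \<psi> x" and x: "x \<in> generate_field R S"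
  shows "\<phi> x = \<psi> x"
proof -
  have "S \<subseteq> carrier R" using S(1) subfieldE(3)[OF L] by blast
  then have "generate_field R S \<subseteq> {x \<in> L. \<phi> x = \<psi> x}"
    by (rule generate_field_min_subfield1[OF _ equalizer_subfield[OF L L' \<phi> \<psi>]]) (use S in blast)
  then show ?thesis using x by blast
qed

lemma compositum_facts:
  assumes "subfield E R" "subfield L R"
  shows "subfield (compositum R E L) R" "E \<subseteq> compositum R E L" "L \<subseteq> compositum R E L"
    "\<And>T. subfield T R \<Longrightarrow> E \<subseteq> T \<Longrightarrow> L \<subseteq> T \<Longrightarrow> compositum R E L \<subseteq> T"
proof -
  have c: "E \<union> L \<subseteq> carrier R" using subfieldE(3)[OF assms(1)] subfieldE(3)[OF assms(2)] by blast
  show "subfield (compositum R E L) R" unfolding compositum_def by (rule generate_field_is_subfield[OF c])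
  show "E \<subseteq> compositum R E L" "L \<subseteq> compositum R E L"
    unfolding compositum_def by (auto intro: generate_field.incl)
  show "compositum R E L \<subseteq> T" if "subfield T R" "E \<subseteq> T" "L \<subseteq> T" for T
    unfolding compositum_def by (rule generate_field_min_subfield1[OF c that(1)]) (use that in blast)
qed

lemma extend_to_carrier:
  assumes ac: "algebraically_closed R" and T: "subfield T R" "\<And>x. x \<in> carrier R \<Longrightarrow> (algebraic over T) x"
    and \<beta>: "\<beta> \<in> subhom T T'" and T': "subfield T' R"
  obtains \<delta> where "\<delta> \<in> ring_hom R R" "\<And>x. x \<in> T \<Longrightarrow> \<delta> x = \<beta> x"
proof -
  note h = subfield_hom[OF T(1) \<beta> T'] and s = subringE[OF subfieldE(1)[OF T(1)]]
  define \<rho> where "\<rho> = {(x, \<beta> x) | x. x \<in> T}"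
  have mk: "(x, \<beta> x) \<in> \<rho>" if "x \<in> T" for x unfolding \<rho>_def using that by blast
  have dest: "x \<in> T \<and> y = \<beta> x" if "(x, y) \<in> \<rho>" for x y using that unfolding \<rho>_def by blast
  have ph: "partial_hom \<rho>"
    unfolding partial_hom_def
  proof (intro conjI allI impI)
    show "\<rho> \<subseteq> carrier R \<times> carrier R" unfolding \<rho>_def using s(1) h(1) subfieldE(3)[OF T'] by blast
    show "(\<one>, \<one>) \<in> \<rho>" using mk[OF s(3)] h(2) by simp
    show "(\<ominus> x, \<ominus> y) \<in> \<rho>" if "(x, y) \<in> \<rho>" for x y
      using mk[OF s(5)[of x]] h(6)[of x] dest[OF that] by simp
    show "(x \<oplus> x', y \<oplus> y') \<in> \<rho>" "(x \<otimes> x', y \<otimes> y') \<in> \<rho>" if "(x, y) \<in> \<rho>" "(x', y') \<in> \<rho>" for x y x' y'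
      using mk[OF s(7)[of x x']] mk[OF s(6)[of x x']] h(4,5)[of x x'] dest[OF that(1)] dest[OF that(2)] by simp_all
    show "y = \<zero>" if "(\<zero>, y) \<in> \<rho>" for y using dest[OF that] h(3) by simp
  qed
  have ran: "Range \<rho> \<subseteq> carrier R" using partial_homD(2)[OF ph] by blast
  have dom: "T \<subseteq> Domain \<rho>" using mk by blast
  show thesis
  proof (rule hom_extension[OF closed_field_carrier[OF ac] ph ran T(1) dom subset_refl T(2)])
    fix \<delta> assume \<delta>: "\<delta> \<in> subhom (carrier R) (carrier R)" "\<And>x y. (x, y) \<in> \<rho> \<Longrightarrow> \<delta> x = y"
    have "\<delta> \<in> ring_hom R R" using \<delta>(1) by simp
    then show thesis by (rule that) (rule \<delta>(2)[OF mk])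
  qed
qed

lemma hom_into_subfield:
  assumes "\<delta> \<in> ring_hom R R" "subfield T R" "\<And>x. x \<in> T \<Longrightarrow> \<delta> x \<in> T"
  shows "\<delta> \<in> subhom T T"
  using ring_hom_one[OF assms(1)] ring_hom_add[OF assms(1)] ring_hom_mult[OF assms(1)] subfieldE(3)[OF assms(2)] assms(3)
  by (intro ring_hom_memI) (simp_all add: subsetD)

lemma ring_hom_carrier: "\<delta> \<in> ring_hom R R \<Longrightarrow> \<delta> \<in> subhom (carrier R) (carrier R)"
  by simp

text \<open>An automorphism is determined by its values on a finite basis, and each basis element
  can only go to one of finitely many roots.\<close>

lemma finite_aut_group:
  assumes E: "subfield E R" and L: "subfield L R" "E \<subseteq> L" and fin: "finite_dimension E L"
  shows "finite (Aut E L)"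
proof -
  obtain Us where Us: "set Us \<subseteq> carrier R" "independent E Us" "length Us = dim E L" "Span E Us = L"
    using exists_base[OF E finite_dimensionE[OF E fin]] by (auto simp: over_def)
  have UL: "set Us \<subseteq> L" using Span_base_incl[OF E Us(1)] Us(4) by simp
  have ex: "\<exists>p\<in>carrier (E[X]). p \<noteq> [] \<and> eval p u = \<zero>" if u: "u \<in> L" for u
  proof -
    have "(algebraic over E) u" by (rule finite_dimension_imp_algebraic[OF E subfieldE(1)[OF L(1)] fin u])
    then show ?thesis using algebraicE[OF subfieldE(1)[OF E], of u] u subfieldE(3)[OF L(1)] unfolding over_def by blast
  qed
  define W where "W u = {z \<in> carrier R. \<forall>p\<in>carrier (E[X]). eval p u = \<zero> \<longrightarrow> eval p z = \<zero>}" for u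
  have Wfin: "finite (W u)" if u: "u \<in> L" for u
  proof -
    obtain p where p: "p \<in> carrier (E[X])" "p \<noteq> []" "eval p u = \<zero>" using ex[OF u] by blast
    have "W u \<subseteq> {z. is_root p z}" unfolding W_def is_root_def using p by blast
    then show ?thesis using finite_number_of_roots[OF carrier_polynomial_shell[OF subfieldE(1)[OF E] p(1)]] finite_subset by blast
  qed
  have "inj_on (\<lambda>g. restrict g (set Us)) (Aut E L)"
  proof (rule inj_onI)
    fix g h assume g: "g \<in> Aut E L" and h: "h \<in> Aut E L"
      and e: "restrict g (set Us) = restrict h (set Us)"
    define V where "V = {x \<in> L. g x = h x}"
    have V: "subfield V R" unfolding V_def by (rule equalizer_subfield[OF L(1) L(1) aut_hom[OF g] aut_hom[OF h]])
    have EV: "E \<subseteq> V" unfolding V_def using aut_fix[OF g] aut_fix[OF h] L(2) by auto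
    have UV: "set Us \<subseteq> V"
    proof
      fix u assume u: "u \<in> set Us"
      then have "g u = h u" using fun_cong[OF e, of u] by simp
      then show "u \<in> V" unfolding V_def using u UL by blast
    qed
    have "subalgebra E V R"
    proof (intro subalgebra.intro subalgebra_axioms.intro)
      show "subgroup V (add_monoid R)" using subfieldE(1)[OF V] by (simp add: subring_def)
      show "a \<otimes> v \<in> V" if "a \<in> E" "v \<in> V" for a v
        using subringE(6)[OF subfieldE(1)[OF V]] that EV by blast
    qed
    then have "L \<subseteq> V" using subalgebra_Span_incl[OF E _ UV] Us(4) by simp
    then show "g = h" by (intro aut_eqI[OF g h]) (auto simp: V_def)
  qed
  moreover have "(\<lambda>g. restrict g (set Us)) ` Aut E L \<subseteq> (\<Pi>\<^sub>E u\<in>set Us. W u)"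
  proof (intro image_subsetI restrict_PiE_iff[THEN iffD2] ballI)
    fix g u assume g: "g \<in> Aut E L" and u: "u \<in> set Us"
    have uL: "u \<in> L" using u UL by blast
    have "eval p (g u) = \<zero>" if p: "p \<in> carrier (E[X])" "eval p u = \<zero>" for p
      by (rule hom_root[OF L(1) aut_hom[OF g] L(1) L(2) aut_fix[OF g] p(1) uL p(2)])
    then show "g u \<in> W u" unfolding W_def using aut_closed[OF g uL] subfieldE(3)[OF L(1)] by blast
  qed
  moreover have "finite (\<Pi>\<^sub>E u\<in>set Us. W u)" using Wfin UL by (intro finite_PiE) auto
  ultimately show ?thesis by (rule inj_on_finite)
qed

end

section \<open>The twisted form\<close>

text \<open>\<open>B\<close> is the field called \<open>K\<close> in the theorem, since \<open>K n\<close> denotes the fixed field of \<open>F\<^sup>n\<close>.\<close>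

locale twist = frob R k kb F for R (structure) and k kb F +
  fixes B M :: "'a set" and \<gamma> :: "'a \<Rightarrow> 'a" and m :: nat
  assumes B: "subfield B R" and kB: "k \<subseteq> B" and Balg: "\<And>x. x \<in> carrier R \<Longrightarrow> (algebraic over B) x"
    and Bkb: "\<And>x. x \<in> B \<Longrightarrow> x \<in> kb \<Longrightarrow> x \<in> k"
    and M: "subfield M R" "B \<subseteq> M" and Mfin: "finite_dimension B M"
    and Mnormal: "\<And>\<delta> x. \<delta> \<in> ring_hom R R \<Longrightarrow> (\<And>b. b \<in> B \<Longrightarrow> \<delta> b = b) \<Longrightarrow> x \<in> M \<Longrightarrow> \<delta> x \<in> M"
    and \<gamma>: "\<gamma> \<in> Aut B M" and \<gamma>F: "\<And>x. x \<in> M \<Longrightarrow> x \<in> kb \<Longrightarrow> \<gamma> x = F x"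
    and m: "m > 0" "dim k (K m) = m" and \<gamma>m: "\<And>x. x \<in> M \<Longrightarrow> (\<gamma> ^^ m) x = x"
begin

text \<open>Endomorphisms of the big field serve as common ground: automorphisms of different
  subfields extend to them, are composed there, and restrict back to every normal subfield.\<close>

definition homs :: "'a set \<Rightarrow> ('a \<Rightarrow> 'a) set" where
  "homs E = {\<delta> \<in> ring_hom R R. \<forall>x\<in>E. \<delta> x = x}"

text \<open>Stability under endomorphisms over \<open>B\<close> is the form of normality that passes
  to composita by looking at generators.\<close>

definition normal :: "'a set \<Rightarrow> bool" where
  "normal T \<longleftrightarrow> subfield T R \<and> B \<subseteq> T \<and> (\<forall>\<delta>\<in>homs B. \<forall>x\<in>T. \<delta> x \<in> T)"

definition "k' = M \<inter> kb"
definition "L = compositum R (K m) M"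
definition "mB = compositum R (K m) B"
definition "k'B = compositum R k' B"

lemma homs_mono: "E \<subseteq> E' \<Longrightarrow> homs E' \<subseteq> homs E" unfolding homs_def by blast

lemma homsD: "\<delta> \<in> homs E \<Longrightarrow> \<delta> \<in> ring_hom R R" "\<delta> \<in> homs E \<Longrightarrow> x \<in> E \<Longrightarrow> \<delta> x = x"
  unfolding homs_def by simp_all

lemma normalD: "normal T \<Longrightarrow> subfield T R" "normal T \<Longrightarrow> B \<subseteq> T" "normal T \<Longrightarrow> \<delta> \<in> homs B \<Longrightarrow> x \<in> T \<Longrightarrow> \<delta> x \<in> T"
  unfolding normal_def by simp_all

lemma normal_M: "normal M"
  unfolding normal_def using M Mnormal homsD by blast

lemma homs_power:
  assumes \<delta>: "\<delta> \<in> homs k" and n: "n > 0"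
  obtains i where "\<And>x. x \<in> K n \<Longrightarrow> \<delta> x = (F ^^ i) x"
proof -
  have "\<delta> \<in> ring_hom (R\<lparr>carrier := K n\<rparr>) R" by (rule ring_hom_sub[OF homsD(1)[OF \<delta>] subfieldE(3)[OF K_subfield]])
  from embedding_eq_power[OF n this homsD(2)[OF \<delta>]] obtain i where "\<forall>x\<in>K n. \<delta> x = (F ^^ i) x" by blast
  then show thesis by (intro that) blast
qed

lemma FK: "x \<in> K n \<Longrightarrow> (F ^^ i) x \<in> K n"
proof -
  assume x: "x \<in> K n"
  have "(F ^^ n) ((F ^^ i) x) = (F ^^ i) ((F ^^ n) x)" by (metis funpow_add comp_apply add.commute)
  then show ?thesis using x Fn_simps(1)[of x i] unfolding K_def by simp
qed

lemma homs_K: "\<delta> \<in> homs k \<Longrightarrow> x \<in> K n \<Longrightarrow> n > 0 \<Longrightarrow> \<delta> x \<in> K n"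
  by (rule homs_power[of \<delta> n]) (use FK in auto)

lemma normal_compositum:
  assumes T: "subfield T R" "k \<subseteq> T" "\<And>\<delta> x. \<delta> \<in> homs B \<Longrightarrow> x \<in> T \<Longrightarrow> \<delta> x \<in> T" and E: "normal E"
  shows "normal (compositum R T E)"
proof -
  note c = compositum_facts[OF T(1) normalD(1)[OF E]]
  have "\<delta> x \<in> compositum R T E" if \<delta>: "\<delta> \<in> homs B" and x: "x \<in> compositum R T E" for \<delta> x
  proof (rule generate_hom_subset[OF carrier_is_subfield ring_hom_carrier[OF homsD(1)[OF \<delta>]] carrier_is_subfield c(1)])
    show "T \<union> E \<subseteq> carrier R" using subfieldE(3)[OF T(1)] subfieldE(3)[OF normalD(1)[OF E]] by blast
    show "\<delta> y \<in> compositum R T E" if "y \<in> T \<union> E" for y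
      using that T(3)[OF \<delta>, of y] normalD(3)[OF E \<delta>, of y] c(2,3) by blast
    show "x \<in> generate_field R (T \<union> E)" using x unfolding compositum_def .
  qed
  then show ?thesis unfolding normal_def using c normalD(2)[OF E] by blast
qed

lemma homs_B_k: "\<delta> \<in> homs B \<Longrightarrow> \<delta> \<in> homs k"
  using homs_mono[OF kB] by blast

lemma normal_B: "normal B"
  unfolding normal_def
proof (intro conjI ballI B subset_refl)
  show "\<delta> x \<in> B" if "\<delta> \<in> homs B" "x \<in> B" for \<delta> x using homsD(2)[OF that] that(2) by simp
qed

lemma normal_L: "normal L" and normal_mB: "normal mB"
  unfolding L_def mB_def
  using normal_compositum[OF K_subfield K_sub(2) _ normal_M] normal_compositum[OF K_subfield K_sub(2) _ normal_B]
    homs_K[OF homs_B_k _ m(1)] by blast+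

lemma k'_subfield: "subfield k' R" "k \<subseteq> k'"
proof -
  have "subring k' R" unfolding k'_def by (rule subring_inter[OF subfieldE(1)[OF M(1)] subfieldE(1)[OF kb_subfield]])
  then show "subfield k' R"
    by (rule subfieldI') (use subfield_m_inv(1)[OF M(1)] subfield_m_inv(1)[OF kb_subfield] in \<open>simp add: k'_def\<close>)
  show "k \<subseteq> k'" unfolding k'_def using kB M(2) k_sub_kb by blast
qed

lemma Fk': "x \<in> k' \<Longrightarrow> (F ^^ i) x \<in> k' \<and> (F ^^ i) x = (\<gamma> ^^ i) x"
proof (induction i)
  case (Suc i)
  note IH = conjunct1[OF Suc.IH[OF Suc.prems]] conjunct2[OF Suc.IH[OF Suc.prems]]
  have y: "(F ^^ i) x \<in> M" "(F ^^ i) x \<in> kb" using IH(1) unfolding k'_def by simp_all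
  have e: "F ((F ^^ i) x) = \<gamma> ((F ^^ i) x)" by (rule \<gamma>F[OF y, symmetric])
  have "F ((F ^^ i) x) \<in> M" unfolding e by (rule aut_closed[OF \<gamma> y(1)])
  moreover have "F ((F ^^ i) x) \<in> kb" using Fn_simps(1)[OF y(2), of 1] by simp
  ultimately have "F ((F ^^ i) x) \<in> k'" unfolding k'_def by (rule IntI)
  moreover have "F ((F ^^ i) x) = \<gamma> ((\<gamma> ^^ i) x)" using e unfolding IH(2) .
  ultimately show ?case unfolding funpow.simps comp_def by (rule conjI)
qed simp

text \<open>On the constants of \<open>M\<close> the powers of \<open>F\<close> are the powers of
  \<open>\<gamma>\<close>, and \<open>\<gamma>^m\<close> is trivial.\<close>

lemma k'_sub_K: "k' \<subseteq> K m"
proof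
  fix x assume x: "x \<in> k'"
  then have "(F ^^ m) x = x" using Fk'[OF x, of m] \<gamma>m unfolding k'_def by simp
  then show "x \<in> K m" using x unfolding K_def k'_def by simp
qed

lemma homs_k': "\<delta> \<in> homs B \<Longrightarrow> x \<in> k' \<Longrightarrow> \<delta> x \<in> k'"
proof -
  assume \<delta>: "\<delta> \<in> homs B" and x: "x \<in> k'"
  obtain i where i: "\<And>x. x \<in> K m \<Longrightarrow> \<delta> x = (F ^^ i) x" by (rule homs_power[OF homs_B_k[OF \<delta>] m(1)]) blast
  show "\<delta> x \<in> k'" using i[of x] Fk'[OF x, of i] k'_sub_K x by auto
qed

lemma normal_k'B: "normal k'B"
  unfolding k'B_def by (rule normal_compositum[OF k'_subfield(1,2) _ normal_B]) (rule homs_k')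

lemmas cL = compositum_facts[OF K_subfield[of m] M(1), folded L_def]
lemmas cmB = compositum_facts[OF K_subfield[of m] B, folded mB_def]
lemmas ck'B = compositum_facts[OF k'_subfield(1) B, folded k'B_def]

lemma sub_fields: "k'B \<subseteq> mB" "k'B \<subseteq> M" "mB \<subseteq> L" "B \<subseteq> L"
proof -
  show "k'B \<subseteq> mB" by (rule ck'B(4)[OF cmB(1)]) (use k'_sub_K cmB(2,3) in blast)+
  show "k'B \<subseteq> M" by (rule ck'B(4)[OF M(1) _ M(2)]) (simp add: k'_def)
  show "B \<subseteq> L" using M(2) cL(3) by blast
  then show "mB \<subseteq> L" by (rule cmB(4)[OF cL(1,2)])
qed

lemma alg_over: "B \<subseteq> E \<Longrightarrow> x \<in> carrier R \<Longrightarrow> (algebraic over E) x"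
  using algebraic_mono[of B E x] Balg by (simp add: over_def)

lemma aut_homs:
  assumes T: "subfield T R" "B \<subseteq> T" and E: "E \<subseteq> T" and g: "g \<in> Aut E T"
  obtains \<delta> where "\<delta> \<in> homs E" "\<And>x. x \<in> T \<Longrightarrow> \<delta> x = g x"
proof (rule extend_to_carrier[OF ac T(1) alg_over[OF T(2)] aut_hom[OF g] T(1)])
  fix \<delta> assume \<delta>: "\<delta> \<in> ring_hom R R" "\<And>x. x \<in> T \<Longrightarrow> \<delta> x = g x"
  have "\<delta> \<in> homs E" unfolding homs_def using \<delta> aut_fix[OF g] E by auto
  then show thesis using \<delta>(2) by (rule that)
qed assumption

lemma restrict_homs:
  assumes T: "normal T" and E: "B \<subseteq> E" "E \<subseteq> T" and \<delta>: "\<delta> \<in> homs E"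
  shows "restrict \<delta> T \<in> Aut E T"
proof -
  note n = normalD[OF T]
  have \<delta>B: "\<delta> \<in> homs B" using homs_mono[OF E(1)] \<delta> by blast
  have h: "\<delta> \<in> subhom T T"
    by (rule hom_into_subfield[OF homsD(1)[OF \<delta>] n(1) n(3)[OF \<delta>B]])
  have a: "(algebraic over B) x" if "x \<in> T" for x using Balg that subfieldE(3)[OF n(1)] by blast
  show ?thesis by (rule restrict_aut[OF n(1) h B n(2) homsD(2)[OF \<delta>B] a E(2) homsD(2)[OF \<delta>]])
qed

lemma restrict_aut_normal:
  assumes T: "normal T" "T \<subseteq> T'" and T': "subfield T' R" and E: "B \<subseteq> E" "E \<subseteq> T" and g: "g \<in> Aut E T'"
  shows "restrict g T \<in> Aut E T"
proof -
  have BT: "B \<subseteq> T'" "E \<subseteq> T'" using normalD(2)[OF T(1)] T(2) E(2) by auto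
  obtain \<delta> where \<delta>: "\<delta> \<in> homs E" "\<And>x. x \<in> T' \<Longrightarrow> \<delta> x = g x" by (rule aut_homs[OF T' BT g]) blast
  have "restrict g T = restrict \<delta> T" using \<delta>(2) T(2) by (intro restrict_ext) auto
  then show ?thesis using restrict_homs[OF T(1) E \<delta>(1)] by simp
qed

lemma restrict_hom:
  assumes T: "normal T" "T \<subseteq> T'" and T': "subfield T' R"
  shows "(\<lambda>g. restrict g T) \<in> hom (aut_group R B T') (aut_group R B T)"
proof (rule homI)
  note r = restrict_aut_normal[OF T T' subset_refl normalD(2)[OF T(1)]]
  have BT: "B \<subseteq> T'" using normalD(2)[OF T(1)] T(2) by blast
  show "restrict g T \<in> Aut B T" if "g \<in> Aut B T'" for g by (rule r[OF that])
  show "restrict (g \<otimes>\<^bsub>aut_group R B T'\<^esub> h) T = restrict g T \<otimes>\<^bsub>aut_group R B T\<^esub> restrict h T"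
    if gh: "g \<in> Aut B T'" "h \<in> Aut B T'" for g h
  proof (rule aut_eqI)
    interpret A: group "aut_group R B T'" by (rule aut_group[OF T' BT])
    interpret A': group "aut_group R B T" by (rule aut_group[OF normalD(1,2)[OF T(1)]])
    show "restrict (g \<otimes>\<^bsub>aut_group R B T'\<^esub> h) T \<in> Aut B T" by (rule r[OF A.m_closed[OF gh]])
    show "restrict g T \<otimes>\<^bsub>aut_group R B T\<^esub> restrict h T \<in> Aut B T" by (rule A'.m_closed[OF r[OF gh(1)] r[OF gh(2)]])
    fix x assume x: "x \<in> T"
    have "restrict h T x \<in> T" by (rule aut_closed[OF r[OF gh(2)] x])
    then show "restrict (g \<otimes>\<^bsub>aut_group R B T'\<^esub> h) T x = (restrict g T \<otimes>\<^bsub>aut_group R B T\<^esub> restrict h T) x"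
      using aut_apply[OF r[OF gh(1)] r[OF gh(2)] x] aut_apply[OF gh, of x] x T(2) by auto
  qed
qed

lemma aut_eq_on_generators:
  assumes T: "subfield T R" "T = compositum R E1 E2" "E1 \<subseteq> T" "E2 \<subseteq> T"
    and g: "g \<in> Aut E T" and h: "h \<in> Aut E' T"
    and eq: "\<And>x. x \<in> E1 \<Longrightarrow> g x = h x" "\<And>x. x \<in> E2 \<Longrightarrow> g x = h x"
  shows "g = h"
proof (rule aut_eqI[OF g h])
  fix x assume x: "x \<in> T"
  show "g x = h x"
    by (rule generate_hom_eq[OF T(1) T(1) aut_hom[OF g] aut_hom[OF h], where S = "E1 \<union> E2"])
      (use T(3,4) eq x in \<open>auto simp: T(2) compositum_def\<close>)
qed

lemma restrict_power:
  assumes E: "subfield E R" "B \<subseteq> E" and s: "\<And>x. x \<in> E \<Longrightarrow> x \<in> kb \<Longrightarrow> (F ^^ j) x = x" and n: "n > 0"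
  shows "\<exists>\<delta>\<in>homs E. \<forall>x\<in>K n. \<delta> x = (F ^^ j) x"
proof (rule extend_power[OF E(1) _ alg_over[OF E(2)] s n])
  show "k \<subseteq> E" using kB E(2) by blast
  fix \<delta> assume \<delta>: "\<delta> \<in> ring_hom R R" "\<And>x. x \<in> E \<Longrightarrow> \<delta> x = x" "\<And>x. x \<in> K n \<Longrightarrow> \<delta> x = (F ^^ j) x"
  have "\<delta> \<in> homs E" unfolding homs_def using \<delta>(1,2) by simp
  moreover have "\<forall>x\<in>K n. \<delta> x = (F ^^ j) x" using \<delta>(3) by (rule ballI)
  ultimately show ?thesis by (intro bexI[of _ \<delta>])
qed assumption

lemma F_m_multiple: "x \<in> K m \<Longrightarrow> (F ^^ (m * j)) x = x"
  using K_dvd[of m "m * j"] unfolding K_def by auto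

text \<open>Surjectivity onto the fibre product. Extensions of the two automorphisms to the big
  field act on \<open>K m\<close> as \<open>F^i\<close> and \<open>F^j\<close>. Agreement on
  \<open>k'\<close> makes \<open>F^(i - j)\<close> trivial on \<open>k'\<close>, so it extends by
  the identity on \<open>M\<close>; composing with this corrects the extension of
  \<open>\<beta>\<close> on \<open>K m\<close> and leaves it unchanged on \<open>M\<close>.\<close>

lemma combine_auts:
  assumes \<alpha>: "\<alpha> \<in> Aut B mB" and \<beta>: "\<beta> \<in> Aut B M"
    and eq: "\<And>x. x \<in> k' \<Longrightarrow> \<alpha> x = \<beta> x"
  obtains g where "g \<in> Aut B L" "restrict g mB = \<alpha>" "restrict g M = \<beta>"
proof -
  obtain \<delta>1 where d1: "\<delta>1 \<in> homs B" "\<And>x. x \<in> mB \<Longrightarrow> \<delta>1 x = \<alpha> x"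
    by (rule aut_homs[OF cmB(1,3,3) \<alpha>]) blast
  obtain \<delta>2 where d2: "\<delta>2 \<in> homs B" "\<And>x. x \<in> M \<Longrightarrow> \<delta>2 x = \<beta> x"
    by (rule aut_homs[OF M M(2) \<beta>]) blast
  obtain i where i: "\<And>x. x \<in> K m \<Longrightarrow> \<delta>1 x = (F ^^ i) x" by (rule homs_power[OF homs_B_k[OF d1(1)] m(1)]) blast
  obtain j where j: "\<And>x. x \<in> K m \<Longrightarrow> \<delta>2 x = (F ^^ j) x" by (rule homs_power[OF homs_B_k[OF d2(1)] m(1)]) blast
  \<comment> \<open>A natural number that stands for \<open>i - j\<close>, since \<open>F^m\<close>
    is trivial on \<open>K m\<close>.\<close>
  define t where "t = i + (m - 1) * j"
  have jt: "j + t = i + m * j"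
  proof -
    have "j + (m - 1) * j = m * j" using m(1) by (metis One_nat_def Suc_pred add_mult_distrib mult_1 plus_1_eq_Suc)
    then show ?thesis unfolding t_def by simp
  qed
  have Ft: "(F ^^ j) ((F ^^ t) x) = (F ^^ i) x" if x: "x \<in> K m" for x
  proof -
    have "(F ^^ j) ((F ^^ t) x) = (F ^^ (j + t)) x" by (simp only: funpow_add comp_apply)
    also have "\<dots> = (F ^^ i) ((F ^^ (m * j)) x)" unfolding jt by (simp only: funpow_add comp_apply)
    finally show ?thesis using F_m_multiple[OF x] by simp
  qed
  have fixM: "(F ^^ t) x = x" if x: "x \<in> M" "x \<in> kb" for x
  proof -
    have xk: "x \<in> k'" using x unfolding k'_def by simp
    have xK: "x \<in> K m" using xk k'_sub_K by blast
    have "(F ^^ i) x = (F ^^ j) x"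
      using i[OF xK] j[OF xK] d1(2)[of x] d2(2)[OF x(1)] eq[OF xk] cmB(2) xK by auto
    then have "(F ^^ j) ((F ^^ t) x) = (F ^^ j) x" using Ft[OF xK] by simp
    moreover have "(F ^^ t) x \<in> kb" by (rule Fn_simps(1)[OF x(2)])
    ultimately show ?thesis using inj_onD[OF Fn_simps(8)[of j], of "(F ^^ t) x" x] x(2) by simp
  qed
  obtain \<epsilon> where e0: "\<epsilon> \<in> homs M" "\<forall>x\<in>K m. \<epsilon> x = (F ^^ t) x"
    by (rule bexE[OF restrict_power[OF M fixM m(1)]])
  note e = e0(1) bspec[OF e0(2)]
  define \<delta> where "\<delta> = \<delta>2 \<circ> \<epsilon>"
  have eB: "\<epsilon> \<in> homs B" using e(1) homs_mono[OF M(2)] by blast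
  have \<delta>: "\<delta> \<in> homs B"
    unfolding homs_def \<delta>_def using ring_hom_trans[OF homsD(1)[OF e(1)] homsD(1)[OF d2(1)]] homsD(2)[OF eB] homsD(2)[OF d2(1)] by simp
  have \<delta>M: "\<delta> x = \<beta> x" if "x \<in> M" for x unfolding \<delta>_def using homsD(2)[OF e(1) that] d2(2)[OF that] by simp
  have \<delta>K: "\<delta> x = \<alpha> x" if x: "x \<in> K m" for x
    unfolding \<delta>_def using e(2)[OF x] j[OF FK[OF x]] Ft[OF x] i[OF x] d1(2)[of x] cmB(2) x by auto
  define g where "g = restrict \<delta> L"
  have g: "g \<in> Aut B L" unfolding g_def by (rule restrict_homs[OF normal_L subset_refl sub_fields(4) \<delta>])
  have r1: "restrict g mB \<in> Aut B mB"
    by (rule restrict_aut_normal[OF normal_mB sub_fields(3) cL(1) subset_refl cmB(3) g])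
  have "restrict g mB = \<alpha>"
  proof (rule aut_eq_on_generators[OF cmB(1) mB_def cmB(2,3) r1 \<alpha>])
    show "restrict g mB x = \<alpha> x" if "x \<in> K m" for x using \<delta>K[OF that] cmB(2) cL(2) that unfolding g_def by auto
    show "restrict g mB x = \<alpha> x" if "x \<in> B" for x
      using homsD(2)[OF \<delta> that] aut_fix[OF \<alpha> that] cmB(3) sub_fields(4) that unfolding g_def by auto
  qed
  moreover have "restrict g M = \<beta>"
  proof (rule extensionalityI[OF restrict_extensional aut_ext[OF \<beta>]])
    fix x assume "x \<in> M"
    then show "restrict g M x = \<beta> x" unfolding g_def using \<delta>M cL(3) by auto
  qed
  ultimately show thesis using g by (intro that)
qed

section \<open>The fibre product and its element (F', \<gamma>)\<close>

definition Phi :: "('a \<Rightarrow> 'a) \<Rightarrow> ('a \<Rightarrow> 'a) \<times> ('a \<Rightarrow> 'a)" where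
  "Phi = (\<lambda>g. (restrict g mB, restrict g M))"

definition "FP = fibre_product (aut_group R B mB) (aut_group R B M) (\<lambda>g. restrict g k'B) (\<lambda>g. restrict g k'B)"

lemma FP_carrier:
  "(a, b) \<in> carrier FP \<longleftrightarrow> a \<in> Aut B mB \<and> b \<in> Aut B M \<and> restrict a k'B = restrict b k'B"
  unfolding FP_def fibre_product_def by simp

lemma FP_mult: "(a, b) \<otimes>\<^bsub>FP\<^esub> (c, d) = (a \<otimes>\<^bsub>aut_group R B mB\<^esub> c, b \<otimes>\<^bsub>aut_group R B M\<^esub> d)"
  unfolding FP_def fibre_product_def DirProd_def by simp

lemma Phi_mem: "g \<in> Aut B L \<Longrightarrow> Phi g \<in> carrier FP"
  unfolding Phi_def FP_carrier
  using restrict_aut_normal[OF normal_mB sub_fields(3) cL(1) subset_refl cmB(3)]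
    restrict_aut_normal[OF normal_M cL(3,1) subset_refl M(2)] sub_fields(1,2)
  by (simp add: Int_absorb1)

lemma Phi_inj: "inj_on Phi (Aut B L)"
proof (rule inj_onI)
  fix g h assume g: "g \<in> Aut B L" and h: "h \<in> Aut B L" and e: "Phi g = Phi h"
  show "g = h"
  proof (rule aut_eq_on_generators[OF cL(1) L_def cL(2,3) g h])
    have e1: "restrict g mB = restrict h mB" and e2: "restrict g M = restrict h M" using e unfolding Phi_def by simp_all
    show "g x = h x" if "x \<in> K m" for x using fun_cong[OF e1, of x] that cmB(2) by auto
    show "g x = h x" if "x \<in> M" for x using fun_cong[OF e2, of x] that by simp
  qed
qed

lemma Phi_iso: "Phi \<in> iso (aut_group R B L) FP"
  unfolding iso_def
proof (intro CollectI conjI)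
  show "Phi \<in> hom (aut_group R B L) FP"
  proof (rule homI)
    show "Phi g \<in> carrier FP" if "g \<in> Aut B L" for g by (rule Phi_mem[OF that])
    show "Phi (g \<otimes>\<^bsub>aut_group R B L\<^esub> h) = Phi g \<otimes>\<^bsub>FP\<^esub> Phi h"
      if "g \<in> Aut B L" "h \<in> Aut B L" for g h
      using hom_mult[OF restrict_hom[OF normal_mB sub_fields(3) cL(1)] that]
        hom_mult[OF restrict_hom[OF normal_M cL(3,1)] that] unfolding Phi_def FP_mult by simp
  qed
  show "bij_betw Phi (Aut B L) (carrier FP)"
    unfolding bij_betw_def
  proof (intro conjI Phi_inj subset_antisym subsetI)
    show "y \<in> carrier FP" if "y \<in> Phi ` Aut B L" for y using that Phi_mem by (auto elim: imageE)
    show "y \<in> Phi ` Aut B L" if "y \<in> carrier FP" for y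
    proof -
      obtain a b where ab: "y = (a, b)" by (cases y)
      have f: "a \<in> Aut B mB" "b \<in> Aut B M" "restrict a k'B = restrict b k'B"
        using \<open>y \<in> carrier FP\<close> unfolding ab FP_carrier by simp_all
      have "a x = b x" if "x \<in> k'" for x using fun_cong[OF f(3), of x] that ck'B(2) by auto
      then obtain g where g: "g \<in> Aut B L" "restrict g mB = a" "restrict g M = b"
        by (rule combine_auts[OF f(1,2)]) blast
      then have "Phi g = y" unfolding Phi_def ab by simp
      then show ?thesis using g(1) by blast
    qed
  qed
qed

definition "F' = inv_into (Aut B mB) (\<lambda>g. restrict g (K m)) (restrict F (K m))"

text \<open>The preimage exists because \<open>B\<close> has no constants outside \<open>k\<close>,
  so \<open>F\<close> on \<open>K m\<close> extends by the identity on \<open>B\<close>.\<close>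

lemma F': "F' \<in> Aut B mB" "x \<in> K m \<Longrightarrow> F' x = F x"
proof -
  have f1: "(F ^^ 1) x = x" if "x \<in> B" "x \<in> kb" for x using Fk Bkb that by simp
  obtain \<delta> where \<delta>0: "\<delta> \<in> homs B" "\<forall>x\<in>K m. \<delta> x = (F ^^ 1) x"
    by (rule bexE[OF restrict_power[OF B subset_refl f1 m(1)]])
  note \<delta> = \<delta>0(1) bspec[OF \<delta>0(2)]
  have d: "restrict \<delta> mB \<in> Aut B mB" by (rule restrict_homs[OF normal_mB subset_refl cmB(3) \<delta>(1)])
  have "restrict (restrict \<delta> mB) (K m) = restrict F (K m)"
    using \<delta>(2) cmB(2) by (intro restrict_ext) auto
  then have mem: "restrict F (K m) \<in> (\<lambda>g. restrict g (K m)) ` Aut B mB" using d by (rule image_eqI[OF sym])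
  show "F' \<in> Aut B mB" unfolding F'_def by (rule inv_into_into[OF mem])
  have e: "restrict F' (K m) = restrict F (K m)" unfolding F'_def by (rule f_inv_into_f[OF mem])
  show "F' x = F x" if "x \<in> K m" using fun_cong[OF e, of x] that by simp
qed

lemma F'\<gamma>: "(F', \<gamma>) \<in> carrier FP"
  unfolding FP_carrier
proof (intro conjI F'(1) \<gamma>)
  have r: "restrict F' k'B \<in> Aut B k'B" "restrict \<gamma> k'B \<in> Aut B k'B"
    by (rule restrict_aut_normal[OF normal_k'B sub_fields(1) cmB(1) subset_refl ck'B(3) F'(1)])
      (rule restrict_aut_normal[OF normal_k'B sub_fields(2) M(1) subset_refl ck'B(3) \<gamma>])
  show "restrict F' k'B = restrict \<gamma> k'B"
  proof (rule aut_eq_on_generators[OF ck'B(1) k'B_def ck'B(2,3) r])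
    show "restrict F' k'B x = restrict \<gamma> k'B x" if "x \<in> k'" for x
      using F'(2)[of x] k'_sub_K \<gamma>F[of x] that ck'B(2) unfolding k'_def by auto
    show "restrict F' k'B x = restrict \<gamma> k'B x" if "x \<in> B" for x
      using aut_fix[OF F'(1) that] aut_fix[OF \<gamma> that] that ck'B(3) by auto
  qed
qed

definition "s = inv_into (Aut B L) Phi (F', \<gamma>)"

lemma s: "s \<in> Aut B L" and s_M: "x \<in> M \<Longrightarrow> s x = \<gamma> x" and s_K: "x \<in> K m \<Longrightarrow> s x = F x"
proof -
  have im: "(F', \<gamma>) \<in> Phi ` Aut B L"
    using Phi_iso F'\<gamma> unfolding iso_def bij_betw_def by simp
  show "s \<in> Aut B L" unfolding s_def by (rule inv_into_into[OF im])
  have "Phi s = (F', \<gamma>)" unfolding s_def by (rule f_inv_into_f[OF im])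
  then have e: "restrict s mB = F'" "restrict s M = \<gamma>" unfolding Phi_def by simp_all
  show "s x = \<gamma> x" if "x \<in> M" using fun_cong[OF e(2), of x] that by simp
  show "s x = F x" if x: "x \<in> K m" using fun_cong[OF e(1), of x] F'(2)[OF x] x cmB(2) by auto
qed

section \<open>The fixed field of s\<close>

definition "Z = fixed_field L (generate (aut_group R B L) {s})"

lemma s_pow_hom: "(s ^^ n) \<in> subhom L L"
proof (induction n)
  case 0 show ?case by (simp add: ring_hom_def)
next
  case (Suc n) show ?case using ring_hom_trans[OF Suc aut_hom[OF s]] by (simp add: comp_def)
qed

lemma s_pow_K: "x \<in> K m \<Longrightarrow> (s ^^ n) x = (F ^^ n) x"
  by (induction n) (simp_all add: s_K FK)

lemma s_pow_m: "x \<in> L \<Longrightarrow> (s ^^ m) x = x"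
proof -
  assume x: "x \<in> L"
  have sM: "(s ^^ n) y = (\<gamma> ^^ n) y \<and> (\<gamma> ^^ n) y \<in> M" if "y \<in> M" for n y
    by (induction n) (simp_all add: that s_M aut_closed[OF \<gamma>])
  have "(s ^^ m) x = id x"
  proof (rule generate_hom_eq[OF cL(1) cL(1) s_pow_hom, where S = "K m \<union> M"])
    show "id \<in> subhom L L" by (simp add: ring_hom_def)
    show "K m \<union> M \<subseteq> L" using cL(2,3) by blast
    show "(s ^^ m) y = id y" if "y \<in> K m \<union> M" for y
      using that s_pow_K[of y m] sM[of y m] \<gamma>m[of y] unfolding K_def by auto
    show "x \<in> generate_field R (K m \<union> M)" using x unfolding L_def compositum_def .
  qed
  then show "(s ^^ m) x = x" by simp
qed

lemma Z_eq: "Z = {x \<in> L. s x = x}"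
proof
  interpret A: group "aut_group R B L" by (rule aut_group[OF cL(1) sub_fields(4)])
  show "Z \<subseteq> {x \<in> L. s x = x}" unfolding Z_def fixed_field_def using generate.incl[of s "{s}"] by auto
  show "{x \<in> L. s x = x} \<subseteq> Z"
  proof
    fix x assume x: "x \<in> {x \<in> L. s x = x}"
    have "generate (aut_group R B L) {s} \<subseteq> {g \<in> Aut B L. \<forall>y\<in>{x}. g y = y}"
      by (rule A.generate_subgroup_incl) (use s x fix_subgroup[OF cL(1) sub_fields(4), of "{x}"] in simp_all)
    then show "x \<in> Z" unfolding Z_def fixed_field_def using x by auto
  qed
qed

lemma Z_subfield: "subfield Z R" "B \<subseteq> Z" "Z \<subseteq> L"
proof -
  have id: "id \<in> subhom L L" by (simp add: ring_hom_def)
  show "subfield Z R" unfolding Z_eq using equalizer_subfield[OF cL(1) cL(1) aut_hom[OF s] id] by simp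
  show "B \<subseteq> Z" "Z \<subseteq> L" unfolding Z_eq using sub_fields(4) aut_fix[OF s] by auto
qed

text \<open>The compositum acquires no constants beyond \<open>K m\<close>: \<open>F^m\<close> is
  trivial on the constants of \<open>M\<close>, so it extends by the identity on \<open>M\<close>.
  The extension fixes \<open>K m\<close> as well, hence all of \<open>L\<close>, and so
  \<open>F^m\<close> fixes every constant of \<open>L\<close>.\<close>

lemma L_kb: "L \<inter> kb = K m"
proof
  show "K m \<subseteq> L \<inter> kb" using cL(2) K_sub(1) by blast
  show "L \<inter> kb \<subseteq> K m"
  proof
    fix x assume "x \<in> L \<inter> kb"
    then have x: "x \<in> L" "x \<in> kb" by simp_all
    \<comment> \<open>Chosen so that \<open>K D\<close> contains both \<open>K m\<close> and
      \<open>x\<close>.\<close>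
    define D where "D = m * per x"
    have D: "D > 0" unfolding D_def using m(1) per(1)[OF x(2)] by simp
    have xD: "x \<in> K D" and mD: "K m \<subseteq> K D"
      unfolding D_def using mem_K_per[OF x(2)] K_dvd[of "per x" "m * per x"] K_dvd[of m "m * per x"] by auto
    have fixM: "(F ^^ m) y = y" if "y \<in> M" "y \<in> kb" for y
      using k'_sub_K that unfolding k'_def K_def by auto
    obtain \<delta> where \<delta>0: "\<delta> \<in> homs M" "\<forall>x\<in>K D. \<delta> x = (F ^^ m) x"
    by (rule bexE[OF restrict_power[OF M fixM D]])
  note \<delta> = \<delta>0(1) bspec[OF \<delta>0(2)]
    have idR: "id \<in> subhom (carrier R) (carrier R)" by (simp add: ring_hom_def)
    have "\<delta> x = id x"
    proof (rule generate_hom_eq[OF carrier_is_subfield carrier_is_subfield ring_hom_carrier[OF homsD(1)[OF \<delta>(1)]] idR, where S = "K m \<union> M"])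
      show "K m \<union> M \<subseteq> carrier R" using subfieldE(3)[OF K_subfield] subfieldE(3)[OF M(1)] by blast
      show "\<delta> y = id y" if y: "y \<in> K m \<union> M" for y
      proof (cases "y \<in> M")
        case True then show ?thesis using homsD(2)[OF \<delta>(1)] by simp
      next
        case False
        then have "y \<in> K m" using y by blast
        then show ?thesis using \<delta>(2)[of y] mD unfolding K_def by auto
      qed
      show "x \<in> generate_field R (K m \<union> M)" using x(1) unfolding L_def compositum_def .
    qed
    then show "x \<in> K m" using \<delta>(2)[OF xD] x(2) unfolding K_def by simp
  qed
qed

text \<open>On the constants of \<open>L\<close> the automorphism \<open>s\<close> is
  \<open>F\<close>, so a constant fixed by \<open>s\<close> is fixed by \<open>F\<close>. This is
  the geometric irreducibility of \<open>Z\<close>.\<close>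

lemma Z_kb: "x \<in> Z \<Longrightarrow> x \<in> kb \<Longrightarrow> x \<in> k"
proof -
  assume x: "x \<in> Z" "x \<in> kb"
  then have "x \<in> K m" "s x = x" using L_kb Z_eq by auto
  then show "x \<in> k" using s_K fixF[OF x(2)] by simp
qed

text \<open>Artin's theorem for the cyclic group generated by \<open>s\<close>, obtained from
  \<open>hom_conj\<close> by comparing \<open>\<delta>\<close> with the inclusion of
  \<open>L\<close>.\<close>

lemma L_subfield_eq_powers:
  assumes \<delta>: "\<delta> \<in> homs Z"
  obtains i where "\<And>x. x \<in> L \<Longrightarrow> \<delta> x = (s ^^ i) x"
proof -
  define H where "H = (\<lambda>i. s ^^ i) ` {..<Suc m}"
  have modL: "(s ^^ (i mod m)) x = (s ^^ i) x" if "x \<in> L" for i x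
    by (rule funpow_mod_eq[OF s_pow_m[OF that]])
  have "\<exists>g\<in>H. \<forall>x\<in>L. \<delta> x = id (g x)"
  proof (rule hom_conj[OF subfieldE(1)[OF cL(1)] _ _ _ _ _ _ _ inf])
    show "finite H" unfolding H_def by simp
    show "g \<in> subhom L L \<and> inj_on g L" if g: "g \<in> H" for g
    proof -
      obtain i where i: "g = s ^^ i" using g unfolding H_def by (auto elim: imageE)
      show ?thesis unfolding i using s_pow_hom subfield_hom(8)[OF cL(1) s_pow_hom cL(1)] by blast
    qed
    show "\<exists>g'\<in>H. \<forall>x\<in>L. g' x = h (g x)" if gh: "g \<in> H" "h \<in> H" for g h
    proof -
      obtain i where i: "g = s ^^ i" using gh(1) unfolding H_def by (auto elim: imageE)
      obtain j where j: "h = s ^^ j" using gh(2) unfolding H_def by (auto elim: imageE)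
      have "(j + i) mod m < Suc m" using m(1) by (simp add: less_SucI)
      then have "s ^^ ((j + i) mod m) \<in> H" unfolding H_def by (intro imageI) simp
      moreover have "\<forall>x\<in>L. (s ^^ ((j + i) mod m)) x = h (g x)"
        unfolding i j using modL[of _ "j + i"] by (simp add: funpow_add)
      ultimately show ?thesis by (intro bexI[of _ "s ^^ ((j + i) mod m)"])
    qed
    have "s ^^ 0 \<in> H" unfolding H_def by (intro imageI) simp
    moreover have "\<forall>x\<in>L. (s ^^ 0) x = x" by simp
    ultimately show "\<exists>e\<in>H. \<forall>x\<in>L. e x = x" by (intro bexI[of _ "s ^^ 0"])
    show "id \<in> ring_hom (R\<lparr>carrier := L\<rparr>) R" using subfieldE(3)[OF cL(1)] by (intro ring_hom_memI) auto
    show "\<delta> \<in> ring_hom (R\<lparr>carrier := L\<rparr>) R" by (rule ring_hom_sub[OF homsD(1)[OF \<delta>] subfieldE(3)[OF cL(1)]])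
    show "id x = \<delta> x" if x: "x \<in> L" and fx: "\<And>h. h \<in> H \<Longrightarrow> h x = x" for x
    proof -
      have "s ^^ 1 \<in> H" unfolding H_def using m(1) by (intro imageI) simp
      then have "s x = x" using fx[of "s ^^ 1"] by simp
      then have "x \<in> Z" unfolding Z_eq using x by simp
      then show ?thesis using homsD(2)[OF \<delta>] by simp
    qed
  qed
  then obtain g where g: "g \<in> H" "\<forall>x\<in>L. \<delta> x = id (g x)" by (rule bexE)
  then obtain i where i: "g = s ^^ i" unfolding H_def by (auto elim: imageE)
  show thesis by (rule that[of i]) (use g(2) in \<open>simp add: i\<close>)
qed

text \<open>\<open>\<delta>\<close> is a power \<open>s^i\<close> on \<open>L\<close>, and
  triviality on \<open>K m\<close> means that \<open>F^i\<close> is trivial there. As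
  \<open>K m\<close> has degree exactly \<open>m\<close>, \<open>m\<close> divides \<open>i\<close>,
  and \<open>s^m\<close> is trivial on \<open>L\<close>.\<close>

lemma homs_Z_K_trivial:
  assumes \<delta>: "\<delta> \<in> homs Z" and fK: "\<And>x. x \<in> K m \<Longrightarrow> \<delta> x = x" and x: "x \<in> L"
  shows "\<delta> x = x"
proof -
  obtain i where i: "\<And>x. x \<in> L \<Longrightarrow> \<delta> x = (s ^^ i) x" by (rule L_subfield_eq_powers[OF \<delta>]) blast
  have "(F ^^ i) y = y" if "y \<in> K m" for y
    using i[of y] s_pow_K[OF that, of i] fK[OF that] cL(2) that by auto
  then have "m dvd i" by (rule K_order[OF m])
  then obtain q where q: "i = q * m" by (metis dvdE mult.commute)
  have "(s ^^ (i mod m)) x = (s ^^ i) x" by (rule funpow_mod_eq[OF s_pow_m[OF x]])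
  then show ?thesis using i[OF x] q by simp
qed

text \<open>Endomorphisms fixing \<open>K m\<close> and \<open>Z\<close> are trivial on
  \<open>L\<close>, so each \<open>x\<close> in \<open>L\<close> is the only root of its minimal
  polynomial over the compositum. The orbit of \<open>x\<close> under \<open>s\<close> gives a
  polynomial over \<open>Z\<close> with simple roots, which excludes inseparability.\<close>

lemma compositum_Z: "compositum R (K m) Z = L"
proof
  note c = compositum_facts[OF K_subfield[of m] Z_subfield(1)]
  show sub: "compositum R (K m) Z \<subseteq> L" by (rule c(4)[OF cL(1,2) Z_subfield(3)])
  define T where "T = compositum R (K m) Z"
  have T: "subfield T R" "K m \<subseteq> T" "Z \<subseteq> T" using c unfolding T_def by blast+
  show "L \<subseteq> compositum R (K m) Z"
  proof
    fix x assume x: "x \<in> L"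
    have Lc: "L \<subseteq> carrier R" by (rule subfieldE(3)[OF cL(1)])
    define S where "S = (\<lambda>i. (s ^^ i) x) ` {..<m}"
    have Sf: "finite S" "S \<subseteq> L" unfolding S_def using subfield_hom(1)[OF cL(1) s_pow_hom cL(1) x] by auto
    have "(s ^^ 0) x \<in> S" unfolding S_def using m(1) by (intro imageI) simp
    then have xS: "x \<in> S" by simp
    have "s ` S \<subseteq> S"
    proof
      fix z assume "z \<in> s ` S"
      then obtain i where "z = s ((s ^^ i) x)" unfolding S_def by blast
      then have "z = (s ^^ (Suc i mod m)) x" using funpow_mod_eq[OF s_pow_m[OF x], of "Suc i"] by simp
      then show "z \<in> S" unfolding S_def using m(1) by simp
    qed
    then have "lin_prod R S \<in> carrier (T[X])"
      by (rule lin_prod_mem[OF cL(1) aut_hom[OF s] Sf]) (use T(3) Z_eq in blast)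
    moreover have "S \<subseteq> carrier R" using Sf(2) Lc by blast
    ultimately have "x \<in> T"
    proof (intro mem_of_only_root[OF ac T(1) Sf(1) _ xS])
      fix z assume z: "z \<in> carrier R" "eval (Irr T x) z = \<zero>"
      have BT: "B \<subseteq> T" using Z_subfield(2) T(3) by blast
      show "z = x"
      proof (rule hom_of_root[OF closed_field_carrier[OF ac] T(1) subfieldE(3)[OF T(1)] subset_refl alg_over[OF BT] subsetD[OF Lc x] z])
        fix \<delta> assume \<delta>: "\<delta> \<in> subhom (carrier R) (carrier R)" "\<And>e. e \<in> T \<Longrightarrow> \<delta> e = e" "\<delta> x = z"
        have "\<delta> \<in> homs Z" unfolding homs_def using \<delta>(1,2) T(3) by auto
        then have "\<delta> x = x" by (rule homs_Z_K_trivial[OF _ _ x]) (use \<delta>(2) T(2) in blast)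
        then show "z = x" using \<delta>(3) by simp
      qed assumption
    qed
    then show "x \<in> compositum R (K m) Z" unfolding T_def .
  qed
qed

lemma subalgebra_subfield: "subfield E R \<Longrightarrow> A \<subseteq> E \<Longrightarrow> subalgebra A E R"
proof (intro subalgebra.intro subalgebra_axioms.intro)
  assume E: "subfield E R" and A: "A \<subseteq> E"
  show "subgroup E (add_monoid R)" using subfieldE(1)[OF E] by (simp add: subring_def)
  show "a \<otimes> v \<in> E" if "a \<in> A" "v \<in> E" for a v using subringE(6)[OF subfieldE(1)[OF E]] that A by blast
qed

lemma L_finite: "finite_dimension B L"
proof -
  have fin: "finite_dimension k (K m)" by (rule dim_K_dvd(1)[OF m(1)])
  obtain Us where Us: "set Us \<subseteq> carrier R" "independent k Us" "length Us = dim k (K m)" "Span k Us = K m"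
    using exists_base[OF k finite_dimensionE[OF k fin]] by (auto simp: over_def)
  define T where "T = finite_extension M Us"
  have a: "(algebraic over M) u" if "u \<in> set Us" for u using alg_over[OF M(2)] that Us(1) by blast
  have T: "subfield T R" unfolding T_def by (rule finite_extension_is_subfield[OF M(1) Us(1) a])
  have MT: "M \<subseteq> T" unfolding T_def by (rule finite_extension_incl[OF subfieldE(3)[OF M(1)] Us(1)])
  have UT: "set Us \<subseteq> T" unfolding T_def by (rule finite_extension_mem[OF subfieldE(1)[OF M(1)] Us(1)])
  have kT: "k \<subseteq> T" using kB M(2) MT by blast
  have "K m \<subseteq> T" using subalgebra_Span_incl[OF k subalgebra_subfield[OF T kT] UT] Us(4) by simp
  then have LT: "L \<subseteq> T" by (rule cL(4)[OF T _ MT])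
  have "finite_dimension M T" unfolding T_def by (rule finite_extension_finite_dimension(1)[OF M(1) Us(1) a])
  then have "finite_dimension B T" by (rule telescopic_base_dim(1)[OF B M(1) Mfin])
  then show ?thesis
    by (rule subalbegra_incl_imp_finite_dimension[OF B _ subalgebra_subfield[OF cL(1) sub_fields(4)] LT])
qed

text \<open>\<open>Z\<close> is finite over \<open>B\<close>, so generators of \<open>B\<close>
  together with a basis of \<open>Z\<close> generate it, and the transcendence basis of
  \<open>B\<close> still serves. That no new constants appear is \<open>Z_kb\<close>.\<close>

lemma Z_function_field:
  assumes ff: "geom_irred_function_field R k B"
  shows "geom_irred_function_field R k Z"
proof -
  obtain S where S: "finite S" "S \<subseteq> B" "B = generate_field R (k \<union> S)"
    using ff unfolding geom_irred_function_field_def by blast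
  obtain t where t: "t \<in> B" "transcendental k t" "\<And>x. x \<in> B \<Longrightarrow> algebraic (generate_field R (k \<union> {t})) x"
    using ff unfolding geom_irred_function_field_def by blast
  have Zfin: "finite_dimension B Z"
    by (rule subalbegra_incl_imp_finite_dimension[OF B L_finite subalgebra_subfield[OF Z_subfield(1,2)] Z_subfield(3)])
  obtain Vs where Vs: "set Vs \<subseteq> carrier R" "independent B Vs" "length Vs = dim B Z" "Span B Vs = Z"
    using exists_base[OF B finite_dimensionE[OF B Zfin]] by (auto simp: over_def)
  have VZ: "set Vs \<subseteq> Z" using Span_base_incl[OF B Vs(1)] Vs(4) by simp
  have kc: "k \<subseteq> carrier R" "B \<subseteq> carrier R" by (rule subfieldE(3)[OF k]) (rule subfieldE(3)[OF B])
  define T where "T = generate_field R (k \<union> (S \<union> set Vs))"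
  have inc: "k \<union> (S \<union> set Vs) \<subseteq> carrier R" using kc S(2) Vs(1) by blast
  have T: "subfield T R" unfolding T_def by (rule generate_field_is_subfield[OF inc])
  have incT: "k \<union> (S \<union> set Vs) \<subseteq> T" unfolding T_def by (auto intro: generate_field.incl)
  have BT: "B \<subseteq> T" unfolding S(3) by (rule generate_field_min_subfield1[OF _ T]) (use inc incT in blast)+
  have "Z \<subseteq> T" using subalgebra_Span_incl[OF B subalgebra_subfield[OF T BT]] incT Vs(4) by blast
  moreover have "T \<subseteq> Z"
    unfolding T_def by (rule generate_field_min_subfield1[OF inc Z_subfield(1)]) (use kB S(2) Z_subfield(2) VZ in blast)
  ultimately have ZT: "Z = T" by blast
  define E where "E = generate_field R (k \<union> {t})"
  have Ein: "k \<union> {t} \<subseteq> carrier R" using kc t(1) by blast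
  have E: "subfield E R" unfolding E_def by (rule generate_field_is_subfield[OF Ein])
  have algE: "algebraic E x" if x: "x \<in> Z" for x
    using algebraic_trans[OF E B, of x] t(3) Balg x subfieldE(3)[OF Z_subfield(1)] unfolding over_def E_def by blast
  have "integral_closure_in R k Z = k"
  proof
    show "integral_closure_in R k Z \<subseteq> k"
    proof
      fix x assume "x \<in> integral_closure_in R k Z"
      then have x: "x \<in> Z" "(algebraic over k) x" unfolding integral_closure_in_def over_def by simp_all
      have "x \<in> kb" using subsetD[OF subfieldE(3)[OF Z_subfield(1)] x(1)] x(2) kb by simp
      then show "x \<in> k" by (rule Z_kb[OF x(1)])
    qed
    show "k \<subseteq> integral_closure_in R k Z"
      unfolding integral_closure_in_def using algebraic_self[OF subfieldE(1)[OF k]] kB Z_subfield(2) by (auto simp: over_def)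
  qed
  moreover have "finite (S \<union> set Vs)" "S \<union> set Vs \<subseteq> Z" using S(1,2) VZ Z_subfield(2) by auto
  moreover have "k \<subseteq> Z" "t \<in> Z" using kB t(1) Z_subfield(2) by auto
  ultimately show ?thesis
    unfolding geom_irred_function_field_def
  proof (intro conjI)
    show "\<exists>S. finite S \<and> S \<subseteq> Z \<and> Z = generate_field R (k \<union> S)"
      by (rule exI[of _ "S \<union> set Vs"]) (use \<open>finite (S \<union> set Vs)\<close> \<open>S \<union> set Vs \<subseteq> Z\<close> ZT in \<open>simp add: T_def\<close>)
    show "\<exists>t\<in>Z. transcendental k t \<and> (\<forall>x\<in>Z. algebraic (generate_field R (k \<union> {t})) x)"
      by (rule bexI[OF _ \<open>t \<in> Z\<close>]) (use t(2) algE in \<open>simp add: E_def\<close>)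
  qed (use k Z_subfield(1) in simp_all)
qed

end

section \<open>Places with values in the algebraic closure of the constant field\<close>

context field
begin

lemma pull_pull:
  assumes "\<And>x. x \<in> T \<Longrightarrow> g x \<in> T"
  shows "pull T g (pull T h \<rho>) = pull T (\<lambda>x. h (g x)) \<rho>"
proof (rule Set.set_eqI)
  show "z \<in> pull T g (pull T h \<rho>) \<longleftrightarrow> z \<in> pull T (\<lambda>x. h (g x)) \<rho>" for z
    using assms[of "fst z"] unfolding pull_def by (cases z) auto
qed

lemma pull_cong: "(\<And>x. x \<in> T \<Longrightarrow> g x = h x) \<Longrightarrow> pull T g \<rho> = pull T h \<rho>"
  unfolding pull_def by auto

lemma pull_ident:
  assumes "Domain \<rho> \<subseteq> T" "\<And>x. x \<in> T \<Longrightarrow> g x = x"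
  shows "pull T g \<rho> = \<rho>"
proof (rule subset_antisym; rule subrelI)
  show "(x, y) \<in> \<rho>" if "(x, y) \<in> pull T g \<rho>" for x y using that assms(2)[of x] unfolding pull_def by simp
  show "(x, y) \<in> pull T g \<rho>" if xy: "(x, y) \<in> \<rho>" for x y
  proof -
    have "x \<in> T" using assms(1) xy by blast
    then show ?thesis using assms(2)[of x] xy unfolding pull_def by simp
  qed
qed

lemma pull_restrict:
  assumes "E \<subseteq> T" "\<And>x. x \<in> E \<Longrightarrow> g x = h x" "\<And>x. x \<in> E \<Longrightarrow> h x \<in> E"
  shows "pull T g \<rho> \<inter> E \<times> UNIV = pull E h (\<rho> \<inter> E \<times> UNIV)"
proof (rule Set.set_eqI)
  show "z \<in> pull T g \<rho> \<inter> E \<times> UNIV \<longleftrightarrow> z \<in> pull E h (\<rho> \<inter> E \<times> UNIV)" for z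
    using assms(2,3)[of "fst z"] subsetD[OF assms(1), of "fst z"] unfolding pull_def by (cases z) auto
qed

text \<open>The zeros of a place are the nonunits of its domain; hence the domain alone determines
  the kernel.\<close>

lemma place_kernel:
  assumes pl: "place_on T \<rho>" and T: "subfield T R" and x: "x \<in> T"
  shows "(x, \<zero>) \<in> \<rho> \<longleftrightarrow> x \<in> Domain \<rho> \<and> (x = \<zero> \<or> inv x \<notin> Domain \<rho>)"
proof
  have h: "partial_hom \<rho>" using pl by (simp add: place_on_def)
  note D = partial_homD[OF h]
  have Tc: "T \<subseteq> carrier R" by (rule subfieldE(3)[OF T])
  {
    assume x0: "(x, \<zero>) \<in> \<rho>"
    have "False" if nz: "x \<noteq> \<zero>" and i: "inv x \<in> Domain \<rho>"
    proof -
      obtain d where d: "(inv x, d) \<in> \<rho>" using i by (rule DomainE)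
      have xU: "x \<in> Units R" using nz x Tc field_Units by auto
      have "(\<one>, \<zero>) \<in> \<rho>" using D(6)[OF x0 d] D(2)[OF d] xU by simp
      then show False using D(10)[OF D(3)] by force
    qed
    then show "x \<in> Domain \<rho> \<and> (x = \<zero> \<or> inv x \<notin> Domain \<rho>)" using x0 by blast
  }
  assume a: "x \<in> Domain \<rho> \<and> (x = \<zero> \<or> inv x \<notin> Domain \<rho>)"
  obtain y where y: "(x, y) \<in> \<rho>" using a by blast
  show "(x, \<zero>) \<in> \<rho>"
  proof (cases "x = \<zero> \<or> y = \<zero>")
    case True then show ?thesis using D(8) y by auto
  next
    case False
    then have "inv x \<in> Domain \<rho>" using place_inv(1)[OF pl Tc y _ T] by blast
    then show ?thesis using a False by blast
  qed
qed

text \<open>An element of value \<open>y\<close> in \<open>k\<close> differs from the constant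
  \<open>y\<close> by an element of the kernel, which depends only on the domain. With larger
  residue fields the domain would determine the place only up to an automorphism of the
  values.\<close>

lemma place_eq_of_Domain:
  assumes pl: "place_on T \<rho>" "place_on T \<rho>'" and T: "subfield T R" and dom: "Domain \<rho> = Domain \<rho>'"
    and ran: "Range \<rho> \<subseteq> k" and ck: "\<And>c. c \<in> k \<Longrightarrow> (c, c) \<in> \<rho> \<and> (c, c) \<in> \<rho>'"
  shows "\<rho> = \<rho>'"
proof (rule place_eq[OF pl subfieldE(3)[OF T]], rule subrelI)
  have h: "partial_hom \<rho>" "partial_hom \<rho>'" using pl by (simp_all add: place_on_def)
  note D = partial_homD[OF h(1)] and D' = partial_homD[OF h(2)]
  fix x y assume xy: "(x, y) \<in> \<rho>"
  then have y: "(y, y) \<in> \<rho>" "(y, y) \<in> \<rho>'" using ran ck by blast+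
  have c: "x \<in> carrier R" "y \<in> carrier R" using D(1,2)[OF xy] by simp_all
  have "(x \<ominus> y, \<zero>) \<in> \<rho>" using D(9)[OF xy y(1)] c by (simp add: minus_eq r_neg)
  moreover from this have "x \<ominus> y \<in> T" using pl(1) unfolding place_on_def by blast
  ultimately have "(x \<ominus> y, \<zero>) \<in> \<rho>'" using place_kernel[OF pl(1) T] place_kernel[OF pl(2) T] dom by simp
  from D'(5)[OF this y(2)] show "(x, y) \<in> \<rho>'" using c by (simp add: minus_eq a_assoc l_neg)
qed

end

context frob
begin

text \<open>Taking values in \<open>kb\<close> records an embedding of the residue field along with
  the prime. This additional datum turns the Frobenius condition into an equation between
  places.\<close>

definition kplace :: "'a set \<Rightarrow> ('a \<times> 'a) set \<Rightarrow> bool" where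
  "kplace T \<rho> \<longleftrightarrow> place_on T \<rho> \<and> Range \<rho> \<subseteq> kb \<and> (\<forall>c\<in>k. (c, c) \<in> \<rho>)"

text \<open>Composition with \<open>F^n\<close> on the side of the values:
  \<open>pull M g \<rho> = push 1 \<rho>\<close> reads \<rho> \<circ> g = F \<circ> \<rho>.\<close>

definition push :: "nat \<Rightarrow> ('a \<times> 'a) set \<Rightarrow> ('a \<times> 'a) set" where
  "push n \<rho> = {(x, z). \<exists>y. (x, y) \<in> \<rho> \<and> z = (F ^^ n) y}"

lemma kplaceD:
  assumes "kplace T \<rho>"
  shows "place_on T \<rho>" "partial_hom \<rho>" "(x, y) \<in> \<rho> \<Longrightarrow> y \<in> kb" "(x, y) \<in> \<rho> \<Longrightarrow> x \<in> T" "c \<in> k \<Longrightarrow> (c, c) \<in> \<rho>"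
    "Domain \<rho> \<subseteq> T"
  using assms unfolding kplace_def place_on_def by auto

lemma kplace_pull:
  assumes T: "subfield T R" "k \<subseteq> T" and g: "g \<in> subhom T T" "\<And>c. c \<in> k \<Longrightarrow> g c = c"
    and \<rho>: "kplace T \<rho>"
  shows "kplace T (pull T g \<rho>)"
  unfolding kplace_def
proof (intro conjI ballI place_pull[OF T(1) g(1) kplaceD(1)[OF \<rho>]])
  show "Range (pull T g \<rho>) \<subseteq> kb" using kplaceD(3)[OF \<rho>] unfolding pull_def by blast
  show "(c, c) \<in> pull T g \<rho>" if "c \<in> k" for c using g(2)[OF that] kplaceD(5)[OF \<rho> that] T(2) that unfolding pull_def by auto
qed

lemma Domain_push: "Domain (push n \<rho>) = Domain \<rho>" unfolding push_def by blast

lemma push_restrict: "push n \<rho> \<inter> E \<times> UNIV = push n (\<rho> \<inter> E \<times> UNIV)" unfolding push_def by blast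

lemma push_pull: "push n (pull T g \<rho>) = pull T g (push n \<rho>)" unfolding push_def pull_def by auto

lemma push_mem: "(x, y) \<in> \<rho> \<Longrightarrow> (x, (F ^^ n) y) \<in> push n \<rho>" unfolding push_def by auto

lemma push_id:
  assumes "Range \<rho> \<subseteq> k" shows "push n \<rho> = \<rho>"
proof (rule Set.set_eqI)
  have "(F ^^ n) y = y" if "(x, y) \<in> \<rho>" for x y using Fn_k assms that by blast
  then show "z \<in> push n \<rho> \<longleftrightarrow> z \<in> \<rho>" for z unfolding push_def by (cases z) auto
qed

lemma kplace_push:
  assumes \<rho>: "kplace T \<rho>"
  shows "kplace T (push n \<rho>)"
proof -
  note D = partial_homD[OF kplaceD(2)[OF \<rho>]] and v = kplaceD(3)[OF \<rho>]
  have mk: "(x, z) \<in> push n \<rho>" if "(x, y) \<in> \<rho>" "z = (F ^^ n) y" for x y z unfolding push_def using that by blast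
  have ph: "partial_hom (push n \<rho>)"
    unfolding partial_hom_def
  proof (intro conjI allI impI)
    show "push n \<rho> \<subseteq> carrier R \<times> carrier R"
    proof (rule subrelI)
      fix x z assume "(x, z) \<in> push n \<rho>"
      then obtain y where y: "(x, y) \<in> \<rho>" "z = (F ^^ n) y" unfolding push_def by auto
      show "(x, z) \<in> carrier R \<times> carrier R" using D(1)[OF y(1)] Fn_simps(1)[OF v[OF y(1)], of n] kb_carr y(2) by auto
    qed
    show "(\<one>, \<one>) \<in> push n \<rho>" by (rule mk[OF D(3)]) (simp add: Fn_simps(2))
    show "(\<ominus> x, \<ominus> z) \<in> push n \<rho>" if h: "(x, z) \<in> push n \<rho>" for x z
    proof -
      obtain y where y: "(x, y) \<in> \<rho>" "z = (F ^^ n) y" using h unfolding push_def by auto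
      show ?thesis by (rule mk[OF D(4)[OF y(1)]]) (simp add: y(2) Fn_simps(6)[OF v[OF y(1)]])
    qed
    show "(x \<oplus> x', z \<oplus> z') \<in> push n \<rho>" "(x \<otimes> x', z \<otimes> z') \<in> push n \<rho>"
      if h: "(x, z) \<in> push n \<rho>" "(x', z') \<in> push n \<rho>" for x z x' z'
    proof -
      obtain y where y: "(x, y) \<in> \<rho>" "z = (F ^^ n) y" using h(1) unfolding push_def by auto
      obtain y' where y': "(x', y') \<in> \<rho>" "z' = (F ^^ n) y'" using h(2) unfolding push_def by auto
      show "(x \<oplus> x', z \<oplus> z') \<in> push n \<rho>"
        by (rule mk[OF D(5)[OF y(1) y'(1)]]) (simp add: y(2) y'(2) Fn_simps(4)[OF v[OF y(1)] v[OF y'(1)]])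
      show "(x \<otimes> x', z \<otimes> z') \<in> push n \<rho>"
        by (rule mk[OF D(6)[OF y(1) y'(1)]]) (simp add: y(2) y'(2) Fn_simps(5)[OF v[OF y(1)] v[OF y'(1)]])
    qed
    show "z = \<zero>" if h: "(\<zero>, z) \<in> push n \<rho>" for z
    proof -
      obtain y where y: "(\<zero>, y) \<in> \<rho>" "z = (F ^^ n) y" using h unfolding push_def by auto
      show ?thesis using D(7)[OF y(1)] y(2) Fn_simps(3) by simp
    qed
  qed
  have z: "(x, \<zero>) \<in> push n \<rho>" if "(x, \<zero>) \<in> \<rho>" for x by (rule mk[OF that]) (simp add: Fn_simps(3))
  have "place_on T (push n \<rho>)"
    unfolding place_on_def Domain_push using ph kplaceD(1)[OF \<rho>] z unfolding place_on_def by blast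
  moreover have "Range (push n \<rho>) \<subseteq> kb" using v Fn_simps(1) unfolding push_def by auto
  moreover have "(c, c) \<in> push n \<rho>" if "c \<in> k" for c
    by (rule mk[OF kplaceD(5)[OF \<rho> that]]) (simp add: Fn_k[OF that])
  ultimately show ?thesis unfolding kplace_def by blast
qed

lemma kplace_restrict:
  assumes \<rho>: "kplace T \<rho>" and E: "E \<subseteq> T" "subfield E R" "k \<subseteq> E"
  shows "kplace E (\<rho> \<inter> E \<times> UNIV)"
  unfolding kplace_def using place_restrict[OF kplaceD(1)[OF \<rho>] E(1,2)] kplaceD(3,5)[OF \<rho>] E(3) by blast

lemma kplace_eq: "kplace T \<rho> \<Longrightarrow> kplace T \<rho>' \<Longrightarrow> subfield T R \<Longrightarrow> \<rho> \<subseteq> \<rho>' \<Longrightarrow> \<rho> = \<rho>'"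
  by (rule place_eq[OF kplaceD(1) kplaceD(1) subfieldE(3)])

lemma kplace_of_partial_hom:
  assumes h: "partial_hom \<tau>" "Range \<tau> \<subseteq> kb" "\<And>c. c \<in> k \<Longrightarrow> (c, c) \<in> \<tau>"
    and T: "subfield T R" "k \<subseteq> T" "Domain \<tau> \<subseteq> T"
  obtains \<rho> where "kplace T \<rho>" "\<tau> \<subseteq> \<rho>"
proof (rule place_extension[OF h(1) kb_closed h(2)])
  fix \<rho> assume \<rho>: "place_on (carrier R) \<rho>" "\<tau> \<subseteq> \<rho>" "Range \<rho> \<subseteq> kb"
  have "kplace (carrier R) \<rho>" unfolding kplace_def using \<rho> h(3) by blast
  then have "kplace T (\<rho> \<inter> T \<times> UNIV)" by (rule kplace_restrict[OF _ subfieldE(3)[OF T(1)] T(1,2)])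
  moreover have "\<tau> \<subseteq> \<rho> \<inter> T \<times> UNIV" using \<rho>(2) T(3) by force
  ultimately show thesis by (rule that)
qed

lemma kplace_extend:
  assumes \<rho>: "kplace E \<rho>" and E: "subfield E R" "k \<subseteq> E" and T: "subfield T R" "E \<subseteq> T"
  obtains \<rho>' where "kplace T \<rho>'" "\<rho>' \<inter> E \<times> UNIV = \<rho>"
proof (rule kplace_of_partial_hom[OF kplaceD(2)[OF \<rho>] _ kplaceD(5)[OF \<rho>] T(1)])
  show "Range \<rho> \<subseteq> kb" using kplaceD(3)[OF \<rho>] by blast
  show "k \<subseteq> T" "Domain \<rho> \<subseteq> T" using E(2) T(2) kplaceD(6)[OF \<rho>] by auto
  fix \<rho>' assume \<rho>': "kplace T \<rho>'" "\<rho> \<subseteq> \<rho>'"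
  have "\<rho> \<subseteq> \<rho>' \<inter> E \<times> UNIV" using \<rho>'(2) kplaceD(6)[OF \<rho>] by force
  then have "\<rho> = \<rho>' \<inter> E \<times> UNIV" by (rule kplace_eq[OF \<rho> kplace_restrict[OF \<rho>'(1) T(2) E] E(1)])
  then show thesis by (intro that[OF \<rho>'(1)]) (rule sym)
qed

text \<open>Integrality over \<open>E\<close> excludes poles. The lemma serves to show that a
  nontrivial prime of \<open>Z\<close> remains nontrivial on \<open>B\<close>.\<close>

lemma kplace_Domain_eq:
  assumes \<rho>: "kplace T \<rho>" and T: "subfield T R" and E: "subfield E R" "E \<subseteq> Domain \<rho>" "\<And>x. x \<in> T \<Longrightarrow> (algebraic over E) x"
  shows "Domain \<rho> = T"
proof
  show "T \<subseteq> Domain \<rho>"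
    using place_integral[OF kplaceD(1)[OF \<rho>] E(1,2)] subfieldE(3)[OF T] E(3) by blast
qed (rule kplaceD(6)[OF \<rho>])

text \<open>Constants are algebraic over \<open>k\<close>, hence never poles, and an embedding of
  \<open>K n\<close> over \<open>k\<close> is a power of \<open>F\<close>.\<close>

lemma kplace_K:
  assumes \<rho>: "kplace T \<rho>" and n: "n > 0" "K n \<subseteq> T"
  obtains i where "\<And>c. c \<in> K n \<Longrightarrow> (c, (F ^^ i) c) \<in> \<rho>"
proof -
  have kD: "k \<subseteq> Domain \<rho>" using kplaceD(5)[OF \<rho>] by blast
  have sub: "K n \<subseteq> Domain \<rho>"
  proof
    fix c assume c: "c \<in> K n"
    then have "c \<in> kb" using K_sub(1) by blast
    then show "c \<in> Domain \<rho>"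
      using place_integral[OF kplaceD(1)[OF \<rho>] k kD, of c] kb_carr kb_alg c n(2) by blast
  qed
  have "app \<rho> \<in> ring_hom (R\<lparr>carrier := K n\<rparr>) R" by (rule app_hom[OF kplaceD(2)[OF \<rho>] sub])
  then have "\<exists>i. \<forall>c\<in>K n. app \<rho> c = (F ^^ i) c"
    by (rule embedding_eq_power[OF n(1)]) (rule app_eq[OF kplaceD(2)[OF \<rho>] kplaceD(5)[OF \<rho>]])
  then obtain i where i: "\<forall>c\<in>K n. app \<rho> c = (F ^^ i) c" by (rule exE)
  show thesis
  proof (rule that)
    fix c assume c: "c \<in> K n"
    show "(c, (F ^^ i) c) \<in> \<rho>" using app_mem[OF kplaceD(2)[OF \<rho>] subsetD[OF sub c]] bspec[OF i c] by simp
  qed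
qed

end

section \<open>Conjugacy and counting of places\<close>

context twist
begin

lemma k_sub: "k \<subseteq> M" "k \<subseteq> L" "k \<subseteq> Z" "k' \<subseteq> M"
  using kB M(2) sub_fields(4) Z_subfield(2) unfolding k'_def by blast+

text \<open>This is \<open>place_conj\<close> for \<open>Aut E T\<close>. Invariants of that group
  are only purely inseparable over \<open>E\<close>, and \<open>place_agree_of_pow\<close> bridges
  the gap.\<close>

lemma kplace_conj:
  assumes T: "normal T" "finite_dimension B T" and E: "subfield E R" "B \<subseteq> E" "E \<subseteq> T"
    and pl: "kplace T \<rho>1" "kplace T \<rho>2" and eq: "\<rho>1 \<inter> E \<times> UNIV = \<rho>2 \<inter> E \<times> UNIV"
  shows "\<exists>g\<in>Aut E T. \<rho>2 = pull T g \<rho>1"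
proof (rule place_conj[OF normalD(1)[OF T(1)] k])
  note T1 = normalD(1)[OF T(1)]
  show "k \<subseteq> T" using kB E(2,3) by blast
  show "finite (Aut E T)"
    by (rule finite_aut_group[OF E(1) T1 E(3) finite_dimension_mono[OF B E(1,2,3) T1 T(2)]])
  interpret A: group "aut_group R E T" by (rule aut_group[OF T1 E(3)])
  show "g \<in> subhom T T \<and> (\<forall>c\<in>k. g c = c)"
    if g: "g \<in> Aut E T" for g
    using aut_hom[OF g] aut_fix[OF g] kB E(2) by (meson subsetD)
  show "\<exists>g'\<in>Aut E T. \<forall>x\<in>T. g' x = h (g x)"
    if gh: "g \<in> Aut E T" "h \<in> Aut E T" for g h
    by (rule bexI[OF _ A.m_closed[OF gh(2,1)]]) (simp add: aut_apply[OF gh(2,1)])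
  show "\<exists>e\<in>Aut E T. \<forall>x\<in>T. e x = x"
    by (rule bexI[OF _ A.one_closed]) (simp add: aut_one)
  show "infinite (carrier R)" by (rule inf)
  show "place_on T \<rho>1" "place_on T \<rho>2" using pl kplaceD(1) by blast+
  show "(c, c) \<in> \<rho>1 \<and> (c, c) \<in> \<rho>2" if "c \<in> k" for c using kplaceD(5) pl that by blast
  show "(algebraic over k) y" if "y \<in> Range \<rho>1 \<union> Range \<rho>2" for y
    using that kplaceD(3)[OF pl(1)] kplaceD(3)[OF pl(2)] kb_alg by blast
  fix x y1 y2 assume xy: "(x, y1) \<in> \<rho>1" "(x, y2) \<in> \<rho>2" and fx: "\<And>h. h \<in> Aut E T \<Longrightarrow> h x = x"
  have xT: "x \<in> T" by (rule kplaceD(4)[OF pl(1) xy(1)])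
  have xc: "x \<in> carrier R" using xT subfieldE(3)[OF T1] by blast
  have a: "(algebraic over E) x" by (rule alg_over[OF E(2) xc])
  have only: "z = x" if z: "z \<in> carrier R" "eval (Irr E x) z = \<zero>" for z
  proof (rule hom_of_root[OF closed_field_carrier[OF ac] E(1) subfieldE(3)[OF E(1)] subset_refl alg_over[OF E(2)] xc z])
    fix \<delta> assume \<delta>: "\<delta> \<in> subhom (carrier R) (carrier R)" "\<And>e. e \<in> E \<Longrightarrow> \<delta> e = e" "\<delta> x = z"
    have "\<delta> \<in> homs E" unfolding homs_def using \<delta>(1,2) by simp
    from fx[OF restrict_homs[OF T(1) E(2,3) this]] show "z = x" using \<delta>(3) xT by simp
  qed assumption
  obtain n where n: "n \<ge> 1" "Irr E x = [\<one>, \<ominus> x] [^]\<^bsub>poly_ring R\<^esub> (n::nat)"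
    using Irr_only_root[OF ac E(1) xc a only] by blast
  have "Irr E x \<in> carrier (E[X])" by (rule IrrE(1)[OF E(1) xc a])
  then have q: "[\<one>, \<ominus> x] [^]\<^bsub>poly_ring R\<^esub> (n::nat) \<in> carrier (E[X])" unfolding n(2) .
  show "y1 = y2"
    by (rule place_agree_of_pow[OF kplaceD(2)[OF pl(1)] kplaceD(2)[OF pl(2)] eq q _ xy]) (use n(1) in simp)
qed

lemma homs_aut_K:
  assumes T: "subfield T R" "B \<subseteq> T" and g: "g \<in> Aut B T" and x: "x \<in> T" "x \<in> K n" and n: "n > 0"
  shows "g x \<in> K n"
proof -
  obtain \<delta> where \<delta>: "\<delta> \<in> homs B" "\<And>x. x \<in> T \<Longrightarrow> \<delta> x = g x" by (rule aut_homs[OF T T(2) g]) blast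
  show ?thesis using homs_K[OF homs_B_k[OF \<delta>(1)] x(2) n] \<delta>(2)[OF x(1)] by simp
qed

lemma aut_mono: "E' \<subseteq> E \<Longrightarrow> g \<in> Aut E T \<Longrightarrow> g \<in> Aut E' T"
  unfolding aut_iff by blast

text \<open>The two places are conjugate over \<open>E\<close>. Comparing values on
  \<open>K m\<close>, where \<open>F^i\<close> is injective, shows that the conjugating automorphism
  fixes \<open>K m\<close> and so all of \<open>L\<close>.\<close>

lemma place_L_unique:
  assumes E: "subfield E R" "B \<subseteq> E" "E \<subseteq> L" "L = compositum R (K m) E"
    and pl: "kplace L \<rho>1" "kplace L \<rho>2" and eq: "\<rho>1 \<inter> E \<times> UNIV = \<rho>2 \<inter> E \<times> UNIV"
    and f: "\<And>c. c \<in> K m \<Longrightarrow> (c, (F ^^ i) c) \<in> \<rho>1" "\<And>c. c \<in> K m \<Longrightarrow> (c, (F ^^ i) c) \<in> \<rho>2"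
  shows "\<rho>1 = \<rho>2"
proof -
  obtain g where g: "g \<in> Aut E L" "\<rho>2 = pull L g \<rho>1"
    using kplace_conj[OF normal_L L_finite E(1,2,3) pl eq] by (rule bexE)
  interpret A: group "aut_group R E L" by (rule aut_group[OF cL(1) E(3)])
  have "g = \<one>\<^bsub>aut_group R E L\<^esub>"
  proof (rule aut_eq_on_generators[OF cL(1) E(4) cL(2) E(3) g(1) A.one_closed])
    show "g x = \<one>\<^bsub>aut_group R E L\<^esub> x" if "x \<in> E" for x
      using aut_fix[OF g(1) that] aut_fix[OF A.one_closed that] by simp
    fix c assume c: "c \<in> K m"
    have cL': "c \<in> L" using c cL(2) by blast
    have gc: "g c \<in> K m" by (rule homs_aut_K[OF cL(1) sub_fields(4) aut_mono[OF E(2) g(1)] cL' c m(1)])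
    have "(g c, (F ^^ i) c) \<in> \<rho>1" using f(2)[OF c] unfolding g(2) pull_def by simp
    then have "(F ^^ i) (g c) = (F ^^ i) c" using partial_homD(10)[OF kplaceD(2)[OF pl(1)]] f(1)[OF gc] by blast
    then have "g c = c" using inj_onD[OF Fn_simps(8)[of i], of "g c" c] gc c K_sub(1) by blast
    then show "g c = \<one>\<^bsub>aut_group R E L\<^esub> c" using cL' by (simp add: aut_one)
  qed
  then have "\<rho>2 = \<rho>1" unfolding g(2) using pull_ident[OF kplaceD(6)[OF pl(1)], of "g"] by (simp add: aut_one)
  then show ?thesis ..
qed

section \<open>The bijections between places of L, M and Z\<close>

definition places_L :: "('a \<times> 'a) set \<Rightarrow> ('a \<times> 'a) set set" where
  "places_L \<pi> = {\<rho>. kplace L \<rho> \<and> \<rho> \<inter> B \<times> UNIV = \<pi> \<and> (\<forall>c\<in>K m. (c, c) \<in> \<rho>) \<and> pull L s \<rho> = push 1 \<rho>}"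

definition places_M :: "('a \<times> 'a) set \<Rightarrow> ('a \<times> 'a) set set" where
  "places_M \<pi> = {\<rho>. kplace M \<rho> \<and> \<rho> \<inter> B \<times> UNIV = \<pi> \<and> (\<forall>c\<in>k'. (c, c) \<in> \<rho>) \<and> pull M \<gamma> \<rho> = push 1 \<rho>}"

definition places_Z :: "('a \<times> 'a) set \<Rightarrow> ('a \<times> 'a) set set" where
  "places_Z \<pi> = {\<rho>. kplace Z \<rho> \<and> \<rho> \<inter> B \<times> UNIV = \<pi> \<and> Range \<rho> \<subseteq> k}"

text \<open>The exponent \<open>(m - 1) * i\<close> stands for \<open>- i\<close>, because
  \<open>F^m\<close> is trivial on \<open>K m\<close>.\<close>

lemma F_inverse: "c \<in> K m \<Longrightarrow> (F ^^ i) ((F ^^ ((m - 1) * i)) c) = c"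
proof -
  assume c: "c \<in> K m"
  have "i + (m - 1) * i = m * i" using m(1) by (metis One_nat_def Suc_pred add_mult_distrib mult_1 plus_1_eq_Suc)
  then have "(F ^^ i) ((F ^^ ((m - 1) * i)) c) = (F ^^ (m * i)) c" by (metis funpow_add comp_apply)
  then show ?thesis using F_m_multiple[OF c] by simp
qed

text \<open>On \<open>K m\<close> both sides are \<open>F\<close>, so by uniqueness the Frobenius
  condition on \<open>L\<close> needs to be checked only on \<open>E\<close>. It is applied with
  \<open>E = M\<close> and with \<open>E = Z\<close>.\<close>

lemma places_L_frobenius:
  assumes E: "subfield E R" "B \<subseteq> E" "E \<subseteq> L" "L = compositum R (K m) E" and pl: "kplace L \<rho>"
    and fK: "\<And>c. c \<in> K m \<Longrightarrow> (c, c) \<in> \<rho>"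
    and eq: "pull L s \<rho> \<inter> E \<times> UNIV = push 1 \<rho> \<inter> E \<times> UNIV"
  shows "pull L s \<rho> = push 1 \<rho>"
proof (rule place_L_unique[OF E _ kplace_push[OF pl] eq, of 1])
  have "s c = c" if "c \<in> k" for c using aut_fix[OF s] that kB by blast
  then show "kplace L (pull L s \<rho>)" by (rule kplace_pull[OF cL(1) k_sub(2) aut_hom[OF s] _ pl])
  show "(c, (F ^^ 1) c) \<in> pull L s \<rho>" if c: "c \<in> K m" for c
    using fK[OF FK[OF c, of 1]] s_K[OF c] subsetD[OF cL(2) c] unfolding pull_def by simp
  show "(c, (F ^^ 1) c) \<in> push 1 \<rho>" if "c \<in> K m" for c by (rule push_mem[OF fK[OF that]])
qed

lemma restrict_restrict: "E \<subseteq> T \<Longrightarrow> \<rho> \<inter> T \<times> UNIV \<inter> E \<times> UNIV = \<rho> \<inter> E \<times> UNIV"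
  by blast

lemma places_L_inj:
  assumes E: "subfield E R" "B \<subseteq> E" "E \<subseteq> L" "L = compositum R (K m) E"
  shows "inj_on (\<lambda>\<rho>. \<rho> \<inter> E \<times> UNIV) (places_L \<pi>)"
proof (rule inj_onI)
  fix \<rho>1 \<rho>2 assume pl: "\<rho>1 \<in> places_L \<pi>" "\<rho>2 \<in> places_L \<pi>" and eq: "\<rho>1 \<inter> E \<times> UNIV = \<rho>2 \<inter> E \<times> UNIV"
  show "\<rho>1 = \<rho>2"
    by (rule place_L_unique[OF E _ _ eq, of 0]) (use pl in \<open>simp_all add: places_L_def\<close>)
qed

text \<open>For surjectivity, an arbitrary extension of the place to \<open>L\<close> acts on
  \<open>K m\<close> as some \<open>F^i\<close>. It is corrected by an automorphism over
  \<open>M\<close> that acts on \<open>K m\<close> as the inverse power.\<close>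

lemma places_L_M: "bij_betw (\<lambda>\<rho>. \<rho> \<inter> M \<times> UNIV) (places_L \<pi>) (places_M \<pi>)"
  unfolding bij_betw_def
proof (intro conjI places_L_inj[OF M cL(3) L_def] subset_antisym subsetI)
  have res: "pull L s \<rho> \<inter> M \<times> UNIV = pull M \<gamma> (\<rho> \<inter> M \<times> UNIV)" for \<rho>
    by (rule pull_restrict[OF cL(3) s_M aut_closed[OF \<gamma>]])
  {
    fix \<rho>' assume "\<rho>' \<in> (\<lambda>\<rho>. \<rho> \<inter> M \<times> UNIV) ` places_L \<pi>"
    then obtain \<rho> where \<rho>: "\<rho> \<in> places_L \<pi>" "\<rho>' = \<rho> \<inter> M \<times> UNIV" by (auto elim: imageE)
    then have f: "kplace L \<rho>" "\<rho> \<inter> B \<times> UNIV = \<pi>" "\<forall>c\<in>K m. (c, c) \<in> \<rho>" "pull L s \<rho> = push 1 \<rho>"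
      unfolding places_L_def by simp_all
    show "\<rho>' \<in> places_M \<pi>"
      unfolding places_M_def \<rho>(2)
    proof (intro CollectI conjI ballI)
      show "kplace M (\<rho> \<inter> M \<times> UNIV)" by (rule kplace_restrict[OF f(1) cL(3) M(1) k_sub(1)])
      show "\<rho> \<inter> M \<times> UNIV \<inter> B \<times> UNIV = \<pi>" unfolding restrict_restrict[OF M(2)] by (rule f(2))
      show "(c, c) \<in> \<rho> \<inter> M \<times> UNIV" if "c \<in> k'" for c using that k'_sub_K f(3) k_sub(4) by blast
      show "pull M \<gamma> (\<rho> \<inter> M \<times> UNIV) = push 1 (\<rho> \<inter> M \<times> UNIV)" using res[of \<rho>] f(4) push_restrict[of 1 \<rho> M] by simp
    qed
  }
  fix \<rho> assume "\<rho> \<in> places_M \<pi>"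
  then have f: "kplace M \<rho>" "\<rho> \<inter> B \<times> UNIV = \<pi>" "\<forall>c\<in>k'. (c, c) \<in> \<rho>" "pull M \<gamma> \<rho> = push 1 \<rho>"
    unfolding places_M_def by simp_all
  obtain \<rho>0 where \<rho>0: "kplace L \<rho>0" "\<rho>0 \<inter> M \<times> UNIV = \<rho>" by (rule kplace_extend[OF f(1) M(1) k_sub(1) cL(1,3)])
  obtain i where i: "\<And>c. c \<in> K m \<Longrightarrow> (c, (F ^^ i) c) \<in> \<rho>0" by (rule kplace_K[OF \<rho>0(1) m(1) cL(2)]) blast
  define j where "j = (m - 1) * i"
  \<comment> \<open>The given place is the identity on \<open>k'\<close>, so \<open>F^i\<close> and
    with it the inverse power are trivial on \<open>k'\<close>, as the extension by the identity on
    \<open>M\<close> demands.\<close>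
  have fixM: "(F ^^ j) c = c" if c: "c \<in> M" "c \<in> kb" for c
  proof -
    have c': "c \<in> k'" using c unfolding k'_def by simp
    have "(c, c) \<in> \<rho>0" using f(3) \<rho>0(2) c' by blast
    then have "(F ^^ i) c = c" using i[of c] k'_sub_K c' partial_homD(10)[OF kplaceD(2)[OF \<rho>0(1)]] by blast
    then have "c \<in> K i" using c(2) unfolding K_def by simp
    then have "c \<in> K j" using K_dvd[of i j] unfolding j_def by auto
    then show ?thesis unfolding K_def by simp
  qed
  obtain \<delta> where \<delta>: "\<delta> \<in> homs M" "\<forall>c\<in>K m. \<delta> c = (F ^^ j) c" by (rule bexE[OF restrict_power[OF M fixM m(1)]])
  have g: "restrict \<delta> L \<in> Aut M L" by (rule restrict_homs[OF normal_L M(2) cL(3) \<delta>(1)])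
  define \<rho>' where "\<rho>' = pull L (restrict \<delta> L) \<rho>0"
  have gk: "restrict \<delta> L c = c" if "c \<in> M" for c by (rule aut_fix[OF g that])
  have pl: "kplace L \<rho>'" unfolding \<rho>'_def by (rule kplace_pull[OF cL(1) k_sub(2) aut_hom[OF g] gk \<rho>0(1)]) (use k_sub(1) in blast)
  have fK: "(c, c) \<in> \<rho>'" if c: "c \<in> K m" for c
    using i[OF FK[OF c, of j]] F_inverse[OF c, of i] bspec[OF \<delta>(2) c] subsetD[OF cL(2) c] unfolding \<rho>'_def pull_def j_def by simp
  have rM: "\<rho>' \<inter> M \<times> UNIV = \<rho>"
    unfolding \<rho>'_def pull_restrict[OF cL(3), of "restrict \<delta> L" "\<lambda>x. x", OF gk, simplified] \<rho>0(2)
    by (rule pull_ident[OF kplaceD(6)[OF f(1)]]) simp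
  have "pull L s \<rho>' = push 1 \<rho>'"
    by (rule places_L_frobenius[OF M cL(3) L_def pl fK]) (simp_all add: res push_restrict rM f(4))
  moreover have "\<rho>' \<inter> B \<times> UNIV = \<pi>" using f(2) restrict_restrict[OF M(2), of \<rho>'] unfolding rM by simp
  ultimately have "\<rho>' \<in> places_L \<pi>" unfolding places_L_def using pl fK by simp
  then show "\<rho> \<in> (\<lambda>\<rho>. \<rho> \<inter> M \<times> UNIV) ` places_L \<pi>" using rM by (intro image_eqI[of _ _ \<rho>']) simp_all
qed

text \<open>On \<open>Z\<close>, where \<open>s\<close> is trivial, the Frobenius condition says
  that values are fixed by \<open>F\<close>, that is, lie in \<open>k\<close>. Conversely, an
  extension to \<open>L\<close> is made the identity on \<open>K m\<close> by a power of
  \<open>s\<close>, which does not affect \<open>Z\<close>.\<close>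

lemma places_L_Z: "bij_betw (\<lambda>\<rho>. \<rho> \<inter> Z \<times> UNIV) (places_L \<pi>) (places_Z \<pi>)"
  unfolding bij_betw_def
proof (intro conjI places_L_inj[OF Z_subfield compositum_Z[symmetric]] subset_antisym subsetI)
  have sZ: "(s ^^ n) x = x" if "x \<in> Z" for x n using that unfolding Z_eq by (induction n) simp_all
  {
    fix \<rho>' assume "\<rho>' \<in> (\<lambda>\<rho>. \<rho> \<inter> Z \<times> UNIV) ` places_L \<pi>"
    then obtain \<rho> where \<rho>: "\<rho> \<in> places_L \<pi>" "\<rho>' = \<rho> \<inter> Z \<times> UNIV" by (auto elim: imageE)
    then have f: "kplace L \<rho>" "\<rho> \<inter> B \<times> UNIV = \<pi>" "pull L s \<rho> = push 1 \<rho>"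
      unfolding places_L_def by simp_all
    have "y \<in> k" if xy: "(x, y) \<in> \<rho>" "x \<in> Z" for x y
    proof -
      have "(x, y) \<in> pull L s \<rho>" using xy sZ[OF xy(2), of 1] Z_subfield(3) unfolding pull_def by auto
      then obtain y' where y': "(x, y') \<in> \<rho>" "y = F y'" unfolding f(3) push_def by auto
      then have "F y = y" using partial_homD(10)[OF kplaceD(2)[OF f(1)] xy(1) y'(1)] by simp
      then show ?thesis by (rule fixF[OF kplaceD(3)[OF f(1) xy(1)]])
    qed
    then have "Range (\<rho> \<inter> Z \<times> UNIV) \<subseteq> k" by blast
    then show "\<rho>' \<in> places_Z \<pi>"
      unfolding places_Z_def \<rho>(2)
      using kplace_restrict[OF f(1) Z_subfield(3,1) k_sub(3)] f(2) restrict_restrict[OF Z_subfield(2), of \<rho>] by simp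
  }
  fix \<rho> assume "\<rho> \<in> places_Z \<pi>"
  then have f: "kplace Z \<rho>" "\<rho> \<inter> B \<times> UNIV = \<pi>" "Range \<rho> \<subseteq> k"
    unfolding places_Z_def by simp_all
  obtain \<rho>0 where \<rho>0: "kplace L \<rho>0" "\<rho>0 \<inter> Z \<times> UNIV = \<rho>" by (rule kplace_extend[OF f(1) Z_subfield(1) k_sub(3) cL(1) Z_subfield(3)])
  obtain i where i: "\<And>c. c \<in> K m \<Longrightarrow> (c, (F ^^ i) c) \<in> \<rho>0" by (rule kplace_K[OF \<rho>0(1) m(1) cL(2)]) blast
  define j where "j = (m - 1) * i"
  define \<rho>' where "\<rho>' = pull L (s ^^ j) \<rho>0"
  have pl: "kplace L \<rho>'" unfolding \<rho>'_def by (rule kplace_pull[OF cL(1) k_sub(2) s_pow_hom sZ \<rho>0(1)]) (use k_sub(3) in blast)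
  have fK: "(c, c) \<in> \<rho>'" if c: "c \<in> K m" for c
    using i[OF FK[OF c, of j]] F_inverse[OF c, of i] s_pow_K[OF c, of j] subsetD[OF cL(2) c] unfolding \<rho>'_def pull_def j_def by simp
  have rZ: "\<rho>' \<inter> Z \<times> UNIV = \<rho>"
    unfolding \<rho>'_def pull_restrict[OF Z_subfield(3), of "s ^^ j" "\<lambda>x. x", OF sZ, simplified] \<rho>0(2)
    by (rule pull_ident[OF kplaceD(6)[OF f(1)]]) simp
  have sr: "pull L s \<rho>' \<inter> Z \<times> UNIV = \<rho>"
    unfolding pull_restrict[OF Z_subfield(3), of "s" "\<lambda>x. x", OF sZ[of _ 1, simplified], simplified] rZ
    by (rule pull_ident[OF kplaceD(6)[OF f(1)]]) simp
  have "pull L s \<rho>' = push 1 \<rho>'"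
    by (rule places_L_frobenius[OF Z_subfield compositum_Z[symmetric] pl fK]) (simp_all only: sr push_restrict rZ push_id[OF f(3)])
  moreover have "\<rho>' \<inter> B \<times> UNIV = \<pi>" using f(2) restrict_restrict[OF Z_subfield(2), of \<rho>'] unfolding rZ by simp
  ultimately have "\<rho>' \<in> places_L \<pi>" unfolding places_L_def using pl fK by simp
  then show "\<rho> \<in> (\<lambda>\<rho>. \<rho> \<inter> Z \<times> UNIV) ` places_L \<pi>" using rZ by (intro image_eqI[of _ _ \<rho>']) simp_all
qed

section \<open>Group theory of the count\<close>

definition "G = aut_group R B M"
definition "N = Aut k'B M"

lemma G_group: "group G" unfolding G_def by (rule aut_group[OF M])

lemma N_eq: "N = {g \<in> carrier G. \<forall>x\<in>k'. g x = x}"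
proof (rule Set.set_eqI)
  fix g
  have "g x = x" if g: "g \<in> carrier G" "\<forall>x\<in>k'. g x = x" and x: "x \<in> k'B" for x
  proof -
    have id: "id \<in> subhom M M" by (simp add: ring_hom_def)
    have "g x = id x"
    proof (rule generate_hom_eq[OF M(1) M(1) aut_hom id, where S = "k' \<union> B"])
      show "g \<in> Aut B M" using g(1) unfolding G_def .
      show "k' \<union> B \<subseteq> M" using k_sub(4) M(2) by blast
      show "g y = id y" if "y \<in> k' \<union> B" for y using that g(2) aut_fix[OF g(1)[unfolded G_def]] by auto
      show "x \<in> generate_field R (k' \<union> B)" using x unfolding k'B_def compositum_def .
    qed
    then show ?thesis by simp
  qed
  moreover have "k' \<subseteq> k'B" "B \<subseteq> k'B" by (rule ck'B(2)) (rule ck'B(3))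
  ultimately show "g \<in> N \<longleftrightarrow> g \<in> {g \<in> carrier G. \<forall>x\<in>k'. g x = x}"
    unfolding N_def G_def aut_iff mem_Collect_eq by (meson subsetD)
qed

lemma N_subgroup: "subgroup N G" unfolding N_eq G_def by (rule fix_subgroup[OF M k_sub(4)])

lemma G_finite: "finite (carrier G)" unfolding G_def by (rule finite_aut_group[OF B M Mfin])

text \<open>On \<open>k'\<close> any \<open>h\<close> acts as a power of \<open>F\<close>, hence as
  a power of \<open>\<gamma>\<close>. Dividing by that power moves \<open>h\<close> into
  \<open>N\<close> without changing the conjugate, as the power commutes with
  \<open>\<gamma>\<close>.\<close>

lemma conj_by_N:
  assumes h: "h \<in> carrier G"
  shows "\<exists>n\<in>N. h \<otimes>\<^bsub>G\<^esub> \<gamma> \<otimes>\<^bsub>G\<^esub> inv\<^bsub>G\<^esub> h = n \<otimes>\<^bsub>G\<^esub> \<gamma> \<otimes>\<^bsub>G\<^esub> inv\<^bsub>G\<^esub> n"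
proof -
  interpret G: group G by (rule G_group)
  have hA: "h \<in> Aut B M" using h unfolding G_def .
  have g: "\<gamma> \<in> carrier G" unfolding G_def by (rule \<gamma>)
  obtain \<delta> where \<delta>: "\<delta> \<in> homs B" "\<And>x. x \<in> M \<Longrightarrow> \<delta> x = h x" by (rule aut_homs[OF M M(2) hA]) blast
  obtain i where i: "\<And>x. x \<in> K m \<Longrightarrow> \<delta> x = (F ^^ i) x" by (rule homs_power[OF homs_B_k[OF \<delta>(1)] m(1)]) blast
  define p where "p = \<gamma> [^]\<^bsub>G\<^esub> i"
  have p: "p \<in> carrier G" unfolding p_def using g by simp
  have pA: "p \<in> Aut B M" using p unfolding G_def .
  have hp: "h x = p x" if x: "x \<in> k'" for x
  proof -
    have xM: "x \<in> M" using x k_sub(4) by blast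
    have "h x = (F ^^ i) x" using \<delta>(2)[OF xM] i[of x] k'_sub_K x by auto
    also have "\<dots> = (\<gamma> ^^ i) x" using Fk'[OF x, of i] by simp
    also have "\<dots> = p x" unfolding p_def G_def using aut_pow[OF M \<gamma> xM] by simp
    finally show ?thesis .
  qed
  define n where "n = h \<otimes>\<^bsub>G\<^esub> inv\<^bsub>G\<^esub> p"
  have ip: "inv\<^bsub>G\<^esub> p \<in> Aut B M" using p unfolding G_def[symmetric] by simp
  have "n x = x" if x: "x \<in> k'" for x
  proof -
    have xM: "x \<in> M" using x k_sub(4) by blast
    have y: "(inv\<^bsub>G\<^esub> p) x \<in> k'"
    proof -
      obtain \<epsilon> where \<epsilon>: "\<epsilon> \<in> homs B" "\<And>x. x \<in> M \<Longrightarrow> \<epsilon> x = (inv\<^bsub>G\<^esub> p) x" by (rule aut_homs[OF M M(2) ip]) blast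
      show ?thesis using homs_k'[OF \<epsilon>(1) x] \<epsilon>(2)[OF xM] by simp
    qed
    have "n x = h ((inv\<^bsub>G\<^esub> p) x)" unfolding n_def using aut_apply[OF hA ip xM] unfolding G_def by simp
    also have "\<dots> = p ((inv\<^bsub>G\<^esub> p) x)" by (rule hp[OF y])
    also have "\<dots> = x" using aut_inv(2)[OF M pA xM] unfolding G_def by simp
    finally show ?thesis .
  qed
  then have nN: "n \<in> N" unfolding N_eq n_def using h p by simp
  have hn: "h = n \<otimes>\<^bsub>G\<^esub> p" unfolding n_def using h p by (simp add: G.m_assoc)
  have n: "n \<in> carrier G" using nN unfolding N_eq by simp
  have pc: "p \<otimes>\<^bsub>G\<^esub> \<gamma> \<otimes>\<^bsub>G\<^esub> inv\<^bsub>G\<^esub> p = \<gamma>"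
  proof -
    have "p \<otimes>\<^bsub>G\<^esub> \<gamma> = \<gamma> \<otimes>\<^bsub>G\<^esub> p" unfolding p_def using g G.nat_pow_Suc2[of \<gamma> i] by simp
    then show ?thesis using g p by (simp add: G.m_assoc)
  qed
  have "h \<otimes>\<^bsub>G\<^esub> \<gamma> \<otimes>\<^bsub>G\<^esub> inv\<^bsub>G\<^esub> h = n \<otimes>\<^bsub>G\<^esub> (p \<otimes>\<^bsub>G\<^esub> \<gamma> \<otimes>\<^bsub>G\<^esub> inv\<^bsub>G\<^esub> p) \<otimes>\<^bsub>G\<^esub> inv\<^bsub>G\<^esub> n"
    unfolding hn using n p g by (simp add: G.m_assoc G.inv_mult_group)
  then show ?thesis unfolding pc using nN by blast
qed

end

lemma card_eq_card_image_times:
  assumes "finite A" "\<And>a. a \<in> A \<Longrightarrow> card {x \<in> A. f x = f a} = c"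
  shows "card A = card (f ` A) * c"
proof -
  have "card A = (\<Sum>y\<in>f ` A. \<Sum>x\<in>{x \<in> A. f x = y}. 1)"
    using sum.image_gen[OF assms(1), of "\<lambda>_. 1 :: nat" f] by simp
  also have "\<dots> = (\<Sum>y\<in>f ` A. c)" by (rule sum.cong) (use assms(2) in auto)
  finally show ?thesis by simp
qed

context twist
begin

context
  fixes \<pi> \<rho> assumes pi: "Range \<pi> \<subseteq> k" and rho: "kplace M \<rho>" "\<rho> \<inter> B \<times> UNIV = \<pi>" "\<And>c. c \<in> k' \<Longrightarrow> (c, c) \<in> \<rho>"
begin

abbreviation "act g \<equiv> pull M g \<rho>"

lemma act_mult:
  assumes "g \<in> carrier G" "h \<in> carrier G"
  shows "pull M (h \<otimes>\<^bsub>G\<^esub> g) \<rho>' = pull M g (pull M h \<rho>')"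
proof -
  note a = assms[unfolded G_def]
  have "pull M g (pull M h \<rho>') = pull M (\<lambda>x. h (g x)) \<rho>'" by (rule pull_pull) (rule aut_closed[OF a(1)])
  also have "\<dots> = pull M (h \<otimes>\<^bsub>G\<^esub> g) \<rho>'"
    by (rule pull_cong) (simp add: G_def aut_apply[OF a(2,1)])
  finally show ?thesis ..
qed

lemma act_one: "Domain \<rho>' \<subseteq> M \<Longrightarrow> pull M \<one>\<^bsub>G\<^esub> \<rho>' = \<rho>'"
  by (rule pull_ident) (simp_all add: G_def aut_one)

lemma act_kplace: "g \<in> carrier G \<Longrightarrow> kplace M \<rho>' \<Longrightarrow> kplace M (pull M g \<rho>')"
  unfolding G_def by (rule kplace_pull[OF M(1) k_sub(1) aut_hom aut_fix]) (use kB in blast)+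

lemma act_restrict: "g \<in> carrier G \<Longrightarrow> pull M g \<rho>' \<inter> B \<times> UNIV = \<rho>' \<inter> B \<times> UNIV"
proof -
  assume "g \<in> carrier G"
  then have g: "g \<in> Aut B M" unfolding G_def .
  have "pull M g \<rho>' \<inter> B \<times> UNIV = pull B (\<lambda>x. x) (\<rho>' \<inter> B \<times> UNIV)"
    by (rule pull_restrict[OF M(2) aut_fix[OF g]])
  also have "\<dots> = \<rho>' \<inter> B \<times> UNIV" by (rule pull_ident) auto
  finally show ?thesis .
qed

lemma transitive:
  assumes "kplace M \<rho>'" "\<rho>' \<inter> B \<times> UNIV = \<pi>"
  obtains g where "g \<in> carrier G" "\<rho>' = act g"
proof -
  have "\<exists>g\<in>Aut B M. \<rho>' = act g"
    by (rule kplace_conj[OF normal_M Mfin B subset_refl M(2) rho(1) assms(1)]) (simp only: rho(2) assms(2))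
  then show thesis using that unfolding G_def by blast
qed

text \<open>\<open>g\<close> preserves \<open>k'\<close> and \<open>\<rho>\<close> is the identity
  there, so the value of \<open>g c\<close> under \<open>\<rho>\<close> is \<open>g c\<close>, while
  the hypothesis says that it is \<open>c\<close>.\<close>

lemma mem_N_of_act:
  assumes g: "g \<in> carrier G" and fx: "\<And>c. c \<in> k' \<Longrightarrow> (c, c) \<in> act g"
  shows "g \<in> N"
proof -
  have gA: "g \<in> Aut B M" using g unfolding G_def .
  obtain \<delta> where \<delta>: "\<delta> \<in> homs B" "\<And>x. x \<in> M \<Longrightarrow> \<delta> x = g x" by (rule aut_homs[OF M M(2) gA]) blast
  have "g c = c" if c: "c \<in> k'" for c
  proof -
    have "g c \<in> k'" using homs_k'[OF \<delta>(1) c] \<delta>(2)[of c] k_sub(4) c by auto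
    then have "(g c, g c) \<in> \<rho>" by (rule rho(3))
    moreover have "(g c, c) \<in> \<rho>" using fx[OF c] unfolding pull_def by simp
    ultimately show ?thesis using partial_homD(10)[OF kplaceD(2)[OF rho(1)]] by blast
  qed
  then show ?thesis unfolding N_eq using g by simp
qed

text \<open>Equality of places means equal primes and trivial action on the residue field, so the
  stabiliser of \<open>\<rho>\<close> is the inertia group of its prime.\<close>

definition "inertia = {g \<in> carrier G. act g = \<rho>}"
definition "Frob = {g \<in> carrier G. act g = push 1 \<rho>}"
definition "centr = {g \<in> N. g \<otimes>\<^bsub>G\<^esub> \<gamma> = \<gamma> \<otimes>\<^bsub>G\<^esub> g}"
definition "cjg g = g \<otimes>\<^bsub>G\<^esub> \<gamma> \<otimes>\<^bsub>G\<^esub> inv\<^bsub>G\<^esub> g"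

lemma inertia_N: "inertia \<subseteq> N"
  unfolding inertia_def using mem_N_of_act rho(3) by auto

text \<open>Orbit and stabiliser for the right action, with fibres the translates of inertia by
  \<open>g0\<close>. The subgroup \<open>A\<close> is \<open>G\<close> when \<open>Frob\<close> is
  counted and \<open>N\<close> when places are counted.\<close>

lemma act_coset:
  assumes g0: "g0 \<in> A" and A: "subgroup A G" "inertia \<subseteq> A"
  shows "bij_betw (\<lambda>x. x \<otimes>\<^bsub>G\<^esub> g0) inertia {g \<in> A. act g = act g0}"
proof -
  interpret G: group G by (rule G_group)
  interpret A: subgroup A G by (rule A(1))
  note Ac = A.subset[THEN subsetD]
  note g0c = Ac[OF g0]
  show ?thesis
    unfolding bij_betw_def
  proof (intro conjI inj_onI subset_antisym subsetI)
    show "x = y" if "x \<in> inertia" "y \<in> inertia" "x \<otimes>\<^bsub>G\<^esub> g0 = y \<otimes>\<^bsub>G\<^esub> g0" for x y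
      using that g0c G.r_cancel[of g0 x y] unfolding inertia_def by simp
    show "y \<in> {g \<in> A. act g = act g0}" if "y \<in> (\<lambda>x. x \<otimes>\<^bsub>G\<^esub> g0) ` inertia" for y
    proof -
      obtain x where x: "x \<in> inertia" "y = x \<otimes>\<^bsub>G\<^esub> g0" using \<open>y \<in> _\<close> by (auto elim: imageE)
      have "x \<in> carrier G" "act x = \<rho>" "x \<in> A" using x(1) A(2) unfolding inertia_def by auto
      then show ?thesis unfolding x(2) using act_mult[OF g0c, of x \<rho>] g0 A.m_closed by simp
    qed
    show "y \<in> (\<lambda>x. x \<otimes>\<^bsub>G\<^esub> g0) ` inertia" if "y \<in> {g \<in> A. act g = act g0}" for y
    proof (rule image_eqI)
      have y: "y \<in> carrier G" "act y = act g0" using that Ac by auto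
      show "y = y \<otimes>\<^bsub>G\<^esub> inv\<^bsub>G\<^esub> g0 \<otimes>\<^bsub>G\<^esub> g0" using y(1) g0c by (simp add: G.m_assoc)
      have "act (y \<otimes>\<^bsub>G\<^esub> inv\<^bsub>G\<^esub> g0) = pull M (inv\<^bsub>G\<^esub> g0) (act g0)" using act_mult[of "inv\<^bsub>G\<^esub> g0" y \<rho>] y g0c by simp
      also have "\<dots> = \<rho>" using act_mult[of "inv\<^bsub>G\<^esub> g0" g0 \<rho>] g0c act_one[OF kplaceD(6)[OF rho(1)]] by simp
      finally show "y \<otimes>\<^bsub>G\<^esub> inv\<^bsub>G\<^esub> g0 \<in> inertia" unfolding inertia_def using y(1) g0c by simp
    qed
  qed
qed

lemma conj_coset:
  assumes n0: "n0 \<in> N"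
  shows "bij_betw (\<lambda>x. n0 \<otimes>\<^bsub>G\<^esub> x) centr {n \<in> N. cjg n = cjg n0}"
proof -
  interpret G: group G by (rule G_group)
  interpret A: subgroup N G by (rule N_subgroup)
  note Nc = A.subset[THEN subsetD]
  note n0c = Nc[OF n0]
  have g: "\<gamma> \<in> carrier G" unfolding G_def by (rule \<gamma>)
  have c: "cjg (n0 \<otimes>\<^bsub>G\<^esub> x) = n0 \<otimes>\<^bsub>G\<^esub> cjg x \<otimes>\<^bsub>G\<^esub> inv\<^bsub>G\<^esub> n0" if "x \<in> N" for x
    unfolding cjg_def using n0c Nc[OF that] g by (simp add: G.m_assoc G.inv_mult_group)
  have e: "x \<otimes>\<^bsub>G\<^esub> \<gamma> = \<gamma> \<otimes>\<^bsub>G\<^esub> x \<longleftrightarrow> cjg x = \<gamma>" if "x \<in> N" for x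
    unfolding cjg_def using G.inv_solve_right'[of \<gamma> "x \<otimes>\<^bsub>G\<^esub> \<gamma>" x] Nc[OF that] g by auto
  show ?thesis
    unfolding bij_betw_def
  proof (intro conjI inj_onI subset_antisym subsetI)
    show "x = y" if "x \<in> centr" "y \<in> centr" "n0 \<otimes>\<^bsub>G\<^esub> x = n0 \<otimes>\<^bsub>G\<^esub> y" for x y
      using that n0c Nc G.l_cancel[of n0 x y] unfolding centr_def by simp
    show "y \<in> {n \<in> N. cjg n = cjg n0}" if "y \<in> (\<lambda>x. n0 \<otimes>\<^bsub>G\<^esub> x) ` centr" for y
    proof -
      obtain x where x: "x \<in> N" "cjg x = \<gamma>" "y = n0 \<otimes>\<^bsub>G\<^esub> x" using \<open>y \<in> _\<close> e unfolding centr_def by (auto elim: imageE)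
      then show ?thesis using c[OF x(1)] n0 unfolding cjg_def by simp
    qed
    show "y \<in> (\<lambda>x. n0 \<otimes>\<^bsub>G\<^esub> x) ` centr" if "y \<in> {n \<in> N. cjg n = cjg n0}" for y
    proof (rule image_eqI)
      have y: "y \<in> N" "cjg y = cjg n0" using that by auto
      note yc = Nc[OF y(1)]
      show "y = n0 \<otimes>\<^bsub>G\<^esub> (inv\<^bsub>G\<^esub> n0 \<otimes>\<^bsub>G\<^esub> y)" using yc n0c by (simp add: G.m_assoc[symmetric])
      have x: "inv\<^bsub>G\<^esub> n0 \<otimes>\<^bsub>G\<^esub> y \<in> N" using y(1) n0 by simp
      have "cjg (inv\<^bsub>G\<^esub> n0 \<otimes>\<^bsub>G\<^esub> y) = inv\<^bsub>G\<^esub> n0 \<otimes>\<^bsub>G\<^esub> cjg y \<otimes>\<^bsub>G\<^esub> n0"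
        unfolding cjg_def using n0c yc g by (simp add: G.m_assoc G.inv_mult_group)
      also have "cjg y = n0 \<otimes>\<^bsub>G\<^esub> \<gamma> \<otimes>\<^bsub>G\<^esub> inv\<^bsub>G\<^esub> n0" unfolding y(2) by (rule cjg_def)
      also have "inv\<^bsub>G\<^esub> n0 \<otimes>\<^bsub>G\<^esub> (n0 \<otimes>\<^bsub>G\<^esub> \<gamma> \<otimes>\<^bsub>G\<^esub> inv\<^bsub>G\<^esub> n0) \<otimes>\<^bsub>G\<^esub> n0 =
          inv\<^bsub>G\<^esub> n0 \<otimes>\<^bsub>G\<^esub> (n0 \<otimes>\<^bsub>G\<^esub> (\<gamma> \<otimes>\<^bsub>G\<^esub> (inv\<^bsub>G\<^esub> n0 \<otimes>\<^bsub>G\<^esub> n0)))"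
        using n0c g by (simp only: G.m_assoc G.m_closed G.inv_closed)
      also have "\<dots> = \<gamma>" using n0c g by (simp add: G.m_assoc[symmetric])
      finally show "inv\<^bsub>G\<^esub> n0 \<otimes>\<^bsub>G\<^esub> y \<in> centr" unfolding centr_def using e[OF x] x by simp
    qed
  qed
qed

text \<open>F \<circ> \<rho> lies over the same place of \<open>B\<close>, because the values of
  \<open>\<pi>\<close> lie in \<open>k\<close> and are fixed by \<open>F\<close>; transitivity
  realises it by some \<open>g\<close>.\<close>

lemma Frob_nonempty: obtains g where "g \<in> Frob"
proof (rule transitive[OF kplace_push[OF rho(1), of 1]])
  show "push 1 \<rho> \<inter> B \<times> UNIV = \<pi>" unfolding push_restrict rho(2) by (rule push_id[OF pi])
  fix g assume "g \<in> carrier G" "push 1 \<rho> = act g"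
  then show thesis by (intro that[of g]) (simp add: Frob_def)
qed

lemma act_N_restrict: "n \<in> N \<Longrightarrow> c \<in> k' \<Longrightarrow> (c, c) \<in> act n"
  using rho(3)[of c] k_sub(4) unfolding N_eq pull_def by auto

text \<open>Composing the Frobenius equation of the conjugate with \<open>n\<close> on the right
  gives the equation for \<open>\<gamma>\<close> and the place \<rho> \<circ> n, and composing with
  the inverse of \<open>n\<close> goes back.\<close>

lemma Frob_conj:
  assumes n: "n \<in> carrier G"
  shows "cjg n \<in> Frob \<longleftrightarrow> pull M \<gamma> (act n) = push 1 (act n)"
proof -
  interpret G: group G by (rule G_group)
  have g: "\<gamma> \<in> carrier G" unfolding G_def by (rule \<gamma>)
  have cn: "cjg n \<in> carrier G" unfolding cjg_def using n g by simp
  have D: "Domain (act h) \<subseteq> M" for h unfolding pull_def by blast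
  have D': "Domain (push 1 \<rho>) \<subseteq> M" unfolding Domain_push by (rule kplaceD(6)[OF rho(1)])
  have e: "pull M n (act (cjg n)) = pull M \<gamma> (act n)"
    using act_mult[OF n cn, of \<rho>] act_mult[OF g n, of \<rho>] n g unfolding cjg_def by (simp add: G.m_assoc)
  have canc: "a = b" if ab: "pull M n a = pull M n b" "Domain a \<subseteq> M" "Domain b \<subseteq> M" for a b
  proof -
    have "pull M (inv\<^bsub>G\<^esub> n) (pull M n a) = a" "pull M (inv\<^bsub>G\<^esub> n) (pull M n b) = b"
      using act_mult[of "inv\<^bsub>G\<^esub> n" n] n act_one ab(2,3) by simp_all
    then show ?thesis unfolding ab(1) by (rule trans[OF sym])
  qed
  have "cjg n \<in> Frob \<longleftrightarrow> act (cjg n) = push 1 \<rho>" unfolding Frob_def using cn by simp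
  also have "\<dots> \<longleftrightarrow> pull M n (act (cjg n)) = pull M n (push 1 \<rho>)"
    by (rule iffI) (simp, erule canc[OF _ D D'])
  finally show ?thesis unfolding e push_pull .
qed

lemma act_image: "(\<lambda>n. act n) ` {n \<in> N. cjg n \<in> Frob} = places_M \<pi>"
proof (intro subset_antisym subsetI)
  have Nc: "n \<in> carrier G" if "n \<in> N" for n using that unfolding N_eq by simp
  show "\<rho>' \<in> places_M \<pi>" if "\<rho>' \<in> (\<lambda>n. act n) ` {n \<in> N. cjg n \<in> Frob}" for \<rho>'
  proof -
    obtain n where n: "n \<in> N" "cjg n \<in> Frob" "\<rho>' = act n" using \<open>\<rho>' \<in> _\<close> by (auto elim: imageE)
    show ?thesis
      unfolding places_M_def n(3)
      using act_kplace[OF Nc[OF n(1)] rho(1)] act_restrict[OF Nc[OF n(1)], of \<rho>] rho(2) act_N_restrict[OF n(1)]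
        Frob_conj[OF Nc[OF n(1)]] n(2) by simp
  qed
  show "\<rho>' \<in> (\<lambda>n. act n) ` {n \<in> N. cjg n \<in> Frob}" if "\<rho>' \<in> places_M \<pi>" for \<rho>'
  proof -
    have f: "kplace M \<rho>'" "\<rho>' \<inter> B \<times> UNIV = \<pi>" "\<And>c. c \<in> k' \<Longrightarrow> (c, c) \<in> \<rho>'" "pull M \<gamma> \<rho>' = push 1 \<rho>'"
      using \<open>\<rho>' \<in> _\<close> unfolding places_M_def by simp_all
    obtain g where g: "g \<in> carrier G" "\<rho>' = act g" by (rule transitive[OF f(1,2)])
    have "g \<in> N" by (rule mem_N_of_act[OF g(1)]) (use f(3) in \<open>simp add: g(2)[symmetric]\<close>)
    moreover have "cjg g \<in> Frob" using Frob_conj[OF g(1)] f(4) unfolding g(2) by simp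
    ultimately show ?thesis unfolding g(2) by (intro imageI) simp
  qed
qed

text \<open>\<open>Frob\<close> is a fibre of the action, so its size can replace that of inertia.
  The identity is multiplied out to remain in the natural numbers; positivity of the two factors
  permits the later division.\<close>

theorem card_places_M:
  "finite (places_M \<pi>)" "card Frob > 0" "card (cjg ` N) > 0"
  "card (places_M \<pi>) * card (cjg ` N) * card Frob = card N * card (Frob \<inter> cjg ` N)"
proof -
  interpret G: group G by (rule G_group)
  have Nf: "finite N" using G_finite unfolding N_eq by simp
  let ?T = "{n \<in> N. cjg n \<in> Frob}"
  have Tf: "finite ?T" using Nf by simp
  show "finite (places_M \<pi>)" unfolding act_image[symmetric] using Tf by simp
  have Ff: "finite Frob" unfolding Frob_def using G_finite by simp
  obtain g0 where g0: "g0 \<in> Frob" by (rule Frob_nonempty)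
  then show Fpos: "card Frob > 0" using Ff card_gt_0_iff by blast
  have "N \<noteq> {}" using subgroup.one_closed[OF N_subgroup] by blast
  then show "card (cjg ` N) > 0" using Nf by (simp add: card_gt_0_iff)
  have g0': "g0 \<in> carrier G" "act g0 = push 1 \<rho>" using g0 unfolding Frob_def by simp_all
  have SI: "card Frob = card inertia"
    using bij_betw_same_card[OF act_coset[OF g0'(1) G.subgroup_self]] g0'(2) unfolding Frob_def inertia_def by simp
  have cN: "card {n \<in> N. cjg n = cjg a} = card centr" if "a \<in> N" for a
    by (rule bij_betw_same_card[OF conj_coset[OF that], symmetric])
  have 1: "card N = card (cjg ` N) * card centr" by (rule card_eq_card_image_times[OF Nf cN])
  have "card {n \<in> ?T. cjg n = cjg a} = card centr" if a: "a \<in> ?T" for a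
  proof -
    have "{n \<in> ?T. cjg n = cjg a} = {n \<in> N. cjg n = cjg a}" using a by auto
    then show ?thesis using cN a by simp
  qed
  then have "card ?T = card (cjg ` ?T) * card centr" by (rule card_eq_card_image_times[OF Tf])
  moreover have "cjg ` ?T = Frob \<inter> cjg ` N" by blast
  ultimately have 2: "card ?T = card (Frob \<inter> cjg ` N) * card centr" by simp
  have "card {n \<in> ?T. act n = act a} = card inertia" if a: "a \<in> ?T" for a
  proof -
    have Nc: "n \<in> carrier G" if "n \<in> N" for n using that unfolding N_eq by simp
    have "{n \<in> ?T. act n = act a} = {n \<in> N. act n = act a}"
      using a Frob_conj[OF Nc] by auto
    then show ?thesis using bij_betw_same_card[OF act_coset[OF _ N_subgroup inertia_N, of a]] a by simp
  qed
  then have "card ?T = card ((\<lambda>n. act n) ` ?T) * card inertia" by (rule card_eq_card_image_times[OF Tf])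
  then have 3: "card ?T = card (places_M \<pi>) * card Frob" unfolding act_image SI .
  have "card (places_M \<pi>) * card (cjg ` N) * card Frob = card ?T * card (cjg ` N)" unfolding 3 by simp
  also have "\<dots> = card N * card (Frob \<inter> cjg ` N)" unfolding 1 2 by simp
  finally show "card (places_M \<pi>) * card (cjg ` N) * card Frob = card N * card (Frob \<inter> cjg ` N)" .
qed

lemma conj_image: "cjg ` N = conjugacy_class G \<gamma>"
proof -
  have g: "\<gamma> \<in> carrier G" unfolding G_def by (rule \<gamma>)
  have "conjugacy_class G \<gamma> = cjg ` carrier G"
    unfolding conjugacy_class_def orbit_def cjg_def using g by auto
  also have "\<dots> = cjg ` N"
    using conj_by_N unfolding cjg_def N_eq by auto
  finally show ?thesis ..
qed

end

end

section \<open>Primes and places\<close>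

context field
begin

lemma mem_maximal_ideal:
  assumes V: "subring V R"
  shows "x \<in> maximal_ideal R V \<longleftrightarrow> x \<in> V \<and> (x = \<zero> \<or> inv x \<notin> V)"
proof -
  note s = subringE[OF V]
  have "x \<in> Units (R\<lparr>carrier := V\<rparr>) \<longleftrightarrow> x \<noteq> \<zero> \<and> inv x \<in> V" if x: "x \<in> V"
  proof
    assume "x \<in> Units (R\<lparr>carrier := V\<rparr>)"
    then obtain y where y: "y \<in> V" "y \<otimes> x = \<one>" "x \<otimes> y = \<one>" unfolding Units_def by auto
    have c: "x \<in> carrier R" "y \<in> carrier R" using x y(1) s(1) by auto
    have "x \<noteq> \<zero>" using y(2) c by auto
    moreover have "inv x = y" using comm_inv_char[OF c y(3)] .
    ultimately show "x \<noteq> \<zero> \<and> inv x \<in> V" using y(1) by simp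
  next
    assume a: "x \<noteq> \<zero> \<and> inv x \<in> V"
    then have "x \<in> Units R" using x s(1) field_Units by auto
    then have "inv x \<otimes> x = \<one>" "x \<otimes> inv x = \<one>" by simp_all
    then show "x \<in> Units (R\<lparr>carrier := V\<rparr>)" unfolding Units_def using a x by auto
  qed
  then show ?thesis unfolding maximal_ideal_def by blast
qed

text \<open>The residue map on those elements of \<open>V\<close> whose residue lies in
  \<open>k\<close>. For every residue field this is a partial homomorphism, and for a rational prime
  it is the whole residue map.\<close>

definition residue_rel :: "'a set \<Rightarrow> 'a set \<Rightarrow> ('a \<times> 'a) set" where
  "residue_rel V k = {(x, c). x \<in> V \<and> c \<in> k \<and> x \<ominus> c \<in> maximal_ideal R V}"

context
  fixes T V assumes T: "subfield T R" and val: "valuation_ring_of R T V"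
begin

lemma V_sub: "subring V R" "V \<subseteq> T" "V \<subseteq> carrier R" "x \<in> T \<Longrightarrow> x \<noteq> \<zero> \<Longrightarrow> x \<in> V \<or> inv x \<in> V"
  using val subringE(1)[of V R] unfolding valuation_ring_of_def by auto

lemmas sV = subringE[OF V_sub(1)]
lemmas max_iff = mem_maximal_ideal[OF V_sub(1)]

lemma max_zero: "\<zero> \<in> maximal_ideal R V" using max_iff sV(2) by simp

lemma max_mult:
  assumes x: "x \<in> maximal_ideal R V" and v: "v \<in> V"
  shows "x \<otimes> v \<in> maximal_ideal R V"
proof (rule ccontr)
  assume n: "x \<otimes> v \<notin> maximal_ideal R V"
  have xV: "x \<in> V" using x max_iff by simp
  have c: "x \<in> carrier R" "v \<in> carrier R" using xV v V_sub(3) by auto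
  have p: "x \<otimes> v \<in> V" by (rule sV(6)[OF xV v])
  then have nz: "x \<otimes> v \<noteq> \<zero>" and i: "inv (x \<otimes> v) \<in> V" using n max_iff[of "x \<otimes> v"] by auto
  then have nz': "x \<noteq> \<zero>" "v \<noteq> \<zero>" using c by auto
  have U: "x \<in> Units R" "v \<in> Units R" using nz' c field_Units by auto
  have pU: "x \<otimes> v \<in> Units R" and ic: "inv (x \<otimes> v) \<in> carrier R"
    using nz c field_Units i V_sub(3) by auto
  have "x \<otimes> (inv (x \<otimes> v) \<otimes> v) = x \<otimes> v \<otimes> inv (x \<otimes> v)" using c ic by (simp add: m_ac)
  then have "x \<otimes> (inv (x \<otimes> v) \<otimes> v) = \<one>" using pU by simp
  then have "inv x = inv (x \<otimes> v) \<otimes> v" using c ic by (intro comm_inv_char) simp_all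
  then have "inv x \<in> V" using sV(6)[OF i v] by simp
  then show False using x nz'(1) max_iff by simp
qed

text \<open>One of \<open>x/y\<close> and \<open>y/x\<close> lies in \<open>V\<close>, so the sum is
  an element of \<open>V\<close> times one of the summands.\<close>

lemma max_add:
  assumes x: "x \<in> maximal_ideal R V" and y: "y \<in> maximal_ideal R V"
  shows "x \<oplus> y \<in> maximal_ideal R V"
proof -
  have aux: "a \<oplus> b \<in> maximal_ideal R V" if ab: "a \<in> maximal_ideal R V" "b \<in> maximal_ideal R V" "b \<noteq> \<zero>" "a \<otimes> inv b \<in> V" for a b
  proof -
    have V: "a \<in> V" "b \<in> V" using ab(1,2) max_iff by simp_all
    then have c: "a \<in> carrier R" "b \<in> carrier R" using V_sub(3) by auto
    have U: "b \<in> Units R" using ab(3) c field_Units by auto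
    have "a \<oplus> b = b \<otimes> (a \<otimes> inv b \<oplus> \<one>)"
    proof -
      have "b \<otimes> (a \<otimes> inv b \<oplus> \<one>) = a \<otimes> (b \<otimes> inv b) \<oplus> b" using c U by (simp add: r_distr m_lcomm)
      then show ?thesis using U c by simp
    qed
    then show ?thesis using max_mult[OF ab(2) sV(7)[OF ab(4) sV(3)]] by simp
  qed
  have V: "x \<in> V" "y \<in> V" using x y max_iff by simp_all
  then have c: "x \<in> carrier R" "y \<in> carrier R" using V_sub(3) by auto
  show ?thesis
  proof (cases "x = \<zero> \<or> y = \<zero>")
    case True then show ?thesis using x y c by auto
  next
    case False
    then have U: "x \<in> Units R" "y \<in> Units R" using c field_Units by auto
    have xyT: "x \<in> T - {\<zero>}" "y \<in> T - {\<zero>}" using V V_sub(2) False by auto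
    have "x \<otimes> inv y \<in> T" "x \<otimes> inv y \<noteq> \<zero>"
      using subfield_m_inv(1)[OF T] subringE(6)[OF subfieldE(1)[OF T]] xyT U integral_iff[of x "inv y"] c by auto
    then have "x \<otimes> inv y \<in> V \<or> inv (x \<otimes> inv y) \<in> V" by (rule V_sub(4))
    moreover have "inv (x \<otimes> inv y) = y \<otimes> inv x"
    proof (rule comm_inv_char)
      have "inv y \<otimes> (y \<otimes> inv x) = (inv y \<otimes> y) \<otimes> inv x" using U c by (simp only: m_assoc Units_inv_closed)
      then have "x \<otimes> inv y \<otimes> (y \<otimes> inv x) = x \<otimes> inv x" using U c by (simp add: m_assoc)
      then show "x \<otimes> inv y \<otimes> (y \<otimes> inv x) = \<one>" using U c by simp
    qed (use U c in simp_all)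
    ultimately consider "x \<otimes> inv y \<in> V" | "y \<otimes> inv x \<in> V" by auto
    then show ?thesis
    proof cases
      case 1 then show ?thesis using aux[OF x y] False by simp
    next
      case 2 then show ?thesis using aux[OF y x] False c by (simp add: a_comm)
    qed
  qed
qed

lemma max_neg: "x \<in> maximal_ideal R V \<Longrightarrow> \<ominus> x \<in> maximal_ideal R V"
proof -
  assume x: "x \<in> maximal_ideal R V"
  then have "x \<in> carrier R" using max_iff V_sub(3) by auto
  then have "\<ominus> x = x \<otimes> (\<ominus> \<one>)" by (simp add: r_minus)
  then show ?thesis using max_mult[OF x sV(5)[OF sV(3)]] by simp
qed

lemma one_not_max: "\<one> \<notin> maximal_ideal R V" using max_iff sV(3) by simp

abbreviation "VR \<equiv> R\<lparr>carrier := V\<rparr>"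

lemma max_ideal: "ideal (maximal_ideal R V) VR"
proof (rule idealI)
  show r: "ring VR" by (rule subring_is_ring[OF V_sub(1)])
  show "subgroup (maximal_ideal R V) (add_monoid VR)"
  proof (rule group.subgroupI)
    show "group (add_monoid VR)" using abelian_group.a_group[OF ring.is_abelian_group[OF r]] .
    show "maximal_ideal R V \<subseteq> carrier (add_monoid VR)" unfolding maximal_ideal_def by auto
    show "maximal_ideal R V \<noteq> {}" using max_zero by blast
    show "inv\<^bsub>add_monoid VR\<^esub> a \<in> maximal_ideal R V" if "a \<in> maximal_ideal R V" for a
    proof -
      have "inv\<^bsub>add_monoid VR\<^esub> a = \<ominus> a" using a_inv_sub[OF V_sub(1), of a] that max_iff unfolding a_inv_def by auto
      then show ?thesis using max_neg[OF that] by simp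
    qed
    show "a \<otimes>\<^bsub>add_monoid VR\<^esub> b \<in> maximal_ideal R V" if "a \<in> maximal_ideal R V" "b \<in> maximal_ideal R V" for a b
      using max_add[OF that] by simp
  qed
  fix a x assume a: "a \<in> maximal_ideal R V" and "x \<in> carrier VR"
  then have x: "x \<in> V" by simp
  show "a \<otimes>\<^bsub>VR\<^esub> x \<in> maximal_ideal R V" using max_mult[OF a x] by simp
  have "a \<in> carrier R" "x \<in> carrier R" using a x max_iff V_sub(3) by auto
  then have "x \<otimes> a = a \<otimes> x" by (simp add: m_comm)
  then show "x \<otimes>\<^bsub>VR\<^esub> a \<in> maximal_ideal R V" using max_mult[OF a x] by simp
qed

lemma residue_class_eq: "residue_class R V x = maximal_ideal R V +>\<^bsub>VR\<^esub> x"
  unfolding residue_class_def a_r_coset_def' by simp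

lemma residue_hom: "ring_hom_ring VR (residue_field R V) (residue_class R V)"
proof -
  have "residue_class R V = (+>\<^bsub>VR\<^esub>) (maximal_ideal R V)" using residue_class_eq by (rule ext)
  then show ?thesis unfolding residue_field_def using ideal.rcos_ring_hom_ring[OF max_ideal] by simp
qed

lemma residue_carrier: "carrier (residue_field R V) = residue_class R V ` V"
  unfolding residue_field_def FactRing_def A_RCOSETS_def' residue_class_eq[abs_def] by auto

lemma residue_class_mem: "y \<in> residue_class R V x \<longleftrightarrow> (\<exists>h\<in>maximal_ideal R V. y = h \<oplus> x)"
  unfolding residue_class_def a_r_coset_def' by auto

lemma residue_class_iff:
  assumes "x \<in> V" "y \<in> V"
  shows "residue_class R V x = residue_class R V y \<longleftrightarrow> x \<ominus> y \<in> maximal_ideal R V"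
proof -
  interpret S: ring VR by (rule subring_is_ring[OF V_sub(1)])
  have "x \<ominus>\<^bsub>VR\<^esub> y = x \<ominus> y" using a_inv_sub[OF V_sub(1) assms(2)] by (simp add: a_minus_def)
  then show ?thesis unfolding residue_class_eq using S.quotient_eq_iff_same_a_r_cos[OF max_ideal, of x y] assms by simp
qed

lemma residue_zero: "x \<in> V \<Longrightarrow> residue_class R V x = \<zero>\<^bsub>residue_field R V\<^esub> \<longleftrightarrow> x \<in> maximal_ideal R V"
proof -
  assume x: "x \<in> V"
  interpret h: ring_hom_ring VR "residue_field R V" "residue_class R V" by (rule residue_hom)
  have "x \<ominus> \<zero> = x" using x V_sub(3) by (auto simp: minus_eq)
  then show ?thesis using residue_class_iff[OF x sV(2)] h.hom_zero by simp
qed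

lemma residue_rel:
  assumes k: "subfield k R" "k \<subseteq> V"
  shows "partial_hom (residue_rel V k)" "\<And>c. c \<in> k \<Longrightarrow> (c, c) \<in> residue_rel V k"
    "\<And>x. x \<in> maximal_ideal R V \<Longrightarrow> (x, \<zero>) \<in> residue_rel V k" "Range (residue_rel V k) \<subseteq> k" "Domain (residue_rel V k) \<subseteq> V"
proof -
  note sk = subringE[OF subfieldE(1)[OF k(1)]]
  note kc = subfieldE(3)[OF k(1), THEN subsetD] and Vc = V_sub(3)[THEN subsetD]
  have mk: "(x, c) \<in> residue_rel V k" if "x \<in> V" "c \<in> k" "x \<ominus> c \<in> maximal_ideal R V" for x c
    unfolding residue_rel_def using that by simp
  have dest: "x \<in> V" "c \<in> k" "x \<ominus> c \<in> maximal_ideal R V" "x \<in> carrier R" "c \<in> carrier R"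
    if "(x, c) \<in> residue_rel V k" for x c
    using that kc Vc unfolding residue_rel_def by simp_all
  show ck: "(c, c) \<in> residue_rel V k" if "c \<in> k" for c
    using mk[of c c] that k(2) max_zero kc by (auto simp: minus_eq r_neg)
  show mz: "(x, \<zero>) \<in> residue_rel V k" if "x \<in> maximal_ideal R V" for x
    using mk[of x \<zero>] that max_iff sk(2) Vc by (auto simp: minus_eq)
  show "Range (residue_rel V k) \<subseteq> k" "Domain (residue_rel V k) \<subseteq> V" using dest(1,2) by blast+
  show "partial_hom (residue_rel V k)"
    unfolding partial_hom_def
  proof (intro conjI allI impI)
    show "residue_rel V k \<subseteq> carrier R \<times> carrier R" using dest(4,5) by auto
    show "(\<one>, \<one>) \<in> residue_rel V k" by (rule ck[OF sk(3)])
    show "(\<ominus> x, \<ominus> c) \<in> residue_rel V k" if h: "(x, c) \<in> residue_rel V k" for x c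
    proof (rule mk[OF sV(5)[OF dest(1)[OF h]] sk(5)[OF dest(2)[OF h]]])
      have "\<ominus> x \<ominus> (\<ominus> c) = \<ominus> (x \<ominus> c)" using dest(4,5)[OF h] by (simp add: minus_eq minus_add)
      then show "\<ominus> x \<ominus> (\<ominus> c) \<in> maximal_ideal R V" using max_neg[OF dest(3)[OF h]] by simp
    qed
    fix x c x' c' assume h: "(x, c) \<in> residue_rel V k" and h': "(x', c') \<in> residue_rel V k"
    note cc = dest(4,5)[OF h] dest(4,5)[OF h']
    show "(x \<oplus> x', c \<oplus> c') \<in> residue_rel V k"
    proof (rule mk[OF sV(7)[OF dest(1)[OF h] dest(1)[OF h']] sk(7)[OF dest(2)[OF h] dest(2)[OF h']]])
      have "x \<oplus> x' \<ominus> (c \<oplus> c') = (x \<ominus> c) \<oplus> (x' \<ominus> c')" using cc by (simp add: minus_eq minus_add a_ac)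
      then show "x \<oplus> x' \<ominus> (c \<oplus> c') \<in> maximal_ideal R V" using max_add[OF dest(3)[OF h] dest(3)[OF h']] by simp
    qed
    show "(x \<otimes> x', c \<otimes> c') \<in> residue_rel V k"
    proof (rule mk[OF sV(6)[OF dest(1)[OF h] dest(1)[OF h']] sk(6)[OF dest(2)[OF h] dest(2)[OF h']]])
      have "(x \<ominus> c) \<otimes> x' \<oplus> (x' \<ominus> c') \<otimes> c = (x \<otimes> x' \<ominus> c \<otimes> x') \<oplus> (x' \<otimes> c \<ominus> c' \<otimes> c)"
        using cc by (simp add: minus_eq l_distr l_minus)
      also have "\<dots> = x \<otimes> x' \<ominus> c \<otimes> c'" using cc by (simp add: minus_eq m_comm a_assoc r_neg1 r_neg2 l_neg)
      finally show "x \<otimes> x' \<ominus> c \<otimes> c' \<in> maximal_ideal R V"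
        using max_add[OF max_mult[OF dest(3)[OF h] dest(1)[OF h']] max_mult[OF dest(3)[OF h'], of c]] dest(2)[OF h] k(2) by auto
    qed
  next
    fix y assume h: "(\<zero>, y) \<in> residue_rel V k"
    have yc: "y \<in> carrier R" "y \<in> k" by (rule dest(5)[OF h], rule dest(2)[OF h])
    have m: "y \<in> maximal_ideal R V" using max_neg[OF dest(3)[OF h]] yc(1) by (simp add: minus_eq)
    show "y = \<zero>"
    proof (rule ccontr)
      assume "y \<noteq> \<zero>"
      then have "inv y \<in> V" using subfield_m_inv(1)[OF k(1), of y] yc(2) k(2) by blast
      then show False using m max_iff[of y] \<open>y \<noteq> \<zero>\<close> by simp
    qed
  qed
qed

lemma prime_degree_rational:
  assumes k: "subfield k R" "k \<subseteq> V" and rat: "carrier (residue_field R V) = residue_class R V ` k"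
  shows "prime_degree R k V = 1"
proof -
  interpret h: ring_hom_ring VR "residue_field R V" "residue_class R V" by (rule residue_hom)
  have "field (VR\<lparr>carrier := k\<rparr>)" using subfield_iff(2)[OF k(1)] by simp
  then have kV: "subfield k VR" by (rule h.R.subfield_iff(1)) (use k(2) in simp)
  have ne: "\<one>\<^bsub>residue_field R V\<^esub> \<noteq> \<zero>\<^bsub>residue_field R V\<^esub>"
    using residue_zero[OF sV(3)] one_not_max h.hom_one by simp
  have sf: "subfield (residue_class R V ` k) (residue_field R V)" by (rule h.img_is_subfield(2)[OF kV ne])
  show ?thesis
    unfolding prime_degree_def rat using h.S.dimI[OF sf h.S.dimension_one[OF sf]] by (simp add: over_def)
qed

end

end

context field
begin

lemma valuation_ring_inv:
  assumes val: "valuation_ring_of R T V" and T: "subfield T R" and x: "x \<in> T" "x \<notin> V"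
  shows "x \<noteq> \<zero>" "inv x \<in> maximal_ideal R V"
proof -
  note s = V_sub[OF T val]
  show nz: "x \<noteq> \<zero>" using x(2) subringE(2)[OF s(1)] by auto
  have "inv x \<in> V" using s(4)[OF x(1) nz] x(2) by blast
  moreover have "x \<in> Units R" using nz x(1) subfieldE(3)[OF T] field_Units by auto
  ultimately show "inv x \<in> maximal_ideal R V" using mem_maximal_ideal[OF s(1)] x(2) by simp
qed

text \<open>A coefficient of minimal valuation is found by induction: the earlier choice
  \<open>b\<close> is kept or replaced by \<open>a\<close>, depending on which of the two quotients
  lies in \<open>V\<close>.\<close>

lemma valuation_ring_normalize:
  assumes val: "valuation_ring_of R T V" and T: "subfield T R"
  shows "set q \<subseteq> T \<Longrightarrow> \<exists>a\<in>set q. a \<noteq> \<zero> \<Longrightarrow> \<exists>b\<in>set q. b \<noteq> \<zero> \<and> (\<forall>a\<in>set q. inv b \<otimes> a \<in> V)"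
proof (induction q)
  case (Cons a q)
  note s = V_sub[OF T val]
  note sV = subringE[OF s(1)] and Tc = subfieldE(3)[OF T, THEN subsetD]
  have aT: "a \<in> T" and qT: "set q \<subseteq> T" using Cons.prems(1) by simp_all
  have ac: "a \<in> carrier R" by (rule Tc[OF aT])
  show ?case
  proof (cases "\<exists>c\<in>set q. c \<noteq> \<zero>")
    case False
    then have z: "c = \<zero>" if "c \<in> set q" for c using that by blast
    have nz: "a \<noteq> \<zero>" using Cons.prems(2) False by auto
    have U: "a \<in> Units R" using nz ac field_Units by auto
    have "inv a \<otimes> c \<in> V" if "c \<in> set (a # q)" for c
      using that z[of c] U sV(2,3) by auto
    then show ?thesis using nz by auto
  next
    case True
    then obtain b where b: "b \<in> set q" "b \<noteq> \<zero>" "\<forall>c\<in>set q. inv b \<otimes> c \<in> V" using Cons.IH[OF qT] by blast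
    have bT: "b \<in> T" using b(1) qT by blast
    have bU: "b \<in> Units R" using Tc[OF bT] b(2) field_Units by auto
    show ?thesis
    proof (cases "inv b \<otimes> a \<in> V")
      case True then show ?thesis using b by auto
    next
      case False
      have nz: "a \<noteq> \<zero>" using False sV(2) bU by auto
      have aU: "a \<in> Units R" using nz ac field_Units by auto
      have "inv b \<in> T" using subfield_m_inv(1)[OF T] bT b(2) by blast
      then have "inv b \<otimes> a \<in> T" using subringE(6)[OF subfieldE(1)[OF T]] aT by blast
      moreover have "inv b \<otimes> a \<noteq> \<zero>" using False sV(2) by metis
      ultimately have "inv (inv b \<otimes> a) \<in> V" using s(4)[of "inv b \<otimes> a"] False by blast
      moreover have "inv (inv b \<otimes> a) = inv a \<otimes> b"
      proof (rule comm_inv_char)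
        have "inv b \<otimes> a \<otimes> (inv a \<otimes> b) = inv b \<otimes> ((a \<otimes> inv a) \<otimes> b)" using aU bU by (simp only: m_assoc Units_closed Units_inv_closed m_closed)
        then show "inv b \<otimes> a \<otimes> (inv a \<otimes> b) = \<one>" using aU bU by (simp add: Units_closed)
      qed (use aU bU in \<open>simp_all add: Units_closed\<close>)
      ultimately have ab: "inv a \<otimes> b \<in> V" by simp
      have "inv a \<otimes> c \<in> V" if c: "c \<in> set (a # q)" for c
      proof (cases "c = a")
        case True then show ?thesis using aU sV(3) by simp
      next
        case False
        then have cq: "c \<in> set q" using c by simp
        have cc: "c \<in> carrier R" using cq qT Tc by blast
        have "(inv a \<otimes> b) \<otimes> (inv b \<otimes> c) = inv a \<otimes> ((b \<otimes> inv b) \<otimes> c)" using aU bU cc by (simp only: m_assoc Units_closed Units_inv_closed m_closed)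
        then have "(inv a \<otimes> b) \<otimes> (inv b \<otimes> c) = inv a \<otimes> c" using bU cc by simp
        then show ?thesis using sV(6)[OF ab bspec[OF b(3) cq]] by simp
      qed
      then show ?thesis using nz by (intro bexI[of _ a]) simp_all
    qed
  qed
qed simp

lemma eval_residue:
  assumes val: "valuation_ring_of R T V" and T: "subfield T R" and x: "x \<in> V" and k: "k \<subseteq> V"
  shows "set ps \<subseteq> residue_rel V k \<Longrightarrow> eval (map fst ps) x \<ominus> eval (map snd ps) x \<in> maximal_ideal R V"
proof (induction ps)
  case Nil show ?case using max_zero[OF T val] by (simp add: minus_eq)
next
  case (Cons z ps)
  note s = V_sub[OF T val]
  note Vc = s(3)[THEN subsetD]
  obtain a c where z: "z = (a, c)" by (cases z)
  have ac: "a \<in> V" "c \<in> V" "a \<ominus> c \<in> maximal_ideal R V" using Cons.prems k unfolding z residue_rel_def by auto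
  have fs: "set (map fst ps) \<subseteq> V" "set (map snd ps) \<subseteq> V" using Cons.prems k unfolding residue_rel_def by auto
  have e: "eval (map fst ps) x \<in> carrier R" "eval (map snd ps) x \<in> carrier R"
    using eval_in_subring[OF s(1) fs(1) x] eval_in_subring[OF s(1) fs(2) x] Vc by auto
  have xn: "x [^] (n::nat) \<in> V" for n
    by (induction n) (use subringE(3,6)[OF s(1)] x in simp_all)
  have "eval (map fst (z # ps)) x \<ominus> eval (map snd (z # ps)) x =
      (a \<ominus> c) \<otimes> x [^] length ps \<oplus> (eval (map fst ps) x \<ominus> eval (map snd ps) x)"
    using e Vc[OF ac(1)] Vc[OF ac(2)] Vc[OF xn] by (simp add: z minus_eq l_distr minus_add l_minus a_ac)
  then show ?case using max_add[OF T val max_mult[OF T val ac(3) xn] Cons.IH] Cons.prems by simp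
qed

text \<open>\<open>g\<close> preserves \<open>V\<close> and therefore its nonunits, so taking images
  of cosets is the action on representatives.\<close>

lemma aut_residue:
  assumes val: "valuation_ring_of R T V" and T: "subfield T R" and g: "g \<in> Aut E T" "g ` V = V" and x: "x \<in> V"
  shows "g ` residue_class R V x = residue_class R V (g x)"
proof -
  note s = V_sub[OF T val] and h = subfield_hom[OF T aut_hom[OF g(1)] T]
  have Vg: "g y \<in> V \<longleftrightarrow> y \<in> V" if y: "y \<in> T" for y
  proof
    assume "g y \<in> V"
    then have "g y \<in> g ` V" unfolding g(2) .
    then obtain z where z: "z \<in> V" "g y = g z" by (rule imageE) simp
    have "y = z" by (rule inj_onD[OF h(8) z(2) y subsetD[OF s(2) z(1)]])
    then show "y \<in> V" using z(1) by simp
  next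
    assume "y \<in> V" then show "g y \<in> V" using g(2) by blast
  qed
  have max: "g y \<in> maximal_ideal R V \<longleftrightarrow> y \<in> maximal_ideal R V" if y: "y \<in> T" for y
  proof (cases "y = \<zero>")
    case True then show ?thesis using h(3) by simp
  next
    case False
    have "inv y \<in> T" using subfield_m_inv(1)[OF T] y False by blast
    then show ?thesis using Vg[OF y] Vg[of "inv y"] h(7)[OF y False] mem_maximal_ideal[OF s(1)] False by simp
  qed
  have mT: "y \<in> T" if "y \<in> maximal_ideal R V" for y using that s(2) unfolding maximal_ideal_def by blast
  have xT: "x \<in> T" using x s(2) by blast
  show ?thesis
  proof (intro subset_antisym subsetI)
    fix z assume "z \<in> g ` residue_class R V x"
    then obtain y where y: "y \<in> maximal_ideal R V" "z = g (y \<oplus> x)" using residue_class_mem[OF T val] by (auto elim: imageE)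
    then have "z = g y \<oplus> g x" using h(4)[OF mT xT] by simp
    then show "z \<in> residue_class R V (g x)" using residue_class_mem[OF T val] max[OF mT[OF y(1)]] y(1) by blast
  next
    fix z assume "z \<in> residue_class R V (g x)"
    then obtain w where w: "w \<in> maximal_ideal R V" "z = w \<oplus> g x" using residue_class_mem[OF T val] by blast
    have "w \<in> g ` T" unfolding aut_surj[OF g(1)] by (rule mT[OF w(1)])
    then obtain y where y: "y \<in> T" "w = g y" by (rule imageE) simp
    have "y \<in> maximal_ideal R V" using max[OF y(1)] w(1) y(2) by simp
    then have "y \<oplus> x \<in> residue_class R V x" using residue_class_mem[OF T val] by blast
    moreover have "z = g (y \<oplus> x)" unfolding w(2) y(2) by (rule h(4)[OF y(1) xT, symmetric])
    ultimately show "z \<in> g ` residue_class R V x" by (intro image_eqI)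
  qed
qed

end

section \<open>Primes as domains of places\<close>

context frob
begin

lemma kplace_valuation:
  assumes \<rho>: "kplace T \<rho>" and T: "subfield T R"
  shows "valuation_ring_of R T (Domain \<rho>)" "k \<subseteq> Domain \<rho>" "x \<in> maximal_ideal R (Domain \<rho>) \<longleftrightarrow> (x, \<zero>) \<in> \<rho>"
proof -
  have sr: "subring (Domain \<rho>) R" by (rule subring_Domain[OF kplaceD(2)[OF \<rho>]])
  show "valuation_ring_of R T (Domain \<rho>)"
    unfolding valuation_ring_of_def using sr kplaceD(1)[OF \<rho>] unfolding place_on_def by blast
  show "k \<subseteq> Domain \<rho>" using kplaceD(5)[OF \<rho>] by blast
  show "x \<in> maximal_ideal R (Domain \<rho>) \<longleftrightarrow> (x, \<zero>) \<in> \<rho>"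
  proof (cases "x \<in> T")
    case True
    then show ?thesis using place_kernel[OF kplaceD(1)[OF \<rho>] T True] mem_maximal_ideal[OF sr] by simp
  next
    case False
    then show ?thesis using kplaceD(4,6)[OF \<rho>] mem_maximal_ideal[OF sr] by blast
  qed
qed

lemma kplace_primes: "kplace T \<rho> \<Longrightarrow> subfield T R \<Longrightarrow> Domain \<rho> \<noteq> T \<Longrightarrow> Domain \<rho> \<in> primes_of R k T"
  unfolding primes_of_def using kplace_valuation by blast

lemma rational_of_kplace:
  assumes \<rho>: "kplace T \<rho>" and T: "subfield T R" and ran: "Range \<rho> \<subseteq> k" and ne: "Domain \<rho> \<noteq> T"
  shows "Domain \<rho> \<in> rational_primes_of R k T"
proof -
  note v = kplace_valuation[OF \<rho> T] and D = partial_homD[OF kplaceD(2)[OF \<rho>]]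
  have "residue_class R (Domain \<rho>) x \<in> residue_class R (Domain \<rho>) ` k" if x: "x \<in> Domain \<rho>" for x
  proof -
    obtain c where c: "(x, c) \<in> \<rho>" using x by blast
    have ck: "c \<in> k" using c ran by blast
    have "(x \<ominus> c, c \<ominus> c) \<in> \<rho>" by (rule D(9)[OF c kplaceD(5)[OF \<rho> ck]])
    then have "(x \<ominus> c, \<zero>) \<in> \<rho>" using D(2)[OF c] by (simp add: minus_eq r_neg)
    then have "residue_class R (Domain \<rho>) x = residue_class R (Domain \<rho>) c"
      using residue_class_iff[OF T v(1) x] ck v(2,3) by blast
    then show ?thesis using ck by blast
  qed
  then have "residue_class R (Domain \<rho>) ` Domain \<rho> = residue_class R (Domain \<rho>) ` k" using v(2) by blast
  then show ?thesis
    unfolding rational_primes_of_def using kplace_primes[OF \<rho> T ne] residue_carrier[OF T v(1)] by simp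
qed

lemma primes_ofD:
  "V \<in> primes_of R k T \<Longrightarrow> valuation_ring_of R T V" "V \<in> primes_of R k T \<Longrightarrow> k \<subseteq> V" "V \<in> primes_of R k T \<Longrightarrow> V \<noteq> T"
  unfolding primes_of_def by simp_all

lemma kplace_of_rational:
  assumes V: "V \<in> rational_primes_of R k T" and T: "subfield T R"
  obtains \<rho> where "kplace T \<rho>" "Range \<rho> \<subseteq> k" "Domain \<rho> = V"
proof (rule that)
  have V': "V \<in> primes_of R k T" "carrier (residue_field R V) = residue_class R V ` k"
    using V unfolding rational_primes_of_def by simp_all
  note v = primes_ofD[OF V'(1)]
  note r = residue_rel[OF T v(1) k v(2)]
  show "Range (residue_rel V k) \<subseteq> k" by (rule r(4))
  show D: "Domain (residue_rel V k) = V"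
  proof (rule subset_antisym[OF r(5)], rule subsetI)
    fix x assume x: "x \<in> V"
    then have "residue_class R V x \<in> residue_class R V ` k" using V'(2) residue_carrier[OF T v(1)] by blast
    then obtain c where c: "c \<in> k" "residue_class R V x = residue_class R V c" by blast
    have "x \<ominus> c \<in> maximal_ideal R V" using residue_class_iff[OF T v(1) x, of c] c v(2) by blast
    then show "x \<in> Domain (residue_rel V k)" unfolding residue_rel_def using x c(1) by blast
  qed
  have "(inv x, \<zero>) \<in> residue_rel V k" if "x \<in> T" "x \<notin> V" for x
    by (rule r(3)[OF valuation_ring_inv(2)[OF v(1) T that]])
  then have "place_on T (residue_rel V k)"
    unfolding place_on_def D using r(1) V_sub(2)[OF T v(1)] by blast
  then show "kplace T (residue_rel V k)"
    unfolding kplace_def using r(2,4) k_sub_kb by blast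
qed

text \<open>Places with the same domain have the same kernel, so matching their values is well
  defined and a homomorphism. Its extension to \<open>kb\<close> is on each finite extension a power
  of \<open>F\<close> and therefore commutes with \<open>F\<close>.\<close>

lemma frobenius_transfer:
  assumes \<rho>0: "kplace T \<rho>0" and \<rho>: "kplace T \<rho>" and T: "subfield T R" and dom: "Domain \<rho> = Domain \<rho>0"
  obtains \<theta> where "\<theta> \<in> subhom kb kb" "\<And>x y. (x, y) \<in> \<rho>0 \<Longrightarrow> (x, \<theta> y) \<in> \<rho>"
    "\<And>y. y \<in> kb \<Longrightarrow> \<theta> (F y) = F (\<theta> y)"
proof -
  note D0 = partial_homD[OF kplaceD(2)[OF \<rho>0]] and D = partial_homD[OF kplaceD(2)[OF \<rho>]]
  define \<tau> where "\<tau> = {(y, z). \<exists>x. (x, y) \<in> \<rho>0 \<and> (x, z) \<in> \<rho>}"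
  have mk: "(y, z) \<in> \<tau>" if "(x, y) \<in> \<rho>0" "(x, z) \<in> \<rho>" for x y z unfolding \<tau>_def using that by blast
  have ph: "partial_hom \<tau>"
    unfolding partial_hom_def
  proof (intro conjI allI impI)
    show "\<tau> \<subseteq> carrier R \<times> carrier R" using D0(2) D(2) unfolding \<tau>_def by blast
    show "(\<one>, \<one>) \<in> \<tau>" by (rule mk[OF D0(3) D(3)])
    show "(\<ominus> y, \<ominus> z) \<in> \<tau>" if h: "(y, z) \<in> \<tau>" for y z
      using h mk[OF D0(4) D(4)] unfolding \<tau>_def by blast
    show "(y \<oplus> y', z \<oplus> z') \<in> \<tau>" "(y \<otimes> y', z \<otimes> z') \<in> \<tau>" if h: "(y, z) \<in> \<tau>" "(y', z') \<in> \<tau>" for y z y' z'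
    proof -
      obtain x where x: "(x, y) \<in> \<rho>0" "(x, z) \<in> \<rho>" using h(1) unfolding \<tau>_def by blast
      obtain x' where x': "(x', y') \<in> \<rho>0" "(x', z') \<in> \<rho>" using h(2) unfolding \<tau>_def by blast
      show "(y \<oplus> y', z \<oplus> z') \<in> \<tau>" by (rule mk[OF D0(5)[OF x(1) x'(1)] D(5)[OF x(2) x'(2)]])
      show "(y \<otimes> y', z \<otimes> z') \<in> \<tau>" by (rule mk[OF D0(6)[OF x(1) x'(1)] D(6)[OF x(2) x'(2)]])
    qed
    fix z assume "(\<zero>, z) \<in> \<tau>"
    then obtain x where x: "(x, \<zero>) \<in> \<rho>0" "(x, z) \<in> \<rho>" unfolding \<tau>_def by blast
    have "(x, \<zero>) \<in> \<rho>" using kplace_valuation(3)[OF \<rho>0 T, of x] kplace_valuation(3)[OF \<rho> T, of x] dom x(1) by simp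
    then show "z = \<zero>" by (rule D(10)[OF x(2)])
  qed
  have kk: "(c, c) \<in> \<tau>" if "c \<in> k" for c by (rule mk[OF kplaceD(5)[OF \<rho>0 that] kplaceD(5)[OF \<rho> that]])
  show thesis
  proof (rule hom_extension[OF kb_closed ph _ k _ kb_carr kb_alg])
    show "Range \<tau> \<subseteq> kb" using kplaceD(3)[OF \<rho>] unfolding \<tau>_def by blast
    show "k \<subseteq> Domain \<tau>" using kk by blast
    fix \<theta> assume \<theta>: "\<theta> \<in> subhom kb kb" "\<And>x y. (x, y) \<in> \<tau> \<Longrightarrow> \<theta> x = y"
    show thesis
    proof (rule that[OF \<theta>(1)])
      show "(x, \<theta> y) \<in> \<rho>" if xy: "(x, y) \<in> \<rho>0" for x y
      proof -
        obtain z where z: "(x, z) \<in> \<rho>" using dom xy by blast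
        then show ?thesis using \<theta>(2)[OF mk[OF xy z]] by simp
      qed
      fix y assume y: "y \<in> kb"
      have "\<exists>i. \<forall>x\<in>K (per y). \<theta> x = (F ^^ i) x"
        by (rule embedding_eq_power[OF per(1)[OF y] K_hom_of_kb[OF \<theta>(1)]]) (rule \<theta>(2)[OF kk])
      then obtain i where i: "\<forall>x\<in>K (per y). \<theta> x = (F ^^ i) x" by (rule exE)
      have yK: "y \<in> K (per y)" by (rule mem_K_per[OF y])
      have "(F ^^ per y) (F y) = F ((F ^^ per y) y)" by (simp only: funpow_swap1)
      then have "F y \<in> K (per y)" using yK Fn_simps(1)[OF y, of 1] unfolding K_def by simp
      then have "\<theta> (F y) = (F ^^ i) (F y)" using i by blast
      also have "\<dots> = F ((F ^^ i) y)" by (simp only: funpow_swap1)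
      also have "(F ^^ i) y = \<theta> y" using i yK by simp
      finally show "\<theta> (F y) = F (\<theta> y)" .
    qed
  qed assumption
qed

text \<open>The change from one embedding of the residue field to another is injective and commutes
  with \<open>F\<close>, so the existential choice of an embedding in \<open>frobenius_at\<close>
  does not affect the condition.\<close>

lemma frobenius_indep:
  assumes \<rho>0: "kplace T \<rho>0" and \<rho>: "kplace T \<rho>" and T: "subfield T R" "k \<subseteq> T" and dom: "Domain \<rho> = Domain \<rho>0"
    and g: "g \<in> Aut k T" and e: "pull T g \<rho> = push 1 \<rho>"
  shows "pull T g \<rho>0 = push 1 \<rho>0"
proof (rule frobenius_transfer[OF \<rho>0 \<rho> T(1) dom])
  fix \<theta> assume \<theta>: "\<theta> \<in> subhom kb kb" "\<And>x y. (x, y) \<in> \<rho>0 \<Longrightarrow> (x, \<theta> y) \<in> \<rho>"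
    "\<And>y. y \<in> kb \<Longrightarrow> \<theta> (F y) = F (\<theta> y)"
  note inj = subfield_hom(8)[OF kb_subfield \<theta>(1) kb_subfield]
  show ?thesis
  proof (rule kplace_eq[OF kplace_pull[OF T aut_hom[OF g] aut_fix[OF g] \<rho>0] kplace_push[OF \<rho>0] T(1)], assumption, rule subrelI)
    fix x y assume "(x, y) \<in> pull T g \<rho>0"
    then have xy: "x \<in> T" "(g x, y) \<in> \<rho>0" unfolding pull_def by simp_all
    have "(x, \<theta> y) \<in> pull T g \<rho>" using \<theta>(2)[OF xy(2)] xy(1) unfolding pull_def by simp
    then obtain z where z: "(x, z) \<in> \<rho>" "\<theta> y = F z" unfolding e push_def by auto
    obtain z0 where z0: "(x, z0) \<in> \<rho>0" using dom z(1) by blast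
    have z0k: "z0 \<in> kb" by (rule kplaceD(3)[OF \<rho>0 z0])
    have "z = \<theta> z0" by (rule partial_homD(10)[OF kplaceD(2)[OF \<rho>] z(1) \<theta>(2)[OF z0]])
    then have "\<theta> y = \<theta> (F z0)" using z(2) \<theta>(3)[OF z0k] by simp
    then have "y = F z0"
      by (rule inj_onD[OF inj]) (use kplaceD(3)[OF \<rho>0 xy(2)] Fn_simps(1)[OF z0k, of 1] in simp_all)
    then show "(x, y) \<in> push 1 \<rho>0" using push_mem[OF z0, of 1] by simp
  qed
qed

lemma integral_closure_kb: "integral_closure_in R k (carrier R) = kb"
  unfolding integral_closure_in_def kb over_def by simp

text \<open>A place with a given domain is the same as an embedding of the residue field over
  \<open>k\<close>; this lemma and the next translate in the two directions.\<close>

lemma residue_embedding_of_kplace: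
  assumes \<rho>: "kplace T \<rho>" and T: "subfield T R"
  obtains \<iota> where "\<iota> \<in> residue_embeddings R k (Domain \<rho>)" "\<And>x y. (x, y) \<in> \<rho> \<Longrightarrow> \<iota> (residue_class R (Domain \<rho>) x) = y"
proof -
  note v = kplace_valuation[OF \<rho> T] and D = partial_homD[OF kplaceD(2)[OF \<rho>]]
  note sV = subringE[OF V_sub(1)[OF T v(1)]]
  let ?rc = "residue_class R (Domain \<rho>)" and ?k = "residue_field R (Domain \<rho>)"
  interpret h: ring_hom_ring "R\<lparr>carrier := Domain \<rho>\<rparr>" ?k ?rc by (rule residue_hom[OF T v(1)])
  define \<iota> where "\<iota> r = (THE y. \<exists>x. (x, y) \<in> \<rho> \<and> r = ?rc x)" for r
  have \<iota>: "\<iota> (?rc x) = y" if xy: "(x, y) \<in> \<rho>" for x y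
    unfolding \<iota>_def
  proof (rule the_equality)
    show "\<exists>x'. (x', y) \<in> \<rho> \<and> ?rc x = ?rc x'" using xy by blast
    fix y' assume "\<exists>x'. (x', y') \<in> \<rho> \<and> ?rc x = ?rc x'"
    then obtain x' where x': "(x', y') \<in> \<rho>" "?rc x = ?rc x'" by blast
    have xd: "x \<in> Domain \<rho>" "x' \<in> Domain \<rho>" using xy x'(1) by blast+
    have "(x \<ominus> x', \<zero>) \<in> \<rho>" using residue_class_iff[OF T v(1) xd] x'(2) v(3) by simp
    from D(5)[OF this x'(1)] have "(x, y') \<in> \<rho>"
      using D(1)[OF xy] D(1,2)[OF x'(1)] by (simp add: minus_eq a_assoc l_neg)
    then show "y' = y" using D(10)[OF xy] by simp
  qed
  have "\<iota> \<in> ring_hom ?k (R\<lparr>carrier := kb\<rparr>)"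
  proof (rule ring_hom_memI)
    have val: "\<exists>x y. r = ?rc x \<and> (x, y) \<in> \<rho>" if "r \<in> carrier ?k" for r
      using that residue_carrier[OF T v(1)] by blast
    show "\<iota> r \<in> carrier (R\<lparr>carrier := kb\<rparr>)" if r: "r \<in> carrier ?k" for r
    proof -
      obtain x y where "r = ?rc x" "(x, y) \<in> \<rho>" using val[OF r] by (elim exE conjE)
      then show ?thesis using \<iota> kplaceD(3)[OF \<rho>] by simp
    qed
    fix r r' assume r: "r \<in> carrier ?k" and r': "r' \<in> carrier ?k"
    obtain x y where x: "r = ?rc x" "(x, y) \<in> \<rho>" using val[OF r] by (elim exE conjE)
    obtain x' y' where x': "r' = ?rc x'" "(x', y') \<in> \<rho>" using val[OF r'] by (elim exE conjE)
    have xd: "x \<in> Domain \<rho>" "x' \<in> Domain \<rho>" using x(2) x'(2) by blast+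
    have "r \<otimes>\<^bsub>?k\<^esub> r' = ?rc (x \<otimes> x')" "r \<oplus>\<^bsub>?k\<^esub> r' = ?rc (x \<oplus> x')"
      unfolding x(1) x'(1) using h.hom_mult[of x x'] h.hom_add[of x x'] xd by simp_all
    then show "\<iota> (r \<otimes>\<^bsub>?k\<^esub> r') = \<iota> r \<otimes>\<^bsub>R\<lparr>carrier := kb\<rparr>\<^esub> \<iota> r'" "\<iota> (r \<oplus>\<^bsub>?k\<^esub> r') = \<iota> r \<oplus>\<^bsub>R\<lparr>carrier := kb\<rparr>\<^esub> \<iota> r'"
      using \<iota>[OF D(6)[OF x(2) x'(2)]] \<iota>[OF D(5)[OF x(2) x'(2)]] \<iota>[OF x(2)] \<iota>[OF x'(2)] x(1) x'(1) by simp_all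
  next
    show "\<iota> \<one>\<^bsub>?k\<^esub> = \<one>\<^bsub>R\<lparr>carrier := kb\<rparr>\<^esub>" using \<iota>[OF D(3)] h.hom_one by simp
  qed
  then have "\<iota> \<in> residue_embeddings R k (Domain \<rho>)"
    unfolding residue_embeddings_def integral_closure_kb using \<iota>[OF kplaceD(5)[OF \<rho>]] by simp
  then show thesis using \<iota> by (rule that)
qed

lemma kplace_of_residue_embedding:
  assumes val: "valuation_ring_of R T V" and T: "subfield T R" and kV: "k \<subseteq> V" and \<iota>: "\<iota> \<in> residue_embeddings R k V"
  defines "\<rho> \<equiv> {(x, \<iota> (residue_class R V x)) | x. x \<in> V}"
  shows "kplace T \<rho>" "Domain \<rho> = V"
proof -
  let ?rc = "residue_class R V" and ?k = "residue_field R V"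
  note s = V_sub[OF T val]
  note sV = subringE[OF s(1)]
  interpret h: ring_hom_ring "R\<lparr>carrier := V\<rparr>" ?k ?rc by (rule residue_hom[OF T val])
  have i: "\<iota> \<in> ring_hom ?k (R\<lparr>carrier := kb\<rparr>)" "\<And>c. c \<in> k \<Longrightarrow> \<iota> (?rc c) = c"
    using \<iota> unfolding residue_embeddings_def integral_closure_kb by simp_all
  interpret kr: ring "R\<lparr>carrier := kb\<rparr>" by (rule subring_is_ring[OF subfieldE(1)[OF kb_subfield]])
  interpret j: ring_hom_ring ?k "R\<lparr>carrier := kb\<rparr>" \<iota> by (rule ring_hom_ringI2[OF h.S.ring_axioms kr.ring_axioms i(1)])
  have rc: "?rc x \<in> carrier ?k" if "x \<in> V" for x using h.hom_closed[of x] that by simp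
  have ikb: "\<iota> (?rc x) \<in> kb" if "x \<in> V" for x using j.hom_closed[OF rc[OF that]] by simp
  have mk: "(x, y) \<in> \<rho>" if "x \<in> V" "y = \<iota> (?rc x)" for x y unfolding \<rho>_def using that by blast
  have dest: "x \<in> V" "y = \<iota> (?rc x)" if "(x, y) \<in> \<rho>" for x y using that unfolding \<rho>_def by simp_all
  have zero: "\<iota> (?rc x) = \<zero>" if x: "x \<in> maximal_ideal R V" for x
  proof -
    have "x \<in> V" using x unfolding maximal_ideal_def by blast
    then have "?rc x = \<zero>\<^bsub>?k\<^esub>" using residue_zero[OF T val] x by simp
    then show ?thesis using j.hom_zero by simp
  qed
  show D: "Domain \<rho> = V" unfolding \<rho>_def by auto
  have ph: "partial_hom \<rho>"
    unfolding partial_hom_def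
  proof (intro conjI allI impI)
    show "\<rho> \<subseteq> carrier R \<times> carrier R" using s(3) ikb kb_carr unfolding \<rho>_def by blast
    show "(\<one>, \<one>) \<in> \<rho>" by (rule mk[OF sV(3)]) (use h.hom_one j.hom_one in simp)
    show "(\<ominus> x, \<ominus> y) \<in> \<rho>" if xy: "(x, y) \<in> \<rho>" for x y
    proof (rule mk[OF sV(5)[OF dest(1)[OF xy]]])
      note x = dest(1)[OF xy]
      have "?rc (\<ominus> x) = \<ominus>\<^bsub>?k\<^esub> ?rc x" using h.hom_a_inv[of x] x a_inv_sub[OF s(1) x] by simp
      then show "\<ominus> y = \<iota> (?rc (\<ominus> x))"
        using j.hom_a_inv[OF rc[OF x]] a_inv_sub[OF subfieldE(1)[OF kb_subfield] ikb[OF x]] dest(2)[OF xy] by simp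
    qed
    fix x y x' y' assume xy: "(x, y) \<in> \<rho>" "(x', y') \<in> \<rho>"
    note x = dest(1)[OF xy(1)] dest(1)[OF xy(2)]
    show "(x \<oplus> x', y \<oplus> y') \<in> \<rho>"
      by (rule mk[OF sV(7)[OF x]])
        (use h.hom_add[of x x'] j.hom_add[OF rc[OF x(1)] rc[OF x(2)]] x dest(2)[OF xy(1)] dest(2)[OF xy(2)] in simp)
    show "(x \<otimes> x', y \<otimes> y') \<in> \<rho>"
      by (rule mk[OF sV(6)[OF x]])
        (use h.hom_mult[of x x'] j.hom_mult[OF rc[OF x(1)] rc[OF x(2)]] x dest(2)[OF xy(1)] dest(2)[OF xy(2)] in simp)
  next
    show "y = \<zero>" if "(\<zero>, y) \<in> \<rho>" for y using dest(2)[OF that] zero[OF max_zero[OF T val]] by simp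
  qed
  have "(inv x, \<zero>) \<in> \<rho>" if x: "x \<in> T" "x \<notin> V" for x
  proof (rule mk)
    have m: "inv x \<in> maximal_ideal R V" by (rule valuation_ring_inv(2)[OF val T x])
    show "inv x \<in> V" using m unfolding maximal_ideal_def by blast
    show "\<zero> = \<iota> (?rc (inv x))" using zero[OF m] by simp
  qed
  then have "place_on T \<rho>" unfolding place_on_def D using ph s(2) by blast
  moreover have "Range \<rho> \<subseteq> kb" using ikb unfolding \<rho>_def by blast
  moreover have "(c, c) \<in> \<rho>" if "c \<in> k" for c by (rule mk) (use that kV i(2) in auto)
  ultimately show "kplace T \<rho>" unfolding kplace_def by blast
qed

end

section \<open>Rational primes of the twisted form\<close>

context frob
begin

text \<open>A pole satisfies no polynomial over \<open>k\<close> even up to value zero: divided by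
  the matching power of \<open>x\<close>, the value of the polynomial becomes its leading nonzero
  coefficient.\<close>

lemma residue_poly_nonzero:
  assumes \<rho>: "kplace T \<rho>" and xy: "x \<in> carrier R" "(y, \<zero>) \<in> \<rho>" "x \<otimes> y = \<one>"
  shows "set q \<subseteq> k \<Longrightarrow> \<exists>a\<in>set q. a \<noteq> \<zero> \<Longrightarrow> (eval q x, \<zero>) \<notin> \<rho>"
proof (induction q)
  case (Cons a q)
  note D = partial_homD[OF kplaceD(2)[OF \<rho>]]
  have a: "(a, a) \<in> \<rho>" "a \<in> carrier R" using kplaceD(5)[OF \<rho>, of a] D(1)[of a a] Cons.prems(1) by auto
  have qk: "set q \<subseteq> k" using Cons.prems(1) by simp
  have qc: "set q \<subseteq> carrier R" "set q \<subseteq> Domain \<rho>" using qk subfieldE(3)[OF k] kplaceD(5)[OF \<rho>] by blast+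
  have e: "eval (a # q) x = a \<otimes> x [^] length q \<oplus> eval q x" by simp
  have ec: "eval q x \<in> carrier R" by (rule eval_in_carrier[OF qc(1) xy(1)])
  show ?case
  proof (cases "a = \<zero>")
    case True
    then have "eval (a # q) x = eval q x" using ec xy(1) unfolding e by simp
    moreover have "\<exists>a\<in>set q. a \<noteq> \<zero>" using Cons.prems(2) True by auto
    ultimately show ?thesis using Cons.IH[OF qk] by simp
  next
    case False
    show ?thesis
    proof
      assume z: "(eval (a # q) x, \<zero>) \<in> \<rho>"
      define n where "n = length q"
      have yc: "y \<in> carrier R" by (rule D(1)[OF xy(2)])
      have yn: "(y [^] n, \<zero> [^] n) \<in> \<rho>" by (rule D(11)[OF xy(2)])
      have t: "(eval q x \<otimes> y [^] n, \<zero>) \<in> \<rho>"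
        by (rule eval_pole[OF kplaceD(2)[OF \<rho>] xy qc(2)]) (simp add: n_def)
      have "(eval (a # q) x \<otimes> y [^] n, \<zero> \<otimes> \<zero> [^] n) \<in> \<rho>" by (rule D(6)[OF z yn])
      moreover have "\<zero> \<otimes> \<zero> [^] n = \<zero>" by simp
      moreover have "eval (a # q) x \<otimes> y [^] n = a \<oplus> eval q x \<otimes> y [^] n"
      proof -
        have "x [^] n \<otimes> y [^] n = \<one>" using nat_pow_distrib[OF xy(1) yc, of n] xy(3) by simp
        then have "a \<otimes> x [^] n \<otimes> y [^] n = a" using a(2) xy(1) yc by (simp add: m_assoc)
        then show ?thesis unfolding e using a(2) xy(1) yc ec by (simp add: l_distr n_def)
      qed
      ultimately have "(a \<oplus> eval q x \<otimes> y [^] n, \<zero>) \<in> \<rho>" by simp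
      from D(9)[OF this t] have "(a, \<zero>) \<in> \<rho>" using a(2) ec yc by (simp add: minus_eq a_assoc r_neg)
      then have "a = \<zero>" by (rule D(10)[OF a(1)])
      then show False using False by simp
    qed
  qed
qed simp

end

context twist
begin

text \<open>On \<open>k'\<close> a place acts as a power of \<open>F\<close>, which a further power
  of \<open>F\<close> on the values undoes.\<close>

lemma push_inverse:
  assumes \<rho>: "kplace M \<rho>"
  obtains j where "\<And>c. c \<in> k' \<Longrightarrow> (c, c) \<in> push j \<rho>"
proof -
  obtain \<rho>L where L: "kplace L \<rho>L" "\<rho>L \<inter> M \<times> UNIV = \<rho>" by (rule kplace_extend[OF \<rho> M(1) k_sub(1) cL(1,3)])
  obtain i where i: "\<And>c. c \<in> K m \<Longrightarrow> (c, (F ^^ i) c) \<in> \<rho>L" by (rule kplace_K[OF L(1) m(1) cL(2)]) blast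
  show thesis
  proof (rule that)
    fix c assume c: "c \<in> k'"
    have cK: "c \<in> K m" using c k'_sub_K by blast
    have "(c, (F ^^ i) c) \<in> \<rho>" using i[OF cK] L(2) c k_sub(4) by blast
    from push_mem[OF this, of "(m - 1) * i"] show "(c, c) \<in> push ((m - 1) * i) \<rho>"
      using F_inverse[OF cK, of i] by (metis funpow_add comp_apply add.commute)
  qed
qed

lemma place_of_prime_above:
  assumes pi: "kplace B \<pi>" "Range \<pi> \<subseteq> k" and Q: "Q \<in> primes_of R k M" "Q \<inter> B = Domain \<pi>"
  obtains \<rho> where "kplace M \<rho>" "\<rho> \<inter> B \<times> UNIV = \<pi>" "\<And>c. c \<in> k' \<Longrightarrow> (c, c) \<in> \<rho>" "Domain \<rho> = Q"
proof -
  note v = primes_ofD[OF Q(1)]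
  note s = V_sub[OF M(1) v(1)]
  note r = residue_rel[OF M(1) v(1) k v(2)]
  note Dp = partial_homD[OF kplaceD(2)[OF pi(1)]]
  have "Range (residue_rel Q k) \<subseteq> kb" using r(4) k_sub_kb by blast
  moreover have "Domain (residue_rel Q k) \<subseteq> M" using r(5) s(2) by blast
  ultimately obtain \<rho> where \<rho>: "kplace M \<rho>" "residue_rel Q k \<subseteq> \<rho>"
    using kplace_of_partial_hom[OF r(1) _ r(2) M(1) k_sub(1)] by blast
  note D = partial_homD[OF kplaceD(2)[OF \<rho>(1)]]
  have pr: "\<pi> \<subseteq> residue_rel Q k"
  proof (rule subrelI)
    fix x c assume xc: "(x, c) \<in> \<pi>"
    have ck: "c \<in> k" using xc pi(2) by blast
    have cc: "c \<in> carrier R" by (rule Dp(2)[OF xc])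
    have "(x \<ominus> c, \<zero>) \<in> \<pi>" using Dp(9)[OF xc kplaceD(5)[OF pi(1) ck]] cc by (simp add: minus_eq r_neg)
    then have xm: "x \<ominus> c \<in> maximal_ideal R (Domain \<pi>)" using kplace_valuation(3)[OF pi(1) B] by simp
    then have xP: "x \<ominus> c \<in> Domain \<pi>" "x \<ominus> c = \<zero> \<or> inv (x \<ominus> c) \<notin> Domain \<pi>"
      using mem_maximal_ideal[OF subring_Domain[OF kplaceD(2)[OF pi(1)]]] by simp_all
    have xB: "x \<ominus> c \<in> B" using xP(1) kplaceD(6)[OF pi(1)] by blast
    have "x \<ominus> c = \<zero> \<or> inv (x \<ominus> c) \<notin> Q"
      using xP(2) subfield_m_inv(1)[OF B, of "x \<ominus> c"] xB Q(2) by blast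
    then have "x \<ominus> c \<in> maximal_ideal R Q" using mem_maximal_ideal[OF s(1)] xP(1) Q(2) by blast
    then show "(x, c) \<in> residue_rel Q k" unfolding residue_rel_def using xc ck Q(2) by blast
  qed
  have "\<pi> \<subseteq> \<rho> \<inter> B \<times> UNIV" using pr \<rho>(2) kplaceD(6)[OF pi(1)] by force
  then have rB: "\<pi> = \<rho> \<inter> B \<times> UNIV" by (rule kplace_eq[OF pi(1) kplace_restrict[OF \<rho>(1) M(2) B kB] B])
  have DQ: "Domain \<rho> \<subseteq> Q"
  proof
    fix x assume x: "x \<in> Domain \<rho>"
    then obtain y where y: "(x, y) \<in> \<rho>" by blast
    have xM: "x \<in> M" by (rule kplaceD(4)[OF \<rho>(1) y])
    show "x \<in> Q"
    proof (rule ccontr)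
      assume nQ: "x \<notin> Q"
      note i = valuation_ring_inv[OF v(1) M(1) xM nQ]
      have "(inv x, \<zero>) \<in> \<rho>" using r(3)[OF i(2)] \<rho>(2) by blast
      from place_kernel[OF kplaceD(1)[OF \<rho>(1)] M(1), of "inv x"] this
      have "inv x = \<zero> \<or> inv (inv x) \<notin> Domain \<rho>"
        using kplaceD(4)[OF \<rho>(1) \<open>(inv x, \<zero>) \<in> \<rho>\<close>] by simp
      moreover have "x \<in> Units R" using i(1) D(1)[OF y] field_Units by auto
      ultimately show False using x by (metis Units_inv_inv Units_inv_Units field_Units DiffD2 singletonI)
    qed
  qed
  \<comment> \<open>An \<open>x\<close> in \<open>Q\<close> satisfies an equation over
    \<open>B\<close>, scaled so that all coefficients are finite under \<open>\<pi>\<close> and one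
    of them is 1. Reducing them gives a nonzero polynomial over \<open>k\<close> whose value at
    \<open>x\<close> is a nonunit of \<open>Q\<close>, hence has value zero under
    \<open>\<rho>\<close>; at a pole this is impossible.\<close>
  have QD: "Q \<subseteq> Domain \<rho>"
  proof
    fix x assume x: "x \<in> Q"
    show "x \<in> Domain \<rho>"
    proof (rule ccontr)
      assume nD: "x \<notin> Domain \<rho>"
      have xM: "x \<in> M" and xc: "x \<in> carrier R" using x s(2,3) by auto
      have nz: "x \<noteq> \<zero>" using nD D(8) by blast
      have inv: "(inv x, \<zero>) \<in> \<rho>" using kplaceD(1)[OF \<rho>(1)] xM nz nD unfolding place_on_def by blast
      have xU: "x \<in> Units R" using nz xc field_Units by auto
      have "(algebraic over B) x" by (rule Balg[OF xc])
      then have "\<exists>q\<in>carrier (B[X]). q \<noteq> [] \<and> eval q x = \<zero>"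
        using algebraicE[OF subfieldE(1)[OF B] xc] unfolding over_def by blast
      then obtain q where q: "q \<in> carrier (B[X])" "q \<noteq> []" "eval q x = \<zero>" by blast
      have qB: "set q \<subseteq> B" "lead_coeff q \<noteq> \<zero>"
        using q(1,2) unfolding univ_poly_carrier[symmetric] polynomial_def by auto
      have "\<exists>a\<in>set q. a \<noteq> \<zero>" using qB(2) q(2) hd_in_set by blast
      from valuation_ring_normalize[OF kplace_valuation(1)[OF pi(1) B] B qB(1) this]
      obtain b where b: "b \<in> set q" "b \<noteq> \<zero>" "\<forall>a\<in>set q. inv b \<otimes> a \<in> Domain \<pi>" by blast
      have bc: "b \<in> carrier R" "inv b \<in> carrier R" using b(1,2) qB(1) subfieldE(3)[OF B] field_Units by auto
      define ps where "ps = map (\<lambda>a. (inv b \<otimes> a, app \<pi> (inv b \<otimes> a))) q"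
      have psP: "set ps \<subseteq> \<pi>" unfolding ps_def using app_mem[OF kplaceD(2)[OF pi(1)]] b(3) by auto
      have e1: "eval (map fst ps) x = \<zero>"
      proof -
        have "map fst ps = map (\<lambda>a. inv b \<otimes> a) q" unfolding ps_def by simp
        then show ?thesis using eval_smult[OF _ xc bc(2), of q] q(3) bc(2) qB(1) subfieldE(3)[OF B] by simp
      qed
      have ck: "set (map snd ps) \<subseteq> k"
      proof
        fix c assume "c \<in> set (map snd ps)"
        then obtain a where "(a, c) \<in> set ps" by auto
        then show "c \<in> k" using psP pi(2) by blast
      qed
      have one: "\<exists>a\<in>set (map snd ps). a \<noteq> \<zero>"
      proof -
        have "inv b \<otimes> b = \<one>" using bc(1) b(2) field_Units by simp
        then have "(\<one>, app \<pi> \<one>) \<in> set ps" unfolding ps_def using b(1) by force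
        moreover have "app \<pi> \<one> = \<one>" by (rule app_eq[OF kplaceD(2)[OF pi(1)] Dp(3)])
        ultimately have "\<one> \<in> set (map snd ps)" by force
        then show ?thesis using one_not_zero by blast
      qed
      have "set ps \<subseteq> residue_rel Q k" using psP pr by blast
      from eval_residue[OF v(1) M(1) x v(2) this]
      have w: "\<zero> \<ominus> eval (map snd ps) x \<in> maximal_ideal R Q" unfolding e1 .
      have ec: "eval (map snd ps) x \<in> carrier R"
        using eval_in_carrier[of "map snd ps" x] ck subfieldE(3)[OF k] xc by blast
      have "eval (map snd ps) x \<in> maximal_ideal R Q" using max_neg[OF M(1) v(1) w] ec by (simp add: minus_eq)
      then have "(eval (map snd ps) x, \<zero>) \<in> \<rho>" using r(3) \<rho>(2) by blast
      moreover have "x \<otimes> inv x = \<one>" using xU by simp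
      ultimately show False using residue_poly_nonzero[OF \<rho>(1) xc inv _ ck one] by blast
    qed
  qed
  obtain j where j: "\<And>c. c \<in> k' \<Longrightarrow> (c, c) \<in> push j \<rho>" by (rule push_inverse[OF \<rho>(1)]) blast
  have "push j \<rho> \<inter> B \<times> UNIV = \<pi>" unfolding push_restrict rB[symmetric] by (rule push_id[OF pi(2)])
  moreover have "Domain (push j \<rho>) = Q" unfolding Domain_push using DQ QD by blast
  ultimately show thesis using that[OF kplace_push[OF \<rho>(1)] _ j] by blast
qed

text \<open>At a rational prime the exponent of \<open>F\<close> is 1. In one direction
  \<open>frobenius_indep\<close> replaces the embedding supplied by the definition with the one
  underlying \<open>\<rho>\<close>; in the other the embedding given by \<open>\<rho>\<close> is the
  witness.\<close>

lemma frobenius_at_eq: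
  assumes FG: "F \<in> Aut k kb" and P: "Domain \<pi> \<in> rational_primes_of R k B"
    and rho: "kplace M \<rho>" "\<rho> \<inter> B \<times> UNIV = \<pi>"
  shows "frobenius_at R k B M F (Domain \<rho>) = {g \<in> carrier G. pull M g \<rho> = push 1 \<rho>}"
proof -
  note v = kplace_valuation[OF rho(1) M(1)]
  note s = V_sub[OF M(1) v(1)]
  let ?Q = "Domain \<rho>"
  have QB: "?Q \<inter> B = Domain \<pi>" using rho(2) by blast
  have P': "Domain \<pi> \<in> primes_of R k B" "carrier (residue_field R (Domain \<pi>)) = residue_class R (Domain \<pi>) ` k"
    using P unfolding rational_primes_of_def by simp_all
  have deg: "prime_degree R k (?Q \<inter> B) = 1"
    unfolding QB by (rule prime_degree_rational[OF B primes_ofD(1)[OF P'(1)] k primes_ofD(2)[OF P'(1)] P'(2)])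
  have F1: "(F [^]\<^bsub>aut_group R k (integral_closure_in R k (carrier R))\<^esub> prime_degree R k (?Q \<inter> B)) x = F x" if "x \<in> kb" for x
    unfolding deg integral_closure_kb using aut_pow[OF kb_subfield k_sub_kb FG that, of 1] by simp
  show ?thesis
  proof (rule Set.set_eqI)
    fix g
    show "g \<in> frobenius_at R k B M F ?Q \<longleftrightarrow> g \<in> {g \<in> carrier G. pull M g \<rho> = push 1 \<rho>}"
    proof
      assume "g \<in> frobenius_at R k B M F ?Q"
      then obtain \<iota> where g: "g \<in> decomposition_group R B M ?Q" and \<iota>: "\<iota> \<in> residue_embeddings R k ?Q"
        and fr: "\<forall>r\<in>carrier (residue_field R ?Q). \<iota> (g ` r) =
          (F [^]\<^bsub>aut_group R k (integral_closure_in R k (carrier R))\<^esub> prime_degree R k (?Q \<inter> B)) (\<iota> r)"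
        unfolding frobenius_at_def by (elim CollectE conjE bexE)
      have gA: "g \<in> Aut B M" and gQ: "g ` ?Q = ?Q" using g unfolding decomposition_group_def by simp_all
      define \<tau> where "\<tau> = {(x, \<iota> (residue_class R ?Q x)) | x. x \<in> ?Q}"
      note t = kplace_of_residue_embedding[OF v(1) M(1) v(2) \<iota>, folded \<tau>_def]
      have gk: "g \<in> Aut k M" by (rule aut_mono[OF kB gA])
      have "push 1 \<tau> = pull M g \<tau>"
      proof (rule kplace_eq[OF kplace_push[OF t(1)] kplace_pull[OF M(1) k_sub(1) aut_hom[OF gk] aut_fix[OF gk] t(1)] M(1)], assumption, rule subrelI)
        fix x z assume "(x, z) \<in> push 1 \<tau>"
        then obtain y where y: "(x, y) \<in> \<tau>" "z = F y" unfolding push_def by auto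
        have x: "x \<in> ?Q" "y = \<iota> (residue_class R ?Q x)" using y(1) unfolding \<tau>_def by simp_all
        have ykb: "y \<in> kb" by (rule kplaceD(3)[OF t(1) y(1)])
        have "residue_class R ?Q x \<in> carrier (residue_field R ?Q)" using residue_carrier[OF M(1) v(1)] x(1) by blast
        then have "\<iota> (g ` residue_class R ?Q x) = F y" using bspec[OF fr] F1[OF ykb] x(2) by simp
        then have "\<iota> (residue_class R ?Q (g x)) = z" using aut_residue[OF v(1) M(1) gA gQ x(1)] y(2) by simp
        moreover have "g x \<in> ?Q" using gQ x(1) by blast
        ultimately have "(g x, z) \<in> \<tau>" unfolding \<tau>_def by blast
        then show "(x, z) \<in> pull M g \<tau>" unfolding pull_def using s(2) x(1) by blast
      qed
      then have "pull M g \<rho> = push 1 \<rho>" by (intro frobenius_indep[OF rho(1) t(1) M(1) k_sub(1) t(2) gk]) (rule sym)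
      then show "g \<in> {g \<in> carrier G. pull M g \<rho> = push 1 \<rho>}" using gA unfolding G_def by simp
    next
      assume "g \<in> {g \<in> carrier G. pull M g \<rho> = push 1 \<rho>}"
      then have gA: "g \<in> Aut B M" and e: "pull M g \<rho> = push 1 \<rho>" unfolding G_def by simp_all
      have dom: "g x \<in> ?Q \<longleftrightarrow> x \<in> ?Q" if "x \<in> M" for x
      proof -
        have "Domain (pull M g \<rho>) = ?Q" unfolding e by (rule Domain_push)
        then show ?thesis using that unfolding pull_def by blast
      qed
      have gQ: "g ` ?Q = ?Q"
      proof (intro subset_antisym subsetI)
        show "y \<in> ?Q" if "y \<in> g ` ?Q" for y using that dom s(2) by blast
        fix y assume y: "y \<in> ?Q"
        then have "y \<in> g ` M" using aut_surj[OF gA] s(2) by blast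
        then obtain x where x: "x \<in> M" "y = g x" by (rule imageE) simp
        then have "x \<in> ?Q" using dom y by simp
        then show "y \<in> g ` ?Q" unfolding x(2) by (rule imageI)
      qed
      obtain \<iota> where \<iota>: "\<iota> \<in> residue_embeddings R k ?Q" "\<And>x y. (x, y) \<in> \<rho> \<Longrightarrow> \<iota> (residue_class R ?Q x) = y"
        by (rule residue_embedding_of_kplace[OF rho(1) M(1)]) blast
      have "\<iota> (g ` r) = (F [^]\<^bsub>aut_group R k (integral_closure_in R k (carrier R))\<^esub> prime_degree R k (?Q \<inter> B)) (\<iota> r)"
        if r: "r \<in> carrier (residue_field R ?Q)" for r
      proof -
        obtain x where x: "x \<in> ?Q" "r = residue_class R ?Q x" using r residue_carrier[OF M(1) v(1)] by blast
        obtain y where y: "(x, y) \<in> \<rho>" using x(1) by blast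
        have "(x, F y) \<in> pull M g \<rho>" unfolding e using push_mem[OF y, of 1] by simp
        then have "(g x, F y) \<in> \<rho>" unfolding pull_def by simp
        then have "\<iota> (g ` r) = F y" using \<iota>(2) aut_residue[OF v(1) M(1) gA gQ x(1)] x(2) by simp
        moreover have "\<iota> r = y" using \<iota>(2)[OF y] x(2) by simp
        ultimately show ?thesis using F1[OF kplaceD(3)[OF rho(1) y]] by simp
      qed
      then have "\<exists>\<iota>\<in>residue_embeddings R k ?Q. \<forall>r\<in>carrier (residue_field R ?Q). \<iota> (g ` r) =
          (F [^]\<^bsub>aut_group R k (integral_closure_in R k (carrier R))\<^esub> prime_degree R k (?Q \<inter> B)) (\<iota> r)"
        by (intro bexI[OF ballI \<iota>(1)])
      then show "g \<in> frobenius_at R k B M F ?Q"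
        unfolding frobenius_at_def decomposition_group_def using gA gQ by (intro CollectI conjI)
    qed
  qed
qed

lemma Domain_restrict: "Domain (\<rho> \<inter> E \<times> UNIV) = Domain \<rho> \<inter> E" by blast

text \<open>A place with values in \<open>k\<close> carries no more information than its domain, so
  the places of \<open>Z\<close> in question can be counted as rational primes.\<close>

lemma places_Z_primes:
  assumes pi: "kplace B \<pi>" "Range \<pi> \<subseteq> k" "Domain \<pi> \<noteq> B"
  shows "bij_betw Domain (places_Z \<pi>) {V \<in> rational_primes_of R k Z. V \<inter> B = Domain \<pi>}"
  unfolding bij_betw_def
proof (intro conjI inj_onI subset_antisym[of "Domain ` places_Z \<pi>"] subsetI)
  note Z = Z_subfield
  have f: "kplace Z \<rho>" "\<rho> \<inter> B \<times> UNIV = \<pi>" "Range \<rho> \<subseteq> k" if "\<rho> \<in> places_Z \<pi>" for \<rho>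
    using that unfolding places_Z_def by simp_all
  show "\<rho> = \<rho>'" if h: "\<rho> \<in> places_Z \<pi>" "\<rho>' \<in> places_Z \<pi>" "Domain \<rho> = Domain \<rho>'" for \<rho> \<rho>'
    using place_eq_of_Domain[OF kplaceD(1)[OF f(1)[OF h(1)]] kplaceD(1)[OF f(1)[OF h(2)]] Z(1) h(3) f(3)[OF h(1)]]
      kplaceD(5)[OF f(1)[OF h(1)]] kplaceD(5)[OF f(1)[OF h(2)]] by blast
  show "V \<in> {V \<in> rational_primes_of R k Z. V \<inter> B = Domain \<pi>}" if "V \<in> Domain ` places_Z \<pi>" for V
  proof -
    obtain \<rho> where \<rho>: "\<rho> \<in> places_Z \<pi>" "V = Domain \<rho>" using \<open>V \<in> _\<close> by (auto elim: imageE)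
    note g = f[OF \<rho>(1)]
    have VB: "V \<inter> B = Domain \<pi>" using g(2) Domain_restrict[of \<rho> B] \<rho>(2) by simp
    then have "V \<noteq> Z" using pi(3) Z(2) by blast
    then have "V \<in> rational_primes_of R k Z" unfolding \<rho>(2) by (rule rational_of_kplace[OF g(1) Z(1) g(3)])
    then show ?thesis using VB by simp
  qed
  fix V assume "V \<in> {V \<in> rational_primes_of R k Z. V \<inter> B = Domain \<pi>}"
  then have V: "V \<in> rational_primes_of R k Z" "V \<inter> B = Domain \<pi>" by simp_all
  obtain \<rho> where \<rho>: "kplace Z \<rho>" "Range \<rho> \<subseteq> k" "Domain \<rho> = V" by (rule kplace_of_rational[OF V(1) Z(1)])
  note rB = kplace_restrict[OF \<rho>(1) Z(2) B kB]
  have "\<pi> = \<rho> \<inter> B \<times> UNIV"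
    by (rule place_eq_of_Domain[OF kplaceD(1)[OF pi(1)] kplaceD(1)[OF rB] B _ pi(2)])
      (use kplaceD(5)[OF pi(1)] kplaceD(5)[OF rB] Domain_restrict[of \<rho> B] \<rho>(3) V(2) in blast)+
  then have "\<rho> \<in> places_Z \<pi>" unfolding places_Z_def using \<rho>(1,2) by simp
  then show "V \<in> Domain ` places_Z \<pi>" using \<rho>(3) by blast
qed

text \<open>Only properness needs an argument: if \<open>V\<close> contained \<open>B\<close>,
  integrality over \<open>B\<close> would make it all of \<open>Z\<close>.\<close>

lemma restrict_rational_prime:
  assumes V: "V \<in> rational_primes_of R k Z"
  shows "V \<inter> B \<in> rational_primes_of R k B"
proof (rule kplace_of_rational[OF V Z_subfield(1)])
  fix \<rho> assume \<rho>: "kplace Z \<rho>" "Range \<rho> \<subseteq> k" "Domain \<rho> = V"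
  have VZ: "V \<noteq> Z" using V unfolding rational_primes_of_def primes_of_def by blast
  have alg: "(algebraic over B) x" if "x \<in> Z" for x using Balg that subfieldE(3)[OF Z_subfield(1)] by blast
  have "\<not> B \<subseteq> V" using kplace_Domain_eq[OF \<rho>(1) Z_subfield(1) B _ alg] \<rho>(3) VZ by blast
  then have "Domain (\<rho> \<inter> B \<times> UNIV) \<noteq> B" unfolding Domain_restrict \<rho>(3) by blast
  moreover have "Range (\<rho> \<inter> B \<times> UNIV) \<subseteq> k" using \<rho>(2) by blast
  ultimately have "Domain (\<rho> \<inter> B \<times> UNIV) \<in> rational_primes_of R k B"
    by (intro rational_of_kplace[OF kplace_restrict[OF \<rho>(1) Z_subfield(2) B kB] B])
  then show ?thesis unfolding Domain_restrict \<rho>(3) .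
qed

text \<open>The set \<open>places_M \<pi>\<close> depends only on \<open>P\<close>, while every
  prime \<open>Q\<close> above \<open>P\<close> is the domain of a place that is the identity on
  \<open>k'\<close> and so can be used to count it. This yields the formula for all \<open>Q\<close>
  at once, and nonemptiness of the set describes the image.\<close>

lemma rational_prime_facts:
  assumes FG: "F \<in> Aut k kb" and P: "P \<in> rational_primes_of R k B"
  shows "finite {V \<in> rational_primes_of R k Z. V \<inter> B = P}" (is ?fin)
    and "primes_above R k B M P \<noteq> {}" (is ?ne)
    and "\<And>Q. Q \<in> primes_above R k B M P \<Longrightarrow>
      real (card {V \<in> rational_primes_of R k Z. V \<inter> B = P}) = real (card N) * frobenius_measure R k B M F Q \<gamma>"
    and "{V \<in> rational_primes_of R k Z. V \<inter> B = P} \<noteq> {} \<longleftrightarrow> \<gamma> \<in> frobenius_over R k B M F P" (is ?img)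
proof -
  obtain \<pi> where pi: "kplace B \<pi>" "Range \<pi> \<subseteq> k" "Domain \<pi> = P" by (rule kplace_of_rational[OF P B])
  have PB: "Domain \<pi> \<noteq> B" using P unfolding pi(3) rational_primes_of_def primes_of_def by blast
  have P': "Domain \<pi> \<in> rational_primes_of R k B" using P unfolding pi(3) .
  have above: "Domain \<rho> \<in> primes_above R k B M P" if \<rho>: "kplace M \<rho>" "\<rho> \<inter> B \<times> UNIV = \<pi>" for \<rho>
  proof -
    have QB: "Domain \<rho> \<inter> B = P" using \<rho>(2) Domain_restrict[of \<rho> B] pi(3) by simp
    then have "Domain \<rho> \<noteq> M" using PB M(2) pi(3) by blast
    then have "Domain \<rho> \<in> primes_of R k M" by (rule kplace_primes[OF \<rho>(1) M(1)])
    then show ?thesis unfolding primes_above_def using QB by simp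
  qed
  obtain \<rho>0 where \<rho>0: "kplace M \<rho>0" "\<rho>0 \<inter> B \<times> UNIV = \<pi>" by (rule kplace_extend[OF pi(1) B kB M])
  then show ?ne using above by blast
  have bij: "bij_betw Domain (places_Z \<pi>) {V \<in> rational_primes_of R k Z. V \<inter> B = P}"
    using places_Z_primes[OF pi(1,2) PB] unfolding pi(3) .
  have place: thesis if Q: "Q \<in> primes_above R k B M P"
    and th: "\<And>\<rho>. kplace M \<rho> \<Longrightarrow> \<rho> \<inter> B \<times> UNIV = \<pi> \<Longrightarrow> (\<And>c. c \<in> k' \<Longrightarrow> (c, c) \<in> \<rho>) \<Longrightarrow> Domain \<rho> = Q \<Longrightarrow> thesis" for Q thesis
  proof (rule place_of_prime_above[OF pi(1,2)])
    show "Q \<in> primes_of R k M" "Q \<inter> B = Domain \<pi>" using Q unfolding primes_above_def pi(3) by simp_all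
  qed (rule th)
  have count: "finite (places_M \<pi>) \<and> real (card (places_M \<pi>)) = real (card N) * frobenius_measure R k B M F Q \<gamma>"
    if Q: "Q \<in> primes_above R k B M P" for Q
  proof (rule place[OF Q])
    fix \<rho> assume \<rho>: "kplace M \<rho>" "\<rho> \<inter> B \<times> UNIV = \<pi>" "\<And>c. c \<in> k' \<Longrightarrow> (c, c) \<in> \<rho>" "Domain \<rho> = Q"
    have ci: "cjg ` N = conjugacy_class G \<gamma>" by (rule conj_image[OF pi(2) \<rho>(1,2)]) (rule \<rho>(3))
    have c1: "finite (places_M \<pi>)" by (rule card_places_M(1)[OF pi(2) \<rho>(1,2)]) (rule \<rho>(3))
    have c2: "card (Frob \<rho>) > 0" by (rule card_places_M(2)[OF pi(2) \<rho>(1,2)]) (rule \<rho>(3))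
    have c3: "card (cjg ` N) > 0" by (rule card_places_M(3)[OF pi(2) \<rho>(1,2)]) (rule \<rho>(3))
    have c4: "card (places_M \<pi>) * card (cjg ` N) * card (Frob \<rho>) = card N * card (Frob \<rho> \<inter> cjg ` N)" by (rule card_places_M(4)[OF pi(2) \<rho>(1,2)]) (rule \<rho>(3))
    have "Frob \<rho> = {g \<in> carrier G. pull M g \<rho> = push 1 \<rho>}"
      by (rule Frob_def[OF pi(2) \<rho>(1,2)]) (rule \<rho>(3))
    then have Fr: "frobenius_at R k B M F Q = Frob \<rho>"
      using frobenius_at_eq[OF FG P' \<rho>(1,2)] unfolding \<rho>(4) by simp
    have "real (card (places_M \<pi>)) * real (card (conjugacy_class G \<gamma>)) * real (card (Frob \<rho>))
        = real (card N) * real (card (Frob \<rho> \<inter> conjugacy_class G \<gamma>))"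
      using arg_cong[OF c4, of real] unfolding ci by simp
    then have "real (card (places_M \<pi>)) = real (card N) * frobenius_measure R k B M F Q \<gamma>"
      unfolding frobenius_measure_def Fr Let_def G_def[symmetric] using c2 c3 unfolding ci by (simp add: field_simps)
    then show ?thesis using c1 by simp
  qed
  have fin: "finite (places_M \<pi>)" using count above[OF \<rho>0] by blast
  have eq: "card {V \<in> rational_primes_of R k Z. V \<inter> B = P} = card (places_M \<pi>)"
    using bij_betw_same_card[OF bij] bij_betw_same_card[OF places_L_M, of \<pi>] bij_betw_same_card[OF places_L_Z, of \<pi>] by simp
  show ?fin
    using fin bij_betw_finite[OF places_L_M, of \<pi>] bij_betw_finite[OF places_L_Z, of \<pi>] bij_betw_finite[OF bij] by simp
  then have emp: "{V \<in> rational_primes_of R k Z. V \<inter> B = P} \<noteq> {} \<longleftrightarrow> places_M \<pi> \<noteq> {}"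
    using eq fin by (metis card_eq_0_iff)
  show "real (card {V \<in> rational_primes_of R k Z. V \<inter> B = P}) = real (card N) * frobenius_measure R k B M F Q \<gamma>"
    if "Q \<in> primes_above R k B M P" for Q using count[OF that] eq by simp
  have "places_M \<pi> \<noteq> {} \<longleftrightarrow> \<gamma> \<in> frobenius_over R k B M F P"
  proof
    assume "places_M \<pi> \<noteq> {}"
    then obtain \<rho> where "\<rho> \<in> places_M \<pi>" by blast
    then have \<rho>: "kplace M \<rho>" "\<rho> \<inter> B \<times> UNIV = \<pi>" "pull M \<gamma> \<rho> = push 1 \<rho>" unfolding places_M_def by simp_all
    have "\<gamma> \<in> frobenius_at R k B M F (Domain \<rho>)"
      unfolding frobenius_at_eq[OF FG P' \<rho>(1,2)] using \<rho>(3) \<gamma> unfolding G_def by simp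
    then show "\<gamma> \<in> frobenius_over R k B M F P" unfolding frobenius_over_def using above[OF \<rho>(1,2)] by blast
  next
    assume "\<gamma> \<in> frobenius_over R k B M F P"
    then obtain Q where Q: "Q \<in> primes_above R k B M P" "\<gamma> \<in> frobenius_at R k B M F Q" unfolding frobenius_over_def by blast
    show "places_M \<pi> \<noteq> {}"
    proof (rule place[OF Q(1)])
      fix \<rho> assume \<rho>: "kplace M \<rho>" "\<rho> \<inter> B \<times> UNIV = \<pi>" "\<And>c. c \<in> k' \<Longrightarrow> (c, c) \<in> \<rho>" "Domain \<rho> = Q"
      have "pull M \<gamma> \<rho> = push 1 \<rho>" using Q(2) frobenius_at_eq[OF FG P' \<rho>(1,2)] unfolding \<rho>(4) by simp
      then have "\<rho> \<in> places_M \<pi>" unfolding places_M_def using \<rho>(1,2,3) by simp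
      then show "places_M \<pi> \<noteq> {}" by blast
    qed
  qed
  then show ?img using emp by simp
qed

end

text \<open>The polynomial splits over \<open>D\<close>, but the root is taken in the other ring
  \<open>C\<close>; linear factors are peeled off until one of them vanishes at
  \<open>y\<close>.\<close>

lemma splitted_root:
  assumes D: "field D" and C: "domain C" and \<Psi>: "\<Psi> \<in> ring_hom D C" and y: "y \<in> carrier C"
  shows "p \<in> carrier (poly_ring D) \<Longrightarrow> p \<noteq> [] \<Longrightarrow> ring.splitted D p \<Longrightarrow> ring.eval C (map \<Psi> p) y = \<zero>\<^bsub>C\<^esub> \<Longrightarrow>
    y \<in> \<Psi> ` carrier D"
proof (induction "degree p" arbitrary: p rule: less_induct)
  case less
  interpret D: field D by (rule D)
  interpret C: domain C by (rule C)
  interpret h: ring_hom_ring D C \<Psi> by (rule ring_hom_ringI2[OF D.ring_axioms C.ring_axioms \<Psi>])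
  have UD: "domain (poly_ring D)" by (rule D.univ_poly_is_domain[OF D.carrier_is_subring])
  interpret UD: domain "poly_ring D" by (rule UD)
  let ?E = "\<lambda>p. C.eval (map \<Psi> p) y"
  have E: "?E \<in> ring_hom (poly_ring D) C" by (rule eval_map_hom[OF D.domain_axioms C.cring_axioms \<Psi> y])
  show ?case
  proof (cases "D.roots p = {#}")
    case True
    then have "degree p = 0" using less.prems(3) unfolding D.splitted_def by simp
    then obtain c where c: "p = [c]" using less.prems(2) by (cases p) auto
    have cD: "c \<in> carrier D" "c \<noteq> \<zero>\<^bsub>D\<^esub>"
      using less.prems(1) unfolding c univ_poly_carrier[symmetric] polynomial_def by auto
    then have cU: "c \<in> Units D" using D.field_Units by simp
    have "\<Psi> c \<otimes>\<^bsub>C\<^esub> \<Psi> (inv\<^bsub>D\<^esub> c) = \<one>\<^bsub>C\<^esub>" using h.hom_mult[of c "inv\<^bsub>D\<^esub> c"] cU cD(1) by simp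
    moreover have "\<Psi> c = \<zero>\<^bsub>C\<^esub>" using less.prems(4) cD(1) y unfolding c by simp
    ultimately show ?thesis using h.hom_closed[of "inv\<^bsub>D\<^esub> c"] cU by simp
  next
    case False
    obtain a where a: "a \<in> carrier D" "[\<one>\<^bsub>D\<^esub>, \<ominus>\<^bsub>D\<^esub> a] \<in> carrier (poly_ring D)" "[\<one>\<^bsub>D\<^esub>, \<ominus>\<^bsub>D\<^esub> a] pdivides\<^bsub>D\<^esub> p"
      by (rule D.not_empty_rootsE[OF less.prems(1) False])
    obtain q where q: "q \<in> carrier (poly_ring D)" "p = [\<one>\<^bsub>D\<^esub>, \<ominus>\<^bsub>D\<^esub> a] \<otimes>\<^bsub>poly_ring D\<^esub> q"
      using a(3) unfolding pdivides_def factor_def by auto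
    have qne: "q \<noteq> []" using q(2) less.prems(2) UD.r_null[OF a(2)] by (auto simp: univ_poly_zero)
    have "degree p = degree [\<one>\<^bsub>D\<^esub>, \<ominus>\<^bsub>D\<^esub> a] + degree q"
      using D.poly_mult_degree_eq[OF D.carrier_is_subring, of "[\<one>\<^bsub>D\<^esub>, \<ominus>\<^bsub>D\<^esub> a]" q] a(2) q qne
      by (simp add: univ_poly_carrier univ_poly_mult)
    then have deg: "degree q < degree p" by simp
    have "p = q \<otimes>\<^bsub>poly_ring D\<^esub> [\<one>\<^bsub>D\<^esub>, \<ominus>\<^bsub>D\<^esub> a]" unfolding q(2) by (rule UD.m_comm[OF a(2) q(1)])
    then have "q pdivides\<^bsub>D\<^esub> p" unfolding pdivides_def factor_def using a(2) by auto
    then have spl: "D.splitted q" by (rule D.pdivides_imp_splitted[OF q(1) less.prems(1,2,3)])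
    have "?E p = ?E [\<one>\<^bsub>D\<^esub>, \<ominus>\<^bsub>D\<^esub> a] \<otimes>\<^bsub>C\<^esub> ?E q" unfolding q(2) by (rule ring_hom_mult[OF E a(2) q(1)])
    then consider "?E [\<one>\<^bsub>D\<^esub>, \<ominus>\<^bsub>D\<^esub> a] = \<zero>\<^bsub>C\<^esub>" | "?E q = \<zero>\<^bsub>C\<^esub>"
      using less.prems(4) C.integral ring_hom_closed[OF E a(2)] ring_hom_closed[OF E q(1)] by metis
    then show ?thesis
    proof cases
      case 1
      then have "y \<ominus>\<^bsub>C\<^esub> \<Psi> a = \<zero>\<^bsub>C\<^esub>" using a(1) y by (simp add: a_minus_def)
      then have "y = \<Psi> a" using C.r_right_minus_eq[OF y, of "\<Psi> a"] a(1) by simp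
      then show ?thesis using a(1) by blast
    next
      case 2
      show ?thesis by (rule less.hyps[OF deg q(1) qne spl 2])
    qed
  qed
qed

text \<open>\<open>\<delta> x\<close> is again a root of the minimal polynomial of \<open>x\<close>,
  which splits in \<open>M\<close>. This converts normality from splitting into stability.\<close>

lemma (in field) finite_normal_extension_stable:
  assumes ext: "finite_normal_extension R B M" and \<delta>: "\<delta> \<in> ring_hom R R" "\<And>b. b \<in> B \<Longrightarrow> \<delta> b = b" and x: "x \<in> M"
  shows "\<delta> x \<in> M"
proof -
  have B: "subfield B R" and M: "subfield M R" and BM: "B \<subseteq> M" and fin: "finite_dimension B M"
    and spl: "\<And>p. p \<in> carrier (B[X]) \<Longrightarrow> pirreducible B p \<Longrightarrow> \<exists>x\<in>M. eval p x = \<zero> \<Longrightarrow> ring.splitted (R\<lparr>carrier := M\<rparr>) p"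
    using ext unfolding finite_normal_extension_def by blast+
  have xc: "x \<in> carrier R" using x subfieldE(3)[OF M] by blast
  have a: "(algebraic over B) x" by (rule finite_dimension_imp_algebraic[OF B subfieldE(1)[OF M] fin x])
  note I = IrrE[OF B xc a]
  have s: "ring.splitted (R\<lparr>carrier := M\<rparr>) (Irr B x)" using spl[OF I(1,2)] I(4) x by blast
  have "eval (Irr B x) (\<delta> x) = \<zero>"
    by (rule hom_root[OF carrier_is_subfield ring_hom_carrier[OF \<delta>(1)] carrier_is_subfield subfieldE(3)[OF B] \<delta>(2) I(1) xc I(4)])
  moreover have ne: "Irr B x \<noteq> []" using pirreducible_degree[OF B I(1,2)] by auto
  moreover have "Irr B x \<in> carrier (poly_ring (R\<lparr>carrier := M\<rparr>))"
    using I(1) ne BM unfolding univ_poly_carrier[symmetric] polynomial_def by auto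
  moreover have "(\<lambda>x. x) \<in> ring_hom (R\<lparr>carrier := M\<rparr>) R"
    using subfieldE(3)[OF M] by (intro ring_hom_memI) auto
  moreover have "\<delta> x \<in> carrier R" by (rule ring_hom_closed[OF \<delta>(1) xc])
  ultimately have "\<delta> x \<in> (\<lambda>x. x) ` carrier (R\<lparr>carrier := M\<rparr>)"
    using splitted_root[OF subfield_iff(2)[OF M] domain_axioms, of "\<lambda>x. x" "\<delta> x" "Irr B x"] s by simp
  then show ?thesis by simp
qed

theorem theorem1p1:
  fixes \<Omega> :: "('a, 'b) ring_scheme"
    and k K M kbar k' k'K km kmK kmM M\<gamma> :: "'a set"
    and F F' \<gamma> :: "'a \<Rightarrow> 'a"
    and \<Phi> :: "('a \<Rightarrow> 'a) \<Rightarrow> ('a \<Rightarrow> 'a) \<times> ('a \<Rightarrow> 'a)"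
    and G :: "('a \<Rightarrow> 'a) monoid"
    and N :: "('a \<Rightarrow> 'a) set"
    and m :: nat
    and FP :: "(('a \<Rightarrow> 'a) \<times> ('a \<Rightarrow> 'a)) monoid"
  assumes \<Omega>: "algebraic_closure \<Omega> K"
    and k: "subfield k \<Omega>" "perfect_field (\<Omega>\<lparr>carrier := k\<rparr>)"
    and kbar: "kbar = integral_closure_in \<Omega> k (carrier \<Omega>)"
    and procyclic: "procyclic (aut_group \<Omega> k kbar) (krull_topology \<Omega> k kbar)"
    and F: "topological_generator (aut_group \<Omega> k kbar) (krull_topology \<Omega> k kbar) F"
    and K: "geom_irred_function_field \<Omega> k K"
    and M: "finite_normal_extension \<Omega> K M"
    and G: "G = aut_group \<Omega> K M"
    and k': "k' = integral_closure_in \<Omega> k M"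
    and k'K: "k'K = compositum \<Omega> k' K"
    and N: "N = carrier (aut_group \<Omega> k'K M)"
    \<comment> \<open>\<open>\<gamma>\<close> lies in the coset of \<open>N\<close> corresponding to the image of \<open>F\<close> in $\mathrm{Gal}(k'/k)$\<close>
    and \<gamma>: "\<gamma> \<in> {g \<in> carrier G. restrict g k' = restrict F k'}"
    and m: "m = group.ord G \<gamma>"
    and m_dvd_r: "nat_dvd_steinitz m
                    (profinite_order (aut_group \<Omega> k kbar) (krull_topology \<Omega> k kbar))"
    and km: "km = the_extension_of_degree \<Omega> k m"
    and kmK: "kmK = compositum \<Omega> km K"
    and kmM: "kmM = compositum \<Omega> km M"
    \<comment> \<open>preimage of \<open>F|km\<close> under the isomorphism \<open>Gal(kmK/K) \<rightarrow> Gal(km/k)\<close>\<close>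
    and F': "F' = inv_into (carrier (aut_group \<Omega> K kmK)) (\<lambda>\<sigma>. restrict \<sigma> km) (restrict F km)"
    and \<Phi>: "\<Phi> = (\<lambda>\<sigma>. (restrict \<sigma> kmK, restrict \<sigma> M))"
    \<comment> \<open>\<open>(F', \<gamma>)\<close> is viewed as an element of \<open>Gal(kmM/K)\<close> via \<open>\<Phi>\<close>\<close>
    and M\<gamma>: "M\<gamma> = fixed_field kmM
               (generate (aut_group \<Omega> K kmM)
                  {inv_into (carrier (aut_group \<Omega> K kmM)) \<Phi> (F', \<gamma>)})"
    and FP: "FP = fibre_product (aut_group \<Omega> K kmK) G (\<lambda>\<sigma>. restrict \<sigma> k'K) (\<lambda>\<sigma>. restrict \<sigma> k'K)"
  shows
    \<comment> \<open>\<open>FP\<close> is a fibre product over \<open>Gal(k'K/K)\<close>\<close>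
    "k'K \<subseteq> kmK \<and>
     (\<lambda>\<sigma>. restrict \<sigma> k'K) \<in> hom (aut_group \<Omega> K kmK) (aut_group \<Omega> K k'K) \<and>
     (\<lambda>\<sigma>. restrict \<sigma> k'K) \<in> hom G (aut_group \<Omega> K k'K) \<and>
     \<Phi> \<in> iso (aut_group \<Omega> K kmM) FP \<and>
     (F', \<gamma>) \<in> carrier FP \<and>
     geom_irred_function_field \<Omega> k M\<gamma> \<and>
     compositum \<Omega> km M\<gamma> = kmM \<and>
     (\<lambda>Q. Q \<inter> K) \<in> rational_primes_of \<Omega> k M\<gamma> \<rightarrow> rational_primes_of \<Omega> k K \<and>
     (\<lambda>Q. Q \<inter> K) ` rational_primes_of \<Omega> k M\<gamma> =
       {P \<in> rational_primes_of \<Omega> k K. \<gamma> \<in> frobenius_over \<Omega> k K M F P} \<and>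
     (\<forall>P \<in> rational_primes_of \<Omega> k K.
        finite {R \<in> rational_primes_of \<Omega> k M\<gamma>. R \<inter> K = P} \<and>
        primes_above \<Omega> k K M P \<noteq> {} \<and>
        (\<forall>Q \<in> primes_above \<Omega> k K M P.
           real (card {R \<in> rational_primes_of \<Omega> k M\<gamma>. R \<inter> K = P}) =
             real (card N) * frobenius_measure \<Omega> k K M F Q \<gamma>))"
proof -
  interpret A: algebraic_closure \<Omega> K by (rule \<Omega>)
  have ac: "algebraically_closed \<Omega>" by (rule A.algebraically_closed_axioms)
  have KK: "subfield K \<Omega>" "k \<subseteq> K" "integral_closure_in \<Omega> k K = k"
    using K unfolding geom_irred_function_field_def by blast+
  obtain t where t: "t \<in> K" "ring.transcendental \<Omega> k t"
    using K unfolding geom_irred_function_field_def by blast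
  have MM: "subfield M \<Omega>" "K \<subseteq> M" "A.finite_dimension K M"
    using M unfolding finite_normal_extension_def by blast+
  have kb: "kbar = {x \<in> carrier \<Omega>. (A.algebraic over k) x}"
    unfolding kbar integral_closure_in_def over_def by simp
  have tc: "t \<in> carrier \<Omega>" using t(1) subfieldE(3)[OF KK(1)] by blast
  \<comment> \<open>The pigeonhole argument behind the conjugacy of places needs infinitely many
    evaluation points; powers of a transcendental element provide them.\<close>
  have inf: "infinite (carrier \<Omega>)" by (rule A.infinite_of_transcendental[OF k(1) tc t(2)])
  have fr: "frob \<Omega> k kbar F" by (rule A.frob_of_topological_generator[OF ac inf k kb F])
  interpret f: frob \<Omega> k kbar F by (rule fr)
  have FG: "F \<in> carrier (aut_group \<Omega> k kbar)" using F unfolding topological_generator_def by simp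
  \<comment> \<open>Divisibility of the Steinitz number becomes the existence of an extension of
    degree \<open>m\<close>, namely the fixed field of \<open>F^m\<close>.\<close>
  note m' = f.dim_K_of_dvd_profinite_order[OF FG m_dvd_r]
  have km': "km = f.K m" unfolding km by (rule f.extension_of_degree[OF m'])
  have k'': "k' = M \<inter> kbar" unfolding k' kb integral_closure_in_def using subfieldE(3)[OF MM(1)] by (auto simp: over_def)
  have \<gamma>G: "\<gamma> \<in> carrier (aut_group \<Omega> K M)" "restrict \<gamma> k' = restrict F k'" using \<gamma> unfolding G by simp_all
  have \<gamma>F: "\<gamma> x = F x" if "x \<in> M" "x \<in> kbar" for x
    using fun_cong[OF \<gamma>G(2), of x] that unfolding k'' by simp
  have \<gamma>m: "(\<gamma> ^^ m) x = x" if "x \<in> M" for x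
  proof -
    interpret G: group "aut_group \<Omega> K M" by (rule A.aut_group[OF MM(1,2)])
    have "\<gamma> [^]\<^bsub>aut_group \<Omega> K M\<^esub> m = \<one>\<^bsub>aut_group \<Omega> K M\<^esub>" unfolding m G using \<gamma>G(1) by simp
    then show ?thesis using A.aut_pow[OF MM(1,2) \<gamma>G(1) that, of m] that by (simp add: A.aut_one)
  qed
  interpret T: twist \<Omega> k kbar F K M \<gamma> m
  proof (rule twist.intro[OF fr twist_axioms.intro])
    show "(A.algebraic over K) x" if "x \<in> carrier \<Omega>" for x by (rule A.algebraic_extension[OF that])
    show "x \<in> k" if "x \<in> K" "x \<in> kbar" for x
      using that KK(3) unfolding kbar integral_closure_in_def by blast
    show "\<delta> x \<in> M" if "\<delta> \<in> ring_hom \<Omega> \<Omega>" "\<And>b. b \<in> K \<Longrightarrow> \<delta> b = b" "x \<in> M" for \<delta> x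
      by (rule A.finite_normal_extension_stable[OF M that])
  qed (fact KK(1,2) MM m' \<gamma>G(1) \<gamma>F \<gamma>m)+
  \<comment> \<open>The constants of the locale are given by the same expressions as the sets fixed
    in the theorem, so the identifications are by unfolding.\<close>
  have k'_eq: "k' = T.k'" unfolding k'' T.k'_def ..
  have k'K_eq: "k'K = T.k'B" unfolding k'K k'_eq T.k'B_def ..
  have kmK_eq: "kmK = T.mB" unfolding kmK km' T.mB_def ..
  have kmM_eq: "kmM = T.L" unfolding kmM km' T.L_def ..
  have F'_eq: "F' = T.F'" unfolding F' kmK_eq km' T.F'_def ..
  have \<Phi>_eq: "\<Phi> = T.Phi" unfolding \<Phi> kmK_eq T.Phi_def ..
  have M\<gamma>_eq: "M\<gamma> = T.Z" unfolding M\<gamma> kmM_eq \<Phi>_eq F'_eq T.Z_def T.s_def ..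
  have FP_eq: "FP = T.FP" unfolding FP kmK_eq G k'K_eq T.FP_def ..
  have N_eq: "N = T.N" unfolding N k'K_eq T.N_def ..
  note rat = T.rational_prime_facts[OF FG]
  have img: "(\<lambda>Q. Q \<inter> K) ` rational_primes_of \<Omega> k M\<gamma> =
      {P \<in> rational_primes_of \<Omega> k K. \<gamma> \<in> frobenius_over \<Omega> k K M F P}"
  proof (intro subset_antisym subsetI)
    fix P assume "P \<in> (\<lambda>Q. Q \<inter> K) ` rational_primes_of \<Omega> k M\<gamma>"
    then obtain Q where Q: "Q \<in> rational_primes_of \<Omega> k T.Z" "P = Q \<inter> K" unfolding M\<gamma>_eq by blast
    have "P \<in> rational_primes_of \<Omega> k K" unfolding Q(2) by (rule T.restrict_rational_prime[OF Q(1)])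
    then show "P \<in> {P \<in> rational_primes_of \<Omega> k K. \<gamma> \<in> frobenius_over \<Omega> k K M F P}" using rat(4) Q by blast
  next
    fix P assume "P \<in> {P \<in> rational_primes_of \<Omega> k K. \<gamma> \<in> frobenius_over \<Omega> k K M F P}"
    then show "P \<in> (\<lambda>Q. Q \<inter> K) ` rational_primes_of \<Omega> k M\<gamma>" using rat(4)[of P] unfolding M\<gamma>_eq by blast
  qed
  show ?thesis
  proof (intro conjI ballI img)
    show "k'K \<subseteq> kmK" unfolding k'K_eq kmK_eq by (rule T.sub_fields(1))
    show "(\<lambda>\<sigma>. restrict \<sigma> k'K) \<in> hom (aut_group \<Omega> K kmK) (aut_group \<Omega> K k'K)"
      unfolding k'K_eq kmK_eq by (rule T.restrict_hom[OF T.normal_k'B T.sub_fields(1) T.cmB(1)])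
    show "(\<lambda>\<sigma>. restrict \<sigma> k'K) \<in> hom G (aut_group \<Omega> K k'K)"
      unfolding k'K_eq G by (rule T.restrict_hom[OF T.normal_k'B T.sub_fields(2) MM(1)])
    show "\<Phi> \<in> iso (aut_group \<Omega> K kmM) FP" unfolding \<Phi>_eq kmM_eq FP_eq by (rule T.Phi_iso)
    show "(F', \<gamma>) \<in> carrier FP" unfolding F'_eq FP_eq by (rule T.F'\<gamma>)
    show "geom_irred_function_field \<Omega> k M\<gamma>" unfolding M\<gamma>_eq by (rule T.Z_function_field[OF K])
    show "compositum \<Omega> km M\<gamma> = kmM" unfolding km' M\<gamma>_eq kmM_eq by (rule T.compositum_Z)
    show "(\<lambda>Q. Q \<inter> K) \<in> rational_primes_of \<Omega> k M\<gamma> \<rightarrow> rational_primes_of \<Omega> k K"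
      unfolding M\<gamma>_eq using T.restrict_rational_prime by blast
  qed (use rat(1,2,3) in \<open>simp_all add: M\<gamma>_eq N_eq\<close>)
qed

end
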